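(* Let $\Sigma\in\mathcal F_\alpha$ for some $\alpha>0$, where $\Sigma$ is the covariance matrix of the data distribution described in the context, and suppose that $\rho n^2/d\gtrsim(\log n)^{2\alpha+3}$. Then the adaptive blockwise tridiagonal estimator $\hat\Sigma^{\mathsf{Ada}}$ with operator-norm thresholding (described in the context; it does not use $\alpha$) is $\rho$-zCDP and satisfies $$ \mathbb E\|\hat\Sigma^{\mathsf{Ada}}-\Sigma\|^2\;\lesssim\;\Bigl(n^{-\frac{2\alpha}{2\alpha+1}}\wedge\frac dn\Bigr)+\Bigl(\bigl(\tfrac{d\log n}{\rho n^2}\bigr)^{\frac{\alpha}{\alpha+1}}\wedge\frac{d^3\log n}{\rho n^2}\Bigr). $$ The same upper bound holds for the normalized Frobenius loss $\frac1d\mathbb E\|\hat\Sigma^{\mathsf{Ada}}-\Sigma\|_F^2$.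
   Context: Norms: $\|\cdot\|$ is the spectral norm, $\|\cdot\|_F$ the Frobenius norm; $a\wedge b=\min(a,b)$. $\|X\|_{\psi_2}=\sup_{\|v\|_2=1}\inf\{t>0:\mathbb E e^{\langle X,v\rangle^2/t^2}\le2\}$. For a matrix $A$ and index set $B$, $A[B]$ or $A_B$ denotes $A$ with entries outside $B$ set to zero. Privacy. Datasets are adjacent if they differ in one observation. For $\lambda>1$, $D_\lambda(P\|Q)=\frac1{\lambda-1}\log\int(\frac{dP}{dQ})^\lambda dQ$. A randomized algorithm $A$ is $\rho$-zCDP if $D_\lambda(A(S)\|A(S'))\le\rho\lambda$ for all adjacent $S,S'$ and all $\lambda\in(1,\infty)$. Model and class. $X_1,\dots,X_n$ are i.i.d. in $\mathbb R^d$ with mean $0$, covariance $\Sigma$, $\|X_1\|_{\psi_2}\le K$; $K,M_0,M$ are fixed. A block $R=I\times J$ ($I,J\subseteq[d]$) is $k$-off-diagonal if it is contained in $\{(i,j):j\ge i+k\}$ or in $\{(i,j):i\ge j+k\}$. $\mathcal F_\alpha=\mathcal F_\alpha(M_0,M)$ is the set of covariance matrices with $0\preceq\Sigma\preceq M_0I_d$ and $\|\Sigma_R\|\le Mk^{-\alpha}$ for every $k\ge1$ and every $k$-off-diagonal block $R$. Regime. Statements are along sequences $(n,d,\rho)$, $n\to\infty$, with $d\gtrsim\log n$, $0<\rho\lesssim1$ (fixed upper bound), $d/(\rho n^2)\to0$. $a\lesssim b$ means $a\le Cb$ for all sufficiently large $n$, with $C$ not depending on $n,d,\rho$ or on the particular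 distribution (it may depend on $\alpha,K,M_0,M$ and the regime constants). Block primitive $\mathsf{DPCovBlock}(X,B;\rho_B,R)$, for a square block $B=I\times J$: with $\chi_R(z)=z\min\{1,R/\|z\|_2\}$ ($\chi_R(0)=0$), return $\frac1n\sum_{i=1}^n\chi_R(X_{i,I})\chi_R(X_{i,J})^\top+\sigma_BM_B$ (supported on $B$), where $\sigma_B^2=18R^4/(\rho_Bn^2)$ and $M_B$ is the $B$-block of a fresh random symmetric $d\times d$ matrix whose upper triangular entries (including the diagonal) are i.i.d. $N(0,1)$. The estimator. Fix sufficiently large constants $C_0,C,L_1$ and a sufficiently small constant $c_0>0$ (not depending on $n,d,\rho$ or $\alpha$). Set $k_0=d\wedge\lceil C_0\log n\rceil$, $k_m=2^mk_0$; the data are padded with deterministic zero coordinates so that $d=2^Jk_0$ for an integer $J\ge0$ (the estimate of the original $\Sigma$ being the corresponding principal submatrix). Let $S=1+\max\{m\ge0:k_m\le\min(c_0n,d)\}$ and $N_m=d/k_m$ for $0\le m<S$. For a block size $k$, $I_{k,\ell}=\{1+(\ell-1)k,\dots,\ell k\}$ and $B_{k;\ell,r}=I_{k,\ell}\times I_{k,\ell+r}$ (blocks with invalid indices are omitted). For $m\ge1$ and $1\le\ell<N_m$ let $\Gamma_{m,\ell}=B_{k_m;\ell,1}\setminus B_{k_{m-1};2\ell,1}$. (1) Start from $\hat\Sigma=0$. With $\rho_0=\rho/(2SN_0)$, set $\hat\Sigma[B_{k_0;\ell,r}]=\mathsf{DPCovBlock}(X,B_{k_0;\ell,r};\rho_0,\sqrt{Ck_0})$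 for $\ell\in[N_0]$, $r\in\{0,1\}$. (2) For $m=1,\dots,S-1$, put $\rho_m=\rho/(SN_m)$ and $$\tau_m^2=L_1\Bigl(\frac{k_m+\log d}{n}+\frac{k_m^2(k_m+\log d)}{\rho_mn^2}+e^{-2k_m}\Bigr);$$ for each $\ell=1,\dots,N_m-1$ compute $A=\mathsf{DPCovBlock}(X,B_{k_m;\ell,1};\rho_m,\sqrt{Ck_m})[\Gamma_{m,\ell}]$ and set $\hat\Sigma[\Gamma_{m,\ell}]=A\cdot\mathbf 1\{\|A\|>\tau_m\}$. (3) Fill in the lower triangular part by symmetry and return $\hat\Sigma^{\mathsf{Ada}}=\hat\Sigma$. *)

theory Defs
  imports "HOL-Probability.Probability"
begin

text \<open>
  Dimensions vary along the asymptotics, so vectors in \<open>\<real>\<^sup>d\<close> are functions \<open>nat \<Rightarrow> real\<close> used on the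
  index set \<open>{1..d}\<close>, and \<open>d \<times> d\<close> matrices are functions \<open>nat \<times> nat \<Rightarrow> real\<close> used on
  \<open>{1..d} \<times> {1..d}\<close>. As measurable spaces they are the finite products of \<open>borel\<close> below.
  A randomized algorithm is a map from datasets to probability measures on the output space.
\<close>

type_synonym rvec = "nat \<Rightarrow> real"
type_synonym rmat = "nat \<times> nat \<Rightarrow> real"

definition vec_space :: "nat \<Rightarrow> rvec measure" where
  "vec_space d = (\<Pi>\<^sub>M i\<in>{1..d}. borel)"

definition mat_space :: "nat \<Rightarrow> rmat measure" where
  "mat_space d = (\<Pi>\<^sub>M p\<in>{1..d} \<times> {1..d}. borel)"

definition spec_norm :: "nat \<Rightarrow> rmat \<Rightarrow> real" where
  "spec_norm d A =
     (SUP v\<in>{v. L2_set v {1..d} \<le> 1}. L2_set (\<lambda>i. \<Sum>j\<in>{1..d}. A (i, j) * v j) {1..d})"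

definition frob_norm :: "nat \<Rightarrow> rmat \<Rightarrow> real" where
  "frob_norm d A = L2_set A ({1..d} \<times> {1..d})"

definition mask :: "rmat \<Rightarrow> (nat \<times> nat) set \<Rightarrow> rmat" where
  "mask A B = (\<lambda>p. if p \<in> B then A p else 0)"


section \<open>Zero-concentrated differential privacy\<close>

text \<open>
  Here \<open>RN_deriv Q P\<close> is \<open>dP/dQ\<close>. The divergence is \<open>\<infinity>\<close> when \<open>P\<close> is not absolutely continuous
  with respect to \<open>Q\<close> or when the integral diverges.
\<close>

definition renyi_div :: "real \<Rightarrow> 'a measure \<Rightarrow> 'a measure \<Rightarrow> ereal" where
  "renyi_div a P Q =
     (let I = (\<integral>\<^sup>+ x. ennreal (enn2real (RN_deriv Q P x) powr a) \<partial>Q)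
      in if absolutely_continuous Q P \<and> I < \<infinity> then ereal (1 / (a - 1) * ln (enn2real I)) else \<infinity>)"

definition adjacent :: "nat \<Rightarrow> (nat \<Rightarrow> 'x) \<Rightarrow> (nat \<Rightarrow> 'x) \<Rightarrow> bool" where
  "adjacent n S S' \<longleftrightarrow> (\<exists>i\<in>{1..n}. \<forall>j\<in>{1..n} - {i}. S j = S' j)"

definition zCDP :: "real \<Rightarrow> nat \<Rightarrow> 'x set \<Rightarrow> ((nat \<Rightarrow> 'x) \<Rightarrow> 'y measure) \<Rightarrow> bool" where
  "zCDP \<rho> n U A \<longleftrightarrow>
     (\<forall>S \<in> {1..n} \<rightarrow>\<^sub>E U. prob_space (A S)) \<and>
     (\<forall>S \<in> {1..n} \<rightarrow>\<^sub>E U. \<forall>S' \<in> {1..n} \<rightarrow>\<^sub>E U. adjacent n S S' \<longrightarrow>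
        (\<forall>a>1. renyi_div a (A S) (A S') \<le> ereal (\<rho> * a)))"


section \<open>Data distributions and the covariance class\<close>

definition psi2_norm :: "nat \<Rightarrow> rvec measure \<Rightarrow> ennreal" where
  "psi2_norm d P =
     (SUP v\<in>{v. L2_set v {1..d} = 1}.
        INF t\<in>{t. 0 < t \<and> (\<integral>\<^sup>+ x. ennreal (exp ((\<Sum>i\<in>{1..d}. x i * v i)\<^sup>2 / t\<^sup>2)) \<partial>P) \<le> 2}.
          ennreal t)"

definition centered_subgaussian :: "nat \<Rightarrow> real \<Rightarrow> rvec measure \<Rightarrow> bool" where
  "centered_subgaussian d K P \<longleftrightarrow>
     prob_space P \<and> sets P = sets (vec_space d) \<and>
     (\<forall>i\<in>{1..d}. (\<integral>x. x i \<partial>P) = 0) \<and> psi2_norm d P \<le> ennreal K"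

definition cov_mat :: "rvec measure \<Rightarrow> rmat" where
  "cov_mat P = (\<lambda>(i, j). \<integral>x. (x i - (\<integral>y. y i \<partial>P)) * (x j - (\<integral>y. y j \<partial>P)) \<partial>P)"

definition off_diag_block :: "nat \<Rightarrow> nat \<Rightarrow> (nat \<times> nat) set \<Rightarrow> bool" where
  "off_diag_block d k R \<longleftrightarrow>
     (\<exists>I J. I \<subseteq> {1..d} \<and> J \<subseteq> {1..d} \<and> R = I \<times> J) \<and>
     (R \<subseteq> {(i, j). j \<ge> i + k} \<or> R \<subseteq> {(i, j). i \<ge> j + k})"

definition quad_form :: "nat \<Rightarrow> rmat \<Rightarrow> rvec \<Rightarrow> real" where
  "quad_form d A v = (\<Sum>i\<in>{1..d}. \<Sum>j\<in>{1..d}. v i * A (i, j) * v j)"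

definition cov_class :: "nat \<Rightarrow> real \<Rightarrow> real \<Rightarrow> real \<Rightarrow> rmat set" where
  "cov_class d \<alpha> M0 M =
     {A. (\<forall>i\<in>{1..d}. \<forall>j\<in>{1..d}. A (i, j) = A (j, i)) \<and>
         (\<forall>v. 0 \<le> quad_form d A v \<and> quad_form d A v \<le> M0 * (\<Sum>i\<in>{1..d}. (v i)\<^sup>2)) \<and>
         (\<forall>k\<ge>1. \<forall>R. off_diag_block d k R \<longrightarrow> spec_norm d (mask A R) \<le> M * real k powr (- \<alpha>))}"


section \<open>The private covariance block\<close>

text \<open>The case \<open>z = 0\<close> needs no separate clause, since then \<open>R / 0 = 0\<close>.\<close>

definition clip :: "real \<Rightarrow> nat set \<Rightarrow> rvec \<Rightarrow> rvec" where
  "clip R I z = (\<lambda>i. z i * min 1 (R / L2_set z I))"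

definition sym_gauss :: "nat \<Rightarrow> rmat measure" where
  "sym_gauss d =
     distr (\<Pi>\<^sub>M p\<in>{(i, j). 1 \<le> i \<and> i \<le> j \<and> j \<le> d}. density lborel std_normal_density)
       (mat_space d) (\<lambda>g. \<lambda>(i, j)\<in>{1..d} \<times> {1..d}. g (min i j, max i j))"

definition DPCovBlock ::
    "nat \<Rightarrow> nat \<Rightarrow> (nat \<Rightarrow> rvec) \<Rightarrow> nat set \<Rightarrow> nat set \<Rightarrow> real \<Rightarrow> real \<Rightarrow> rmat measure" where
  "DPCovBlock n d X I J \<rho>B R =
     distr (sym_gauss d) (mat_space d)
       (\<lambda>G. \<lambda>(i, j)\<in>{1..d} \<times> {1..d}.
          if (i, j) \<in> I \<times> J
          then 1 / real n * (\<Sum>a\<in>{1..n}. clip R I (X a) i * clip R J (X a) j)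
               + sqrt (18 * R ^ 4 / (\<rho>B * (real n)\<^sup>2)) * G (i, j)
          else 0)"


section \<open>The adaptive estimator\<close>

text \<open>
  In this section \<open>d\<close> is the original dimension; \<open>ada_dim\<close> is the dimension after padding, which
  replaces \<open>d\<close> everywhere except in \<open>k\<^sub>0\<close> and in the final restriction to the principal submatrix.
\<close>

definition ada_k :: "real \<Rightarrow> nat \<Rightarrow> nat \<Rightarrow> nat \<Rightarrow> nat" where
  "ada_k C0 n d m = 2 ^ m * min d (nat \<lceil>C0 * ln (real n)\<rceil>)"

definition ada_dim :: "real \<Rightarrow> nat \<Rightarrow> nat \<Rightarrow> nat" where
  "ada_dim C0 n d = ada_k C0 n d (LEAST J. d \<le> ada_k C0 n d J)"

definition pad :: "nat \<Rightarrow> nat \<Rightarrow> (nat \<Rightarrow> rvec) \<Rightarrow> nat \<Rightarrow> rvec" where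
  "pad D d X a = (\<lambda>i\<in>{1..D}. if i \<le> d then X a i else 0)"

text \<open>
  If no \<open>m\<close> satisfies the constraint (possible only for small \<open>n\<close>), then by convention there is one
  scale; otherwise \<open>m = 0\<close> satisfies it and the \<open>insert\<close> has no effect.
\<close>

definition ada_S :: "real \<Rightarrow> real \<Rightarrow> nat \<Rightarrow> nat \<Rightarrow> nat" where
  "ada_S C0 c0 n d =
     1 + Max (insert 0 {m. real (ada_k C0 n d m) \<le> min (c0 * real n) (real (ada_dim C0 n d))})"

text \<open>The division is exact for all the scales \<open>m < S\<close> in use.\<close>

definition ada_N :: "real \<Rightarrow> nat \<Rightarrow> nat \<Rightarrow> nat \<Rightarrow> nat" where
  "ada_N C0 n d m = ada_dim C0 n d div ada_k C0 n d m"

definition idx :: "nat \<Rightarrow> nat \<Rightarrow> nat set" where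
  "idx k l = {1 + (l - 1) * k..l * k}"

definition blk :: "nat \<Rightarrow> nat \<Rightarrow> nat \<Rightarrow> (nat \<times> nat) set" where
  "blk k l r = idx k l \<times> idx k (l + r)"

definition ada_Gamma :: "real \<Rightarrow> nat \<Rightarrow> nat \<Rightarrow> nat \<Rightarrow> nat \<Rightarrow> (nat \<times> nat) set" where
  "ada_Gamma C0 n d m l = blk (ada_k C0 n d m) l 1 - blk (ada_k C0 n d (m - 1)) (2 * l) 1"

definition ada_rho :: "real \<Rightarrow> real \<Rightarrow> nat \<Rightarrow> nat \<Rightarrow> real \<Rightarrow> nat \<Rightarrow> real" where
  "ada_rho C0 c0 n d \<rho> m =
     (if m = 0 then \<rho> / (2 * real (ada_S C0 c0 n d) * real (ada_N C0 n d 0))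
      else \<rho> / (real (ada_S C0 c0 n d) * real (ada_N C0 n d m)))"

definition ada_tau :: "real \<Rightarrow> real \<Rightarrow> real \<Rightarrow> nat \<Rightarrow> nat \<Rightarrow> real \<Rightarrow> nat \<Rightarrow> real" where
  "ada_tau C0 L1 c0 n d \<rho> m =
     (let k = real (ada_k C0 n d m); D = real (ada_dim C0 n d)
      in sqrt (L1 * ((k + ln D) / real n
                     + k\<^sup>2 * (k + ln D) / (ada_rho C0 c0 n d \<rho> m * (real n)\<^sup>2)
                     + exp (- 2 * k))))"

text \<open>
  The calls of \<open>DPCovBlock\<close>, indexed by \<open>(m, l, r)\<close>; \<open>ada_call\<close> is the output law of each.
\<close>

definition ada_calls :: "real \<Rightarrow> real \<Rightarrow> nat \<Rightarrow> nat \<Rightarrow> (nat \<times> nat \<times> nat) set" where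
  "ada_calls C0 c0 n d =
     {(0, l, r) | l r. l \<in> {1..ada_N C0 n d 0} \<and> r \<in> {0, 1} \<and> l + r \<le> ada_N C0 n d 0} \<union>
     {(m, l, 1) | m l. m \<in> {1..<ada_S C0 c0 n d} \<and> l \<in> {1..<ada_N C0 n d m}}"

definition ada_call ::
    "real \<Rightarrow> real \<Rightarrow> real \<Rightarrow> nat \<Rightarrow> nat \<Rightarrow> real \<Rightarrow> (nat \<Rightarrow> rvec) \<Rightarrow> nat \<times> nat \<times> nat \<Rightarrow> rmat measure" where
  "ada_call C0 C c0 n d \<rho> X = (\<lambda>(m, l, r).
     (let k = ada_k C0 n d m; D = ada_dim C0 n d
      in DPCovBlock n D (pad D d X) (idx k l) (idx k (l + r))
           (ada_rho C0 c0 n d \<rho> m) (sqrt (C * real k))))"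

text \<open>
  The index sets assigned to are pairwise disjoint, so the successive assignments, started from the
  zero matrix, amount to a sum.
\<close>

definition ada_piece ::
    "real \<Rightarrow> real \<Rightarrow> real \<Rightarrow> nat \<Rightarrow> nat \<Rightarrow> real \<Rightarrow> nat \<times> nat \<times> nat \<Rightarrow> rmat \<Rightarrow> rmat" where
  "ada_piece C0 L1 c0 n d \<rho> = (\<lambda>(m, l, r) Y.
     if m = 0 then mask Y (blk (ada_k C0 n d 0) l r)
     else (let A = mask Y (ada_Gamma C0 n d m l)
           in if spec_norm (ada_dim C0 n d) A > ada_tau C0 L1 c0 n d \<rho> m then A else (\<lambda>_. 0)))"

definition ada_assemble ::
    "real \<Rightarrow> real \<Rightarrow> real \<Rightarrow> nat \<Rightarrow> nat \<Rightarrow> real \<Rightarrow> (nat \<times> nat \<times> nat \<Rightarrow> rmat) \<Rightarrow> rmat" where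
  "ada_assemble C0 L1 c0 n d \<rho> Y =
     (\<lambda>(i, j)\<in>{1..d} \<times> {1..d}.
        \<Sum>c\<in>ada_calls C0 c0 n d. ada_piece C0 L1 c0 n d \<rho> c (Y c) (min i j, max i j))"

text \<open>The product measure expresses that every call uses fresh noise.\<close>

definition ada_estimator ::
    "real \<Rightarrow> real \<Rightarrow> real \<Rightarrow> real \<Rightarrow> nat \<Rightarrow> nat \<Rightarrow> real \<Rightarrow> (nat \<Rightarrow> rvec) \<Rightarrow> rmat measure" where
  "ada_estimator C0 C L1 c0 n d \<rho> X =
     distr (PiM (ada_calls C0 c0 n d) (ada_call C0 C c0 n d \<rho> X)) (mat_space d)
       (ada_assemble C0 L1 c0 n d \<rho>)"


section \<open>Risk, rate and asymptotic regime\<close>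

definition expected_loss ::
    "nat \<Rightarrow> rvec measure \<Rightarrow> ((nat \<Rightarrow> rvec) \<Rightarrow> rmat measure) \<Rightarrow> (rmat \<Rightarrow> real) \<Rightarrow> ennreal" where
  "expected_loss n P A loss =
     (\<integral>\<^sup>+ X. (\<integral>\<^sup>+ E. ennreal (loss (\<lambda>p. E p - cov_mat P p)) \<partial>A X) \<partial>(\<Pi>\<^sub>M a\<in>{1..n}. P))"

definition rate :: "real \<Rightarrow> nat \<Rightarrow> nat \<Rightarrow> real \<Rightarrow> real" where
  "rate \<alpha> n d \<rho> =
     min (real n powr (- (2 * \<alpha> / (2 * \<alpha> + 1)))) (real d / real n)
     + min ((real d * ln (real n) / (\<rho> * (real n)\<^sup>2)) powr (\<alpha> / (\<alpha> + 1)))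
           (real d ^ 3 * ln (real n) / (\<rho> * (real n)\<^sup>2))"

definition regime ::
    "real \<Rightarrow> real \<Rightarrow> (nat \<Rightarrow> nat) \<Rightarrow> (nat \<Rightarrow> nat) \<Rightarrow> (nat \<Rightarrow> real) \<Rightarrow> bool" where
  "regime c\<^sub>d \<rho>\<^sub>m\<^sub>a\<^sub>x n d \<rho> \<longleftrightarrow>
     filterlim n at_top sequentially \<and>
     (\<forall>\<^sub>F t in sequentially. real (d t) \<ge> c\<^sub>d * ln (real (n t))) \<and>
     (\<forall>\<^sub>F t in sequentially. 0 < \<rho> t \<and> \<rho> t \<le> \<rho>\<^sub>m\<^sub>a\<^sub>x) \<and>
     (\<lambda>t. real (d t) / (\<rho> t * (real (n t))\<^sup>2)) \<longlonglongrightarrow> 0"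

end

theory Submission
  imports Defs
begin

text \<open>
  Privacy. One call of the block primitive releases a Gaussian vector whose mean depends on the
  data: the block shifted by the noise, read off its upper triangle. The moment of order \<open>a\<close> of
  the likelihood ratio of two unit Gaussians is \<open>exp (a (a - 1) x\<^sup>2 / 2)\<close>, where \<open>x\<close> is the
  distance of their means, and clipping bounds the squared distance for adjacent datasets
  (\<open>emp_block_sensitivity\<close>). Such moments multiply over independent outputs
  (\<open>renyi_moment_PiM\<close>) and do not grow under maps (\<open>renyi_moment_distr\<close>), so the privacy
  budgets of the calls add up, and they were chosen to add up to at most \<open>\<rho>\<close>
  (\<open>zCDP_ada_estimator\<close>).

  Accuracy. For a block of side \<open>k\<close>, the operator norm is comparable to a maximum of bilinear
  forms over a net of \<open>exp (O(k))\<close> points, so exponential moments and a union bound control both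
  the Gaussian noise (\<open>sym_gauss_block_tail\<close>) and the clipped sample covariance
  (\<open>emp_block_tail\<close>), outside an event of probability \<open>exp (- h k)\<close> and up to an error of the
  order of the standard deviation times \<open>sqrt k\<close>; clipping itself biases the forms by only
  \<open>O(1/n)\<close>. The threshold \<open>\<tau>\<^sub>m\<close> is chosen to be at least four times this error, so
  a thresholded block is wrong by at most a multiple of \<open>\<tau>\<^sub>m\<close> and also by at most the
  norm of the true block (\<open>threshold_error\<close>). This minimum is what makes the estimator adaptive:
  it is the better of keeping and dropping the block, without knowledge of \<open>\<alpha>\<close>.

  The scale-zero blocks and the corner regions \<open>\<Gamma>\<close> of all larger scales cover every entry
  of the upper triangle exactly once (\<open>decompose\<close>). The regions of one scale have disjoint rows
  and disjoint columns, so their errors do not add up (\<open>op_bounded_blocks\<close>); the errors of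
  different scales do (\<open>assemble_error\<close>). In the sum over scales, the stochastic
  error grows geometrically and the norm of the true blocks decays geometrically, so the sum is of
  the order of the term where the two cross, which is the square root of the rate
  (\<open>sum_statistical_le\<close>, \<open>sum_privacy_le\<close>). The blocks of scale zero are kept without a
  threshold, and only for their privacy noise is the lower bound on \<open>\<rho> n\<^sup>2 / d\<close> needed
  (\<open>scale0_privacy_le\<close>).

  On the exceptional event the loss is bounded by a polynomial in \<open>n\<close> times a polynomial in the
  Gaussian noise (\<open>crude_loss\<close>). Since every block has side at least a multiple of \<open>log n\<close>, the
  exceptional probability is below any prescribed power of \<open>1/n\<close>, which absorbs the polynomial
  (\<open>expected_loss_le\<close>, \<open>polynomial_slack\<close>). Finally, the squared Frobenius norm is at most \<open>d\<close>
  times the squared spectral norm, so the bound for the second loss follows from the first.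
\<close>

section \<open>Bilinear forms and operator norm bounds\<close>

text \<open>Block and row indices start at one; unfolding \<open>1\<close> to \<open>Suc 0\<close> would obscure them.\<close>

declare One_nat_def [simp del]

definition bilin :: "nat \<Rightarrow> rmat \<Rightarrow> rvec \<Rightarrow> rvec \<Rightarrow> real" where
  "bilin D A u v = (\<Sum>i\<in>{1..D}. \<Sum>j\<in>{1..D}. u i * A (i, j) * v j)"

text \<open>
  An upper bound on the operator norm, stated through bilinear forms: these restrict to index
  sets, add up and transpose without any choice of maximizers, and the dimension can be changed
  by padding the vectors with zeros.
\<close>

definition op_bounded :: "nat \<Rightarrow> rmat \<Rightarrow> real \<Rightarrow> bool" where
  "op_bounded D A b \<longleftrightarrow> (\<forall>u v. \<bar>bilin D A u v\<bar> \<le> b * L2_set u {1..D} * L2_set v {1..D})"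

lemma abs_sum_mult_le_L2_set: "\<bar>\<Sum>i\<in>A. f i * g i\<bar> \<le> L2_set f A * L2_set g A" for f g :: "'a \<Rightarrow> real"
  by (rule order_trans[OF sum_abs]) (simp add: abs_mult L2_set_mult_ineq)

lemma L2_set_scale: "L2_set (\<lambda>i. c * f i) A = \<bar>c\<bar> * L2_set f A"
proof -
  have "L2_set (\<lambda>i. c * f i) A = L2_set (\<lambda>i. \<bar>c\<bar> * f i) A"
    by (simp add: L2_set_def power_mult_distrib)
  then show ?thesis by (simp add: L2_set_right_distrib)
qed

lemma L2_set_power2: "(L2_set f A)\<^sup>2 = (\<Sum>i\<in>A. (f i)\<^sup>2)"
  by (simp add: L2_set_def sum_nonneg)

lemma L2_set_le_iff: "0 \<le> b \<Longrightarrow> L2_set f A \<le> b \<longleftrightarrow> (\<Sum>i\<in>A. (f i)\<^sup>2) \<le> b\<^sup>2"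
  unfolding L2_set_power2[symmetric] by (auto simp: power2_le_iff_abs_le)

lemma bilin_matvec: "bilin D A u v = (\<Sum>i\<in>{1..D}. u i * (\<Sum>j\<in>{1..D}. A (i, j) * v j))"
  by (simp add: bilin_def sum_distrib_left mult.assoc)

lemma bilin_add: "bilin D (\<lambda>p. A p + B p) u v = bilin D A u v + bilin D B u v"
  by (simp add: bilin_def sum.distrib algebra_simps)

lemma bilin_diff: "bilin D (\<lambda>p. A p - B p) u v = bilin D A u v - bilin D B u v"
  by (simp add: bilin_def sum_subtractf algebra_simps)

lemma bilin_scale: "bilin D (\<lambda>p. c * A p) u v = c * bilin D A u v"
  by (simp add: bilin_def sum_distrib_left algebra_simps)

lemma bilin_zero [simp]: "bilin D (\<lambda>p. 0) u v = 0"
  by (simp add: bilin_def)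

lemma bilin_cong:
  "(\<And>i j. i \<in> {1..D} \<Longrightarrow> j \<in> {1..D} \<Longrightarrow> A (i,j) = B (i,j)) \<Longrightarrow> bilin D A u v = bilin D B u v"
  unfolding bilin_def by (intro sum.cong refl) auto

lemma bilin_sum: "finite S \<Longrightarrow> bilin D (\<lambda>p. \<Sum>l\<in>S. A l p) u v = (\<Sum>l\<in>S. bilin D (A l) u v)"
proof (induction S rule: finite_induct)
  case (insert x F)
  then show ?case using bilin_add[of D "A x" "\<lambda>p. \<Sum>l\<in>F. A l p"] by simp
qed simp

lemma bilin_diff_left: "bilin D A (\<lambda>i. u i - w i) v = bilin D A u v - bilin D A w v"
  by (simp add: bilin_def sum_subtractf algebra_simps)

lemma bilin_diff_right: "bilin D A u (\<lambda>i. v i - w i) = bilin D A u v - bilin D A u w"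
  by (simp add: bilin_def sum_subtractf algebra_simps)

lemma bilin_scale_vec: "bilin D A (\<lambda>i. a * u i) (\<lambda>i. b * v i) = a * b * bilin D A u v"
  by (simp add: bilin_def sum_distrib_left algebra_simps)

lemma bilin_transpose: "bilin D (\<lambda>(i, j). A (j, i)) u v = bilin D A v u"
  unfolding bilin_def by (subst sum.swap) (auto intro!: sum.cong)

lemma bilin_supported:
  assumes "\<And>i j. i \<in> {1..D} \<Longrightarrow> j \<in> {1..D} \<Longrightarrow> (i, j) \<notin> I \<times> J \<Longrightarrow> A (i, j) = 0"
  shows "bilin D A u v = bilin D A (\<lambda>i. if i \<in> I then u i else 0) (\<lambda>j. if j \<in> J then v j else 0)"
  unfolding bilin_def by (intro sum.cong refl) (use assms in auto)

lemma bilin_mask_Times: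
  "bilin D (mask A (I \<times> J)) u v = bilin D A (\<lambda>i. if i \<in> I then u i else 0) (\<lambda>j. if j \<in> J then v j else 0)"
  unfolding bilin_def mask_def by (intro sum.cong refl) auto

lemma op_boundedD: "op_bounded D A b \<Longrightarrow> \<bar>bilin D A u v\<bar> \<le> b * L2_set u {1..D} * L2_set v {1..D}"
  by (simp add: op_bounded_def)

lemma op_boundedI_unit:
  assumes "\<And>u v. L2_set u {1..D} \<le> 1 \<Longrightarrow> L2_set v {1..D} \<le> 1 \<Longrightarrow> \<bar>bilin D A u v\<bar> \<le> b"
  shows "op_bounded D A b"
  unfolding op_bounded_def
proof (intro allI)
  fix u v :: rvec
  let ?a = "L2_set u {1..D}" and ?c = "L2_set v {1..D}"
  show "\<bar>bilin D A u v\<bar> \<le> b * ?a * ?c"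
  proof (cases "?a = 0 \<or> ?c = 0")
    case True
    then have "bilin D A u v = 0"
    proof
      assume "?a = 0" then show ?thesis by (simp add: L2_set_eq_0_iff bilin_def)
    next
      assume "?c = 0" then show ?thesis by (simp add: L2_set_eq_0_iff bilin_def)
    qed
    with True show ?thesis by auto
  next
    case False
    then have pos: "?a > 0" "?c > 0" by (simp_all add: less_le)
    have "\<bar>bilin D A (\<lambda>i. (1 / ?a) * u i) (\<lambda>i. (1 / ?c) * v i)\<bar> \<le> b"
      using pos by (intro assms; subst L2_set_scale) auto
    then have "\<bar>bilin D A u v\<bar> / (?a * ?c) \<le> b"
      using pos unfolding bilin_scale_vec by (simp add: abs_mult abs_divide)
    then show ?thesis using pos by (simp add: pos_divide_le_eq mult.assoc)
  qed
qed

lemma op_bounded_mono: "op_bounded D A b \<Longrightarrow> b \<le> c \<Longrightarrow> op_bounded D A c"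
  unfolding op_bounded_def
  by (meson L2_set_nonneg mult_right_mono order_trans)

lemma op_bounded_zero: "0 \<le> b \<Longrightarrow> op_bounded D (\<lambda>_. 0) b"
  by (simp add: op_bounded_def)

lemma op_bounded_cong:
  assumes "\<And>i j. i \<in> {1..D} \<Longrightarrow> j \<in> {1..D} \<Longrightarrow> A (i,j) = B (i,j)"
  shows "op_bounded D A b \<longleftrightarrow> op_bounded D B b"
proof -
  have "bilin D A u v = bilin D B u v" for u v by (rule bilin_cong) (rule assms)
  then show ?thesis by (simp add: op_bounded_def)
qed

lemma op_bounded_add:
  assumes "op_bounded D A a" "op_bounded D B b"
  shows "op_bounded D (\<lambda>p. A p + B p) (a + b)"
  unfolding op_bounded_def bilin_add
proof (intro allI)
  fix u v
  show "\<bar>bilin D A u v + bilin D B u v\<bar> \<le> (a + b) * L2_set u {1..D} * L2_set v {1..D}"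
    using op_boundedD[OF assms(1), of u v] op_boundedD[OF assms(2), of u v]
    by (simp add: algebra_simps)
qed

lemma op_bounded_scale:
  assumes "op_bounded D A a" shows "op_bounded D (\<lambda>p. c * A p) (\<bar>c\<bar> * a)"
  unfolding op_bounded_def bilin_scale abs_mult
  using op_boundedD[OF assms] by (simp add: mult.assoc mult_left_mono)

lemma op_bounded_diff:
  assumes "op_bounded D A a" "op_bounded D B b"
  shows "op_bounded D (\<lambda>p. A p - B p) (a + b)"
  using op_bounded_add[OF assms(1) op_bounded_scale[OF assms(2), of "-1"]] by simp

lemma op_bounded_sum:
  assumes "finite S" "\<And>l. l \<in> S \<Longrightarrow> op_bounded D (A l) (b l)"
  shows "op_bounded D (\<lambda>p. \<Sum>l\<in>S. A l p) (\<Sum>l\<in>S. b l)"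
  using assms
proof (induction S rule: finite_induct)
  case empty then show ?case by (simp add: op_bounded_zero)
next
  case (insert x F)
  then show ?case using op_bounded_add[of D "A x" "b x" "\<lambda>p. \<Sum>l\<in>F. A l p" "\<Sum>l\<in>F. b l"] by simp
qed

lemma op_bounded_transpose: "op_bounded D A b \<Longrightarrow> op_bounded D (\<lambda>(i, j). A (j, i)) b"
  unfolding op_bounded_def bilin_transpose by (metis mult.commute mult.assoc)

lemma L2_set_restrict_le: "L2_set (\<lambda>i. if i \<in> I then u i else 0) {1..D} \<le> L2_set u {1..D}"
  unfolding L2_set_def by (intro real_sqrt_le_mono sum_mono) auto

lemma op_bounded_mask_Times:
  assumes "op_bounded D A b" "0 \<le> b"
  shows "op_bounded D (mask A (I \<times> J)) b"
  unfolding op_bounded_def bilin_mask_Times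
proof (intro allI)
  fix u v :: rvec
  let ?u = "\<lambda>i. if i \<in> I then u i else 0" and ?v = "\<lambda>i. if i \<in> J then v i else 0"
  have "\<bar>bilin D A ?u ?v\<bar> \<le> b * (L2_set ?u {1..D} * L2_set ?v {1..D})"
    using op_boundedD[OF assms(1)] by (simp add: mult.assoc)
  also have "\<dots> \<le> b * (L2_set u {1..D} * L2_set v {1..D})"
    by (intro mult_left_mono mult_mono L2_set_restrict_le assms(2)) auto
  finally show "\<bar>bilin D A ?u ?v\<bar> \<le> b * L2_set u {1..D} * L2_set v {1..D}"
    by (simp add: mult.assoc)
qed

lemma sum_blocks_L2_le:
  assumes "finite S" "\<And>l l'. l \<in> S \<Longrightarrow> l' \<in> S \<Longrightarrow> l \<noteq> l' \<Longrightarrow> I l \<inter> I l' = {}"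
  shows "(\<Sum>l\<in>S. (L2_set (\<lambda>i. if i \<in> I l then u i else 0) {1..D})\<^sup>2) \<le> (L2_set u {1..D})\<^sup>2"
proof -
  have "(\<Sum>l\<in>S. if i \<in> I l then (u i)\<^sup>2 else 0) \<le> (u i)\<^sup>2" for i
  proof (cases "\<exists>l\<in>S. i \<in> I l")
    case True
    then obtain l where l: "l \<in> S" "i \<in> I l" by blast
    have "(\<Sum>l'\<in>S. if i \<in> I l' then (u i)\<^sup>2 else 0) = (\<Sum>l'\<in>S. if l' = l then (u i)\<^sup>2 else 0)"
      by (intro sum.cong refl) (use assms(2) l in auto)
    then show ?thesis using assms(1) l by simp
  next
    case False
    then have "(\<Sum>l'\<in>S. if i \<in> I l' then (u i)\<^sup>2 else 0) = (\<Sum>l'\<in>S. 0)"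
      by (intro sum.cong refl) auto
    then show ?thesis by simp
  qed
  then have "(\<Sum>i\<in>{1..D}. \<Sum>l\<in>S. if i \<in> I l then (u i)\<^sup>2 else 0) \<le> (\<Sum>i\<in>{1..D}. (u i)\<^sup>2)"
    by (intro sum_mono)
  then show ?thesis
    unfolding L2_set_power2 by (subst sum.swap) (simp add: if_distrib[of "\<lambda>x. x^2"] cong: if_cong)
qed

text \<open>
  A matrix whose blocks share neither rows nor columns acts on orthogonal pieces of both vectors,
  so by the Cauchy-Schwarz inequality its norm is the largest norm of a block, not their sum.
\<close>

lemma op_bounded_blocks:
  assumes S: "finite S" and b: "0 \<le> b"
    and A: "\<And>l. l \<in> S \<Longrightarrow> op_bounded D (A l) b"
    and supp: "\<And>l i j. l \<in> S \<Longrightarrow> (i, j) \<notin> I l \<times> J l \<Longrightarrow> A l (i, j) = 0"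
    and I: "\<And>l l'. l \<in> S \<Longrightarrow> l' \<in> S \<Longrightarrow> l \<noteq> l' \<Longrightarrow> I l \<inter> I l' = {}"
    and J: "\<And>l l'. l \<in> S \<Longrightarrow> l' \<in> S \<Longrightarrow> l \<noteq> l' \<Longrightarrow> J l \<inter> J l' = {}"
  shows "op_bounded D (\<lambda>p. \<Sum>l\<in>S. A l p) b"
  unfolding op_bounded_def bilin_sum[OF S]
proof (intro allI)
  fix u v :: rvec
  let ?u = "\<lambda>l i. if i \<in> I l then u i else 0" and ?v = "\<lambda>l i. if i \<in> J l then v i else 0"
  let ?a = "\<lambda>l. L2_set (?u l) {1..D}" and ?c = "\<lambda>l. L2_set (?v l) {1..D}"
  have "\<bar>\<Sum>l\<in>S. bilin D (A l) u v\<bar> \<le> (\<Sum>l\<in>S. \<bar>bilin D (A l) u v\<bar>)" by (rule sum_abs)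
  also have "\<dots> \<le> (\<Sum>l\<in>S. b * (?a l * ?c l))"
  proof (rule sum_mono)
    fix l assume l: "l \<in> S"
    have "bilin D (A l) u v = bilin D (A l) (?u l) (?v l)"
      by (rule bilin_supported) (use supp l in blast)
    then show "\<bar>bilin D (A l) u v\<bar> \<le> b * (?a l * ?c l)"
      using op_boundedD[OF A[OF l], of "?u l" "?v l"] by (simp add: mult.assoc)
  qed
  also have "\<dots> = b * (\<Sum>l\<in>S. ?a l * ?c l)" by (simp add: sum_distrib_left)
  also have "\<dots> \<le> b * (L2_set ?a S * L2_set ?c S)"
    using L2_set_mult_ineq[of ?a ?c S] b by (intro mult_left_mono) auto
  also have "\<dots> \<le> b * (L2_set u {1..D} * L2_set v {1..D})"
    using b sum_blocks_L2_le[OF S, of I u D] sum_blocks_L2_le[OF S, of J v D] I J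
    by (intro mult_left_mono mult_mono) (auto simp: L2_set_le_iff)
  finally show "\<bar>\<Sum>l\<in>S. bilin D (A l) u v\<bar> \<le> b * L2_set u {1..D} * L2_set v {1..D}"
    by (simp add: mult.assoc)
qed

lemma L2_set_matvec_le_sum:
  fixes A :: rmat and v :: rvec
  assumes "L2_set v {1..D} \<le> 1"
  shows "L2_set (\<lambda>i. \<Sum>j\<in>{1..D}. A (i, j) * v j) {1..D} \<le> (\<Sum>p\<in>{1..D} \<times> {1..D}. \<bar>A p\<bar>)"
proof -
  have v: "\<bar>v j\<bar> \<le> 1" if "j \<in> {1..D}" for j
  proof -
    have "\<bar>v j\<bar> \<le> L2_set (\<lambda>j. \<bar>v j\<bar>) {1..D}" by (rule member_le_L2_set) (use that in auto)
    also have "\<dots> = L2_set v {1..D}" by (simp add: L2_set_def)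
    finally show ?thesis using assms by simp
  qed
  have "L2_set (\<lambda>i. \<Sum>j\<in>{1..D}. A (i, j) * v j) {1..D} \<le> (\<Sum>i\<in>{1..D}. \<bar>\<Sum>j\<in>{1..D}. A (i, j) * v j\<bar>)"
    by (rule L2_set_le_sum_abs)
  also have "\<dots> \<le> (\<Sum>i\<in>{1..D}. \<Sum>j\<in>{1..D}. \<bar>A (i, j)\<bar>)"
    using v by (intro sum_mono order_trans[OF sum_abs]) (simp add: abs_mult mult_left_le)
  finally show ?thesis by (simp add: sum.cartesian_product)
qed

lemma spec_norm_bdd_above:
  fixes A :: rmat
  shows
  "bdd_above ((\<lambda>v. L2_set (\<lambda>i. \<Sum>j\<in>{1..D}. A (i, j) * v j) {1..D}) ` {v. L2_set v {1..D} \<le> 1})"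
  by (rule bdd_aboveI2[where M = "\<Sum>p\<in>{1..D} \<times> {1..D}. \<bar>A p\<bar>"]) (simp add: L2_set_matvec_le_sum)

lemma unit_ball_zero: "(\<lambda>_. 0) \<in> {v. L2_set v {1..D} \<le> 1}"
  by (simp add: L2_set_def)

lemma spec_norm_nonneg: "0 \<le> spec_norm D A"
  unfolding spec_norm_def
  by (rule order_trans[OF _ cSUP_upper[OF unit_ball_zero spec_norm_bdd_above]]) simp

lemma op_bounded_spec_norm: "op_bounded D A (spec_norm D A)"
proof (rule op_boundedI_unit)
  fix u v :: rvec assume u: "L2_set u {1..D} \<le> 1" and v: "L2_set v {1..D} \<le> 1"
  have "\<bar>bilin D A u v\<bar> \<le> L2_set u {1..D} * L2_set (\<lambda>i. \<Sum>j\<in>{1..D}. A (i, j) * v j) {1..D}"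
    unfolding bilin_matvec by (rule abs_sum_mult_le_L2_set)
  also have "\<dots> \<le> 1 * spec_norm D A"
    unfolding spec_norm_def
    by (intro mult_mono u cSUP_upper spec_norm_bdd_above) (use v in auto)
  finally show "\<bar>bilin D A u v\<bar> \<le> spec_norm D A" by simp
qed

text \<open>
  Testing the bilinear form at \<open>u = A v\<close> gives \<open>|A v|\<^sup>2 \<le> b |A v| |v|\<close>.
\<close>

lemma spec_norm_le:
  assumes "op_bounded D A b" "0 \<le> b"
  shows "spec_norm D A \<le> b"
  unfolding spec_norm_def
proof (rule cSUP_least)
  show "{v. L2_set v {1..D} \<le> 1} \<noteq> {}" using unit_ball_zero by blast
  fix v :: rvec assume "v \<in> {v. L2_set v {1..D} \<le> 1}"
  then have v: "L2_set v {1..D} \<le> 1" by simp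
  let ?w = "\<lambda>i. \<Sum>j\<in>{1..D}. A (i, j) * v j"
  let ?x = "L2_set ?w {1..D}"
  have "?x * ?x = bilin D A ?w v"
    unfolding bilin_matvec using L2_set_power2[of ?w "{1..D}"] by (simp add: power2_eq_square)
  also have "\<dots> \<le> b * ?x * L2_set v {1..D}" using op_boundedD[OF assms(1), of ?w v] by linarith
  also have "\<dots> \<le> b * ?x * 1" using v assms(2) by (intro mult_left_mono) auto
  finally have "?x * ?x \<le> b * ?x" by simp
  then show "?x \<le> b"
    using assms(2) by (cases "?x = 0") (simp_all add: mult_le_cancel_right less_le)
qed

lemma spec_norm_triangle: "spec_norm D A \<le> spec_norm D B + spec_norm D (\<lambda>p. A p - B p)"
proof -
  have "op_bounded D (\<lambda>p. B p + (A p - B p)) (spec_norm D B + spec_norm D (\<lambda>p. A p - B p))"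
    by (intro op_bounded_add op_bounded_spec_norm)
  then show ?thesis by (intro spec_norm_le) (auto simp: spec_norm_nonneg)
qed

lemma spec_norm_le_sum: "spec_norm D A \<le> (\<Sum>p\<in>{1..D} \<times> {1..D}. \<bar>A p\<bar>)"
  unfolding spec_norm_def
proof (rule cSUP_least)
  show "{v. L2_set v {1..D} \<le> 1} \<noteq> {}" using unit_ball_zero by blast
qed (simp add: L2_set_matvec_le_sum)

lemma spec_norm_minus: "spec_norm D (\<lambda>p. A p - B p) = spec_norm D (\<lambda>p. B p - A p)"
proof -
  have *: "spec_norm D (\<lambda>p. A p - B p) \<le> spec_norm D (\<lambda>p. B p - A p)" for A B
  proof -
    have "op_bounded D (\<lambda>p. -1 * (B p - A p)) (\<bar>-1\<bar> * spec_norm D (\<lambda>p. B p - A p))"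
      by (rule op_bounded_scale[OF op_bounded_spec_norm])
    moreover have "(\<lambda>p. -1 * (B p - A p)) = (\<lambda>p. A p - B p)" by auto
    ultimately show ?thesis by (simp add: spec_norm_le spec_norm_nonneg)
  qed
  show ?thesis by (intro antisym *)
qed

lemma spec_norm_lipschitz: "\<bar>spec_norm D A - spec_norm D B\<bar> \<le> (\<Sum>p\<in>{1..D} \<times> {1..D}. \<bar>A p - B p\<bar>)"
  using spec_norm_triangle[of D A B] spec_norm_triangle[of D B A] spec_norm_minus[of D A B]
    spec_norm_le_sum[of D "\<lambda>p. A p - B p"] by linarith

lemma spec_norm_cong:
  assumes "\<And>i j. i \<in> {1..D} \<Longrightarrow> j \<in> {1..D} \<Longrightarrow> A (i,j) = B (i,j)"
  shows "spec_norm D A = spec_norm D B"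
proof -
  have "(\<Sum>p\<in>{1..D} \<times> {1..D}. \<bar>A p - B p\<bar>) = 0" using assms by (intro sum.neutral) auto
  then show ?thesis using spec_norm_lipschitz[of D A B] by linarith
qed

lemma continuous_spec_norm: "continuous_on UNIV (spec_norm D)"
  unfolding continuous_on_def
proof (intro ballI)
  fix A :: rmat
  have "((\<lambda>B. \<Sum>p\<in>{1..D} \<times> {1..D}. \<bar>B p - A p\<bar>) \<longlongrightarrow> (\<Sum>p\<in>{1..D} \<times> {1..D}. \<bar>A p - A p\<bar>)) (at A within UNIV)"
  proof (intro tendsto_sum tendsto_rabs tendsto_diff tendsto_const)
    fix p :: "nat \<times> nat"
    have "continuous_on UNIV (\<lambda>B::rmat. B p)" by (rule continuous_on_product_coordinates)
    then show "((\<lambda>B. B p) \<longlongrightarrow> A p) (at A within UNIV)" by (simp add: continuous_on_def)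
  qed
  then have "((\<lambda>B. \<Sum>p\<in>{1..D} \<times> {1..D}. \<bar>B p - A p\<bar>) \<longlongrightarrow> 0) (at A within UNIV)" by simp
  then have "((\<lambda>B. spec_norm D B - spec_norm D A) \<longlongrightarrow> 0) (at A within UNIV)"
    by (rule Lim_null_comparison[rotated]) (intro always_eventually allI, simp only: real_norm_def spec_norm_lipschitz)
  then show "(spec_norm D \<longlongrightarrow> spec_norm D A) (at A within UNIV)" by (simp add: Lim_null[symmetric])
qed

text \<open>
  The spectral norm is Lipschitz in finitely many entries, hence continuous for the product
  topology on all matrices, and there the product and Borel sigma-algebras coincide.
\<close>

lemma borel_measurable_spec_norm:
  assumes "\<And>p. p \<in> {1..D} \<times> {1..D} \<Longrightarrow> (\<lambda>x. f x p) \<in> borel_measurable N"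
  shows "(\<lambda>x. spec_norm D (f x)) \<in> borel_measurable N"
proof -
  let ?g = "\<lambda>x p. if p \<in> {1..D} \<times> {1..D} then f x p else 0"
  have "?g \<in> measurable N (PiM UNIV (\<lambda>_. borel))"
  proof (rule measurable_PiM_single')
    show "(\<lambda>x. ?g x p) \<in> borel_measurable N" for p
      by (cases "p \<in> {1..D} \<times> {1..D}") (simp_all add: assms del: mem_Sigma_iff)
  qed auto
  then have "?g \<in> measurable N (borel :: rmat measure)"
    using sets_PiM_equal_borel measurable_cong_sets by blast
  then have "(\<lambda>x. spec_norm D (?g x)) \<in> borel_measurable N"
    by (rule measurable_compose) (rule borel_measurable_continuous_onI[OF continuous_spec_norm])
  moreover have "spec_norm D (?g x) = spec_norm D (f x)" for x by (rule spec_norm_cong) auto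
  ultimately show ?thesis by simp
qed

text \<open>
  Each of the \<open>D\<close> columns is the image of a unit vector.
\<close>

lemma frob_norm_le_spec_norm: "(frob_norm D A)\<^sup>2 \<le> real D * (spec_norm D A)\<^sup>2"
proof -
  define e :: "nat \<Rightarrow> rvec" where "e = (\<lambda>j i. if i = j then 1 else 0)"
  have col: "(\<Sum>i\<in>{1..D}. (A (i, j))\<^sup>2) \<le> (spec_norm D A)\<^sup>2" if j: "j \<in> {1..D}" for j
  proof -
    have e: "L2_set (e j) {1..D} \<le> 1"
      using j by (simp add: L2_set_def e_def if_distrib[of "\<lambda>x. x^2"] sum.delta cong: if_cong)
    have "(\<Sum>j'\<in>{1..D}. A (i, j') * e j j') = A (i, j)" for i
      using j by (simp add: e_def if_distrib[of "\<lambda>x. _ * x"] sum.delta cong: if_cong)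
    then have "L2_set (\<lambda>i. A (i, j)) {1..D} = L2_set (\<lambda>i. \<Sum>j'\<in>{1..D}. A (i, j') * e j j') {1..D}" by simp
    also have "\<dots> \<le> spec_norm D A"
      unfolding spec_norm_def by (rule cSUP_upper[OF _ spec_norm_bdd_above]) (use e in auto)
    finally show ?thesis using spec_norm_nonneg by (simp add: L2_set_le_iff)
  qed
  have "(frob_norm D A)\<^sup>2 = (\<Sum>i\<in>{1..D}. \<Sum>j\<in>{1..D}. (A (i, j))\<^sup>2)"
    unfolding frob_norm_def L2_set_power2 by (simp add: sum.cartesian_product)
  also have "\<dots> = (\<Sum>j\<in>{1..D}. \<Sum>i\<in>{1..D}. (A (i, j))\<^sup>2)" by (rule sum.swap)
  also have "\<dots> \<le> (\<Sum>j\<in>{1..D}. (spec_norm D A)\<^sup>2)" by (intro sum_mono col)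
  finally show ?thesis by simp
qed

section \<open>A lattice net of the unit ball\<close>

lemma sum_exp_neg_squares_le: "(\<Sum>z\<in>{- int m..int m}. exp (- (real_of_int z)\<^sup>2)) \<le> 3"
proof -
  have e: "exp (1::real) \<ge> 2" using exp_ge_add_one_self[of 1] by simp
  have "(\<Sum>z\<in>{- int m..int m}. exp (- (real_of_int z)\<^sup>2)) \<le> 3 - 2 * (1/2) ^ m" 
  proof (induction m)
    case 0 then show ?case by simp
  next
    case (Suc m)
    have eq: "{- int (Suc m)..int (Suc m)} = insert (- int (Suc m)) (insert (int (Suc m)) {- int m..int m})"
      by auto
    have "exp (- (real (Suc m))\<^sup>2) \<le> exp (- real (Suc m))"
      using self_le_power[of "real (Suc m)" 2] by simp
    also have "\<dots> = exp (-1) ^ Suc m" by (subst exp_of_nat_mult[symmetric]) simp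
    also have "\<dots> \<le> (1/2) ^ Suc m"
      using e by (intro power_mono) (auto simp: exp_minus field_simps)
    finally have "exp (- (real (Suc m))\<^sup>2) \<le> (1/2) ^ Suc m" .
    then show ?case unfolding eq using Suc by (simp add: power2_eq_square algebra_simps)
  qed
  then show ?thesis by (rule order_trans) simp
qed

text \<open>
  The points of the unit ball of the coordinate space of \<open>I\<close> with coordinates in
  \<open>(1 / (4 sqrt k)) \<int>\<close>. An explicit lattice makes both the covering and the counting
  argument elementary.
\<close>

definition lattice_net :: "nat \<Rightarrow> nat set \<Rightarrow> rvec set" where
  "lattice_net k I =
     (\<lambda>z i. if i \<in> I then real_of_int (z i) / (4 * sqrt (real k)) else 0) `
       {z \<in> I \<rightarrow>\<^sub>E {- int (4 * k)..int (4 * k)}. (\<Sum>i\<in>I. (real_of_int (z i))\<^sup>2) \<le> 16 * real k}"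

lemma finite_lattice_net: "finite I \<Longrightarrow> finite (lattice_net k I)"
  unfolding lattice_net_def
  by (intro finite_imageI finite_subset[OF _ finite_PiE[of I "\<lambda>_. {- int (4 * k)..int (4 * k)}"]]) auto

text \<open>
  Every counted \<open>z\<close> satisfies \<open>1 \<le> exp (16 k - \<Sum> z\<^sup>2)\<close>, and the sum of the right-hand side
  over the whole grid factorizes over the coordinates into at most \<open>card I\<close> factors \<open>3\<close>.
\<close>

lemma card_lattice_net:
  assumes I: "finite I" "card I \<le> k"
  shows "real (card (lattice_net k I)) \<le> exp (18 * real k)"
proof -
  let ?P = "I \<rightarrow>\<^sub>E {- int (4 * k)..int (4 * k)}"
  let ?Z = "{z \<in> ?P. (\<Sum>i\<in>I. (real_of_int (z i))\<^sup>2) \<le> 16 * real k}"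
  have P: "finite ?P" by (intro finite_PiE I) auto
  have e: "(3::real) \<le> exp 2" using exp_ge_add_one_self[of 2] by simp
  have "real (card (lattice_net k I)) \<le> real (card ?Z)"
    unfolding lattice_net_def by (intro of_nat_mono card_image_le finite_subset[OF _ P]) auto
  also have "\<dots> = (\<Sum>z\<in>?Z. 1)" by simp
  also have "\<dots> \<le> (\<Sum>z\<in>?Z. exp (16 * real k) * (\<Prod>i\<in>I. exp (- (real_of_int (z i))\<^sup>2)))"
    by (intro sum_mono) (simp add: exp_sum[symmetric] I exp_add[symmetric] sum_negf)
  also have "\<dots> \<le> (\<Sum>z\<in>?P. exp (16 * real k) * (\<Prod>i\<in>I. exp (- (real_of_int (z i))\<^sup>2)))"
    by (rule sum_mono2[OF P]) (auto intro!: mult_nonneg_nonneg prod_nonneg)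
  also have "\<dots> = exp (16 * real k) * (\<Prod>i\<in>I. \<Sum>z\<in>{- int (4 * k)..int (4 * k)}. exp (- (real_of_int z)\<^sup>2))"
    using I by (subst prod_sum_PiE) (auto simp: sum_distrib_left)
  also have "\<dots> \<le> exp (16 * real k) * (\<Prod>i\<in>I. 3)"
    by (intro mult_left_mono prod_mono conjI sum_exp_neg_squares_le sum_nonneg) auto
  also have "\<dots> \<le> exp (16 * real k) * exp 2 ^ k"
    using I e by (auto intro!: mult_left_mono order_trans[OF power_increasing[of "card I" k 3] power_mono])
  also have "\<dots> = exp (18 * real k)" by (simp add: exp_of_nat_mult[symmetric] exp_add[symmetric] algebra_simps)
  finally show ?thesis .
qed

lemma lattice_net_L2:
  assumes I: "I \<subseteq> {1..D}" and k: "k \<ge> 1" and w: "w \<in> lattice_net k I"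
  shows "L2_set w {1..D} \<le> 1" "L2_set w I \<le> 1" "\<And>i. i \<notin> I \<Longrightarrow> w i = 0"
proof -
  obtain z where z: "(\<Sum>i\<in>I. (real_of_int (z i))\<^sup>2) \<le> 16 * real k"
    and weq: "w = (\<lambda>i. if i \<in> I then real_of_int (z i) / (4 * sqrt (real k)) else 0)"
    using w unfolding lattice_net_def by auto
  show w0: "\<And>i. i \<notin> I \<Longrightarrow> w i = 0" by (simp add: weq)
  have "(\<Sum>i\<in>I. (w i)\<^sup>2) = (\<Sum>i\<in>I. (real_of_int (z i))\<^sup>2) / (16 * real k)"
    unfolding sum_divide_distrib by (intro sum.cong refl) (simp add: weq power_divide power_mult_distrib)
  also have "\<dots> \<le> 1" using z k by simp
  finally show *: "L2_set w I \<le> 1" by (simp add: L2_set_le_iff)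
  have "L2_set w I = L2_set w {1..D}"
    unfolding L2_set_def by (intro arg_cong[of _ _ sqrt] sum.mono_neutral_left) (use I w0 in auto)
  with * show "L2_set w {1..D} \<le> 1" by simp
qed

text \<open>
  Rounding moves each of the at most \<open>k\<close> coordinates by at most \<open>1 / (4 sqrt k)\<close>.
\<close>

lemma lattice_net_approx:
  assumes I: "finite I" "card I \<le> k" and k: "k \<ge> 1" and u: "L2_set u I \<le> 1"
  shows "\<exists>w\<in>lattice_net k I. L2_set (\<lambda>i. u i - w i) I \<le> 1 / 4"
proof -
  let ?s = "4 * sqrt (real k)"
  have s: "?s > 0" using k by simp
  \<comment> \<open>rounding toward zero keeps the vector in the unit ball\<close>
  define z where "z = (\<lambda>i\<in>I. if u i \<ge> 0 then \<lfloor>u i * ?s\<rfloor> else \<lceil>u i * ?s\<rceil>)"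
  define w where "w = (\<lambda>i. if i \<in> I then real_of_int (z i) / ?s else 0)"
  have zle: "\<bar>real_of_int (z i)\<bar> \<le> \<bar>u i\<bar> * ?s" and zclose: "\<bar>u i * ?s - real_of_int (z i)\<bar> \<le> 1" if i: "i \<in> I" for i
  proof -
    have "\<bar>real_of_int (z i)\<bar> \<le> \<bar>u i * ?s\<bar> \<and> \<bar>u i * ?s - real_of_int (z i)\<bar> \<le> 1"
    proof (cases "u i \<ge> 0")
      case True
      then have "u i * ?s \<ge> 0" using s by simp
      then show ?thesis using True i unfolding z_def by simp linarith
    next
      case False
      then have "u i * ?s < 0" using s by (simp add: mult_less_0_iff)
      then show ?thesis using False i unfolding z_def by simp linarith
    qed
    then show "\<bar>real_of_int (z i)\<bar> \<le> \<bar>u i\<bar> * ?s" "\<bar>u i * ?s - real_of_int (z i)\<bar> \<le> 1"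
      using s by (auto simp: abs_mult)
  qed
  have "(\<Sum>i\<in>I. (real_of_int (z i))\<^sup>2) \<le> (\<Sum>i\<in>I. (u i * ?s)\<^sup>2)"
    using zle by (intro sum_mono) (metis abs_mult abs_le_square_iff abs_of_pos s)
  also have "\<dots> = 16 * real k * (L2_set u I)\<^sup>2"
    unfolding L2_set_power2 by (simp add: power_mult_distrib sum_distrib_left mult_ac)
  also have "\<dots> \<le> 16 * real k * 1"
    using u by (intro mult_left_mono) (auto simp: power_le_one)
  finally have sz: "(\<Sum>i\<in>I. (real_of_int (z i))\<^sup>2) \<le> 16 * real k" by simp
  have zr: "z i \<in> {- int (4 * k)..int (4 * k)}" if i: "i \<in> I" for i
  proof -
    have "(real_of_int (z i))\<^sup>2 \<le> 16 * real k"
      using sz member_le_sum[of i I "\<lambda>i. (real_of_int (z i))\<^sup>2"] i I by auto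
    also have "\<dots> \<le> (4 * real k)\<^sup>2" using k by (simp add: power2_eq_square)
    finally have "\<bar>real_of_int (z i)\<bar> \<le> 4 * real k" by (subst (asm) abs_le_square_iff[symmetric]) simp
    then have "\<bar>z i\<bar> \<le> int (4 * k)" by linarith
    then show ?thesis by auto
  qed
  have "w \<in> lattice_net k I"
    unfolding lattice_net_def
    by (rule image_eqI[of _ _ z]) (use sz zr in \<open>auto simp: w_def z_def\<close>)
  moreover have "L2_set (\<lambda>i. u i - w i) I \<le> 1 / 4"
  proof -
    have "\<bar>u i - w i\<bar> \<le> 1 / ?s" if "i \<in> I" for i
    proof -
      have "u i - w i = (u i * ?s - real_of_int (z i)) / ?s" using that s by (simp add: w_def field_simps)
      then show ?thesis using zclose[OF that] s by (simp add: abs_divide divide_right_mono)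
    qed
    then have "(\<Sum>i\<in>I. (u i - w i)\<^sup>2) \<le> (\<Sum>i\<in>I. (1 / ?s)\<^sup>2)"
      using s by (intro sum_mono) (metis abs_le_square_iff abs_of_pos zero_less_divide_1_iff)
    also have "\<dots> = real (card I) / (16 * real k)" by (simp add: power_divide power_mult_distrib)
    also have "\<dots> \<le> (1 / 4)\<^sup>2" using I k by (simp add: power2_eq_square field_simps)
    finally show ?thesis by (subst L2_set_le_iff) auto
  qed
  ultimately show ?thesis by blast
qed

text \<open>
  Replacing both unit vectors by net points at distance \<open>1/4\<close> changes the bilinear form by at most
  half of the norm itself, which can then be absorbed into the left-hand side.
\<close>

lemma op_bounded_via_net:
  assumes I: "I \<subseteq> {1..D}" "card I \<le> k" and J: "J \<subseteq> {1..D}" "card J \<le> k" and k: "k \<ge> 1" and s: "0 \<le> s"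
    and supp: "\<And>i j. i \<in> {1..D} \<Longrightarrow> j \<in> {1..D} \<Longrightarrow> (i, j) \<notin> I \<times> J \<Longrightarrow> A (i, j) = 0"
    and net: "\<And>w w'. w \<in> lattice_net k I \<Longrightarrow> w' \<in> lattice_net k J \<Longrightarrow> \<bar>bilin D A w w'\<bar> \<le> s"
  shows "op_bounded D A (2 * s)"
proof -
  let ?b = "spec_norm D A"
  have fin: "finite I" "finite J" using I J finite_subset by auto
  have restr: "L2_set f I = L2_set f {1..D}" if "I \<subseteq> {1..D}" "\<And>i. i \<notin> I \<Longrightarrow> f i = 0" for f :: rvec and I
    unfolding L2_set_def by (intro arg_cong[of _ _ sqrt] sum.mono_neutral_left) (use that in auto)
  have "op_bounded D A (s + ?b / 2)"
  proof (rule op_boundedI_unit)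
    fix u v :: rvec assume u: "L2_set u {1..D} \<le> 1" and v: "L2_set v {1..D} \<le> 1"
    let ?u = "\<lambda>i. if i \<in> I then u i else 0" and ?v = "\<lambda>i. if i \<in> J then v i else 0"
    have u1: "L2_set ?u {1..D} \<le> 1" and v1: "L2_set ?v {1..D} \<le> 1"
      using u v L2_set_restrict_le order_trans by blast+
    then have "L2_set ?u I \<le> 1" "L2_set ?v J \<le> 1"
      by (subst restr; use I J in auto)+
    then obtain w w' where w: "w \<in> lattice_net k I" "L2_set (\<lambda>i. ?u i - w i) I \<le> 1 / 4"
      and w': "w' \<in> lattice_net k J" "L2_set (\<lambda>i. ?v i - w' i) J \<le> 1 / 4"
      using lattice_net_approx[OF fin(1) I(2) k] lattice_net_approx[OF fin(2) J(2) k] by meson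
    have du: "L2_set (\<lambda>i. ?u i - w i) {1..D} \<le> 1 / 4"
      using w lattice_net_L2(3)[OF I(1) k w(1)] by (subst restr[symmetric]) (use I in auto)
    have dv: "L2_set (\<lambda>i. ?v i - w' i) {1..D} \<le> 1 / 4"
      using w' lattice_net_L2(3)[OF J(1) k w'(1)] by (subst restr[symmetric]) (use J in auto)
    have "\<bar>bilin D A (\<lambda>i. ?u i - w i) ?v\<bar> \<le> ?b * L2_set (\<lambda>i. ?u i - w i) {1..D} * L2_set ?v {1..D}"
      by (rule op_boundedD[OF op_bounded_spec_norm])
    also have "\<dots> \<le> ?b * (1 / 4) * 1"
      by (intro mult_mono mult_left_mono du v1) (auto simp: spec_norm_nonneg)
    finally have 1: "\<bar>bilin D A (\<lambda>i. ?u i - w i) ?v\<bar> \<le> ?b / 4" by simp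
    have "\<bar>bilin D A w (\<lambda>i. ?v i - w' i)\<bar> \<le> ?b * L2_set w {1..D} * L2_set (\<lambda>i. ?v i - w' i) {1..D}"
      by (rule op_boundedD[OF op_bounded_spec_norm])
    also have "\<dots> \<le> ?b * 1 * (1 / 4)"
      by (intro mult_mono mult_left_mono dv lattice_net_L2(1)[OF I(1) k w(1)]) (auto simp: spec_norm_nonneg)
    finally have 2: "\<bar>bilin D A w (\<lambda>i. ?v i - w' i)\<bar> \<le> ?b / 4" by simp
    have "bilin D A u v = bilin D A ?u ?v" by (rule bilin_supported) (use supp in blast)
    also have "\<dots> = bilin D A (\<lambda>i. ?u i - w i) ?v + bilin D A w (\<lambda>i. ?v i - w' i) + bilin D A w w'"
      unfolding bilin_diff_left bilin_diff_right by simp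
    finally show "\<bar>bilin D A u v\<bar> \<le> s + ?b / 2"
      using 1 2 net[OF w(1) w'(1)] by linarith
  qed
  then have "?b \<le> s + ?b / 2" by (rule spec_norm_le) (use s spec_norm_nonneg in auto)
  then have "?b \<le> 2 * s" by simp
  then show ?thesis by (rule op_bounded_mono[OF op_bounded_spec_norm])
qed

section \<open>Renyi moments: products and post-processing\<close>

lemma distr_PiM_componentwise:
  assumes I: "finite I"
    and M: "\<And>i. prob_space (M i)"
    and f: "\<And>i. f i \<in> measurable (M i) (N i)"
  shows "distr (PiM I M) (PiM I N) (\<lambda>x. \<lambda>i\<in>I. f i (x i)) = PiM I (\<lambda>i. distr (M i) (N i) (f i))"
proof -
  interpret D: product_prob_space "\<lambda>i. distr (M i) (N i) (f i)"
    by (intro product_prob_spaceI prob_space.prob_space_distr M f)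
  interpret M: product_prob_space M by (intro product_prob_spaceI M)
  have meas: "(\<lambda>x. \<lambda>i\<in>I. f i (x i)) \<in> measurable (PiM I M) (PiM I N)"
    by (intro measurable_restrict measurable_compose[OF measurable_component_singleton] f)
  show ?thesis
  proof (rule D.PiM_eqI[OF I])
    show "sets (distr (PiM I M) (PiM I N) (\<lambda>x. \<lambda>i\<in>I. f i (x i))) = sets (PiM I (\<lambda>i. distr (M i) (N i) (f i)))"
      by (simp, intro sets_PiM_cong) auto
    fix A assume A: "\<And>i. i \<in> I \<Longrightarrow> A i \<in> sets (distr (M i) (N i) (f i))"
    then have A': "A i \<in> sets (N i)" if "i \<in> I" for i using that by simp
    have "(\<lambda>x. \<lambda>i\<in>I. f i (x i)) -` Pi\<^sub>E I A \<inter> space (PiM I M) = Pi\<^sub>E I (\<lambda>i. f i -` A i \<inter> space (M i))"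
      by (auto simp: space_PiM PiE_def Pi_def extensional_def)
    then have "emeasure (distr (PiM I M) (PiM I N) (\<lambda>x. \<lambda>i\<in>I. f i (x i))) (Pi\<^sub>E I A) =
        emeasure (PiM I M) (Pi\<^sub>E I (\<lambda>i. f i -` A i \<inter> space (M i)))"
      using A' I by (subst emeasure_distr[OF meas]) (auto intro!: sets_PiM_I_finite)
    also have "\<dots> = (\<Prod>i\<in>I. emeasure (M i) (f i -` A i \<inter> space (M i)))"
      by (rule M.emeasure_PiM[OF I]) (use A' measurable_sets[OF f] in blast)
    also have "\<dots> = (\<Prod>i\<in>I. emeasure (distr (M i) (N i) (f i)) (A i))"
      by (intro prod.cong refl) (use A' in \<open>auto simp: emeasure_distr[OF f]\<close>)
    finally show "emeasure (distr (PiM I M) (PiM I N) (\<lambda>x. \<lambda>i\<in>I. f i (x i))) (Pi\<^sub>E I A) =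
        (\<Prod>i\<in>I. emeasure (distr (M i) (N i) (f i)) (A i))" .
  qed
qed

text \<open>
  The moment of order \<open>a\<close> of the likelihood ratio, bounded by \<open>exp b\<close>. Unlike the divergence it
  is multiplicative, and working with an explicit density avoids Radon-Nikodym derivatives of
  product measures.
\<close>

definition renyi_moment_le :: "real \<Rightarrow> 'a measure \<Rightarrow> 'a measure \<Rightarrow> real \<Rightarrow> bool" where
  "renyi_moment_le a P Q b \<longleftrightarrow>
     (\<exists>f. f \<in> borel_measurable Q \<and> (\<forall>x. 0 \<le> f x) \<and> P = density Q (\<lambda>x. ennreal (f x)) \<and>
       (\<integral>\<^sup>+ x. ennreal (f x powr a) \<partial>Q) \<le> ennreal (exp b))"

lemma renyi_moment_le_mono: "renyi_moment_le a P Q b \<Longrightarrow> b \<le> c \<Longrightarrow> renyi_moment_le a P Q c"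
proof -
  assume R: "renyi_moment_le a P Q b" and bc: "b \<le> c"
  have "ennreal (exp b) \<le> ennreal (exp c)" using bc by (intro ennreal_leI) simp
  with R show ?thesis unfolding renyi_moment_le_def by (blast intro: order_trans)
qed

text \<open>
  Completing the square: the second density times the power of the ratio is a multiple of the
  Gaussian density with mean \<open>\<nu> + a (\<mu> - \<nu>)\<close>.
\<close>

lemma renyi_moment_normal:
  "renyi_moment_le a (density lborel (normal_density \<mu> 1)) (density lborel (normal_density \<nu> 1))
     (a * (a - 1) / 2 * (\<mu> - \<nu>)\<^sup>2)"
  unfolding renyi_moment_le_def
proof (intro exI conjI allI)
  let ?f = "\<lambda>x. exp (((x - \<nu>)\<^sup>2 - (x - \<mu>)\<^sup>2) / 2)"
  let ?g = "\<lambda>x. ennreal (normal_density \<nu> 1 x)"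
  show "?f \<in> borel_measurable (density lborel ?g)" by simp
  have 1: "normal_density \<nu> 1 x * ?f x = normal_density \<mu> 1 x" for x
    by (simp add: normal_density_def exp_add[symmetric] field_simps)
  show "density lborel (normal_density \<mu> 1) = density (density lborel ?g) (\<lambda>x. ennreal (?f x))"
    by (subst density_density_eq) (simp_all add: ennreal_mult[symmetric] 1)
  have 2: "normal_density \<nu> 1 x * ?f x powr a =
      exp (a * (a - 1) / 2 * (\<mu> - \<nu>)\<^sup>2) * normal_density (\<nu> + a * (\<mu> - \<nu>)) 1 x" for x
    by (simp add: normal_density_def powr_def exp_add[symmetric] power2_eq_square field_simps)
  have "(\<integral>\<^sup>+ x. ennreal (?f x powr a) \<partial>density lborel ?g) =
      (\<integral>\<^sup>+ x. ennreal (exp (a * (a - 1) / 2 * (\<mu> - \<nu>)\<^sup>2)) * ennreal (normal_density (\<nu> + a * (\<mu> - \<nu>)) 1 x) \<partial>lborel)"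
    by (subst nn_integral_density) (simp_all add: ennreal_mult[symmetric] 2)
  also have "\<dots> = ennreal (exp (a * (a - 1) / 2 * (\<mu> - \<nu>)\<^sup>2))"
    by (subst nn_integral_cmult) (simp_all add: nn_integral_eq_integral integrable_normal_density)
  finally show "(\<integral>\<^sup>+ x. ennreal (?f x powr a) \<partial>density lborel ?g) \<le> ennreal (exp (a * (a - 1) / 2 * (\<mu> - \<nu>)\<^sup>2))"
    by simp
qed simp

lemma renyi_moment_PiM:
  assumes I: "finite I" and P: "\<And>i. prob_space (P i)" and Q: "\<And>i. prob_space (Q i)"
    and R: "\<And>i. i \<in> I \<Longrightarrow> renyi_moment_le a (P i) (Q i) (b i)"
  shows "renyi_moment_le a (PiM I P) (PiM I Q) (\<Sum>i\<in>I. b i)"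
proof -
  interpret P: product_prob_space P by (intro product_prob_spaceI P)
  interpret Q: product_prob_space Q by (intro product_prob_spaceI Q)
  obtain f where f: "\<And>i. i \<in> I \<Longrightarrow> f i \<in> borel_measurable (Q i)" "\<And>i x. i \<in> I \<Longrightarrow> 0 \<le> f i x"
    "\<And>i. i \<in> I \<Longrightarrow> P i = density (Q i) (\<lambda>x. ennreal (f i x))"
    "\<And>i. i \<in> I \<Longrightarrow> (\<integral>\<^sup>+ x. ennreal (f i x powr a) \<partial>Q i) \<le> ennreal (exp (b i))"
    using R unfolding renyi_moment_le_def by metis
  define F where "F = (\<lambda>x. \<Prod>i\<in>I. f i (x i))"
  have comp: "(\<lambda>x. f i (x i)) \<in> borel_measurable (PiM I Q)" if "i \<in> I" for i
    by (rule measurable_compose[OF measurable_component_singleton[OF that, of Q] f(1)[OF that]])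
  have Fm: "F \<in> borel_measurable (PiM I Q)"
    unfolding F_def by (intro borel_measurable_prod comp)
  have F0: "0 \<le> F x" for x unfolding F_def by (intro prod_nonneg) (use f(2) in auto)
  have PF: "PiM I P = density (PiM I Q) (\<lambda>x. ennreal (F x))"
  proof (rule P.PiM_eqI[symmetric, OF I])
    show "sets (density (PiM I Q) (\<lambda>x. ennreal (F x))) = sets (PiM I P)"
      by (simp, intro sets_PiM_cong) (use f(3) in auto)
    fix A assume A: "\<And>i. i \<in> I \<Longrightarrow> A i \<in> sets (P i)"
    then have A': "A i \<in> sets (Q i)" if "i \<in> I" for i using that f(3) by simp
    have ind: "indicator (Pi\<^sub>E I A) x = (\<Prod>i\<in>I. indicator (A i) (x i) :: ennreal)" if sp: "x \<in> space (PiM I Q)" for x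
    proof (cases "x \<in> Pi\<^sub>E I A")
      case True then show ?thesis by (auto simp: PiE_def Pi_def indicator_def)
    next
      case False
      then obtain i where "i \<in> I" "x i \<notin> A i" using sp by (auto simp: space_PiM PiE_def Pi_def)
      then have "(\<Prod>i\<in>I. indicator (A i) (x i) :: ennreal) = 0" using I by (intro prod_zero bexI[of _ i]) auto
      then show ?thesis using False by simp
    qed
    have "emeasure (density (PiM I Q) (\<lambda>x. ennreal (F x))) (Pi\<^sub>E I A) =
        (\<integral>\<^sup>+ x. ennreal (F x) * indicator (Pi\<^sub>E I A) x \<partial>PiM I Q)"
      using A' I Fm by (subst emeasure_density) (auto intro!: sets_PiM_I_finite)
    also have "\<dots> = (\<integral>\<^sup>+ x. (\<Prod>i\<in>I. ennreal (f i (x i)) * indicator (A i) (x i)) \<partial>PiM I Q)"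
      using f(2) by (intro nn_integral_cong) (simp add: F_def prod_ennreal[symmetric] ind prod.distrib)
    also have "\<dots> = (\<Prod>i\<in>I. \<integral>\<^sup>+ x. ennreal (f i x) * indicator (A i) x \<partial>Q i)"
      using A' f(1) by (subst Q.product_nn_integral_prod[OF I]) auto
    also have "\<dots> = (\<Prod>i\<in>I. emeasure (P i) (A i))"
      using A' f by (intro prod.cong refl) (simp add: emeasure_density)
    finally show "emeasure (density (PiM I Q) (\<lambda>x. ennreal (F x))) (Pi\<^sub>E I A) = (\<Prod>i\<in>I. emeasure (P i) (A i))" .
  qed
  have "(\<integral>\<^sup>+ x. ennreal (F x powr a) \<partial>PiM I Q) = (\<integral>\<^sup>+ x. (\<Prod>i\<in>I. ennreal (f i (x i) powr a)) \<partial>PiM I Q)"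
    using f(2) by (intro nn_integral_cong) (simp add: F_def prod_powr_distrib prod_ennreal)
  also have "\<dots> = (\<Prod>i\<in>I. \<integral>\<^sup>+ x. ennreal (f i x powr a) \<partial>Q i)"
    using f(1) by (subst Q.product_nn_integral_prod[OF I]) auto
  also have "\<dots> \<le> (\<Prod>i\<in>I. ennreal (exp (b i)))"
    by (intro prod_mono_ennreal) (use f(4) in auto)
  also have "\<dots> = ennreal (exp (\<Sum>i\<in>I. b i))"
    using I by (simp add: prod_ennreal exp_sum)
  finally show ?thesis unfolding renyi_moment_le_def using Fm F0 PF by blast
qed

text \<open>
  The data processing inequality. Let \<open>g\<close> be the likelihood ratio of the images. As
  \<open>\<integral> g\<^sup>a\<close> equals the integral of \<open>g(T)\<close> to the power \<open>a - 1\<close> under \<open>P\<close>, that is, of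
  \<open>f g(T)\<close> to the powers \<open>1\<close> and \<open>a - 1\<close> under \<open>Q\<close>, Young's inequality with the exponents
  \<open>a\<close> and \<open>a / (a - 1)\<close> bounds it by \<open>(1/a) \<integral> f\<^sup>a + (1 - 1/a) \<integral> g\<^sup>a\<close>, which gives the claim
  once the integral of \<open>g\<^sup>a\<close> is known to be finite.
\<close>

lemma renyi_moment_distr:
  assumes a: "1 < a" and Q: "prob_space Q" and P: "prob_space P"
    and T: "T \<in> measurable Q N" and R: "renyi_moment_le a P Q b"
  shows "renyi_moment_le a (distr P N T) (distr Q N T) b"
proof -
  obtain f where f: "f \<in> borel_measurable Q" "\<And>x. 0 \<le> f x" "P = density Q (\<lambda>x. ennreal (f x))"
    "(\<integral>\<^sup>+ x. ennreal (f x powr a) \<partial>Q) \<le> ennreal (exp b)"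
    using R unfolding renyi_moment_le_def by blast
  let ?P = "distr P N T" and ?Q = "distr Q N T"
  have TP: "T \<in> measurable P N" using T f(3) by simp
  interpret Q: prob_space Q by (rule Q)
  interpret QT: prob_space ?Q by (rule Q.prob_space_distr[OF T])
  interpret PT: prob_space ?P by (rule prob_space.prob_space_distr[OF P TP])
  have ac: "absolutely_continuous ?Q ?P"
    unfolding absolutely_continuous_def
  proof
    fix A assume A: "A \<in> null_sets ?Q"
    then have "T -` A \<inter> space Q \<in> null_sets Q" using T by (simp add: null_sets_distr_iff)
    moreover have "absolutely_continuous Q P"
      unfolding f(3) by (rule absolutely_continuousI_density) (use f(1) in auto)
    ultimately have "T -` A \<inter> space P \<in> null_sets P"
      using f(3) by (auto simp: absolutely_continuous_def)
    then show "A \<in> null_sets ?P" using A TP by (auto simp: null_sets_distr_iff)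
  qed
  define g where "g = (\<lambda>y. enn2real (RN_deriv ?Q ?P y))"
  have gm [measurable]: "g \<in> borel_measurable N"
    unfolding g_def using borel_measurable_RN_deriv[of ?Q ?P] by simp
  have g0: "0 \<le> g y" for y by (simp add: g_def)
  have fin: "AE y in ?Q. RN_deriv ?Q ?P y \<noteq> \<infinity>"
    by (rule QT.RN_deriv_finite) (use ac PT.sigma_finite_measure_axioms in auto)
  have "density ?Q (\<lambda>y. ennreal (g y)) = density ?Q (RN_deriv ?Q ?P)"
  proof (rule density_cong)
    show "AE y in ?Q. ennreal (g y) = RN_deriv ?Q ?P y"
      using fin by eventually_elim (simp add: g_def less_top)
  qed (use borel_measurable_RN_deriv[of ?Q ?P] in auto)
  then have gP: "?P = density ?Q (\<lambda>y. ennreal (g y))"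
    using QT.density_RN_deriv[OF ac] by simp
  define F where "F = (\<integral>\<^sup>+ x. ennreal (f x powr a) \<partial>Q)"
  \<comment> \<open>truncating \<open>g\<close> at level \<open>k\<close> keeps the integrals finite, so that they can be subtracted\<close>
  have trunc: "(\<integral>\<^sup>+ y. ennreal (min (g y) (real k) powr a) \<partial>?Q) \<le> F" for k :: nat
  proof -
    let ?h = "\<lambda>y. min (g y) (real k)"
    let ?H = "\<integral>\<^sup>+ y. ennreal (?h y powr a) \<partial>?Q"
    have h0: "0 \<le> ?h y" for y using g0 by simp
    have young: "f x * ?h y powr (a - 1) \<le> f x powr a / a + (1 - 1 / a) * ?h y powr a" for x y
    proof -
      have "f x * ?h y powr (a - 1) \<le> f x powr a / a + (?h y powr (a - 1)) powr (a / (a - 1)) / (a / (a - 1))"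
        by (rule Youngs_inequality) (use a f(2) in \<open>auto simp: field_simps\<close>)
      also have "(?h y powr (a - 1)) powr (a / (a - 1)) / (a / (a - 1)) = (1 - 1 / a) * ?h y powr a"
      proof -
        have "(a - 1) * (a / (a - 1)) = a" "z / (a / (a - 1)) = (1 - 1 / a) * z" for z
          using a by (auto simp: field_simps)
        then show ?thesis by (simp only: powr_powr)
      qed
      finally show ?thesis .
    qed
    have "?H \<le> (\<integral>\<^sup>+ y. ennreal (g y) * ennreal (?h y powr (a - 1)) \<partial>?Q)"
    proof (rule nn_integral_mono)
      fix y
      have "?h y powr a = ?h y * ?h y powr (a - 1)"
      proof (cases "?h y = 0")
        case False
        then have "?h y > 0" using h0[of y] by linarith
        then show ?thesis by (simp add: powr_mult_base)
      qed simp
      also have "\<dots> \<le> g y * ?h y powr (a - 1)" by (intro mult_right_mono) auto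
      finally show "ennreal (?h y powr a) \<le> ennreal (g y) * ennreal (?h y powr (a - 1))"
        using g0 by (simp add: ennreal_mult[symmetric] ennreal_leI)
    qed
    also have "\<dots> = (\<integral>\<^sup>+ y. ennreal (?h y powr (a - 1)) \<partial>?P)"
      unfolding gP by (subst nn_integral_density) auto
    also have "\<dots> = (\<integral>\<^sup>+ x. ennreal (?h (T x) powr (a - 1)) \<partial>P)"
      using TP by (subst nn_integral_distr) auto
    also have "\<dots> = (\<integral>\<^sup>+ x. ennreal (f x) * ennreal (?h (T x) powr (a - 1)) \<partial>Q)"
      unfolding f(3) using f(1) T by (subst nn_integral_density) auto
    also have "\<dots> \<le> (\<integral>\<^sup>+ x. ennreal (1 / a) * ennreal (f x powr a) + ennreal (1 - 1 / a) * ennreal (?h (T x) powr a) \<partial>Q)"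
      using a f(2) young by (intro nn_integral_mono)
        (simp add: ennreal_mult[symmetric] ennreal_plus[symmetric] ennreal_leI del: ennreal_plus)
    also have "\<dots> = ennreal (1 / a) * F + ennreal (1 - 1 / a) * (\<integral>\<^sup>+ x. ennreal (?h (T x) powr a) \<partial>Q)"
      unfolding F_def using f(1) T by (subst nn_integral_add) (auto simp: nn_integral_cmult)
    also have "(\<integral>\<^sup>+ x. ennreal (?h (T x) powr a) \<partial>Q) = ?H"
      using T by (subst nn_integral_distr) auto
    finally have le: "?H \<le> ennreal (1 / a) * F + ennreal (1 - 1 / a) * ?H" .
    have "?H \<le> (\<integral>\<^sup>+ y. ennreal (real k powr a) \<partial>?Q)"
      using a g0 by (intro nn_integral_mono ennreal_leI powr_mono2) auto
    also have "\<dots> = ennreal (real k powr a)" using QT.emeasure_space_1 by simp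
    finally have "?H < \<infinity>" using ennreal_less_top le_less_trans by (metis infinity_ennreal_def)
    then obtain s where s: "0 \<le> s" "?H = ennreal s" by (cases ?H) auto
    have "F < \<infinity>" using f(4) unfolding F_def by (metis ennreal_less_top infinity_ennreal_def le_less_trans)
    then obtain r where r: "0 \<le> r" "F = ennreal r" by (cases F) auto
    have "s \<le> 1 / a * r + (1 - 1 / a) * s"
      using le a s(1) r(1) unfolding s(2) r(2)
      by (simp add: ennreal_mult[symmetric] ennreal_plus[symmetric] del: ennreal_plus)
    then have "s \<le> r" using a by (simp add: field_simps)
    then show "?H \<le> F" unfolding s(2) r(2) by (rule ennreal_leI)
  qed
  have "(\<integral>\<^sup>+ y. ennreal (g y powr a) \<partial>?Q) = (\<integral>\<^sup>+ y. (SUP k. ennreal (min (g y) (real k) powr a)) \<partial>?Q)"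
  proof (intro nn_integral_cong antisym)
    fix y
    have "ennreal (g y powr a) = ennreal (min (g y) (real (nat \<lceil>g y\<rceil>)) powr a)"
      by (simp add: min_def) linarith
    also have "\<dots> \<le> (SUP k. ennreal (min (g y) (real k) powr a))" by (rule SUP_upper) simp
    finally show "ennreal (g y powr a) \<le> (SUP k. ennreal (min (g y) (real k) powr a))" .
    show "(SUP k. ennreal (min (g y) (real k) powr a)) \<le> ennreal (g y powr a)"
      using a g0 by (intro SUP_least ennreal_leI powr_mono2) auto
  qed
  also have "\<dots> = (SUP k. \<integral>\<^sup>+ y. ennreal (min (g y) (real k) powr a) \<partial>?Q)"
  proof (rule nn_integral_monotone_convergence_SUP)
    show "incseq (\<lambda>k y. ennreal (min (g y) (real k) powr a))"
      using a g0 by (intro incseq_SucI le_funI ennreal_leI powr_mono2) auto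
  qed auto
  also have "\<dots> \<le> F" by (intro SUP_least trunc)
  also have "\<dots> \<le> ennreal (exp b)" unfolding F_def by (rule f(4))
  finally show ?thesis unfolding renyi_moment_le_def using gP g0 gm by (intro exI[of _ g]) auto
qed

lemma renyi_div_le_of_moment:
  assumes a: "1 < a" and b: "0 \<le> b" and Q: "prob_space Q" and R: "renyi_moment_le a P Q b"
  shows "renyi_div a P Q \<le> ereal (b / (a - 1))"
proof -
  obtain f where f: "f \<in> borel_measurable Q" "\<And>x. 0 \<le> f x" "P = density Q (\<lambda>x. ennreal (f x))"
    "(\<integral>\<^sup>+ x. ennreal (f x powr a) \<partial>Q) \<le> ennreal (exp b)"
    using R unfolding renyi_moment_le_def by blast
  interpret Q: prob_space Q by (rule Q)
  have ac: "absolutely_continuous Q P" unfolding f(3) by (rule absolutely_continuousI_density) (use f in auto)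
  have ae: "AE x in Q. ennreal (f x) = RN_deriv Q P x"
    by (rule Q.RN_deriv_unique) (use f in auto)
  define I where "I = (\<integral>\<^sup>+ x. ennreal (enn2real (RN_deriv Q P x) powr a) \<partial>Q)"
  have "I = (\<integral>\<^sup>+ x. ennreal (f x powr a) \<partial>Q)"
    unfolding I_def by (rule nn_integral_cong_AE) (use ae in \<open>eventually_elim, metis enn2real_ennreal f(2)\<close>)
  then have I: "I \<le> ennreal (exp b)" using f(4) by simp
  then have fin: "I < \<infinity>" by (metis ennreal_less_top infinity_ennreal_def le_less_trans)
  have "ln (enn2real I) \<le> b"
  proof (cases "enn2real I = 0")
    case False
    then have pos: "enn2real I > 0" by (simp add: less_le)
    have "enn2real I \<le> exp b" using I by (simp add: enn2real_leI)
    then show ?thesis using pos by (metis ln_exp ln_le_cancel_iff exp_gt_zero)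
  qed (use b in simp)
  then have "1 / (a - 1) * ln (enn2real I) \<le> b / (a - 1)" using a by (simp add: divide_right_mono)
  then show ?thesis unfolding renyi_div_def Let_def I_def[symmetric] using ac fin by simp
qed

section \<open>The private covariance block as a Gaussian shift\<close>

abbreviation upper_pairs :: "nat \<Rightarrow> (nat \<times> nat) set" where
  "upper_pairs d \<equiv> {(i, j). 1 \<le> i \<and> i \<le> j \<and> j \<le> d}"

lemma finite_upper_pairs [simp]: "finite (upper_pairs d)"
  by (rule finite_subset[of _ "{1..d} \<times> {1..d}"]) auto

definition emp_block :: "nat \<Rightarrow> (nat \<Rightarrow> rvec) \<Rightarrow> nat set \<Rightarrow> nat set \<Rightarrow> real \<Rightarrow> rmat" where
  "emp_block n X I J R = (\<lambda>(i, j). 1 / real n * (\<Sum>a\<in>{1..n}. clip R I (X a) i * clip R J (X a) j))"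

definition noise_scale :: "nat \<Rightarrow> real \<Rightarrow> real \<Rightarrow> real" where
  "noise_scale n \<rho> R = sqrt (18 * R ^ 4 / (\<rho> * (real n)\<^sup>2))"

definition noisy_block :: "nat \<Rightarrow> nat \<Rightarrow> (nat \<Rightarrow> rvec) \<Rightarrow> nat set \<Rightarrow> nat set \<Rightarrow> real \<Rightarrow> real \<Rightarrow> rmat \<Rightarrow> rmat" where
  "noisy_block n d X I J \<rho> R G = (\<lambda>(i, j)\<in>{1..d} \<times> {1..d}.
      if (i, j) \<in> I \<times> J then emp_block n X I J R (i, j) + noise_scale n \<rho> R * G (i, j) else 0)"

lemma DPCovBlock_eq:
  "DPCovBlock n d X I J \<rho> R = distr (sym_gauss d) (mat_space d) (noisy_block n d X I J \<rho> R)"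
  unfolding DPCovBlock_def
  by (intro distr_cong refl) (auto simp: fun_eq_iff noisy_block_def emp_block_def noise_scale_def)

lemma measurable_mat_space:
  assumes "\<And>p. p \<in> {1..d} \<times> {1..d} \<Longrightarrow> (\<lambda>x. f x p) \<in> borel_measurable M"
  shows "(\<lambda>x. \<lambda>p\<in>{1..d} \<times> {1..d}. f x p) \<in> measurable M (mat_space d)"
  unfolding mat_space_def by (intro measurable_restrict assms)

lemma mat_space_component: "p \<in> {1..d} \<times> {1..d} \<Longrightarrow> (\<lambda>A. A p) \<in> borel_measurable (mat_space d)"
  unfolding mat_space_def by (rule measurable_component_singleton)

lemma measurable_noisy_block: "noisy_block n d X I J \<rho> R \<in> measurable (mat_space d) (mat_space d)"
proof -
  let ?f = "\<lambda>G p. if p \<in> I \<times> J then emp_block n X I J R p + noise_scale n \<rho> R * G p else 0"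
  have "(\<lambda>G. \<lambda>p\<in>{1..d} \<times> {1..d}. ?f G p) \<in> measurable (mat_space d) (mat_space d)"
  proof (rule measurable_mat_space)
    fix p assume p: "p \<in> {1..d} \<times> {1..d}"
    note [measurable] = mat_space_component[OF p]
    show "(\<lambda>G. ?f G p) \<in> borel_measurable (mat_space d)" by measurable
  qed
  also have "(\<lambda>G. \<lambda>p\<in>{1..d} \<times> {1..d}. ?f G p) = noisy_block n d X I J \<rho> R"
    by (auto simp: fun_eq_iff noisy_block_def)
  finally show ?thesis .
qed

abbreviation std_normal :: "real measure" where
  "std_normal \<equiv> density lborel (\<lambda>x. ennreal (std_normal_density x))"

lemma prob_space_std_normal: "prob_space std_normal"
  by (rule prob_space_normal_density) simp

lemma measurable_symmetrize:
  "(\<lambda>g. \<lambda>(i, j)\<in>{1..d} \<times> {1..d}. g (min i j, max i j))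
     \<in> measurable (\<Pi>\<^sub>M p\<in>upper_pairs d. std_normal) (mat_space d)"
proof -
  have "(\<lambda>g. \<lambda>p\<in>{1..d} \<times> {1..d}. g (min (fst p) (snd p), max (fst p) (snd p)))
     \<in> measurable (\<Pi>\<^sub>M p\<in>upper_pairs d. std_normal) (mat_space d)"
    by (intro measurable_mat_space)
      (auto intro!: measurable_compose[OF measurable_component_singleton[of _ _ "\<lambda>_. std_normal"]])
  then show ?thesis by (simp add: case_prod_beta')
qed

lemma prob_space_sym_gauss: "prob_space (sym_gauss d)"
  unfolding sym_gauss_def
  by (intro prob_space.prob_space_distr measurable_symmetrize prob_space_PiM prob_space_std_normal)

lemma sets_sym_gauss [simp]: "sets (sym_gauss d) = sets (mat_space d)"
  by (simp add: sym_gauss_def)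

lemma prob_space_DPCovBlock: "prob_space (DPCovBlock n d X I J \<rho> R)"
  unfolding DPCovBlock_eq
  by (intro prob_space.prob_space_distr prob_space_sym_gauss)
    (simp add: measurable_cong_sets[OF sets_sym_gauss refl] measurable_noisy_block)

lemma sets_DPCovBlock [simp]: "sets (DPCovBlock n d X I J \<rho> R) = sets (mat_space d)"
  by (simp add: DPCovBlock_def)

lemma L2_set_clip_le: "0 \<le> R \<Longrightarrow> L2_set (clip R I z) I \<le> R"
proof -
  assume R: "0 \<le> R"
  have "L2_set (clip R I z) I = L2_set (\<lambda>i. min 1 (R / L2_set z I) * z i) I"
    by (simp add: clip_def mult.commute)
  also have "\<dots> = min 1 (R / L2_set z I) * L2_set z I"
    by (subst L2_set_scale) (use R in simp)
  also have "\<dots> \<le> R"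
    by (cases "L2_set z I = 0") (use R in \<open>auto simp: min_def divide_simps less_le\<close>)
  finally show ?thesis .
qed

text \<open>
  Only one summand changes, and both of its values are rank-one matrices of Frobenius norm at most
  \<open>R\<^sup>2\<close> because of the clipping.
\<close>

lemma emp_block_sensitivity:
  assumes adj: "adjacent n X X'" and R: "0 \<le> R" and fin: "finite I" "finite J"
  shows "(\<Sum>p\<in>I \<times> J. (emp_block n X I J R p - emp_block n X' I J R p)\<^sup>2) \<le> 4 * R ^ 4 / (real n)\<^sup>2"
proof -
  obtain b where b: "b \<in> {1..n}" "\<And>j. j \<in> {1..n} - {b} \<Longrightarrow> X j = X' j"
    using adj unfolding adjacent_def by blast
  let ?u = "clip R I (X b)" and ?v = "clip R J (X b)" and ?u' = "clip R I (X' b)" and ?v' = "clip R J (X' b)"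
  have diff: "emp_block n X I J R (i, j) - emp_block n X' I J R (i, j) =
      1 / real n * (?u i * ?v j - ?u' i * ?v' j)" for i j
  proof -
    have "(\<Sum>a\<in>{1..n}. clip R I (X a) i * clip R J (X a) j) - (\<Sum>a\<in>{1..n}. clip R I (X' a) i * clip R J (X' a) j)
        = (\<Sum>a\<in>{1..n}. if a = b then ?u i * ?v j - ?u' i * ?v' j else 0)"
      unfolding sum_subtractf[symmetric] by (intro sum.cong refl) (use b in auto)
    also have "\<dots> = ?u i * ?v j - ?u' i * ?v' j" using b by simp
    finally show ?thesis unfolding emp_block_def by (simp add: right_diff_distrib[symmetric] del: right_diff_distrib)
      (simp add: algebra_simps diff_divide_distrib[symmetric])
  qed
  have sq: "(1 / real n * (x - y))\<^sup>2 \<le> 2 / (real n)\<^sup>2 * (x\<^sup>2 + y\<^sup>2)" for x y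
  proof -
    have "(x - y)\<^sup>2 \<le> 2 * (x\<^sup>2 + y\<^sup>2)" using zero_le_power2[of "x + y"] by (simp add: power2_eq_square algebra_simps)
    then show ?thesis by (simp add: power_mult_distrib power_divide divide_right_mono)
  qed
  have prod: "(\<Sum>i\<in>I. \<Sum>j\<in>J. (u i * v j)\<^sup>2) \<le> R ^ 4" if "L2_set u I \<le> R" "L2_set v J \<le> R" for u v :: rvec
  proof -
    have "(\<Sum>i\<in>I. \<Sum>j\<in>J. (u i * v j)\<^sup>2) = (L2_set u I)\<^sup>2 * (L2_set v J)\<^sup>2"
      unfolding L2_set_power2 by (simp add: power_mult_distrib sum_product)
    also have "\<dots> \<le> R\<^sup>2 * R\<^sup>2" using that by (intro mult_mono power_mono) auto
    finally show ?thesis by (simp add: power2_eq_square power4_eq_xxxx mult.assoc)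
  qed
  have "(\<Sum>p\<in>I \<times> J. (emp_block n X I J R p - emp_block n X' I J R p)\<^sup>2) =
      (\<Sum>i\<in>I. \<Sum>j\<in>J. (1 / real n * (?u i * ?v j - ?u' i * ?v' j))\<^sup>2)"
    unfolding diff[symmetric] by (simp add: sum.cartesian_product)
  also have "\<dots> \<le> (\<Sum>i\<in>I. \<Sum>j\<in>J. 2 / (real n)\<^sup>2 * ((?u i * ?v j)\<^sup>2 + (?u' i * ?v' j)\<^sup>2))"
    by (intro sum_mono sq)
  also have "\<dots> = 2 / (real n)\<^sup>2 * ((\<Sum>i\<in>I. \<Sum>j\<in>J. (?u i * ?v j)\<^sup>2) + (\<Sum>i\<in>I. \<Sum>j\<in>J. (?u' i * ?v' j)\<^sup>2))"
    by (simp add: sum_distrib_left sum.distrib distrib_left)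
  also have "\<dots> \<le> 2 / (real n)\<^sup>2 * (R ^ 4 + R ^ 4)"
    by (intro mult_left_mono add_mono prod L2_set_clip_le R) auto
  finally show ?thesis by simp
qed

lemma PiM_std_normal_shift:
  "(\<Pi>\<^sub>M p\<in>upper_pairs d. density lborel (\<lambda>x. ennreal (normal_density (\<theta> p) 1 x))) =
    distr (\<Pi>\<^sub>M p\<in>upper_pairs d. std_normal) (\<Pi>\<^sub>M p\<in>upper_pairs d. borel) (\<lambda>g. \<lambda>p\<in>upper_pairs d. \<theta> p + g p)"
proof -
  have 1: "distr std_normal borel (\<lambda>x. \<theta> p + x) = density lborel (\<lambda>x. ennreal (normal_density (\<theta> p) 1 x))" for p
  proof -
    interpret prob_space std_normal by (rule prob_space_std_normal)
    have "distributed std_normal lborel (\<lambda>x. x) std_normal_density"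
      by (simp add: distributed_def distr_id2)
    from normal_density_affine[OF this, of 1 "\<theta> p"]
    have "distributed std_normal lborel (\<lambda>x. \<theta> p + x) (normal_density (\<theta> p) 1)" by simp
    then have "distr std_normal lborel (\<lambda>x. \<theta> p + x) = density lborel (\<lambda>x. ennreal (normal_density (\<theta> p) 1 x))"
      by (simp add: distributed_def)
    moreover have "distr std_normal borel (\<lambda>x. \<theta> p + x) = distr std_normal lborel (\<lambda>x. \<theta> p + x)"
      by (intro distr_cong) auto
    ultimately show ?thesis by simp
  qed
  show ?thesis
    by (subst distr_PiM_componentwise[where N = "\<lambda>_. borel" and f = "\<lambda>p x. \<theta> p + x"])
       (simp_all add: prob_space_std_normal 1)
qed

text \<open>
  The map that produces the output of a call from a shifted Gaussian vector indexed by the upper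
  triangle; it does not depend on the data, so it is a post-processing step.
\<close>

definition scaled_symmetrize :: "nat \<Rightarrow> nat set \<Rightarrow> nat set \<Rightarrow> real \<Rightarrow> rmat \<Rightarrow> rmat" where
  "scaled_symmetrize d I J s y = (\<lambda>(i, j)\<in>{1..d} \<times> {1..d}. if (i, j) \<in> I \<times> J then s * y (min i j, max i j) else 0)"

lemma measurable_scaled_symmetrize:
  assumes N: "\<And>p. sets (N p) = sets borel"
  shows "scaled_symmetrize d I J s \<in> measurable (\<Pi>\<^sub>M p\<in>upper_pairs d. N p) (mat_space d)"
proof -
  let ?f = "\<lambda>y p. if p \<in> I \<times> J then s * y (min (fst p) (snd p), max (fst p) (snd p)) else 0"
  have "(\<lambda>y. \<lambda>p\<in>{1..d} \<times> {1..d}. ?f y p) \<in> measurable (\<Pi>\<^sub>M p\<in>upper_pairs d. N p) (mat_space d)"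
  proof (rule measurable_mat_space)
    fix p :: "nat \<times> nat" assume p: "p \<in> {1..d} \<times> {1..d}"
    let ?q = "(min (fst p) (snd p), max (fst p) (snd p))"
    have "?q \<in> upper_pairs d" using p by auto
    then have "(\<lambda>y. y ?q) \<in> measurable (\<Pi>\<^sub>M p\<in>upper_pairs d. N p) (N ?q)"
      by (rule measurable_component_singleton)
    then have [measurable]: "(\<lambda>y. y ?q) \<in> borel_measurable (\<Pi>\<^sub>M p\<in>upper_pairs d. N p)"
      using measurable_cong_sets[OF refl N] by blast
    show "(\<lambda>y. ?f y p) \<in> borel_measurable (\<Pi>\<^sub>M p\<in>upper_pairs d. N p)" by measurable
  qed
  also have "(\<lambda>y. \<lambda>p\<in>{1..d} \<times> {1..d}. ?f y p) = scaled_symmetrize d I J s"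
    by (auto simp: fun_eq_iff scaled_symmetrize_def)
  finally show ?thesis .
qed

text \<open>
  All dependence on the data is moved into the means of the independent Gaussian variables. In a
  diagonal block the entries \<open>(i, j)\<close> and \<open>(j, i)\<close> share one noise variable, which is consistent
  because the sample block is symmetric; the other blocks lie strictly above the diagonal.
\<close>

lemma DPCovBlock_as_shift:
  assumes IJ: "I = J \<or> (\<forall>i\<in>I. \<forall>j\<in>J. i < j)" and s: "noise_scale n \<rho> R > 0"
  shows "DPCovBlock n d X I J \<rho> R =
    distr (\<Pi>\<^sub>M p\<in>upper_pairs d. density lborel
        (\<lambda>x. ennreal (normal_density (if p \<in> I \<times> J then emp_block n X I J R p / noise_scale n \<rho> R else 0) 1 x)))
      (mat_space d) (scaled_symmetrize d I J (noise_scale n \<rho> R))"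
proof -
  let ?s = "noise_scale n \<rho> R"
  let ?\<theta> = "\<lambda>p. if p \<in> I \<times> J then emp_block n X I J R p / ?s else 0"
  let ?G = "\<Pi>\<^sub>M p\<in>upper_pairs d. std_normal"
  let ?B = "(\<Pi>\<^sub>M p\<in>upper_pairs d. borel) :: rmat measure"
  have m: "scaled_symmetrize d I J ?s \<in> measurable ?B (mat_space d)"
    by (rule measurable_scaled_symmetrize) simp
  have sh: "(\<lambda>g. \<lambda>p\<in>upper_pairs d. ?\<theta> p + g p) \<in> measurable ?G ?B"
    by (intro measurable_restrict borel_measurable_add)
      (auto intro!: measurable_compose[OF measurable_component_singleton[of _ _ "\<lambda>_. std_normal"]])
  have "distr (\<Pi>\<^sub>M p\<in>upper_pairs d. density lborel (\<lambda>x. ennreal (normal_density (?\<theta> p) 1 x)))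
        (mat_space d) (scaled_symmetrize d I J ?s) =
      distr ?G (mat_space d) (\<lambda>g. scaled_symmetrize d I J ?s (\<lambda>p\<in>upper_pairs d. ?\<theta> p + g p))"
    by (subst PiM_std_normal_shift, subst distr_distr[OF m sh]) (simp add: comp_def)
  also have "\<dots> = distr ?G (mat_space d)
      (\<lambda>g. noisy_block n d X I J \<rho> R (\<lambda>(i, j)\<in>{1..d} \<times> {1..d}. g (min i j, max i j)))"
  proof (rule distr_cong[OF refl refl], rule ext)
    fix g :: rmat and p :: "nat \<times> nat"
    obtain i j where p: "p = (i, j)" by (cases p)
    show "scaled_symmetrize d I J ?s (\<lambda>p\<in>upper_pairs d. ?\<theta> p + g p) p =
        noisy_block n d X I J \<rho> R (\<lambda>(i, j)\<in>{1..d} \<times> {1..d}. g (min i j, max i j)) p"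
    proof (cases "(i, j) \<in> {1..d} \<times> {1..d} \<and> (i, j) \<in> I \<times> J")
      case True
      have sym: "(min i j, max i j) \<in> I \<times> J \<and> emp_block n X I J R (min i j, max i j) = emp_block n X I J R (i, j)"
        using IJ
      proof
        assume "I = J" then show ?thesis using True by (auto simp: min_def max_def emp_block_def mult.commute)
      next
        assume "\<forall>i\<in>I. \<forall>j\<in>J. i < j"
        then have "i < j" using True by auto
        then show ?thesis using True by auto
      qed
      then show ?thesis using True s
        by (simp add: p scaled_symmetrize_def noisy_block_def distrib_left min_def max_def)
    qed (auto simp: p scaled_symmetrize_def noisy_block_def)
  qed
  also have "\<dots> = DPCovBlock n d X I J \<rho> R"
    unfolding DPCovBlock_eq sym_gauss_def
    by (subst distr_distr[OF measurable_noisy_block measurable_symmetrize]) (simp add: comp_def)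
  finally show ?thesis by simp
qed

text \<open>
  The squared distance of the means is at most \<open>4 R\<^sup>4 / n\<^sup>2\<close> divided by the noise variance
  \<open>18 R\<^sup>4 / (\<rho> n\<^sup>2)\<close>, which is below \<open>2 \<rho>\<close>.
\<close>

lemma renyi_moment_DPCovBlock:
  assumes a: "1 < a" and IJ: "I = J \<or> (\<forall>i\<in>I. \<forall>j\<in>J. i < j)" and R: "0 < R" and \<rho>: "0 < \<rho>" and n: "0 < n"
    and fin: "finite I" "finite J" and adj: "adjacent n X X'"
  shows "renyi_moment_le a (DPCovBlock n d X I J \<rho> R) (DPCovBlock n d X' I J \<rho> R) (a * (a - 1) * \<rho>)"
proof -
  let ?s = "noise_scale n \<rho> R"
  define \<theta> where "\<theta> = (\<lambda>X p. if p \<in> I \<times> J then emp_block n X I J R p / ?s else 0)"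
  let ?N = "\<lambda>X p. density lborel (\<lambda>x. ennreal (normal_density (\<theta> X p) 1 x))"
  have s: "?s > 0" using R \<rho> n by (simp add: noise_scale_def)
  have s2: "?s\<^sup>2 = 18 * R ^ 4 / (\<rho> * (real n)\<^sup>2)" using R \<rho> n by (simp add: noise_scale_def)
  have ps: "prob_space (?N X p)" for X p by (rule prob_space_normal_density) simp
  have "(\<Sum>p\<in>upper_pairs d. (\<theta> X p - \<theta> X' p)\<^sup>2) =
      (\<Sum>p\<in>upper_pairs d \<inter> (I \<times> J). (emp_block n X I J R p - emp_block n X' I J R p)\<^sup>2 / ?s\<^sup>2)"
    unfolding \<theta>_def by (rule sum.mono_neutral_cong_right)
      (auto simp: diff_divide_distrib[symmetric] power_divide)
  also have "\<dots> \<le> (\<Sum>p\<in>I \<times> J. (emp_block n X I J R p - emp_block n X' I J R p)\<^sup>2 / ?s\<^sup>2)"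
    using fin by (intro sum_mono2) auto
  also have "\<dots> \<le> (4 * R ^ 4 / (real n)\<^sup>2) / ?s\<^sup>2"
    unfolding sum_divide_distrib[symmetric]
    using emp_block_sensitivity[OF adj _ fin, of R] R by (intro divide_right_mono) auto
  also have "\<dots> \<le> 2 * \<rho>" unfolding s2 using R \<rho> n by (simp add: field_simps)
  finally have sens: "(\<Sum>p\<in>upper_pairs d. (\<theta> X p - \<theta> X' p)\<^sup>2) \<le> 2 * \<rho>" .
  have "renyi_moment_le a (PiM (upper_pairs d) (?N X)) (PiM (upper_pairs d) (?N X'))
      (\<Sum>p\<in>upper_pairs d. a * (a - 1) / 2 * (\<theta> X p - \<theta> X' p)\<^sup>2)"
    by (intro renyi_moment_PiM ps renyi_moment_normal) simp
  then have mom: "renyi_moment_le a (PiM (upper_pairs d) (?N X)) (PiM (upper_pairs d) (?N X')) (a * (a - 1) * \<rho>)"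
  proof (rule renyi_moment_le_mono)
    have "(\<Sum>p\<in>upper_pairs d. a * (a - 1) / 2 * (\<theta> X p - \<theta> X' p)\<^sup>2) \<le> a * (a - 1) / 2 * (2 * \<rho>)"
      unfolding sum_distrib_left[symmetric] using a sens by (intro mult_left_mono) auto
    then show "(\<Sum>p\<in>upper_pairs d. a * (a - 1) / 2 * (\<theta> X p - \<theta> X' p)\<^sup>2) \<le> a * (a - 1) * \<rho>" by simp
  qed
  have m: "scaled_symmetrize d I J ?s \<in> measurable (PiM (upper_pairs d) (?N X')) (mat_space d)"
    by (rule measurable_scaled_symmetrize) simp
  show ?thesis
    unfolding DPCovBlock_as_shift[OF IJ s] \<theta>_def[symmetric]
    using renyi_moment_distr[OF a prob_space_PiM prob_space_PiM m mom, OF ps ps]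
    unfolding \<theta>_def .
qed

section \<open>Dyadic scales and the composition of the calls\<close>

definition ada_J :: "real \<Rightarrow> nat \<Rightarrow> nat \<Rightarrow> nat" where
  "ada_J C0 n d = (LEAST J. d \<le> ada_k C0 n d J)"

locale ada_setup =
  fixes C0 c0 :: real and n d :: nat
  assumes C0: "0 < C0" and n: "2 \<le> n" and d: "1 \<le> d"
begin

abbreviation "k m \<equiv> ada_k C0 n d m"
abbreviation "D \<equiv> ada_dim C0 n d"
abbreviation "J \<equiv> ada_J C0 n d"
abbreviation "S \<equiv> ada_S C0 c0 n d"
abbreviation "N m \<equiv> ada_N C0 n d m"
abbreviation "calls \<equiv> ada_calls C0 c0 n d"

lemma k_0_pos: "1 \<le> k 0"
proof -
  have "0 < C0 * ln (real n)" using C0 n by simp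
  then have "0 < \<lceil>C0 * ln (real n)\<rceil>" by simp
  then have "1 \<le> nat \<lceil>C0 * ln (real n)\<rceil>" by linarith
  then show ?thesis using d by (simp add: ada_k_def)
qed

lemma k_eq: "k m = 2 ^ m * k 0"
  by (simp add: ada_k_def)

lemma k_Suc: "k (Suc m) = 2 * k m"
  by (simp add: ada_k_def)

lemma k_add: "k (m + j) = 2 ^ j * k m"
  by (simp add: ada_k_def power_add)

lemma k_pos: "1 \<le> k m"
proof -
  have "1 * 1 \<le> 2 ^ m * k 0" using k_0_pos by (intro mult_le_mono) auto
  then show ?thesis using k_eq[of m] by simp
qed

lemma k_mono: "m \<le> m' \<Longrightarrow> k m \<le> k m'"
  by (metis k_add le_Suc_ex one_le_numeral one_le_power mult_le_mono1 nat_mult_1)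

lemma k_strict_mono: "m < m' \<Longrightarrow> k m < k m'"
  using k_mono[of "Suc m" m'] k_pos[of m] by (simp add: k_Suc)

lemma k_0_le_d: "k 0 \<le> d"
  by (simp add: ada_k_def)

lemma d_le_D: "d \<le> D"
proof -
  have "d \<le> k d"
    using k_0_pos less_exp[of d] by (subst k_eq) (metis less_imp_le mult_le_mono nat_mult_1_right order_trans)
  then show ?thesis unfolding ada_dim_def by (rule LeastI)
qed

lemma D_eq: "D = k J"
  by (simp add: ada_dim_def ada_J_def)

lemma D_pos: "1 \<le> D"
  using d_le_D d by simp

lemma D_le: "D \<le> 2 * d"
proof (cases J)
  case 0 then show ?thesis using D_eq k_0_le_d by simp
next
  case (Suc j)
  then have "\<not> d \<le> k j" using not_less_Least[of j "\<lambda>J. d \<le> k J"] unfolding ada_J_def by simp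
  then show ?thesis using D_eq Suc by (simp add: k_Suc)
qed

lemma S_set_finite: "finite {m. real (k m) \<le> min (c0 * real n) (real D)}"
proof (rule finite_subset)
  show "{m. real (k m) \<le> min (c0 * real n) (real D)} \<subseteq> {..J}"
  proof
    fix m assume "m \<in> {m. real (k m) \<le> min (c0 * real n) (real D)}"
    then have "k m \<le> k J" using D_eq by simp
    then show "m \<in> {..J}" using k_strict_mono[of J m] by (auto simp: not_le[symmetric])
  qed
qed simp

lemma S_pos: "1 \<le> S"
  by (simp add: ada_S_def)

lemma k_le_of_less_S:
  assumes "m < S"
  shows "m = 0 \<or> real (k m) \<le> c0 * real n" and "k m \<le> D"
proof -
  let ?A = "insert 0 {m. real (k m) \<le> min (c0 * real n) (real D)}"
  have "Max ?A \<in> ?A" by (rule Max_in) (use S_set_finite in auto)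
  moreover have m: "m \<le> Max ?A" using assms by (simp add: ada_S_def)
  ultimately have *: "m = 0 \<or> real (k m) \<le> min (c0 * real n) (real D)"
    using k_mono[OF m] by (auto simp: min_def split: if_splits)
  then show "m = 0 \<or> real (k m) \<le> c0 * real n" by auto
  show "k m \<le> D" using * k_0_le_d d_le_D by auto
qed

lemma less_S_le_J: "m < S \<Longrightarrow> m \<le> J"
  using k_le_of_less_S(2)[of m] k_strict_mono[of J m] D_eq by (metis not_le)

lemma S_le_J: "S \<le> Suc J"
  using less_S_le_J[of "S - 1"] S_pos by simp

lemma S_maximal:
  assumes "S \<le> J"
  shows "c0 * real n < real (k S)"
proof (rule ccontr)
  assume "\<not> ?thesis"
  moreover have "k S \<le> D" using k_mono[OF assms] D_eq by simp
  ultimately have "S \<in> insert 0 {m. real (k m) \<le> min (c0 * real n) (real D)}" by simp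
  then have "S \<le> Max (insert 0 {m. real (k m) \<le> min (c0 * real n) (real D)})"
    by (intro Max_ge) (use S_set_finite in auto)
  then show False by (simp add: ada_S_def)
qed

lemma N_eq: "m \<le> J \<Longrightarrow> N m = 2 ^ (J - m)"
  unfolding ada_N_def D_eq using k_add[of m "J - m"] k_pos[of m] by simp

lemma N_mult_k: "m \<le> J \<Longrightarrow> N m * k m = D"
  using k_add[of m "J - m"] by (simp add: N_eq D_eq)

lemma N_pos: "m \<le> J \<Longrightarrow> 1 \<le> N m"
  by (simp add: N_eq)

lemma calls_eq:
  "calls = (\<lambda>l. (0, l, 0)) ` {1..N 0} \<union> (\<lambda>l. (0, l, 1)) ` {1..<N 0} \<union>
     (\<lambda>(m, l). (m, l, 1)) ` (SIGMA m:{1..<S}. {1..<N m})"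
  unfolding ada_calls_def by (auto simp: image_iff)

lemma finite_calls [simp]: "finite calls"
  unfolding calls_eq by auto

lemma sum_calls:
  "(\<Sum>c\<in>calls. f c) = (\<Sum>l\<in>{1..N 0}. f (0, l, 0)) + (\<Sum>l\<in>{1..<N 0}. f (0, l, 1)) +
     (\<Sum>m\<in>{1..<S}. \<Sum>l\<in>{1..<N m}. f (m, l, 1))" for f :: "_ \<Rightarrow> 'b :: comm_monoid_add"
proof -
  let ?A = "(\<lambda>l. (0 :: nat, l, 0 :: nat)) ` {1..N 0}" and ?B = "(\<lambda>l. (0 :: nat, l, 1 :: nat)) ` {1..<N 0}"
    and ?C = "(\<lambda>(m, l). (m, l, 1 :: nat)) ` (SIGMA m:{1..<S}. {1..<N m})"
  have "(\<Sum>c\<in>calls. f c) = sum f ?A + sum f ?B + sum f ?C"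
    unfolding calls_eq by (subst sum.union_disjoint; (subst sum.union_disjoint)?) auto
  moreover have "sum f ?A = (\<Sum>l\<in>{1..N 0}. f (0, l, 0))"
    by (subst sum.reindex) (auto simp: inj_on_def)
  moreover have "sum f ?B = (\<Sum>l\<in>{1..<N 0}. f (0, l, 1))"
    by (subst sum.reindex) (auto simp: inj_on_def)
  moreover have "sum f ?C = (\<Sum>m\<in>{1..<S}. \<Sum>l\<in>{1..<N m}. f (m, l, 1))"
    by (subst sum.reindex) (auto simp: inj_on_def sum.Sigma case_prod_beta')
  ultimately show ?thesis by simp
qed

lemma calls_cases:
  assumes "c \<in> calls"
  obtains m l r where "c = (m, l, r)" "m < S" "m \<le> J" "1 \<le> l" "l + r \<le> N m" "r \<le> 1" "m \<noteq> 0 \<longrightarrow> r = 1"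
proof -
  from assms consider l r where "c = (0, l, r)" "l \<in> {1..N 0}" "r \<in> {0, 1}" "l + r \<le> N 0"
    | m l where "c = (m, l, 1)" "m \<in> {1..<S}" "l \<in> {1..<N m}"
    unfolding ada_calls_def by auto
  then show thesis
  proof cases
    case 1 then show thesis using S_pos by (intro that[of 0 l r]) auto
  next
    case 2 then show thesis using less_S_le_J[of m] by (intro that[of m l 1]) auto
  qed
qed

lemma ada_rho_pos: "0 < \<rho> \<Longrightarrow> m \<le> J \<Longrightarrow> 0 < ada_rho C0 c0 n d \<rho> m"
  using N_pos[of m] N_pos[of 0] S_pos by (simp add: ada_rho_def)

text \<open>
  Each of the \<open>S\<close> scales spends at most \<open>\<rho> / S\<close>: scale zero makes fewer than \<open>2 N\<^sub>0\<close> calls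
  and scale \<open>m\<close> fewer than \<open>N\<^sub>m\<close>.
\<close>

lemma sum_ada_rho_le:
  assumes "0 < \<rho>"
  shows "(\<Sum>(m, l, r)\<in>calls. ada_rho C0 c0 n d \<rho> m) \<le> \<rho>"
proof -
  have N0: "1 \<le> N 0" by (rule N_pos) simp
  have S: "real S > 0" using S_pos by simp
  have "(\<Sum>(m, l, r)\<in>calls. ada_rho C0 c0 n d \<rho> m) =
      real (N 0) * ada_rho C0 c0 n d \<rho> 0 + real (N 0 - 1) * ada_rho C0 c0 n d \<rho> 0 +
      (\<Sum>m\<in>{1..<S}. real (N m - 1) * ada_rho C0 c0 n d \<rho> m)"
    by (subst sum_calls) simp
  also have "\<dots> \<le> \<rho> / real S + (\<Sum>m\<in>{1..<S}. \<rho> / real S)"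
  proof (rule add_mono)
    have "real (N 0) * ada_rho C0 c0 n d \<rho> 0 + real (N 0 - 1) * ada_rho C0 c0 n d \<rho> 0
        \<le> real (N 0) * ada_rho C0 c0 n d \<rho> 0 + real (N 0) * ada_rho C0 c0 n d \<rho> 0"
      using ada_rho_pos[OF assms, of 0] by (intro add_mono mult_right_mono) auto
    also have "\<dots> = \<rho> / real S" using N0 S by (simp add: ada_rho_def field_simps)
    finally show "real (N 0) * ada_rho C0 c0 n d \<rho> 0 + real (N 0 - 1) * ada_rho C0 c0 n d \<rho> 0 \<le> \<rho> / real S" .
    show "(\<Sum>m\<in>{1..<S}. real (N m - 1) * ada_rho C0 c0 n d \<rho> m) \<le> (\<Sum>m\<in>{1..<S}. \<rho> / real S)"
    proof (rule sum_mono)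
      fix m assume m: "m \<in> {1..<S}"
      have N: "1 \<le> N m" using m less_S_le_J[of m] by (intro N_pos) auto
      have "real (N m - 1) * ada_rho C0 c0 n d \<rho> m \<le> real (N m) * ada_rho C0 c0 n d \<rho> m"
        using ada_rho_pos[OF assms, of m] m less_S_le_J[of m] by (intro mult_right_mono) auto
      also have "\<dots> = \<rho> / real S" using N S m by (simp add: ada_rho_def field_simps)
      finally show "real (N m - 1) * ada_rho C0 c0 n d \<rho> m \<le> \<rho> / real S" .
    qed
  qed
  also have "\<dots> = \<rho>" using S S_pos by (simp add: of_nat_diff field_simps)
  finally show ?thesis .
qed

lemma measurable_ada_assemble:
  "ada_assemble C0 L1 c0 n d \<rho> \<in> measurable (\<Pi>\<^sub>M c\<in>calls. mat_space D) (mat_space d)"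
proof -
  let ?M = "\<Pi>\<^sub>M c\<in>calls. mat_space D"
  let ?f = "\<lambda>Y p. \<Sum>c\<in>calls. ada_piece C0 L1 c0 n d \<rho> c (Y c) (min (fst p) (snd p), max (fst p) (snd p))"
  have entry: "(\<lambda>Y. Y c p) \<in> borel_measurable ?M" if "c \<in> calls" "p \<in> {1..D} \<times> {1..D}" for c p
    using measurable_compose[OF measurable_component_singleton[OF that(1), of "\<lambda>_. mat_space D"] mat_space_component[OF that(2)]] .
  have masked: "(\<lambda>Y. mask (Y c) B p) \<in> borel_measurable ?M" if "c \<in> calls" "p \<in> {1..D} \<times> {1..D}" for c p B
    using entry[OF that] by (cases "p \<in> B") (simp_all add: mask_def)
  have "(\<lambda>Y. \<lambda>p\<in>{1..d} \<times> {1..d}. ?f Y p) \<in> measurable ?M (mat_space d)"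
  proof (intro measurable_mat_space borel_measurable_sum)
    fix p :: "nat \<times> nat" and c assume p: "p \<in> {1..d} \<times> {1..d}" and c: "c \<in> calls"
    let ?q = "(min (fst p) (snd p), max (fst p) (snd p))"
    have q: "?q \<in> {1..D} \<times> {1..D}" using p d_le_D by auto
    obtain m l r where mlr: "c = (m, l, r)" using prod_cases3 by blast
    let ?G = "ada_Gamma C0 n d m l"
    have [measurable]: "(\<lambda>Y. mask (Y c) ?G ?q) \<in> borel_measurable ?M"
      "(\<lambda>Y. spec_norm D (mask (Y c) ?G)) \<in> borel_measurable ?M"
      by (intro masked c q borel_measurable_spec_norm; simp)+
    have "(\<lambda>Y. if spec_norm D (mask (Y c) ?G) > ada_tau C0 L1 c0 n d \<rho> m then mask (Y c) ?G ?q else 0) \<in> borel_measurable ?M"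
      by measurable
    also have "(\<lambda>Y. if spec_norm D (mask (Y c) ?G) > ada_tau C0 L1 c0 n d \<rho> m then mask (Y c) ?G ?q else 0) =
        (\<lambda>Y. (if spec_norm D (mask (Y c) ?G) > ada_tau C0 L1 c0 n d \<rho> m then mask (Y c) ?G else (\<lambda>_. 0)) ?q)"
      by auto
    finally show "(\<lambda>Y. ada_piece C0 L1 c0 n d \<rho> c (Y c) ?q) \<in> borel_measurable ?M"
      using masked[OF c q] unfolding mlr by (cases "m = 0") (simp_all add: ada_piece_def Let_def)
  qed
  also have "(\<lambda>Y. \<lambda>p\<in>{1..d} \<times> {1..d}. ?f Y p) = ada_assemble C0 L1 c0 n d \<rho>"
    by (auto simp: fun_eq_iff ada_assemble_def restrict_def)
  finally show ?thesis .
qed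

lemma prob_space_ada_call: "prob_space (ada_call C0 C c0 n d \<rho> X c)"
  by (cases c) (simp add: ada_call_def Let_def prob_space_DPCovBlock)

lemma sets_ada_call: "sets (ada_call C0 C c0 n d \<rho> X c) = sets (mat_space D)"
  by (cases c) (simp add: ada_call_def Let_def)

lemma measurable_ada_assemble_call:
  "ada_assemble C0 L1 c0 n d \<rho> \<in> measurable (PiM calls (ada_call C0 C c0 n d \<rho> X)) (mat_space d)"
proof -
  have "sets (PiM calls (ada_call C0 C c0 n d \<rho> X)) = sets (\<Pi>\<^sub>M c\<in>calls. mat_space D)"
    by (intro sets_PiM_cong refl sets_ada_call)
  then show ?thesis
    using measurable_ada_assemble measurable_cong_sets[OF _ refl[of "sets (mat_space d)"]] by blast
qed

lemma prob_space_ada_estimator: "prob_space (ada_estimator C0 C L1 c0 n d \<rho> X)"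
  unfolding ada_estimator_def
  by (intro prob_space.prob_space_distr prob_space_PiM prob_space_ada_call measurable_ada_assemble_call)

text \<open>
  The estimator is a fixed map of the product of the calls, so the moments multiply, the budgets
  add up, and the factor \<open>a - 1\<close> in the exponent cancels against the divisor in the divergence.
\<close>

lemma zCDP_ada_estimator:
  assumes C: "0 < C" and \<rho>: "0 < \<rho>"
  shows "zCDP \<rho> n U (ada_estimator C0 C L1 c0 n d \<rho>)"
  unfolding zCDP_def
proof (intro conjI ballI impI allI)
  show "prob_space (ada_estimator C0 C L1 c0 n d \<rho> X)" for X by (rule prob_space_ada_estimator)
next
  fix X X' :: "nat \<Rightarrow> rvec" and a :: real
  assume adj: "adjacent n X X'" and a: "1 < a"
  have adj': "adjacent n (pad D d X) (pad D d X')"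
  proof -
    obtain i where i: "i \<in> {1..n}" "\<forall>j\<in>{1..n} - {i}. X j = X' j" using adj unfolding adjacent_def by blast
    have "pad D d X j = pad D d X' j" if "X j = X' j" for j by (simp only: pad_def that)
    with i show ?thesis unfolding adjacent_def by blast
  qed
  have call: "renyi_moment_le a (ada_call C0 C c0 n d \<rho> X c) (ada_call C0 C c0 n d \<rho> X' c)
      (case c of (m, l, r) \<Rightarrow> a * (a - 1) * ada_rho C0 c0 n d \<rho> m)" if c: "c \<in> calls" for c
  proof -
    obtain m l r where mlr: "c = (m, l, r)" "m < S" "m \<le> J" "r \<le> 1" using calls_cases[OF c] by metis
    have IJ: "idx (k m) l = idx (k m) (l + r) \<or> (\<forall>i\<in>idx (k m) l. \<forall>j\<in>idx (k m) (l + r). i < j)"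
      using mlr(4) by (cases r) (auto simp: idx_def)
    show ?thesis
      unfolding mlr(1) ada_call_def Let_def split
      using renyi_moment_DPCovBlock[OF a IJ _ ada_rho_pos[OF \<rho> mlr(3)] _ _ _ adj', of "sqrt (C * real (k m))" D] C k_pos[of m] n
      by (simp add: idx_def)
  qed
  let ?b = "\<Sum>c\<in>calls. case c of (m, l, r) \<Rightarrow> a * (a - 1) * ada_rho C0 c0 n d \<rho> m"
  have "?b = a * (a - 1) * (\<Sum>(m, l, r)\<in>calls. ada_rho C0 c0 n d \<rho> m)"
    by (simp add: sum_distrib_left case_prod_beta')
  also have "\<dots> \<le> a * (a - 1) * \<rho>"
    using a sum_ada_rho_le[OF \<rho>] by (intro mult_left_mono) auto
  finally have b: "?b \<le> a * (a - 1) * \<rho>" .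
  have "renyi_moment_le a (PiM calls (ada_call C0 C c0 n d \<rho> X)) (PiM calls (ada_call C0 C c0 n d \<rho> X')) ?b"
    by (intro renyi_moment_PiM prob_space_ada_call call) simp
  then have "renyi_moment_le a (PiM calls (ada_call C0 C c0 n d \<rho> X)) (PiM calls (ada_call C0 C c0 n d \<rho> X'))
      (a * (a - 1) * \<rho>)" using b by (rule renyi_moment_le_mono)
  then have "renyi_moment_le a (ada_estimator C0 C L1 c0 n d \<rho> X) (ada_estimator C0 C L1 c0 n d \<rho> X') (a * (a - 1) * \<rho>)"
    unfolding ada_estimator_def
    by (intro renyi_moment_distr a prob_space_PiM prob_space_ada_call measurable_ada_assemble_call)
  then have "renyi_div a (ada_estimator C0 C L1 c0 n d \<rho> X) (ada_estimator C0 C L1 c0 n d \<rho> X')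
      \<le> ereal (a * (a - 1) * \<rho> / (a - 1))"
    using a \<rho> by (intro renyi_div_le_of_moment prob_space_ada_estimator) auto
  then show "renyi_div a (ada_estimator C0 C L1 c0 n d \<rho> X) (ada_estimator C0 C L1 c0 n d \<rho> X') \<le> ereal (\<rho> * a)"
    using a by (simp add: mult.commute)
qed

end

section \<open>Exponential moments\<close>

lemma exp_le_quadratic: "exp (y::real) \<le> 1 + y + y\<^sup>2 / 2 * exp \<bar>y\<bar>"
proof -
  obtain t where t: "\<bar>t\<bar> \<le> \<bar>y\<bar>" "exp y = (\<Sum>m<2. y ^ m / fact m) + exp t / fact 2 * y ^ 2"
    using Maclaurin_exp_le[of y 2] by blast
  have "exp t * y\<^sup>2 \<le> exp \<bar>y\<bar> * y\<^sup>2" using t(1) by (intro mult_right_mono) auto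
  then show ?thesis using t(2) by (simp add: numeral_2_eq_2 field_simps)
qed

lemma square_le_exp: "0 \<le> z \<Longrightarrow> z\<^sup>2 \<le> 2 * exp (z::real)"
  using exp_lower_Taylor_quadratic[of z] by simp

lemma power4_le_exp: "(x::real) ^ 4 \<le> 256 * (exp x + exp (- x))"
proof -
  have "(\<bar>x\<bar> / 4) ^ 4 \<le> (1 + \<bar>x\<bar> / real 4) ^ 4" by (intro power_mono) auto
  also have "\<dots> \<le> exp \<bar>x\<bar>" by (rule exp_ge_one_plus_x_over_n_power_n) auto
  also have "\<dots> \<le> exp x + exp (- x)" by (auto simp: abs_if)
  finally show ?thesis by (simp add: power_divide)
qed

text \<open>
  The moment generating function of a sub-exponential variable, near zero. The second-order Taylor
  remainder is controlled by the exponential moment. The variable is compared with an arbitrary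
  number \<open>\<mu>\<close> in place of its mean, which later is the target that a clipped average estimates
  with a small bias.
\<close>

lemma (in prob_space) mgf_centered_le:
  assumes Y [measurable]: "Y \<in> borel_measurable M" and b: "0 < b"
    and exp_moment: "(\<integral>\<^sup>+ x. ennreal (exp (\<bar>Y x\<bar> / b)) \<partial>M) \<le> 2"
    and l: "\<bar>l\<bar> \<le> 1 / (2 * b)"
  shows "integrable M Y" and "(\<integral>x. (Y x)\<^sup>2 \<partial>M) \<le> 4 * b\<^sup>2" and "integrable M (\<lambda>x. (Y x)\<^sup>2)"
    and "(\<integral>\<^sup>+ x. ennreal (exp (l * (Y x - \<mu>))) \<partial>M) \<le> ennreal (exp (8 * l\<^sup>2 * b\<^sup>2 + \<bar>l\<bar> * \<bar>expectation Y - \<mu>\<bar>))"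
proof -
  let ?E = "\<lambda>x. exp (\<bar>Y x\<bar> / b)"
  have intE: "integrable M ?E"
    by (rule integrableI_bounded) (use exp_moment in \<open>auto intro: le_less_trans\<close>)
  have E2: "expectation ?E \<le> 2"
  proof -
    have "ennreal (expectation ?E) = (\<integral>\<^sup>+ x. ennreal (?E x) \<partial>M)" by (rule nn_integral_eq_integral[symmetric, OF intE]) auto
    then have "ennreal (expectation ?E) \<le> ennreal 2" using exp_moment by simp
    then show ?thesis by (metis ennreal_le_iff zero_le_numeral)
  qed
  have Yle: "\<bar>Y x\<bar> \<le> b * ?E x" for x
  proof -
    have "\<bar>Y x\<bar> / b \<le> ?E x" using exp_ge_add_one_self[of "\<bar>Y x\<bar> / b"] by linarith
    then show ?thesis using b by (simp add: field_simps)
  qed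
  show intY: "integrable M Y"
    by (rule Bochner_Integration.integrable_bound[OF integrable_mult_right[OF intE, of b]]) (use Yle b in auto)
  have Y2le: "(Y x)\<^sup>2 \<le> 2 * b\<^sup>2 * ?E x" for x
    using square_le_exp[of "\<bar>Y x\<bar> / b"] b by (simp add: power_divide field_simps)
  show intY2: "integrable M (\<lambda>x. (Y x)\<^sup>2)"
    by (rule Bochner_Integration.integrable_bound[OF integrable_mult_right[OF intE, of "2 * b\<^sup>2"]]) (use Y2le in auto)
  have "(\<integral>x. (Y x)\<^sup>2 \<partial>M) \<le> (\<integral>x. 2 * b\<^sup>2 * ?E x \<partial>M)"
    by (intro integral_mono intY2 integrable_mult_right intE Y2le)
  also have "\<dots> = 2 * b\<^sup>2 * expectation ?E" by simp
  also have "\<dots> \<le> 2 * b\<^sup>2 * 2" by (intro mult_left_mono E2) auto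
  finally show "(\<integral>x. (Y x)\<^sup>2 \<partial>M) \<le> 4 * b\<^sup>2" by simp
  have pt: "exp (l * Y x) \<le> 1 + l * Y x + 4 * l\<^sup>2 * b\<^sup>2 * ?E x" for x
  proof -
    let ?z = "\<bar>Y x\<bar> / (2 * b)"
    have z: "0 \<le> ?z" using b by simp
    have "(Y x)\<^sup>2 = 4 * b\<^sup>2 * ?z\<^sup>2" using b by (simp add: power_divide power_mult_distrib)
    also have "\<dots> \<le> 4 * b\<^sup>2 * (2 * exp ?z)" by (intro mult_left_mono square_le_exp z) auto
    finally have 1: "(Y x)\<^sup>2 \<le> 8 * b\<^sup>2 * exp ?z" by simp
    have "\<bar>l * Y x\<bar> \<le> 1 / (2 * b) * \<bar>Y x\<bar>" unfolding abs_mult by (intro mult_right_mono l) auto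
    then have 2: "exp \<bar>l * Y x\<bar> \<le> exp ?z" by simp
    have "exp (l * Y x) \<le> 1 + l * Y x + (l * Y x)\<^sup>2 / 2 * exp \<bar>l * Y x\<bar>" by (rule exp_le_quadratic)
    also have "(l * Y x)\<^sup>2 / 2 * exp \<bar>l * Y x\<bar> \<le> (l\<^sup>2 * (8 * b\<^sup>2 * exp ?z)) / 2 * exp ?z"
      unfolding power_mult_distrib by (intro mult_mono divide_right_mono mult_left_mono 1 2) auto
    also have "\<dots> = 4 * l\<^sup>2 * b\<^sup>2 * (exp ?z * exp ?z)" by simp
    also have "exp ?z * exp ?z = ?E x" by (simp add: exp_add[symmetric])
    finally show ?thesis by simp
  qed
  have intexp: "integrable M (\<lambda>x. exp (l * Y x))"
  proof (rule Bochner_Integration.integrable_bound[OF intE])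
    have "l * Y x \<le> \<bar>Y x\<bar> / b" for x
    proof -
      have "l * Y x \<le> \<bar>l\<bar> * \<bar>Y x\<bar>" by (metis abs_ge_self abs_mult)
      also have "\<dots> \<le> 1 / (2 * b) * \<bar>Y x\<bar>" by (intro mult_right_mono l) auto
      also have "\<dots> \<le> \<bar>Y x\<bar> / b" using b by (simp add: field_simps)
      finally show ?thesis .
    qed
    then show "AE x in M. norm (exp (l * Y x)) \<le> norm (?E x)" by auto
  qed auto
  have "expectation (\<lambda>x. exp (l * Y x)) \<le> (\<integral>x. 1 + l * Y x + 4 * l\<^sup>2 * b\<^sup>2 * ?E x \<partial>M)"
    by (intro integral_mono pt intexp Bochner_Integration.integrable_add integrable_mult_right intE intY) auto
  also have "\<dots> = 1 + l * expectation Y + 4 * l\<^sup>2 * b\<^sup>2 * expectation ?E"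
    using intE intY by (simp add: prob_space)
  also have "\<dots> \<le> 1 + l * expectation Y + 4 * l\<^sup>2 * b\<^sup>2 * 2"
    by (intro add_left_mono mult_left_mono E2) auto
  also have "\<dots> \<le> exp (l * expectation Y + 8 * l\<^sup>2 * b\<^sup>2)"
    by (rule order_trans[OF _ exp_ge_add_one_self]) simp
  finally have main: "expectation (\<lambda>x. exp (l * Y x)) \<le> exp (l * expectation Y + 8 * l\<^sup>2 * b\<^sup>2)" .
  have "(\<integral>\<^sup>+ x. ennreal (exp (l * (Y x - \<mu>))) \<partial>M) = (\<integral>\<^sup>+ x. ennreal (exp (- l * \<mu>)) * ennreal (exp (l * Y x)) \<partial>M)"
    by (intro nn_integral_cong) (simp add: ennreal_mult[symmetric] exp_add[symmetric] algebra_simps)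
  also have "\<dots> = ennreal (exp (- l * \<mu>)) * ennreal (expectation (\<lambda>x. exp (l * Y x)))"
    by (subst nn_integral_cmult) (auto simp: nn_integral_eq_integral[OF intexp])
  also have "\<dots> \<le> ennreal (exp (- l * \<mu>)) * ennreal (exp (l * expectation Y + 8 * l\<^sup>2 * b\<^sup>2))"
    by (intro mult_left_mono ennreal_leI main) auto
  also have "\<dots> = ennreal (exp (8 * l\<^sup>2 * b\<^sup>2 + l * (expectation Y - \<mu>)))"
    by (simp add: ennreal_mult[symmetric] exp_add[symmetric] algebra_simps)
  also have "\<dots> \<le> ennreal (exp (8 * l\<^sup>2 * b\<^sup>2 + \<bar>l\<bar> * \<bar>expectation Y - \<mu>\<bar>))"
    by (intro ennreal_leI) (simp add: abs_mult[symmetric])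
  finally show "(\<integral>\<^sup>+ x. ennreal (exp (l * (Y x - \<mu>))) \<partial>M) \<le> ennreal (exp (8 * l\<^sup>2 * b\<^sup>2 + \<bar>l\<bar> * \<bar>expectation Y - \<mu>\<bar>))" .
qed

section \<open>Chernoff bounds over nets and the norm of the noise\<close>

lemma std_normal_mgf: "(\<integral>\<^sup>+ x. ennreal (exp (t * x)) \<partial>std_normal) = ennreal (exp (t\<^sup>2 / 2))"
proof -
  have 1: "std_normal_density x * exp (t * x) = exp (t\<^sup>2 / 2) * normal_density t 1 x" for x
    by (simp add: normal_density_def exp_add[symmetric] power2_eq_square field_simps)
  have "(\<integral>\<^sup>+ x. ennreal (exp (t * x)) \<partial>std_normal) = (\<integral>\<^sup>+ x. ennreal (exp (t\<^sup>2 / 2)) * ennreal (normal_density t 1 x) \<partial>lborel)"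
    by (subst nn_integral_density) (simp_all add: ennreal_mult[symmetric] 1)
  also have "\<dots> = ennreal (exp (t\<^sup>2 / 2))"
    by (subst nn_integral_cmult) (simp_all add: nn_integral_eq_integral integrable_normal_density)
  finally show ?thesis .
qed

lemma nn_integral_sym_gauss:
  assumes "h \<in> borel_measurable (mat_space d)"
  shows "(\<integral>\<^sup>+ G. h G \<partial>sym_gauss d) =
    (\<integral>\<^sup>+ g. h (\<lambda>(i, j)\<in>{1..d} \<times> {1..d}. g (min i j, max i j)) \<partial>(\<Pi>\<^sub>M p\<in>upper_pairs d. std_normal))"
  unfolding sym_gauss_def by (rule nn_integral_distr[OF measurable_symmetrize]) (use assms in simp)

lemma measurable_bilin:
  assumes "\<And>p. p \<in> {1..D} \<times> {1..D} \<Longrightarrow> (\<lambda>x. f x p) \<in> borel_measurable M"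
  shows "(\<lambda>x. bilin D (f x) u v) \<in> borel_measurable M"
  unfolding bilin_def using assms by (intro borel_measurable_sum borel_measurable_times) auto

text \<open>
  The form is a linear combination of the independent variables of the upper triangle. Each
  variable occurs at most twice, so the squared coefficients sum to at most \<open>2 |u|\<^sup>2 |v|\<^sup>2\<close>.
\<close>

lemma sym_gauss_bilin_mgf:
  assumes u: "L2_set u {1..D} \<le> 1" and v: "L2_set v {1..D} \<le> 1"
  shows "(\<integral>\<^sup>+ G. ennreal (exp (t * bilin D G u v)) \<partial>sym_gauss D) \<le> ennreal (exp (t\<^sup>2))"
proof -
  interpret product_prob_space "\<lambda>_. std_normal" by (intro product_prob_spaceI prob_space_std_normal)
  let ?S = "{1..D} \<times> {1..D}" and ?sort = "\<lambda>(i, j). (min i j, max i (j::nat))"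
  define f where "f = (\<lambda>(i, j). u i * v j)"
  define c where "c = (\<lambda>p. \<Sum>q\<in>{q \<in> ?S. ?sort q = p}. f q)"
  have "(c p)\<^sup>2 \<le> 2 * (\<Sum>q\<in>{q \<in> ?S. ?sort q = p}. (f q)\<^sup>2)" for p
  proof -
    let ?Q = "{q \<in> ?S. ?sort q = p}"
    have "?Q \<subseteq> {p, (snd p, fst p)}" by (auto simp: min_def max_def split: if_splits)
    then have "card ?Q \<le> card {p, (snd p, fst p)}" by (intro card_mono) auto
    also have "\<dots> \<le> 2" by (simp add: card_insert_if)
    finally have card: "real (card ?Q) \<le> 2" by simp
    have "(c p)\<^sup>2 \<le> (\<Sum>q\<in>?Q. (f q)\<^sup>2) * real (card ?Q)"
      unfolding c_def by (rule sum_squared_le_sum_of_squares)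
    also have "\<dots> \<le> (\<Sum>q\<in>?Q. (f q)\<^sup>2) * 2" by (intro mult_left_mono card sum_nonneg) auto
    finally show ?thesis by simp
  qed
  then have "(\<Sum>p\<in>upper_pairs D. (c p)\<^sup>2) \<le> 2 * (\<Sum>p\<in>upper_pairs D. \<Sum>q\<in>{q \<in> ?S. ?sort q = p}. (f q)\<^sup>2)"
    unfolding sum_distrib_left by (intro sum_mono)
  also have "(\<Sum>p\<in>upper_pairs D. \<Sum>q\<in>{q \<in> ?S. ?sort q = p}. (f q)\<^sup>2) = (\<Sum>q\<in>?S. (f q)\<^sup>2)"
    by (rule sum.group) auto
  also have "\<dots> = (L2_set u {1..D})\<^sup>2 * (L2_set v {1..D})\<^sup>2"
    unfolding L2_set_power2 by (simp add: f_def power_mult_distrib sum_product sum.cartesian_product case_prod_beta')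
  also have "\<dots> \<le> 1 * 1" using u v by (intro mult_mono power_le_one) auto
  finally have c2: "(\<Sum>p\<in>upper_pairs D. (c p)\<^sup>2) \<le> 2" by simp
  have lin: "bilin D (\<lambda>(i, j)\<in>?S. g (min i j, max i j)) u v = (\<Sum>p\<in>upper_pairs D. c p * g p)" for g :: rmat
  proof -
    have "bilin D (\<lambda>(i, j)\<in>?S. g (min i j, max i j)) u v = (\<Sum>q\<in>?S. f q * g (?sort q))"
      unfolding bilin_def by (simp add: sum.cartesian_product f_def case_prod_beta' mult_ac)
    also have "\<dots> = (\<Sum>p\<in>upper_pairs D. \<Sum>q\<in>{q \<in> ?S. ?sort q = p}. f q * g (?sort q))"
      by (rule sum.group[symmetric]) auto
    also have "\<dots> = (\<Sum>p\<in>upper_pairs D. c p * g p)"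
      unfolding c_def sum_distrib_right by (intro sum.cong refl) auto
    finally show ?thesis .
  qed
  have "(\<integral>\<^sup>+ G. ennreal (exp (t * bilin D G u v)) \<partial>sym_gauss D) =
      (\<integral>\<^sup>+ g. (\<Prod>p\<in>upper_pairs D. ennreal (exp (t * c p * g p))) \<partial>(\<Pi>\<^sub>M p\<in>upper_pairs D. std_normal))"
    by (subst nn_integral_sym_gauss)
      (auto intro!: measurable_compose[OF measurable_bilin] borel_measurable_times mat_space_component
        simp: lin sum_distrib_left exp_sum prod_ennreal mult.assoc)
  also have "\<dots> = (\<Prod>p\<in>upper_pairs D. \<integral>\<^sup>+ x. ennreal (exp (t * c p * x)) \<partial>std_normal)"
    by (rule product_nn_integral_prod) auto
  also have "\<dots> = ennreal (exp (\<Sum>p\<in>upper_pairs D. (t * c p)\<^sup>2 / 2))"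
    by (simp add: std_normal_mgf prod_ennreal exp_sum)
  also have "(\<Sum>p\<in>upper_pairs D. (t * c p)\<^sup>2 / 2) = t\<^sup>2 / 2 * (\<Sum>p\<in>upper_pairs D. (c p)\<^sup>2)"
    by (simp add: sum_distrib_left power_mult_distrib)
  also have "ennreal (exp \<dots>) \<le> ennreal (exp (t\<^sup>2 / 2 * 2))"
    by (intro ennreal_leI iffD2[OF exp_le_cancel_iff] mult_left_mono c2) auto
  finally show ?thesis by simp
qed

lemma sym_gauss_fourth_moment:
  assumes p: "p \<in> {1..D} \<times> {1..D}"
  shows "(\<integral>\<^sup>+ G. ennreal ((G p) ^ 4) \<partial>sym_gauss D) \<le> 2048"
proof -
  obtain i j where ij: "p = (i, j)" "i \<in> {1..D}" "j \<in> {1..D}" using p by auto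
  define e :: "nat \<Rightarrow> rvec" where "e = (\<lambda>a i. if i = a then 1 else 0)"
  have e: "L2_set (e a) {1..D} \<le> 1" for a
    by (simp add: L2_set_def e_def if_distrib[of "\<lambda>x. x^2"] sum.delta cong: if_cong)
  have Gp: "bilin D G (e i) (e j) = G p" for G
    using ij by (simp add: bilin_def e_def if_distrib[of "\<lambda>x. x * _"] if_distrib[of "\<lambda>x. _ * x"] sum.delta cong: if_cong)
  have [measurable]: "(\<lambda>G. G p) \<in> borel_measurable (sym_gauss D)"
    using mat_space_component[OF p] measurable_cong_sets[OF sets_sym_gauss refl] by blast
  have mgf: "(\<integral>\<^sup>+ G. ennreal (exp (t * G p)) \<partial>sym_gauss D) \<le> ennreal (exp (t\<^sup>2))" for t
    using sym_gauss_bilin_mgf[OF e[of i] e[of j], where t = t] by (simp add: Gp)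
  have "(\<integral>\<^sup>+ G. ennreal ((G p) ^ 4) \<partial>sym_gauss D) \<le>
      (\<integral>\<^sup>+ G. 256 * (ennreal (exp (1 * G p)) + ennreal (exp ((-1) * G p))) \<partial>sym_gauss D)"
  proof (rule nn_integral_mono)
    fix G
    have "ennreal ((G p) ^ 4) \<le> ennreal (256 * (exp (G p) + exp (- G p)))" by (intro ennreal_leI power4_le_exp)
    also have "\<dots> = 256 * (ennreal (exp (1 * G p)) + ennreal (exp ((-1) * G p)))" by (simp add: ennreal_mult)
    finally show "ennreal ((G p) ^ 4) \<le> \<dots>" .
  qed
  also have "\<dots> = 256 * ((\<integral>\<^sup>+ G. ennreal (exp (1 * G p)) \<partial>sym_gauss D) + (\<integral>\<^sup>+ G. ennreal (exp ((-1) * G p)) \<partial>sym_gauss D))"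
    by (subst nn_integral_cmult, simp, subst nn_integral_add, simp_all)
  also have "\<dots> \<le> 256 * (ennreal (exp (1\<^sup>2)) + ennreal (exp ((-1)\<^sup>2)))"
    by (intro mult_left_mono add_mono mgf) auto
  also have "\<dots> = ennreal (512 * exp 1)" by (simp add: ennreal_plus[symmetric] ennreal_mult' del: ennreal_plus)
  also have "\<dots> \<le> ennreal 2048"
    using exp_le by (intro ennreal_leI) simp
  finally show ?thesis by simp
qed

text \<open>
  A union bound over both nets and both signs: \<open>37 = 18 + 18 + 1\<close> accounts for the cardinalities of
  the two nets and for the two signs. The exceptional event is represented by a measurable function
  \<open>H\<close> that is at least one on it, namely the sum of all Chernoff weights. Such functions can be
  added and integrated directly, which replaces probabilities of events in the sequel.
\<close>

lemma chernoff_net: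
  fixes T :: "'a \<Rightarrow> rvec \<Rightarrow> rvec \<Rightarrow> real"
  assumes I: "finite I" "card I \<le> k" and J: "finite J" "card J \<le> k" and k: "1 \<le> k" and l: "0 < l"
    and T: "\<And>w w'. w \<in> lattice_net k I \<Longrightarrow> w' \<in> lattice_net k J \<Longrightarrow> (\<lambda>x. T x w w') \<in> borel_measurable M"
    and mgf: "\<And>w w' \<sigma>. w \<in> lattice_net k I \<Longrightarrow> w' \<in> lattice_net k J \<Longrightarrow> \<bar>\<sigma>\<bar> = 1 \<Longrightarrow>
        (\<integral>\<^sup>+ x. ennreal (exp (l * (\<sigma> * T x w w'))) \<partial>M) \<le> ennreal (exp (q * real k))"
    and s: "(37 + q + h) * real k \<le> l * s"
  shows "\<exists>H. H \<in> borel_measurable M \<and> (\<integral>\<^sup>+ x. H x \<partial>M) \<le> ennreal (exp (- h * real k)) \<and>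
    (\<forall>x. H x < 1 \<longrightarrow> (\<forall>w\<in>lattice_net k I. \<forall>w'\<in>lattice_net k J. \<bar>T x w w'\<bar> \<le> s))"
proof -
  let ?A = "lattice_net k I" and ?B = "lattice_net k J"
  let ?Q = "?A \<times> ?B \<times> {1, -1 :: real}"
  define hh where "hh = (\<lambda>(w, w', \<sigma>) x. ennreal (exp (- l * s)) * ennreal (exp (l * (\<sigma> * T x w w'))))"
  define H where "H = (\<lambda>x. \<Sum>q\<in>?Q. hh q x)"
  have fin: "finite ?A" "finite ?B" using finite_lattice_net I J by auto
  have hm: "hh q \<in> borel_measurable M" if q_in: "q \<in> ?Q" for q
  proof -
    obtain w w' \<sigma> where q: "q = (w, w', \<sigma>)" "w \<in> ?A" "w' \<in> ?B" using q_in by auto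
    note [measurable] = T[OF q(2,3)]
    show ?thesis unfolding q hh_def by simp
  qed
  have meas: "H \<in> borel_measurable M" unfolding H_def by (intro borel_measurable_sum hm)
  have "(\<integral>\<^sup>+ x. H x \<partial>M) = (\<Sum>q\<in>?Q. \<integral>\<^sup>+ x. hh q x \<partial>M)"
    unfolding H_def by (intro nn_integral_sum hm)
  also have "\<dots> \<le> (\<Sum>_\<in>?Q. ennreal (exp (- l * s)) * ennreal (exp (q * real k)))"
  proof (intro sum_mono)
    fix q' assume "q' \<in> ?Q"
    then obtain w w' \<sigma> where q': "q' = (w, w', \<sigma>)" "w \<in> ?A" "w' \<in> ?B" "\<sigma> \<in> {1, -1}" by auto
    note [measurable] = T[OF q'(2,3)]
    have "(\<integral>\<^sup>+ x. hh q' x \<partial>M) = ennreal (exp (- l * s)) * (\<integral>\<^sup>+ x. ennreal (exp (l * (\<sigma> * T x w w'))) \<partial>M)"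
      unfolding q' hh_def split by (intro nn_integral_cmult) measurable
    also have "\<dots> \<le> ennreal (exp (- l * s)) * ennreal (exp (q * real k))"
      by (intro mult_left_mono mgf q'(2,3)) (use q'(4) in auto)
    finally show "(\<integral>\<^sup>+ x. hh q' x \<partial>M) \<le> \<dots>" .
  qed
  also have "\<dots> = of_nat (card ?Q) * ennreal (exp (- l * s) * exp (q * real k))"
    by (simp add: ennreal_mult)
  also have "\<dots> = ennreal (real (card ?Q) * (exp (- l * s) * exp (q * real k)))"
    by (simp add: ennreal_of_nat_eq_real_of_nat ennreal_mult)
  also have "real (card ?Q) * (exp (- l * s) * exp (q * real k)) =
      real (card ?A) * (real (card ?B) * (2 * (exp (- l * s) * exp (q * real k))))"
    by (simp add: card_cartesian_product)
  also have "\<dots> \<le> ennreal (exp (18 * real k) * (exp (18 * real k) * (exp (real k) * (exp (- l * s) * exp (q * real k)))))"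
  proof (intro ennreal_leI mult_mono card_lattice_net I J)
    \<comment> \<open>the two signs\<close>
    have "2 \<le> 1 + real k" using k by simp
    also have "\<dots> \<le> exp (real k)" by (rule exp_ge_add_one_self)
    finally show "2 \<le> exp (real k)" .
  qed auto
  also have "\<dots> = ennreal (exp ((37 + q) * real k - l * s))"
    by (simp add: exp_add[symmetric] algebra_simps)
  also have "\<dots> \<le> ennreal (exp (- h * real k))"
    using s by (intro ennreal_leI) (simp add: algebra_simps)
  finally have int: "(\<integral>\<^sup>+ x. H x \<partial>M) \<le> ennreal (exp (- h * real k))" .
  have small: "\<bar>T x w w'\<bar> \<le> s" if H: "H x < 1" and w: "w \<in> ?A" "w' \<in> ?B" for x w w'
  proof (rule ccontr)
    assume "\<not> \<bar>T x w w'\<bar> \<le> s"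
    then have "1 * T x w w' > s \<or> (-1) * T x w w' > s" by linarith
    then obtain \<sigma> :: real where \<sigma>: "\<sigma> \<in> {1, -1}" "\<sigma> * T x w w' > s" by blast
    have "1 \<le> ennreal (exp (l * (\<sigma> * T x w w') - l * s))"
      using \<sigma>(2) l by simp
    also have "\<dots> = hh (w, w', \<sigma>) x" by (simp add: hh_def ennreal_mult[symmetric] exp_add[symmetric] algebra_simps)
    also have "\<dots> \<le> H x"
      unfolding H_def by (rule member_le_sum[of _ ?Q "\<lambda>q. hh q x"]) (use w fin \<sigma> in auto)
    finally show False using H by simp
  qed
  show ?thesis using meas int small by blast
qed

text \<open>
  The symmetry of the noise matrix, which holds almost surely, is included in the good event because
  the error of a diagonal block must be symmetric when the lower triangle is filled in.
\<close>

lemma sym_gauss_block_tail: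
  assumes I: "I \<subseteq> {1..D}" "card I \<le> k" and J: "J \<subseteq> {1..D}" "card J \<le> k" and k: "1 \<le> k" and h: "0 \<le> h"
  shows "\<exists>H. H \<in> borel_measurable (mat_space D) \<and> (\<integral>\<^sup>+ G. H G \<partial>sym_gauss D) \<le> ennreal (exp (- h * real k)) \<and>
    (\<forall>G. H G < 1 \<longrightarrow> op_bounded D (mask G (I \<times> J)) (2 * ((38 + h) * sqrt (real k))) \<and>
       (\<forall>i\<in>{1..D}. \<forall>j\<in>{1..D}. G (i, j) = G (j, i)))"
proof -
  have fin: "finite I" "finite J" using I J finite_subset by auto
  have "\<exists>H. H \<in> borel_measurable (sym_gauss D) \<and> (\<integral>\<^sup>+ G. H G \<partial>sym_gauss D) \<le> ennreal (exp (- h * real k)) \<and>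
    (\<forall>G. H G < 1 \<longrightarrow> (\<forall>w\<in>lattice_net k I. \<forall>w'\<in>lattice_net k J. \<bar>bilin D G w w'\<bar> \<le> (38 + h) * sqrt (real k)))"
  proof (rule chernoff_net[OF fin(1) I(2) fin(2) J(2) k, where l = "sqrt (real k)" and q = 1])
    show "0 < sqrt (real k)" using k by simp
    fix w w' :: rvec and \<sigma> :: real assume w: "w \<in> lattice_net k I" "w' \<in> lattice_net k J"
    show "(\<lambda>G. bilin D G w w') \<in> borel_measurable (sym_gauss D)"
      unfolding measurable_cong_sets[OF sets_sym_gauss refl] by (intro measurable_bilin mat_space_component)
    assume "\<bar>\<sigma>\<bar> = 1"
    then have "\<sigma>\<^sup>2 = 1" by (metis one_power2 power2_abs)
    then show "(\<integral>\<^sup>+ G. ennreal (exp (sqrt (real k) * (\<sigma> * bilin D G w w'))) \<partial>sym_gauss D) \<le> ennreal (exp (1 * real k))"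
      using sym_gauss_bilin_mgf[OF lattice_net_L2(1)[OF I(1) k w(1)] lattice_net_L2(1)[OF J(1) k w(2)], of "sqrt (real k) * \<sigma>"]
      by (simp add: power_mult_distrib mult.assoc)
  next
    have e: "sqrt (real k) * sqrt (real k) = real k" by simp
    have "sqrt (real k) * ((38 + h) * sqrt (real k)) = (38 + h) * (sqrt (real k) * sqrt (real k))"
      by (simp only: mult_ac)
    also have "\<dots> = (37 + 1 + h) * real k" unfolding e by simp
    finally show "(37 + 1 + h) * real k \<le> sqrt (real k) * ((38 + h) * sqrt (real k))" by (rule eq_refl[OF sym])
  qed
  then obtain H where H: "H \<in> borel_measurable (sym_gauss D)" "(\<integral>\<^sup>+ G. H G \<partial>sym_gauss D) \<le> ennreal (exp (- h * real k))"
    "\<And>G w w'. H G < 1 \<Longrightarrow> w \<in> lattice_net k I \<Longrightarrow> w' \<in> lattice_net k J \<Longrightarrow> \<bar>bilin D G w w'\<bar> \<le> (38 + h) * sqrt (real k)"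
    by blast
  have "op_bounded D (mask G (I \<times> J)) (2 * ((38 + h) * sqrt (real k)))" if "H G < 1" for G
  proof (rule op_bounded_via_net[OF I J k])
    fix w w' assume w: "w \<in> lattice_net k I" "w' \<in> lattice_net k J"
    have "(\<lambda>i. if i \<in> I then w i else 0) = w" "(\<lambda>i. if i \<in> J then w' i else 0) = w'"
      using lattice_net_L2(3)[OF I(1) k w(1)] lattice_net_L2(3)[OF J(1) k w(2)] by auto
    then show "\<bar>bilin D (mask G (I \<times> J)) w w'\<bar> \<le> (38 + h) * sqrt (real k)"
      using H(3)[OF that w] by (simp add: bilin_mask_Times)
  qed (use h in \<open>auto simp: mask_def\<close>)
  moreover define A where "A = (\<lambda>G :: rmat. \<Sum>(i, j)\<in>{1..D} \<times> {1..D}. if G (i, j) = G (j, i) then 0 else 1 :: ennreal)"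
  have Am: "A \<in> borel_measurable (mat_space D)"
    unfolding A_def case_prod_beta
  proof (rule borel_measurable_sum)
    fix p assume "p \<in> {1..D} \<times> {1..D}"
    then have [measurable]: "(\<lambda>G. G (fst p, snd p)) \<in> borel_measurable (mat_space D)"
      "(\<lambda>G. G (snd p, fst p)) \<in> borel_measurable (mat_space D)"
      by (auto intro!: mat_space_component)
    show "(\<lambda>G. if G (fst p, snd p) = G (snd p, fst p) then 0 else 1 :: ennreal) \<in> borel_measurable (mat_space D)"
      by measurable
  qed
  have A0: "(\<integral>\<^sup>+ G. A G \<partial>sym_gauss D) = 0"
  proof -
    have "A (\<lambda>(i, j)\<in>{1..D} \<times> {1..D}. g (min i j, max i j)) = 0" for g
      unfolding A_def by (intro sum.neutral) (auto simp: min.commute max.commute)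
    then show ?thesis by (simp add: nn_integral_sym_gauss[OF Am])
  qed
  have Asym: "G (i, j) = G (j, i)" if "A G < 1" "i \<in> {1..D}" "j \<in> {1..D}" for G i j
  proof (rule ccontr)
    assume "G (i, j) \<noteq> G (j, i)"
    then have "1 \<le> (\<lambda>(i, j). if G (i, j) = G (j, i) then 0 else (1 :: ennreal)) (i, j)" by simp
    also have "\<dots> \<le> A G"
      unfolding A_def by (rule member_le_sum[of "(i, j)"]) (use that in auto)
    finally show False using that(1) by simp
  qed
  have Hm: "H \<in> borel_measurable (mat_space D)" using H(1) measurable_cong_sets[OF sets_sym_gauss refl] by blast
  have "(\<integral>\<^sup>+ G. H G + A G \<partial>sym_gauss D) = (\<integral>\<^sup>+ G. H G \<partial>sym_gauss D)"
    using Am measurable_cong_sets[OF sets_sym_gauss refl] H(1) A0 by (subst nn_integral_add) auto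
  moreover have "H G < 1" "A G < 1" if "H G + A G < 1" for G
    using that by (meson add_increasing add_increasing2 le_less_trans order_refl zero_le)+
  ultimately show ?thesis
    using Asym H(2) borel_measurable_add[OF Hm Am] by (intro exI[of _ "\<lambda>G. H G + A G"]) auto
qed

section \<open>Sample covariance of clipped sub-Gaussian data\<close>

definition lin_form :: "nat \<Rightarrow> rvec \<Rightarrow> rvec \<Rightarrow> real" where
  "lin_form d w x = (\<Sum>i\<in>{1..d}. x i * w i)"

definition pad_vec :: "nat \<Rightarrow> nat \<Rightarrow> rvec \<Rightarrow> rvec" where
  "pad_vec D d x = (\<lambda>i\<in>{1..D}. if i \<le> d then x i else 0)"

lemma pad_eq: "pad D d X a = pad_vec D d (X a)"
  by (simp only: pad_def pad_vec_def)

text \<open>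
  The factor by which clipping scales the block \<open>I\<close> of a data vector. Since it is a scalar, the
  clipped sample covariance is a weighted average of products of linear forms.
\<close>

definition shrink :: "nat \<Rightarrow> nat \<Rightarrow> real \<Rightarrow> nat set \<Rightarrow> rvec \<Rightarrow> real" where
  "shrink D d R I x = min 1 (R / L2_set (pad_vec D d x) I)"

lemma clip_pad: "clip R I (pad_vec D d x) i = shrink D d R I x * pad_vec D d x i"
  by (simp add: clip_def shrink_def)

lemma shrink_bounds: "0 \<le> R \<Longrightarrow> 0 \<le> shrink D d R I x" "shrink D d R I x \<le> 1"
  by (auto simp: shrink_def)

lemma lin_form_pad:
  assumes "d \<le> D"
  shows "(\<Sum>i\<in>{1..D}. w i * pad_vec D d x i) = lin_form d w x"
proof -
  have "(\<Sum>i\<in>{1..D}. w i * pad_vec D d x i) = (\<Sum>i\<in>{1..d}. w i * pad_vec D d x i)"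
    by (rule sum.mono_neutral_right) (use assms in \<open>auto simp: pad_vec_def\<close>)
  also have "\<dots> = lin_form d w x"
    unfolding lin_form_def by (intro sum.cong refl) (use assms in \<open>auto simp: pad_vec_def\<close>)
  finally show ?thesis .
qed

lemma bilin_emp_block:
  assumes "d \<le> D"
  shows "bilin D (emp_block n (pad D d X) I J R) w w' =
    1 / real n * (\<Sum>a\<in>{1..n}. shrink D d R I (X a) * shrink D d R J (X a) * (lin_form d w (X a) * lin_form d w' (X a)))"
proof -
  have "bilin D (emp_block n (pad D d X) I J R) w w' =
      (\<Sum>i\<in>{1..D}. \<Sum>j\<in>{1..D}. \<Sum>a\<in>{1..n}. 1 / real n * ((w i * clip R I (pad_vec D d (X a)) i) * (w' j * clip R J (pad_vec D d (X a)) j)))"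
    unfolding bilin_def emp_block_def pad_eq by (simp add: sum_distrib_left sum_distrib_right mult_ac)
  also have "\<dots> = (\<Sum>a\<in>{1..n}. \<Sum>i\<in>{1..D}. \<Sum>j\<in>{1..D}. 1 / real n * ((w i * clip R I (pad_vec D d (X a)) i) * (w' j * clip R J (pad_vec D d (X a)) j)))"
    by (subst sum.swap[where A = "{1..n}" and B = "{1..D}"], rule sum.cong[OF refl], rule sum.swap)
  also have "\<dots> = (\<Sum>a\<in>{1..n}. 1 / real n * ((\<Sum>i\<in>{1..D}. w i * clip R I (pad_vec D d (X a)) i) * (\<Sum>j\<in>{1..D}. w' j * clip R J (pad_vec D d (X a)) j)))"
    unfolding sum_product unfolding sum_distrib_left ..
  also have "\<dots> = (\<Sum>a\<in>{1..n}. 1 / real n * (shrink D d R I (X a) * shrink D d R J (X a) * (lin_form d w (X a) * lin_form d w' (X a))))"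
  proof (intro sum.cong refl)
    fix a
    have "(\<Sum>i\<in>{1..D}. w i * clip R I (pad_vec D d (X a)) i) = shrink D d R I (X a) * lin_form d w (X a)" for w I
      unfolding clip_pad lin_form_pad[OF assms, symmetric] by (simp add: sum_distrib_left mult_ac)
    then show "1 / real n * ((\<Sum>i\<in>{1..D}. w i * clip R I (pad_vec D d (X a)) i) * (\<Sum>j\<in>{1..D}. w' j * clip R J (pad_vec D d (X a)) j)) =
      1 / real n * (shrink D d R I (X a) * shrink D d R J (X a) * (lin_form d w (X a) * lin_form d w' (X a)))"
      by (simp add: mult_ac)
  qed
  finally show ?thesis by (simp only: sum_distrib_left)
qed

locale subgaussian_law =
  fixes d :: nat and K :: real and P :: "rvec measure"
  assumes K: "0 < K" and d: "1 \<le> d" and sg: "centered_subgaussian d K P"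
begin

sublocale prob_space P
  using sg by (simp add: centered_subgaussian_def)

lemma sets_P: "sets P = sets (vec_space d)"
  using sg by (simp add: centered_subgaussian_def)

lemma component [measurable]: "i \<in> {1..d} \<Longrightarrow> (\<lambda>x. x i) \<in> borel_measurable P"
  unfolding measurable_cong_sets[OF sets_P refl] vec_space_def by (rule measurable_component_singleton)

lemma measurable_lin_form [measurable]: "lin_form d w \<in> borel_measurable P"
  unfolding lin_form_def[abs_def] by (intro borel_measurable_sum borel_measurable_times component) auto

lemma measurable_pad_vec: "(\<lambda>x. pad_vec D d x i) \<in> borel_measurable P" if "i \<in> {1..D}"
proof (cases "i \<le> d")
  case True
  then have "(\<lambda>x. x i) \<in> borel_measurable P" using that by (intro component) auto
  then show ?thesis using that True by (simp add: pad_vec_def)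
qed (use that in \<open>simp add: pad_vec_def\<close>)

lemma measurable_L2_pad: "I \<subseteq> {1..D} \<Longrightarrow> (\<lambda>x. L2_set (pad_vec D d x) I) \<in> borel_measurable P"
proof -
  assume I: "I \<subseteq> {1..D}"
  have "(\<lambda>x. sqrt (\<Sum>i\<in>I. (pad_vec D d x i)\<^sup>2)) \<in> borel_measurable P"
    using I by (intro borel_measurable_continuous_on[of sqrt] borel_measurable_sum borel_measurable_power
        measurable_pad_vec continuous_intros) auto
  then show ?thesis by (simp add: L2_set_def)
qed

lemma measurable_shrink: "I \<subseteq> {1..D} \<Longrightarrow> shrink D d R I \<in> borel_measurable P"
  unfolding shrink_def[abs_def]
  by (intro borel_measurable_min borel_measurable_divide measurable_L2_pad) auto

text \<open>
  The infimum in the sub-Gaussian norm need not be attained, hence the constant \<open>2 K\<close> in place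
  of \<open>K\<close>.
\<close>

lemma exp_square_moment:
  assumes w: "L2_set w {1..d} \<le> 1"
  shows "(\<integral>\<^sup>+ x. ennreal (exp ((lin_form d w x)\<^sup>2 / (4 * K\<^sup>2))) \<partial>P) \<le> 2"
proof (cases "L2_set w {1..d} = 0")
  case True
  then have "lin_form d w x = 0" for x by (simp add: L2_set_eq_0_iff lin_form_def)
  then show ?thesis by (simp add: emeasure_space_1)
next
  case False
  let ?c = "L2_set w {1..d}"
  have c: "0 < ?c" using False by (simp add: less_le)
  define v where "v = (\<lambda>i. (1 / ?c) * w i)"
  have v: "L2_set v {1..d} = 1" unfolding v_def L2_set_scale using c by simp
  let ?T = "{t. 0 < t \<and> (\<integral>\<^sup>+ x. ennreal (exp ((\<Sum>i\<in>{1..d}. x i * v i)\<^sup>2 / t\<^sup>2)) \<partial>P) \<le> 2}"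
  have "(INF t\<in>?T. ennreal t) \<le> psi2_norm d P"
    unfolding psi2_norm_def by (rule SUP_upper2[where i = v]) (use v in auto)
  also have "\<dots> \<le> ennreal K" using sg by (simp add: centered_subgaussian_def)
  also have "\<dots> < ennreal (2 * K)" using K by (simp add: ennreal_less_iff)
  finally obtain t where t: "t \<in> ?T" "ennreal t < ennreal (2 * K)" by (auto simp: INF_less_iff)
  then have t0: "0 < t" "t < 2 * K" by (auto simp: ennreal_less_iff)
  have le: "(lin_form d w x)\<^sup>2 / (4 * K\<^sup>2) \<le> (\<Sum>i\<in>{1..d}. x i * v i)\<^sup>2 / t\<^sup>2" for x
  proof -
    have "lin_form d w x = ?c * (\<Sum>i\<in>{1..d}. x i * v i)"
      unfolding lin_form_def v_def using c by (simp add: sum_distrib_left)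
    then have "(lin_form d w x)\<^sup>2 = ?c\<^sup>2 * (\<Sum>i\<in>{1..d}. x i * v i)\<^sup>2" by (simp only: power_mult_distrib)
    also have "\<dots> \<le> 1 * (\<Sum>i\<in>{1..d}. x i * v i)\<^sup>2" using w by (intro mult_right_mono power_le_one) auto
    finally have 1: "(lin_form d w x)\<^sup>2 \<le> (\<Sum>i\<in>{1..d}. x i * v i)\<^sup>2" by simp
    have "t\<^sup>2 \<le> (2 * K)\<^sup>2" using t0 by (intro power_mono) auto
    then have 2: "t\<^sup>2 \<le> 4 * K\<^sup>2" by (simp add: power_mult_distrib)
    show ?thesis using 1 2 t0 by (intro frac_le) auto
  qed
  have "(\<integral>\<^sup>+ x. ennreal (exp ((lin_form d w x)\<^sup>2 / (4 * K\<^sup>2))) \<partial>P) \<le>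
      (\<integral>\<^sup>+ x. ennreal (exp ((\<Sum>i\<in>{1..d}. x i * v i)\<^sup>2 / t\<^sup>2)) \<partial>P)"
    by (intro nn_integral_mono ennreal_leI iffD2[OF exp_le_cancel_iff] le)
  also have "\<dots> \<le> 2" using t by auto
  finally show ?thesis .
qed

lemma exp_product_moment:
  assumes w: "L2_set w {1..d} \<le> 1" "L2_set w' {1..d} \<le> 1"
    and Y: "\<And>x. \<bar>Y x\<bar> \<le> \<bar>lin_form d w x * lin_form d w' x\<bar>"
  shows "(\<integral>\<^sup>+ x. ennreal (exp (\<bar>Y x\<bar> / (4 * K\<^sup>2))) \<partial>P) \<le> 2"
proof -
  let ?b = "4 * K\<^sup>2"
  let ?p = "\<lambda>x. exp ((lin_form d w x)\<^sup>2 / ?b)" and ?q = "\<lambda>x. exp ((lin_form d w' x)\<^sup>2 / ?b)"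
  have "exp (\<bar>Y x\<bar> / ?b) \<le> 1 / 2 * (?p x + ?q x)" for x
  proof -
    have "\<bar>lin_form d w x * lin_form d w' x\<bar> \<le> ((lin_form d w x)\<^sup>2 + (lin_form d w' x)\<^sup>2) / 2"
      using sum_squares_bound[of "\<bar>lin_form d w x\<bar>" "\<bar>lin_form d w' x\<bar>"] by (simp add: abs_mult)
    then have "\<bar>Y x\<bar> \<le> ((lin_form d w x)\<^sup>2 + (lin_form d w' x)\<^sup>2) / 2" using Y[of x] by linarith
    then have "\<bar>Y x\<bar> / ?b \<le> (((lin_form d w x)\<^sup>2 + (lin_form d w' x)\<^sup>2) / 2) / ?b"
      by (intro divide_right_mono) auto
    also have "\<dots> = (lin_form d w x)\<^sup>2 / ?b / 2 + (lin_form d w' x)\<^sup>2 / ?b / 2"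
      by (simp add: add_divide_distrib)
    finally have "exp (\<bar>Y x\<bar> / ?b) \<le> exp ((lin_form d w x)\<^sup>2 / ?b / 2) * exp ((lin_form d w' x)\<^sup>2 / ?b / 2)"
      by (simp add: exp_add[symmetric])
    also have "\<dots> \<le> ((exp ((lin_form d w x)\<^sup>2 / ?b / 2))\<^sup>2 + (exp ((lin_form d w' x)\<^sup>2 / ?b / 2))\<^sup>2) / 2"
      using sum_squares_bound[of "exp ((lin_form d w x)\<^sup>2 / ?b / 2)" "exp ((lin_form d w' x)\<^sup>2 / ?b / 2)"] by simp
    also have "\<dots> = 1 / 2 * (?p x + ?q x)" by (simp add: exp_double[symmetric])
    finally show ?thesis .
  qed
  then have "(\<integral>\<^sup>+ x. ennreal (exp (\<bar>Y x\<bar> / ?b)) \<partial>P) \<le> (\<integral>\<^sup>+ x. ennreal (1 / 2) * (ennreal (?p x) + ennreal (?q x)) \<partial>P)"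
  proof (intro nn_integral_mono)
    fix x
    assume "\<And>x. exp (\<bar>Y x\<bar> / ?b) \<le> 1 / 2 * (?p x + ?q x)"
    then have "ennreal (exp (\<bar>Y x\<bar> / ?b)) \<le> ennreal (1 / 2 * (?p x + ?q x))" by (intro ennreal_leI)
    also have "\<dots> = ennreal (1 / 2) * (ennreal (?p x) + ennreal (?q x))" by (subst ennreal_mult) auto
    finally show "ennreal (exp (\<bar>Y x\<bar> / ?b)) \<le> \<dots>" .
  qed
  also have "\<dots> = ennreal (1 / 2) * ((\<integral>\<^sup>+ x. ennreal (?p x) \<partial>P) + (\<integral>\<^sup>+ x. ennreal (?q x) \<partial>P))"
    by (subst nn_integral_cmult, simp, subst nn_integral_add, simp_all)
  also have "\<dots> \<le> ennreal (1 / 2) * (2 + 2)"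
    by (intro mult_left_mono add_mono exp_square_moment w) auto
  also have "\<dots> = ennreal (1 / 2 * 4)" by (subst ennreal_mult) auto
  finally show ?thesis by simp
qed

lemma lin_form_unit: "i \<in> {1..d} \<Longrightarrow> lin_form d (\<lambda>j. if j = i then 1 else 0) x = x i"
  by (simp add: lin_form_def if_distrib[of "\<lambda>y. _ * y"] sum.delta cong: if_cong)

lemma L2_unit_le: "L2_set (\<lambda>j. if j = i then 1 else 0) {1..d} \<le> 1"
  by (simp add: L2_set_def if_distrib[of "\<lambda>x. x^2"] sum.delta cong: if_cong)

lemma integrable_lin_product:
  assumes "L2_set w {1..d} \<le> 1" "L2_set w' {1..d} \<le> 1"
  shows "integrable P (\<lambda>x. lin_form d w x * lin_form d w' x)"
  by (rule mgf_centered_le(1)[where b = "4 * K\<^sup>2" and l = 0, OF _ _ exp_product_moment[OF assms]]) (use K in auto)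

lemma integrable_component_product:
  assumes "i \<in> {1..d}" "j \<in> {1..d}"
  shows "integrable P (\<lambda>x. x i * x j)"
  using integrable_lin_product[OF L2_unit_le[of i] L2_unit_le[of j]]
  unfolding lin_form_unit[OF assms(1)] lin_form_unit[OF assms(2)] .

lemma cov_mat_eq: "i \<in> {1..d} \<Longrightarrow> j \<in> {1..d} \<Longrightarrow> cov_mat P (i, j) = (\<integral>x. x i * x j \<partial>P)"
  using sg by (simp add: cov_mat_def centered_subgaussian_def)

abbreviation cov0 :: rmat where "cov0 \<equiv> mask (cov_mat P) ({1..d} \<times> {1..d})"

lemma bilin_cov0:
  assumes "d \<le> D"
  shows "bilin D cov0 w w' = (\<integral>x. lin_form d w x * lin_form d w' x \<partial>P)"
proof -
  have "bilin D cov0 w w' = (\<Sum>i\<in>{1..D}. \<Sum>j\<in>{1..D}. if i \<in> {1..d} \<and> j \<in> {1..d} then w i * cov_mat P (i, j) * w' j else 0)"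
    unfolding bilin_def mask_def by (intro sum.cong refl) auto
  also have "\<dots> = (\<Sum>i\<in>{1..d}. \<Sum>j\<in>{1..D}. if i \<in> {1..d} \<and> j \<in> {1..d} then w i * cov_mat P (i, j) * w' j else 0)"
    by (rule sum.mono_neutral_right) (use assms in auto)
  also have "\<dots> = (\<Sum>i\<in>{1..d}. \<Sum>j\<in>{1..d}. w i * cov_mat P (i, j) * w' j)"
    by (intro sum.cong refl sum.mono_neutral_cong_right) (use assms in auto)
  also have "\<dots> = (\<Sum>i\<in>{1..d}. \<Sum>j\<in>{1..d}. \<integral>x. (x i * w i) * (x j * w' j) \<partial>P)"
  proof (intro sum.cong refl)
    fix i j assume ij: "i \<in> {1..d}" "j \<in> {1..d}"
    have "(\<integral>x. (x i * w i) * (x j * w' j) \<partial>P) = (\<integral>x. (w i * w' j) * (x i * x j) \<partial>P)" by (simp add: mult_ac)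
    also have "\<dots> = (w i * w' j) * cov_mat P (i, j)" unfolding cov_mat_eq[OF ij] by simp
    finally show "w i * cov_mat P (i, j) * w' j = (\<integral>x. (x i * w i) * (x j * w' j) \<partial>P)" by simp
  qed
  also have "\<dots> = (\<integral>x. (\<Sum>i\<in>{1..d}. \<Sum>j\<in>{1..d}. (x i * w i) * (x j * w' j)) \<partial>P)"
  proof -
    have int: "integrable P (\<lambda>x. (x i * w i) * (x j * w' j))" if "i \<in> {1..d}" "j \<in> {1..d}" for i j
      using integrable_mult_right[OF integrable_component_product[OF that], of "w i * w' j"] by (simp add: mult_ac)
    show ?thesis
      by (subst Bochner_Integration.integral_sum, intro Bochner_Integration.integrable_sum int, assumption, assumption,
          intro sum.cong refl, subst Bochner_Integration.integral_sum, intro int, assumption, assumption, rule refl)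
  qed
  also have "\<dots> = (\<integral>x. lin_form d w x * lin_form d w' x \<partial>P)"
    unfolding lin_form_def by (simp only: sum_product)
  finally show ?thesis .
qed

text \<open>
  If the block of \<open>x\<close> has norm above \<open>R\<close>, the net point next to its direction gives a linear form
  of value at least \<open>3/4\<close> of that norm, so at least \<open>R / 2\<close>; this is rare for each net point.
\<close>

lemma prob_clipped_le:
  assumes I: "I \<subseteq> {1..D}" "card I \<le> k" and k: "1 \<le> k" and dD: "d \<le> D" and C: "0 < C"
  shows "prob {x \<in> space P. sqrt (C * real k) < L2_set (pad_vec D d x) I} \<le> 2 * exp (18 * real k - C * real k / (16 * K\<^sup>2))"
proof -
  let ?R = "sqrt (C * real k)"
  let ?A = "{x \<in> space P. ?R < L2_set (pad_vec D d x) I}"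
  let ?N = "lattice_net k I"
  have fin: "finite I" using I finite_subset by auto
  note [measurable] = measurable_L2_pad[OF I(1)]
  have A: "?A \<in> sets P" by measurable
  have pt: "indicator ?A x \<le> (\<Sum>w\<in>?N. ennreal (exp (- C * real k / (16 * K\<^sup>2))) * ennreal (exp ((lin_form d w x)\<^sup>2 / (4 * K\<^sup>2))))" for x
  proof (cases "x \<in> ?A")
    case True
    let ?z = "pad_vec D d x" and ?n = "L2_set (pad_vec D d x) I"
    have R0: "0 \<le> ?R" using C by simp
    have "?R < ?n" using True by simp
    then have n0: "0 < ?n" using R0 by linarith
    have "L2_set (\<lambda>i. (1 / ?n) * ?z i) I \<le> 1" unfolding L2_set_scale using n0 by simp
    then obtain w where w: "w \<in> ?N" "L2_set (\<lambda>i. (1 / ?n) * ?z i - w i) I \<le> 1 / 4"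
      using lattice_net_approx[OF fin I(2) k] by blast
    have "\<bar>\<Sum>i\<in>I. ((1 / ?n) * ?z i - w i) * ?z i\<bar> \<le> (1 / 4) * ?n"
      by (rule order_trans[OF abs_sum_mult_le_L2_set mult_right_mono[OF w(2) L2_set_nonneg]])
    moreover have "(\<Sum>i\<in>I. ((1 / ?n) * ?z i - w i) * ?z i) = ?n - (\<Sum>i\<in>I. w i * ?z i)"
    proof -
      have "(\<Sum>i\<in>I. ((1 / ?n) * ?z i - w i) * ?z i) = (1 / ?n) * (\<Sum>i\<in>I. (?z i)\<^sup>2) - (\<Sum>i\<in>I. w i * ?z i)"
        by (simp add: algebra_simps sum_subtractf sum_distrib_left power2_eq_square)
      also have "(1 / ?n) * (\<Sum>i\<in>I. (?z i)\<^sup>2) = ?n"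
        unfolding L2_set_power2[symmetric] using n0 by (simp add: power2_eq_square)
      finally show ?thesis .
    qed
    moreover have "(\<Sum>i\<in>I. w i * ?z i) = lin_form d w x"
    proof -
      have "(\<Sum>i\<in>I. w i * ?z i) = (\<Sum>i\<in>{1..D}. w i * ?z i)"
        using lattice_net_L2(3)[OF I(1) k w(1)] by (intro sum.mono_neutral_left) (use I in auto)
      then show ?thesis using lin_form_pad[OF dD] by simp
    qed
    ultimately have "lin_form d w x \<ge> ?n / 2" using n0 by linarith
    then have "?R / 2 \<le> lin_form d w x" using True by simp
    then have "(?R / 2)\<^sup>2 \<le> (lin_form d w x)\<^sup>2" using R0 by (intro power_mono) auto
    then have "C * real k \<le> 4 * (lin_form d w x)\<^sup>2" using C by (simp add: power_divide)
    then have "C * real k / (16 * K\<^sup>2) \<le> (4 * (lin_form d w x)\<^sup>2) / (16 * K\<^sup>2)" by (intro divide_right_mono) auto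
    then have "0 \<le> - C * real k / (16 * K\<^sup>2) + (lin_form d w x)\<^sup>2 / (4 * K\<^sup>2)" by simp
    then have "1 \<le> ennreal (exp (- C * real k / (16 * K\<^sup>2) + (lin_form d w x)\<^sup>2 / (4 * K\<^sup>2)))"
      by (simp only: ennreal_ge_1 one_le_exp_iff)
    also have "\<dots> = ennreal (exp (- C * real k / (16 * K\<^sup>2))) * ennreal (exp ((lin_form d w x)\<^sup>2 / (4 * K\<^sup>2)))"
      by (simp only: exp_add ennreal_mult exp_ge_zero)
    also have "\<dots> \<le> (\<Sum>w\<in>?N. ennreal (exp (- C * real k / (16 * K\<^sup>2))) * ennreal (exp ((lin_form d w x)\<^sup>2 / (4 * K\<^sup>2))))"
      by (rule member_le_sum[OF w(1)]) (use finite_lattice_net[OF fin] in auto)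
    finally show ?thesis using True by simp
  qed simp
  have "ennreal (prob ?A) = (\<integral>\<^sup>+ x. indicator ?A x \<partial>P)" using A by (simp add: emeasure_eq_measure)
  also have "\<dots> \<le> (\<integral>\<^sup>+ x. (\<Sum>w\<in>?N. ennreal (exp (- C * real k / (16 * K\<^sup>2))) * ennreal (exp ((lin_form d w x)\<^sup>2 / (4 * K\<^sup>2)))) \<partial>P)"
    by (intro nn_integral_mono pt)
  also have "\<dots> = (\<Sum>w\<in>?N. ennreal (exp (- C * real k / (16 * K\<^sup>2))) * (\<integral>\<^sup>+ x. ennreal (exp ((lin_form d w x)\<^sup>2 / (4 * K\<^sup>2))) \<partial>P))"
    by (subst nn_integral_sum) (auto simp: nn_integral_cmult)
  also have "\<dots> \<le> (\<Sum>w\<in>?N. ennreal (exp (- C * real k / (16 * K\<^sup>2))) * 2)"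
  proof (intro sum_mono mult_left_mono exp_square_moment)
    fix w assume w: "w \<in> ?N"
    have "L2_set w {1..d} \<le> L2_set w {1..D}"
      unfolding L2_set_def by (intro real_sqrt_le_mono sum_mono2) (use dD in auto)
    then show "L2_set w {1..d} \<le> 1" using lattice_net_L2(1)[OF I(1) k w] by linarith
  qed auto
  also have "\<dots> = ennreal (real (card ?N) * (exp (- C * real k / (16 * K\<^sup>2)) * 2))"
    by (simp add: ennreal_mult ennreal_of_nat_eq_real_of_nat)
  also have "\<dots> \<le> ennreal (exp (18 * real k) * (exp (- C * real k / (16 * K\<^sup>2)) * 2))"
    by (intro ennreal_leI mult_right_mono card_lattice_net fin I) auto
  also have "\<dots> = ennreal (2 * exp (18 * real k - C * real k / (16 * K\<^sup>2)))"
    by (simp add: exp_diff exp_minus field_simps)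
  finally show ?thesis by (simp add: ennreal_le_iff)
qed

text \<open>
  The clipped and unclipped products \<open>Y\<close> and \<open>Z\<close> differ only on the event that a block is clipped,
  and there by at most \<open>|Z| \<le> Z\<^sup>2 / (2n) + n / 2\<close>. The first term has mean \<open>O(1/n)\<close>, and so has the
  second since the event has probability \<open>O(1/n\<^sup>2)\<close>.
\<close>

lemma clipping_bias:
  assumes I: "I \<subseteq> {1..D}" "card I \<le> k" and J: "J \<subseteq> {1..D}" "card J \<le> k" and k: "1 \<le> k" and dD: "d \<le> D"
    and n: "1 \<le> n" and h: "0 \<le> h" and C: "16 * K\<^sup>2 * (18 + h) \<le> C" and small: "exp (- h * real k) \<le> 1 / (real n)\<^sup>2"
    and w: "w \<in> lattice_net k I" "w' \<in> lattice_net k J"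
  defines "Y \<equiv> \<lambda>x. shrink D d (sqrt (C * real k)) I x * shrink D d (sqrt (C * real k)) J x * (lin_form d w x * lin_form d w' x)"
  shows "\<bar>(\<integral>x. Y x \<partial>P) - bilin D cov0 w w'\<bar> \<le> (2 * (4 * K\<^sup>2)\<^sup>2 + 2) / real n"
    and "Y \<in> borel_measurable P" and "(\<integral>\<^sup>+ x. ennreal (exp (\<bar>Y x\<bar> / (4 * K\<^sup>2))) \<partial>P) \<le> 2"
proof -
  let ?R = "sqrt (C * real k)" and ?b = "4 * K\<^sup>2"
  let ?Z = "\<lambda>x. lin_form d w x * lin_form d w' x"
  let ?A = "{x \<in> space P. ?R < L2_set (pad_vec D d x) I}" and ?B = "{x \<in> space P. ?R < L2_set (pad_vec D d x) J}"
  have "0 < 16 * K\<^sup>2 * (18 + h)" using K h by simp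
  then have C0: "0 < C" using C by linarith
  have R0: "0 \<le> ?R" using C0 by simp
  note [measurable] = measurable_L2_pad[OF I(1)] measurable_L2_pad[OF J(1)] measurable_shrink[OF I(1)] measurable_shrink[OF J(1)]
  show Ym [measurable]: "Y \<in> borel_measurable P" unfolding Y_def by measurable
  have wd: "L2_set w {1..d} \<le> 1" if "w \<in> lattice_net k I" "I \<subseteq> {1..D}" for w I
  proof -
    have "L2_set w {1..d} \<le> L2_set w {1..D}"
      unfolding L2_set_def by (intro real_sqrt_le_mono sum_mono2) (use dD in auto)
    then show "L2_set w {1..d} \<le> 1" using lattice_net_L2(1)[OF that(2) k that(1)] by linarith
  qed
  note w1 = wd[OF w(1) I(1)] and w2 = wd[OF w(2) J(1)]
  have th: "0 \<le> shrink D d ?R I x * shrink D d ?R J x \<and> shrink D d ?R I x * shrink D d ?R J x \<le> 1" for x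
    using shrink_bounds(1)[OF R0, of D d] shrink_bounds(2)[of D d ?R] by (auto intro!: mult_le_one)
  have YZ: "\<bar>Y x\<bar> \<le> \<bar>?Z x\<bar>" for x
    unfolding Y_def abs_mult[of "_ * _" "?Z x"] using th[of x] by (intro mult_left_le_one_le) auto
  show Yexp: "(\<integral>\<^sup>+ x. ennreal (exp (\<bar>Y x\<bar> / ?b)) \<partial>P) \<le> 2"
    by (rule exp_product_moment[OF w1 w2 YZ])
  have b: "0 < ?b" using K by simp
  have intY: "integrable P Y"
    by (rule mgf_centered_le(1)[OF Ym b Yexp, of 0]) (use b in auto)
  have Zm: "?Z \<in> borel_measurable P" by measurable
  have Zexp: "(\<integral>\<^sup>+ x. ennreal (exp (\<bar>?Z x\<bar> / ?b)) \<partial>P) \<le> 2" by (rule exp_product_moment[OF w1 w2]) auto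
  have Z: "integrable P ?Z" "(\<integral>x. (?Z x)\<^sup>2 \<partial>P) \<le> 4 * ?b\<^sup>2" "integrable P (\<lambda>x. (?Z x)\<^sup>2)"
    using mgf_centered_le(1,2,3)[OF Zm b Zexp, of 0] b by auto
  have lin0: "lin_form d w x = 0" if "w \<in> lattice_net k I" "I \<subseteq> {1..D}" "L2_set (pad_vec D d x) I = 0" for w I x
  proof -
    have "finite I" using that finite_subset by blast
    then have "pad_vec D d x i = 0" if "i \<in> I" for i using \<open>L2_set (pad_vec D d x) I = 0\<close> that by (simp add: L2_set_eq_0_iff)
    then have "(\<Sum>i\<in>{1..D}. w i * pad_vec D d x i) = 0"
      using lattice_net_L2(3)[OF that(2) k that(1)] by (intro sum.neutral) (metis mult_eq_0_iff)
    then show ?thesis using lin_form_pad[OF dD] by simp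
  qed
  \<comment> \<open>for a vector of norm zero the clipping factor is \<open>0\<close>, but then the form vanishes as well\<close>
  have unshrunk: "shrink D d ?R I x * lin_form d w x = lin_form d w x"
    if "w \<in> lattice_net k I" "I \<subseteq> {1..D}" "L2_set (pad_vec D d x) I \<le> ?R" for w I x
  proof (cases "L2_set (pad_vec D d x) I = 0")
    case True then show ?thesis using lin0[OF that(1,2)] by simp
  next
    case False
    then have "0 < L2_set (pad_vec D d x) I" by (simp add: less_le)
    then have "1 \<le> ?R / L2_set (pad_vec D d x) I" using that(3) by simp
    then show ?thesis by (simp add: shrink_def)
  qed
  \<comment> \<open>the arithmetic-geometric mean inequality, weighted so that both terms integrate to \<open>O(1/n)\<close>\<close>
  have pt: "\<bar>Y x - ?Z x\<bar> \<le> 1 / (2 * real n) * (?Z x)\<^sup>2 + real n / 2 * (indicator ?A x + indicator ?B x)" if x: "x \<in> space P" for x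
  proof (cases "x \<in> ?A \<or> x \<in> ?B")
    case True
    have "\<bar>Y x - ?Z x\<bar> = \<bar>(shrink D d ?R I x * shrink D d ?R J x - 1) * ?Z x\<bar>"
      unfolding Y_def by (simp add: left_diff_distrib)
    also have "\<dots> \<le> \<bar>?Z x\<bar>"
      unfolding abs_mult[of "_ - _"] using th[of x] by (intro mult_left_le_one_le) auto
    also have "\<dots> \<le> 1 / (2 * real n) * (?Z x)\<^sup>2 + real n / 2"
    proof -
      have "0 \<le> (\<bar>?Z x\<bar> - real n)\<^sup>2" by simp
      then have "2 * real n * \<bar>?Z x\<bar> \<le> (?Z x)\<^sup>2 + (real n)\<^sup>2" by (simp add: power2_diff mult_ac)
      then show ?thesis using n by (simp add: field_simps power2_eq_square)
    qed
    also have "\<dots> \<le> 1 / (2 * real n) * (?Z x)\<^sup>2 + real n / 2 * (indicator ?A x + indicator ?B x)"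
      using True by (intro add_left_mono) (auto simp: indicator_def)
    finally show ?thesis .
  next
    case False
    then have "L2_set (pad_vec D d x) I \<le> ?R" "L2_set (pad_vec D d x) J \<le> ?R" using x by auto
    from unshrunk[OF w(1) I(1) this(1)] unshrunk[OF w(2) J(1) this(2)]
    have "Y x = ?Z x" unfolding Y_def by (metis (no_types, lifting) mult.assoc mult.left_commute)
    then show ?thesis by simp
  qed
  have pA: "prob {x \<in> space P. ?R < L2_set (pad_vec D d x) I} \<le> 2 / (real n)\<^sup>2"
    if I: "I \<subseteq> {1..D}" "card I \<le> k" for I
  proof -
    have "(18 + h) * real k \<le> C / (16 * K\<^sup>2) * real k"
      using C K by (intro mult_right_mono) (auto simp: field_simps)
    then have "exp (18 * real k - C * real k / (16 * K\<^sup>2)) \<le> exp (- h * real k)" by (simp add: algebra_simps)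
    from order_trans[OF this small] have "2 * exp (18 * real k - C * real k / (16 * K\<^sup>2)) \<le> 2 * (1 / (real n)\<^sup>2)"
      by (intro mult_left_mono) auto
    from order_trans[OF prob_clipped_le[OF I k dD C0] this] show ?thesis by simp
  qed
  have intA: "integrable P (indicat_real ?A)" and intB: "integrable P (indicat_real ?B)"
    by (intro integrable_real_indicator; measurable; simp add: emeasure_eq_measure)+
  have intR: "integrable P (\<lambda>x. 1 / (2 * real n) * (?Z x)\<^sup>2 + real n / 2 * (indicat_real ?A x + indicat_real ?B x))"
    by (intro Bochner_Integration.integrable_add integrable_mult_right Z(3) intA intB)
  have "\<bar>(\<integral>x. Y x \<partial>P) - bilin D cov0 w w'\<bar> = \<bar>\<integral>x. Y x - ?Z x \<partial>P\<bar>"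
    unfolding bilin_cov0[OF dD] using intY Z(1) by simp
  also have "\<dots> \<le> (\<integral>x. \<bar>Y x - ?Z x\<bar> \<partial>P)" by (rule integral_abs_bound)
  also have "\<dots> \<le> (\<integral>x. 1 / (2 * real n) * (?Z x)\<^sup>2 + real n / 2 * (indicator ?A x + indicator ?B x) \<partial>P)"
    using intY Z(1) by (intro integral_mono pt intR) auto
  also have "\<dots> = 1 / (2 * real n) * (\<integral>x. (?Z x)\<^sup>2 \<partial>P) + real n / 2 * (prob ?A + prob ?B)"
    using Z(3) intA intB by simp
  also have "\<dots> \<le> 1 / (2 * real n) * (4 * ?b\<^sup>2) + real n / 2 * (2 / (real n)\<^sup>2 + 2 / (real n)\<^sup>2)"
    by (intro add_mono mult_left_mono Z pA I J) auto
  also have "\<dots> = (2 * ?b\<^sup>2 + 2) / real n" using n by (simp add: field_simps power2_eq_square)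
  finally show "\<bar>(\<integral>x. Y x \<partial>P) - bilin D cov0 w w'\<bar> \<le> (2 * ?b\<^sup>2 + 2) / real n" .
qed

text \<open>
  The average over \<open>n\<close> samples has a moment generating function with exponent of order \<open>k\<close> at the
  parameter \<open>l\<close> of order \<open>sqrt (k / n)\<close> per sample, which is in the admissible range because
  \<open>k \<le> n\<close>; the clipping bias contributes \<open>l n O(1/n)\<close>, which is bounded.
\<close>

lemma emp_block_tail:
  assumes I: "I \<subseteq> {1..D}" "card I \<le> k" and J: "J \<subseteq> {1..D}" "card J \<le> k" and k: "1 \<le> k" "k \<le> n" and dD: "d \<le> D"
    and h: "0 \<le> h" and C: "16 * K\<^sup>2 * (18 + h) \<le> C" and small: "exp (- h * real k) \<le> 1 / (real n)\<^sup>2"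
  defines "B \<equiv> 8 * K\<^sup>2 * (39 + h) + (2 * (4 * K\<^sup>2)\<^sup>2 + 2)"
  shows "\<exists>H. H \<in> borel_measurable (\<Pi>\<^sub>M a\<in>{1..n}. P) \<and> (\<integral>\<^sup>+ X. H X \<partial>(\<Pi>\<^sub>M a\<in>{1..n}. P)) \<le> ennreal (exp (- h * real k)) \<and>
    (\<forall>X. H X < 1 \<longrightarrow>
       op_bounded D (mask (\<lambda>p. emp_block n (pad D d X) I J (sqrt (C * real k)) p - cov0 p) (I \<times> J)) (2 * (B * sqrt (real k / real n))))"
proof -
  interpret PP: product_prob_space "\<lambda>_. P" by (intro product_prob_spaceI prob_space_axioms)
  define b where "b = 4 * K\<^sup>2"
  define B0 where "B0 = 2 * b\<^sup>2 + 2"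
  have B_eq: "B = 2 * b * (39 + h) + B0" by (simp add: B_def b_def B0_def)
  let ?M = "\<Pi>\<^sub>M a\<in>{1..n}. P" and ?R = "sqrt (C * real k)"
  let ?r = "sqrt (real k / real n)"
  define Y where "Y = (\<lambda>w w' x. shrink D d ?R I x * shrink D d ?R J x * (lin_form d w x * lin_form d w' x))"
  define T where "T = (\<lambda>X w w'. \<Sum>a\<in>{1..n}. Y w w' (X a) - bilin D cov0 w w')"
  \<comment> \<open>optimizes the Chernoff bound up to constants\<close>
  define l where "l = ?r / (2 * b)"
  have n1: "1 \<le> n" using k by simp
  have b: "0 < b" using K by (simp add: b_def)
  have B0: "0 < B0" by (simp add: B0_def add_nonneg_pos)
  have r: "0 < ?r" "?r \<le> 1" "?r\<^sup>2 = real k / real n" using k by (auto simp: divide_simps)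
  have l: "0 < l" "l \<le> 1 / (2 * b)" using r b by (auto simp: l_def intro!: divide_right_mono)
  have fin: "finite I" "finite J" using I J finite_subset by auto
  have "\<exists>H. H \<in> borel_measurable ?M \<and> (\<integral>\<^sup>+ X. H X \<partial>?M) \<le> ennreal (exp (- h * real k)) \<and>
      (\<forall>X. H X < 1 \<longrightarrow> (\<forall>w\<in>lattice_net k I. \<forall>w'\<in>lattice_net k J. \<bar>T X w w'\<bar> \<le> real n * (B * ?r)))"
  proof (rule chernoff_net[OF fin(1) I(2) fin(2) J(2) k(1) l(1), where q = "2 + B0 / (2 * b)"])
    fix w w' assume w: "w \<in> lattice_net k I" "w' \<in> lattice_net k J"
    have bias: "\<bar>(\<integral>x. Y w w' x \<partial>P) - bilin D cov0 w w'\<bar> \<le> B0 / real n" and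
      Ym: "Y w w' \<in> borel_measurable P" and Yexp: "(\<integral>\<^sup>+ x. ennreal (exp (\<bar>Y w w' x\<bar> / b)) \<partial>P) \<le> 2"
      using clipping_bias[OF I J k(1) dD n1 h C small w] unfolding Y_def b_def B0_def by blast+
    have comp: "(\<lambda>X. Y w w' (X a)) \<in> borel_measurable ?M" if "a \<in> {1..n}" for a
      by (rule measurable_compose[OF measurable_component_singleton[OF that, of "\<lambda>_. P"] Ym])
    show "(\<lambda>X. T X w w') \<in> borel_measurable ?M"
      unfolding T_def by (intro borel_measurable_sum borel_measurable_diff comp) auto
    fix \<sigma> :: real assume \<sigma>: "\<bar>\<sigma>\<bar> = 1"
    have ls: "\<bar>l * \<sigma>\<bar> = l" using l \<sigma> by (simp add: abs_mult)
    have sq: "(l * \<sigma>)\<^sup>2 = l\<^sup>2" by (metis ls power2_abs)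
    have "(\<integral>\<^sup>+ X. ennreal (exp (l * (\<sigma> * T X w w'))) \<partial>?M) =
        (\<integral>\<^sup>+ X. (\<Prod>a\<in>{1..n}. ennreal (exp (l * \<sigma> * (Y w w' (X a) - bilin D cov0 w w')))) \<partial>?M)"
      by (simp add: T_def sum_distrib_left exp_sum prod_ennreal mult.assoc del: sum_subtractf)
    also have "\<dots> = (\<Prod>a\<in>{1..n}. \<integral>\<^sup>+ x. ennreal (exp (l * \<sigma> * (Y w w' x - bilin D cov0 w w'))) \<partial>P)"
      by (rule PP.product_nn_integral_prod) (use Ym in auto)
    also have "\<dots> \<le> (\<Prod>a\<in>{1..n}. ennreal (exp (8 * (l * \<sigma>)\<^sup>2 * b\<^sup>2 + \<bar>l * \<sigma>\<bar> * \<bar>(\<integral>x. Y w w' x \<partial>P) - bilin D cov0 w w'\<bar>)))"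
      by (intro prod_mono_ennreal mgf_centered_le(4)[OF Ym b Yexp]) (use l ls in auto)
    also have "\<dots> = ennreal (exp (real n * (8 * l\<^sup>2 * b\<^sup>2 + l * \<bar>(\<integral>x. Y w w' x \<partial>P) - bilin D cov0 w w'\<bar>)))"
      unfolding ls sq by (simp add: ennreal_power exp_of_nat_mult)
    also have "\<dots> \<le> ennreal (exp ((2 + B0 / (2 * b)) * real k))"
    proof (intro ennreal_leI iffD2[OF exp_le_cancel_iff])
      have "real n * (8 * l\<^sup>2 * b\<^sup>2) = 2 * real k"
        using r(3) b n1 by (simp add: l_def power_divide power_mult_distrib field_simps)
      moreover have "real n * (l * \<bar>(\<integral>x. Y w w' x \<partial>P) - bilin D cov0 w w'\<bar>) \<le> real n * (l * (B0 / real n))"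
        using l bias by (intro mult_left_mono) auto
      moreover have "real n * (l * (B0 / real n)) = l * B0" using n1 by simp
      moreover have "l * B0 \<le> 1 / (2 * b) * B0" using l B0 by (intro mult_right_mono) auto
      moreover have "1 / (2 * b) * B0 * 1 \<le> 1 / (2 * b) * B0 * real k" using k b B0 by (intro mult_left_mono) auto
      ultimately show "real n * (8 * l\<^sup>2 * b\<^sup>2 + l * \<bar>(\<integral>x. Y w w' x \<partial>P) - bilin D cov0 w w'\<bar>) \<le> (2 + B0 / (2 * b)) * real k"
      proof -
        assume a: "real n * (8 * l\<^sup>2 * b\<^sup>2) = 2 * real k"
          "real n * (l * \<bar>(\<integral>x. Y w w' x \<partial>P) - bilin D cov0 w w'\<bar>) \<le> real n * (l * (B0 / real n))"
          "real n * (l * (B0 / real n)) = l * B0" "l * B0 \<le> 1 / (2 * b) * B0"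
          "1 / (2 * b) * B0 * 1 \<le> 1 / (2 * b) * B0 * real k"
        have "(2 + B0 / (2 * b)) * real k = 2 * real k + 1 / (2 * b) * B0 * real k" by (simp add: distrib_right)
        then show ?thesis unfolding distrib_left[of "real n"] using a by linarith
      qed
    qed
    finally show "(\<integral>\<^sup>+ X. ennreal (exp (l * (\<sigma> * T X w w'))) \<partial>?M) \<le> ennreal (exp ((2 + B0 / (2 * b)) * real k))" .
  next
    have "l * (real n * (B * ?r)) = B / (2 * b) * (?r\<^sup>2 * real n)"
      unfolding l_def power2_eq_square by (simp only: times_divide_eq_left times_divide_eq_right mult_ac)
    also have "?r\<^sup>2 * real n = real k" unfolding r(3) using n1 by simp
    also have "B / (2 * b) = 39 + h + B0 / (2 * b)" unfolding B_eq using b by (simp add: field_simps)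
    finally have e: "l * (real n * (B * ?r)) = (39 + h + B0 / (2 * b)) * real k" .
    have "37 + (2 + B0 / (2 * b)) + h = 39 + h + B0 / (2 * b)" by simp
    then show "(37 + (2 + B0 / (2 * b)) + h) * real k \<le> l * (real n * (B * ?r))" unfolding e by (simp only: order_refl)
  qed
  then obtain H where H: "H \<in> borel_measurable ?M" "(\<integral>\<^sup>+ X. H X \<partial>?M) \<le> ennreal (exp (- h * real k))"
    "\<And>X w w'. H X < 1 \<Longrightarrow> w \<in> lattice_net k I \<Longrightarrow> w' \<in> lattice_net k J \<Longrightarrow> \<bar>T X w w'\<bar> \<le> real n * (B * ?r)"
    by blast
  have "op_bounded D (mask (\<lambda>p. emp_block n (pad D d X) I J ?R p - cov0 p) (I \<times> J)) (2 * (B * ?r))" if "H X < 1" for X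
  proof (rule op_bounded_via_net[OF I J k(1)])
    show "0 \<le> B * ?r" unfolding B_eq using h b B0 by simp
    fix w w' assume w: "w \<in> lattice_net k I" "w' \<in> lattice_net k J"
    have supp: "(\<lambda>i. if i \<in> I then w i else 0) = w" "(\<lambda>i. if i \<in> J then w' i else 0) = w'"
      using lattice_net_L2(3)[OF I(1) k(1) w(1)] lattice_net_L2(3)[OF J(1) k(1) w(2)] by auto
    have "bilin D (mask (\<lambda>p. emp_block n (pad D d X) I J ?R p - cov0 p) (I \<times> J)) w w' =
        bilin D (emp_block n (pad D d X) I J ?R) w w' - bilin D cov0 w w'"
      by (subst bilin_mask_Times) (simp only: supp bilin_diff)
    also have "\<dots> = T X w w' / real n"
      unfolding bilin_emp_block[OF dD] T_def Y_def using n1 by (simp add: sum_subtractf diff_divide_distrib)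
    finally have e: "bilin D (mask (\<lambda>p. emp_block n (pad D d X) I J ?R p - cov0 p) (I \<times> J)) w w' = T X w w' / real n" .
    show "\<bar>bilin D (mask (\<lambda>p. emp_block n (pad D d X) I J ?R p - cov0 p) (I \<times> J)) w w'\<bar> \<le> B * ?r"
      unfolding e abs_divide using H(3)[OF that w] n1 by (simp add: pos_divide_le_eq mult.commute)
  qed (auto simp: mask_def)
  then show ?thesis using H(1,2) by blast
qed

end

section \<open>Dyadic decomposition and thresholding\<close>

lemma bilin_dim_mono:
  assumes "d \<le> D"
  shows "bilin d A u v = bilin D A (\<lambda>i. if i \<in> {1..d} then u i else 0) (\<lambda>i. if i \<in> {1..d} then v i else 0)"
proof -
  have "bilin D A (\<lambda>i. if i \<in> {1..d} then u i else 0) (\<lambda>i. if i \<in> {1..d} then v i else 0) =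
      (\<Sum>i\<in>{1..d}. \<Sum>j\<in>{1..D}. (if i \<in> {1..d} then u i else 0) * A (i, j) * (if j \<in> {1..d} then v j else 0))"
    unfolding bilin_def by (rule sum.mono_neutral_right) (use assms in auto)
  also have "\<dots> = (\<Sum>i\<in>{1..d}. \<Sum>j\<in>{1..d}. u i * A (i, j) * v j)"
    by (intro sum.cong refl sum.mono_neutral_cong_right) (use assms in auto)
  finally show ?thesis by (simp add: bilin_def)
qed

lemma L2_set_restrict_dim: "d \<le> D \<Longrightarrow> L2_set (\<lambda>i. if i \<in> {1..d} then u i else 0) {1..D} = L2_set u {1..d}" for u :: rvec
  unfolding L2_set_def by (intro arg_cong[of _ _ sqrt] sum.mono_neutral_cong_right) auto

lemma op_bounded_restrict_dim:
  assumes "d \<le> D" "op_bounded D A b"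
  shows "op_bounded d A b"
  unfolding op_bounded_def bilin_dim_mono[OF assms(1)]
  using op_boundedD[OF assms(2)] L2_set_restrict_dim[OF assms(1)] by metis

lemma op_bounded_extend_dim:
  assumes dD: "d \<le> D" and b: "op_bounded d A b" "0 \<le> b" and supp: "\<And>p. p \<notin> {1..d} \<times> {1..d} \<Longrightarrow> A p = 0"
  shows "op_bounded D A b"
  unfolding op_bounded_def
proof (intro allI)
  fix u v :: rvec
  have "bilin D A u v = bilin D A (\<lambda>i. if i \<in> {1..d} then u i else 0) (\<lambda>j. if j \<in> {1..d} then v j else 0)"
    by (rule bilin_supported) (use supp in blast)
  also have "\<dots> = bilin d A u v" by (rule bilin_dim_mono[OF dD, symmetric])
  finally have "\<bar>bilin D A u v\<bar> \<le> b * (L2_set u {1..d} * L2_set v {1..d})"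
    using op_boundedD[OF b(1), of u v] by (simp add: mult.assoc)
  also have "\<dots> \<le> b * (L2_set u {1..D} * L2_set v {1..D})"
    unfolding L2_set_def using dD b(2)
    by (intro mult_left_mono mult_mono real_sqrt_le_mono sum_mono2) (auto intro!: sum_nonneg)
  finally show "\<bar>bilin D A u v\<bar> \<le> b * L2_set u {1..D} * L2_set v {1..D}" by (simp add: mult.assoc)
qed

lemma op_bounded_spec_norm_le: "spec_norm D A \<le> b \<Longrightarrow> op_bounded D A b"
  by (rule op_bounded_mono[OF op_bounded_spec_norm])

text \<open>
  Zero-based number of the block of side \<open>k\<close> that contains the one-based index \<open>i\<close>. Passing to
  the doubled scale halves it, rounding down.
\<close>

definition block_index :: "nat \<Rightarrow> nat \<Rightarrow> nat" where
  "block_index k i = (i - 1) div k"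

lemma idx_iff: "1 \<le> k \<Longrightarrow> 1 \<le> l \<Longrightarrow> 1 \<le> i \<Longrightarrow> i \<in> idx k l \<longleftrightarrow> block_index k i = l - 1"
proof -
  assume k: "1 \<le> k" and l: "1 \<le> l" and i: "1 \<le> i"
  have "i \<in> idx k l \<longleftrightarrow> (l - 1) * k \<le> i - 1 \<and> i - 1 < l * k"
    using i by (auto simp: idx_def)
  also have "\<dots> \<longleftrightarrow> (i - 1) div k = l - 1"
  proof -
    obtain l' where l': "l = Suc l'" using l by (cases l) auto
    show ?thesis
    proof
      assume "(l - 1) * k \<le> i - 1 \<and> i - 1 < l * k"
      then show "(i - 1) div k = l - 1" unfolding l' by (intro div_nat_eqI) (auto simp: mult.commute)
    next
      assume "(i - 1) div k = l - 1"
      then have "i - 1 = (l - 1) * k + (i - 1) mod k" using div_mult_mod_eq[of "i - 1" k] by simp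
      moreover have "(i - 1) mod k < k" using k by simp
      moreover have "l * k = (l - 1) * k + k" by (simp add: l')
      ultimately show "(l - 1) * k \<le> i - 1 \<and> i - 1 < l * k" by linarith
    qed
  qed
  finally show ?thesis by (simp add: block_index_def)
qed

lemma idx_disjoint: "1 \<le> l \<Longrightarrow> 1 \<le> l' \<Longrightarrow> l \<noteq> l' \<Longrightarrow> idx k l \<inter> idx k l' = {}"
proof -
  have *: "idx k l \<inter> idx k l' = {}" if "l < l'" for l l'
  proof -
    have le: "l * k \<le> (l' - 1) * k" using that by (intro mult_le_mono1) auto
    show ?thesis
    proof (rule equals0I)
      fix x assume "x \<in> idx k l \<inter> idx k l'"
      then have "x \<le> l * k" "1 + (l' - 1) * k \<le> x" by (auto simp: idx_def)
      with le show False by linarith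
    qed
  qed
  assume "l \<noteq> l'"
  then show ?thesis using *[of l l'] *[of l' l] by (cases "l < l'") auto
qed

lemma card_idx_le: "card (idx k l) \<le> k"
  by (cases l) (auto simp: idx_def)

lemma mask_diff_sets: "B' \<subseteq> B \<Longrightarrow> mask A (B - B') = (\<lambda>p. mask A B p - mask A B' p)"
  by (auto simp: mask_def fun_eq_iff)

text \<open>
  \<open>X\<close> is the noisy block and \<open>T\<close> the true one. If \<open>X\<close> is kept, then \<open>\<tau> < s + w\<close>, so \<open>w \<le> \<tau> / 2\<close>
  is also below \<open>s\<close>. If it is dropped, then the error is \<open>T\<close>, of norm at most \<open>\<tau> + w\<close>.
\<close>

lemma threshold_error:
  assumes w: "op_bounded D (\<lambda>p. X p - T p) w" and wt: "0 \<le> w" "w \<le> \<tau> / 2" and T: "op_bounded D T s" and s: "0 \<le> s"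
  shows "op_bounded D (\<lambda>p. (if spec_norm D X > \<tau> then X else (\<lambda>_. 0)) p - T p) (min (3 / 2 * \<tau>) s)"
proof (cases "spec_norm D X > \<tau>")
  case True
  have "op_bounded D (\<lambda>p. T p + (X p - T p)) (s + w)" by (intro op_bounded_add T w)
  then have "spec_norm D X \<le> s + w" using s wt by (intro spec_norm_le) auto
  then have "w \<le> min (3 / 2 * \<tau>) s" using True wt by simp
  then show ?thesis using True op_bounded_mono[OF w] by simp
next
  case False
  have "op_bounded D (\<lambda>p. X p - (X p - T p)) (spec_norm D X + w)" by (intro op_bounded_diff op_bounded_spec_norm w)
  then have "op_bounded D T (spec_norm D X + w)" by simp
  then have "op_bounded D T (3 / 2 * \<tau>)" by (rule op_bounded_mono) (use False wt in simp)
  then have "op_bounded D T (min (3 / 2 * \<tau>) s)" using T by (simp add: min_def)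
  from op_bounded_scale[OF this, of "-1"] show ?thesis using False by simp
qed

lemma op_bounded_symmetrize_upper:
  assumes b: "op_bounded D E b" and upper: "\<And>i j. j \<le> i \<Longrightarrow> E (i, j) = 0"
  shows "op_bounded D (\<lambda>(i, j). E (min i j, max i j)) (2 * b)"
proof -
  have "op_bounded D (\<lambda>p. E p + (case p of (i, j) \<Rightarrow> E (j, i))) (b + b)"
    using op_bounded_add[OF b op_bounded_transpose[OF b]] by simp
  moreover have "(\<lambda>p. E p + (case p of (i, j) \<Rightarrow> E (j, i))) = (\<lambda>(i, j). E (min i j, max i j))"
  proof (rule ext)
    fix p :: "nat \<times> nat"
    obtain i j where p: "p = (i, j)" by (cases p)
    show "E p + (case p of (i, j) \<Rightarrow> E (j, i)) = (case p of (i, j) \<Rightarrow> E (min i j, max i j))"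
      using upper[of j i] upper[of i j] by (cases "i \<le> j") (auto simp: p min_def max_def)
  qed
  ultimately show ?thesis by (simp only: mult_2)
qed

text \<open>
  Here \<open>p\<close> and \<open>q\<close> are the block numbers of the row and the column at some scale, and their halves
  those at the next scale. The left-hand side says that the entry lies in the \<open>l\<close>-th corner region of
  the next scale; the three facts identify this with the blocks becoming neighbours exactly at the
  next scale, and split the region into two rectangles.
\<close>

lemma corner_arith:
  "1 \<le> l \<Longrightarrow> (p div 2 = l - 1 \<and> q div 2 = l \<and> \<not> (p = 2 * l - 1 \<and> q = 2 * l)) \<longleftrightarrow>
     (l = q div 2 \<and> q div 2 = p div 2 + 1 \<and> \<not> q = p + 1)" for l p q :: nat
  by (cases l) auto

lemma near_arith:
  "p \<le> q \<Longrightarrow> (q div 2 = p div 2 + 1 \<and> \<not> q = p + 1) \<longleftrightarrow> (q div 2 \<le> p div 2 + 1 \<and> \<not> q \<le> p + 1)" for p q :: nat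
  by auto

lemma corner_split_arith:
  "1 \<le> l \<Longrightarrow> (p div 2 = l - 1 \<and> q div 2 = l \<and> \<not> (p = 2 * l - 1 \<and> q = 2 * l)) \<longleftrightarrow>
     (p = 2 * l - 2 \<and> q div 2 = l \<or> p = 2 * l - 1 \<and> q = 2 * l + 1)" for l p q :: nat
  by (cases l) auto

context ada_setup
begin

abbreviation "\<Gamma> m l \<equiv> ada_Gamma C0 n d m l"
abbreviation "bi m i \<equiv> block_index (k m) i"

lemma bi_less_N: "m \<le> J \<Longrightarrow> i \<in> {1..D} \<Longrightarrow> bi m i < N m"
  unfolding block_index_def using N_mult_k[of m] k_pos[of m]
  by (intro iffD2[OF div_less_iff_less_mult]) auto

lemma bi_Suc: "bi (Suc m) i = bi m i div 2"
  unfolding block_index_def k_Suc mult.commute[of 2] by (rule div_mult2_eq)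

lemma bi_mono: "i \<le> j \<Longrightarrow> bi m i \<le> bi m j"
  unfolding block_index_def by (intro div_le_mono) auto

lemma idx_k_iff: "1 \<le> l \<Longrightarrow> 1 \<le> i \<Longrightarrow> i \<in> idx (k m) l \<longleftrightarrow> bi m i = l - 1"
  by (rule idx_iff[OF k_pos])

lemma idx_subset: "m \<le> J \<Longrightarrow> l \<le> N m \<Longrightarrow> idx (k m) l \<subseteq> {1..D}"
proof -
  assume m: "m \<le> J" and l: "l \<le> N m"
  have "l * k m \<le> N m * k m" using l by (rule mult_le_mono1)
  then show ?thesis using N_mult_k[OF m] by (auto simp: idx_def)
qed

text \<open>
  Indicator that, at scale \<open>m\<close>, an entry of the upper triangle lies in a diagonal block or in the
  block right of it: the block tridiagonal band.
\<close>

definition near :: "nat \<Rightarrow> nat \<Rightarrow> nat \<Rightarrow> real" where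
  "near m i j = (if bi m j \<le> bi m i + 1 then 1 else 0)"

lemma sum_blk_indicator:
  assumes m: "m \<le> J" and ij: "i \<in> {1..D}" "j \<in> {1..D}" "i \<le> j"
  shows "(\<Sum>l\<in>{1..N m}. if (i, j) \<in> blk (k m) l 0 then 1 else 0) + (\<Sum>l\<in>{1..<N m}. if (i, j) \<in> blk (k m) l 1 then 1 else 0) = near m i j"
proof -
  let ?p = "bi m i" and ?q = "bi m j"
  have pq: "?p \<le> ?q" "?q < N m" using bi_mono ij bi_less_N[OF m] by auto
  have "(\<Sum>l\<in>{1..N m}. if (i, j) \<in> blk (k m) l 0 then 1 else (0::real)) = (\<Sum>l\<in>{1..N m}. if l = ?p + 1 then (if ?q = ?p then 1 else 0) else 0)"
    using ij by (intro sum.cong refl) (auto simp: blk_def idx_k_iff)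
  also have "\<dots> = (if ?q = ?p then 1 else 0)" using pq by (subst sum.delta) auto
  finally have 1: "(\<Sum>l\<in>{1..N m}. if (i, j) \<in> blk (k m) l 0 then 1 else (0::real)) = (if ?q = ?p then 1 else 0)" .
  have "(\<Sum>l\<in>{1..<N m}. if (i, j) \<in> blk (k m) l 1 then 1 else (0::real)) = (\<Sum>l\<in>{1..<N m}. if l = ?p + 1 then (if ?q = ?p + 1 then 1 else 0) else 0)"
    using ij by (intro sum.cong refl) (auto simp: blk_def idx_k_iff)
  also have "\<dots> = (if ?q = ?p + 1 then 1 else 0)" using pq by (subst sum.delta) auto
  finally have 2: "(\<Sum>l\<in>{1..<N m}. if (i, j) \<in> blk (k m) l 1 then 1 else (0::real)) = (if ?q = ?p + 1 then 1 else 0)" .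
  show ?thesis unfolding 1 2 near_def using pq by auto
qed

lemma Gamma_iff:
  assumes ij: "i \<in> {1..D}" "j \<in> {1..D}" and l: "1 \<le> l"
  shows "(i, j) \<in> \<Gamma> (Suc m) l \<longleftrightarrow> bi (Suc m) i = l - 1 \<and> bi (Suc m) j = l \<and> \<not> (bi m i = 2 * l - 1 \<and> bi m j = 2 * l)"
  using l ij unfolding ada_Gamma_def blk_def by (auto simp: idx_k_iff)

text \<open>
  The corner regions of a scale fill exactly the gap between the band of the previous scale and the
  band of this one, so the sum over the scales telescopes.
\<close>

lemma sum_Gamma_indicator:
  assumes m: "Suc m \<le> J" and ij: "i \<in> {1..D}" "j \<in> {1..D}" "i \<le> j"
  shows "(\<Sum>l\<in>{1..<N (Suc m)}. if (i, j) \<in> \<Gamma> (Suc m) l then 1 else 0) = near (Suc m) i j - near m i j"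
proof -
  let ?p = "bi m i" and ?q = "bi m j"
  have pq: "?p \<le> ?q" "bi (Suc m) j < N (Suc m)" using bi_mono ij bi_less_N[OF m] by auto
  let ?c = "?q div 2 = ?p div 2 + 1 \<and> \<not> ?q = ?p + 1"
  have "(\<Sum>l\<in>{1..<N (Suc m)}. if (i, j) \<in> \<Gamma> (Suc m) l then 1 else (0::real)) =
      (\<Sum>l\<in>{1..<N (Suc m)}. if l = ?q div 2 then (if ?c then 1 else 0) else 0)"
  proof (intro sum.cong refl)
    fix l assume l: "l \<in> {1..<N (Suc m)}"
    have "(i, j) \<in> \<Gamma> (Suc m) l \<longleftrightarrow> l = ?q div 2 \<and> ?c"
    proof -
      have l1: "1 \<le> l" using l by simp
      show ?thesis unfolding Gamma_iff[OF ij(1,2) l1] bi_Suc by (rule corner_arith[OF l1])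
    qed
    then show "(if (i, j) \<in> \<Gamma> (Suc m) l then 1 else 0) = (if l = ?q div 2 then (if ?c then 1 else 0) else (0::real))" by auto
  qed
  also have "\<dots> = (if ?c then 1 else 0)" using pq by (subst sum.delta) (auto simp: bi_Suc)
  also have "\<dots> = near (Suc m) i j - near m i j"
  proof -
    note near_arith[OF pq(1)]
    moreover have "?q \<le> ?p + 1 \<Longrightarrow> ?q div 2 \<le> ?p div 2 + 1" by linarith
    ultimately show ?thesis unfolding near_def bi_Suc by auto
  qed
  finally show ?thesis .
qed

lemma sum_all_indicators:
  assumes ij: "i \<in> {1..D}" "j \<in> {1..D}" "i \<le> j"
  shows "(\<Sum>l\<in>{1..N 0}. if (i, j) \<in> blk (k 0) l 0 then 1 else 0) + (\<Sum>l\<in>{1..<N 0}. if (i, j) \<in> blk (k 0) l 1 then 1 else 0)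
     + (\<Sum>m\<in>{1..J}. \<Sum>l\<in>{1..<N m}. if (i, j) \<in> \<Gamma> m l then 1 else 0) = (1 :: real)"
proof -
  have "(\<Sum>m\<in>{1..M}. \<Sum>l\<in>{1..<N m}. if (i, j) \<in> \<Gamma> m l then 1 else 0) = near M i j - near 0 i j" if "M \<le> J" for M
    using that
  proof (induction M)
    case (Suc M)
    then show ?case using sum_Gamma_indicator[OF Suc.prems ij] by simp
  qed simp
  moreover have "near J i j = 1"
    using bi_less_N[of J j] ij N_eq[of J] by (simp add: near_def)
  ultimately show ?thesis using sum_blk_indicator[of 0, OF _ ij] by simp
qed

lemma decompose:
  assumes ij: "i \<in> {1..D}" "j \<in> {1..D}" "i \<le> j"
  shows "A (i, j) = (\<Sum>l\<in>{1..N 0}. mask A (blk (k 0) l 0) (i, j)) + (\<Sum>l\<in>{1..<N 0}. mask A (blk (k 0) l 1) (i, j))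
     + (\<Sum>m\<in>{1..J}. \<Sum>l\<in>{1..<N m}. mask A (\<Gamma> m l) (i, j))"
proof -
  have "mask A B (i, j) = A (i, j) * (if (i, j) \<in> B then 1 else 0)" for B by (simp add: mask_def)
  then show ?thesis
    using sum_all_indicators[OF ij] by (simp only: sum_distrib_left[symmetric] distrib_left[symmetric] mult_1_right)
qed

lemma Gamma_subset: "1 \<le> m \<Longrightarrow> \<Gamma> m l \<subseteq> idx (k m) l \<times> idx (k m) (l + 1)"
  by (auto simp: ada_Gamma_def blk_def)

lemma Gamma_hole_subset:
  assumes "1 \<le> l"
  shows "blk (k m) (2 * l) 1 \<subseteq> blk (k (Suc m)) l 1"
proof -
  obtain l' where l': "l = Suc l'" using assms by (cases l) auto
  have e: "2 * l - 1 = 2 * l' + 1" "2 * l = 2 * l' + 2" "l - 1 = l'" by (auto simp: l')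
  show ?thesis
    unfolding blk_def idx_def k_Suc e by (auto simp: l' algebra_simps)
qed

text \<open>
  The region is a square block minus a smaller square block inside it.
\<close>

lemma op_bounded_Gamma:
  assumes l: "1 \<le> l" and z: "op_bounded D (mask E (blk (k (Suc m)) l 1)) z" "0 \<le> z"
  shows "op_bounded D (mask E (\<Gamma> (Suc m) l)) (2 * z)"
proof -
  let ?B = "blk (k (Suc m)) l 1" and ?B' = "blk (k m) (2 * l) 1"
  have "mask (mask E ?B) ?B' = mask E ?B'" using Gamma_hole_subset[OF l, of m] by (auto simp: mask_def fun_eq_iff)
  moreover have "op_bounded D (mask (mask E ?B) ?B') z"
    unfolding blk_def[of "k m"] by (rule op_bounded_mask_Times[OF z])
  ultimately have "op_bounded D (mask E ?B') z" by simp
  then have "op_bounded D (mask E (?B - ?B')) (z + z)"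
    unfolding mask_diff_sets[OF Gamma_hole_subset[OF l]] by (intro op_bounded_diff z)
  then show ?thesis by (simp only: ada_Gamma_def mult_2 diff_Suc_1)
qed

text \<open>
  The corner region is a union of two rectangles: the rows of the first half against all columns,
  and the rows of the second half against the second half of the columns. Both are separated from
  the diagonal by one block of the previous scale.
\<close>

lemma op_bounded_Gamma_class:
  assumes l: "1 \<le> l" and supp: "\<And>p. p \<notin> {1..d} \<times> {1..d} \<Longrightarrow> A p = 0"
    and cls: "\<And>R. off_diag_block d (k m) R \<Longrightarrow> spec_norm d (mask A R) \<le> s" and s: "0 \<le> s"
  shows "op_bounded D (mask A (\<Gamma> (Suc m) l)) (2 * s)"
proof -
  let ?d = "{1..d}" and ?k = "k m"
  let ?R1 = "(idx ?k (2 * l - 1) \<inter> ?d) \<times> (idx (2 * ?k) (l + 1) \<inter> ?d)"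
  let ?R2 = "(idx ?k (2 * l) \<inter> ?d) \<times> (idx ?k (2 * l + 2) \<inter> ?d)"
  have block: "op_bounded D (mask A R) s" if "off_diag_block d ?k R" for R
  proof -
    have "op_bounded d (mask A R) s" by (rule op_bounded_spec_norm_le[OF cls[OF that]])
    then show ?thesis by (rule op_bounded_extend_dim[OF d_le_D _ s]) (use supp in \<open>auto simp: mask_def\<close>)
  qed
  obtain l' where l': "l = Suc l'" using l by (cases l) auto
  have b1: "off_diag_block d ?k ?R1"
    unfolding off_diag_block_def by (intro conjI exI disjI1) (auto simp: idx_def l' algebra_simps)
  have b2: "off_diag_block d ?k ?R2"
    unfolding off_diag_block_def by (intro conjI exI disjI1) (auto simp: idx_def l' algebra_simps)
  have "mask A (\<Gamma> (Suc m) l) = (\<lambda>p. mask A ?R1 p + mask A ?R2 p)"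
  proof (rule ext)
    fix p :: "nat \<times> nat"
    show "mask A (\<Gamma> (Suc m) l) p = mask A ?R1 p + mask A ?R2 p"
    proof (cases "p \<in> ?d \<times> ?d")
      case False then show ?thesis using supp by (auto simp: mask_def)
    next
      case True
      then obtain i j where p: "p = (i, j)" and ij: "i \<in> ?d" "j \<in> ?d" by auto
      then have ijD: "i \<in> {1..D}" "j \<in> {1..D}" using d_le_D by auto
      have G: "p \<in> \<Gamma> (Suc m) l \<longleftrightarrow> bi m i div 2 = l - 1 \<and> bi m j div 2 = l \<and> \<not> (bi m i = 2 * l - 1 \<and> bi m j = 2 * l)"
        unfolding p Gamma_iff[OF ijD l] bi_Suc ..
      have R1: "p \<in> ?R1 \<longleftrightarrow> bi m i = 2 * l - 2 \<and> bi m j div 2 = l"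
      proof -
        have "i \<in> idx ?k (2 * l - 1) \<longleftrightarrow> bi m i = 2 * l - 2" using l ij idx_k_iff[of "2 * l - 1" i m] by auto
        moreover have "j \<in> idx (2 * ?k) (l + 1) \<longleftrightarrow> bi m j div 2 = l"
          using ij idx_k_iff[of "l + 1" j "Suc m", unfolded bi_Suc, unfolded k_Suc] by auto
        ultimately show ?thesis using ij by (auto simp: p)
      qed
      have R2: "p \<in> ?R2 \<longleftrightarrow> bi m i = 2 * l - 1 \<and> bi m j = 2 * l + 1"
        using l ij idx_k_iff[of "2 * l" i m] idx_k_iff[of "2 * l + 2" j m] ijD by (auto simp: p)
      have "p \<in> \<Gamma> (Suc m) l \<longleftrightarrow> p \<in> ?R1 \<or> p \<in> ?R2" "\<not> (p \<in> ?R1 \<and> p \<in> ?R2)"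
        unfolding G R1 R2 using corner_split_arith[OF l, of "bi m i" "bi m j"] l by auto
      then show ?thesis unfolding mask_def by auto
    qed
  qed
  then show ?thesis using op_bounded_add[OF block[OF b1] block[OF b2]] by (simp only: mult_2)
qed

lemma op_bounded_level:
  assumes e: "0 \<le> e" and E: "\<And>l. l \<in> L \<Longrightarrow> op_bounded D (E l) e" and L: "finite L" "\<And>l. l \<in> L \<Longrightarrow> 1 \<le> l"
    and supp: "\<And>l p. l \<in> L \<Longrightarrow> p \<notin> idx kk l \<times> idx kk (l + r) \<Longrightarrow> E l p = 0"
  shows "op_bounded D (\<lambda>p. \<Sum>l\<in>L. E l p) e"
proof (rule op_bounded_blocks[OF L(1) e E, where I = "\<lambda>l. idx kk l" and J = "\<lambda>l. idx kk (l + r)"])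
  show "idx kk l \<inter> idx kk l' = {}" "idx kk (l + r) \<inter> idx kk (l' + r) = {}"
    if "l \<in> L" "l' \<in> L" "l \<noteq> l'" for l l'
    using idx_disjoint[of l l'] idx_disjoint[of "l + r" "l' + r"] L(2)[OF that(1)] L(2)[OF that(2)] that(3) by auto
qed (use supp in auto)

text \<open>
  The diagonal blocks of scale zero have a symmetric error and count once. Everything else lies
  strictly above the diagonal, and its mirror image at most doubles the norm. Scales that are not
  estimated contribute the norm of the true blocks.
\<close>

lemma assemble_error:
  fixes A :: rmat and Y :: "nat \<times> nat \<times> nat \<Rightarrow> rmat"
  assumes A: "\<And>p. p \<notin> {1..d} \<times> {1..d} \<Longrightarrow> A p = 0" "\<And>i j. A (i, j) = A (j, i)"
    and cls: "\<And>m R. off_diag_block d (k m) R \<Longrightarrow> spec_norm d (mask A R) \<le> s m" and s: "\<And>m. 0 \<le> s m"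
    and sym: "\<And>l i j. (0, l, 0) \<in> calls \<Longrightarrow> (i, j) \<in> blk (k 0) l 0 \<Longrightarrow> Y (0, l, 0) (i, j) = Y (0, l, 0) (j, i)"
    and e0: "0 \<le> e0" "\<And>l r. (0, l, r) \<in> calls \<Longrightarrow> op_bounded D (mask (\<lambda>p. Y (0, l, r) p - A p) (blk (k 0) l r)) e0"
    and e: "\<And>m l. (m, l, 1) \<in> calls \<Longrightarrow> 1 \<le> m \<Longrightarrow>
        op_bounded D (mask (\<lambda>p. Y (m, l, 1) p - A p) (blk (k m) l 1)) (ada_tau C0 L1 c0 n d \<rho> m / 4)"
    and tau: "\<And>m. 0 \<le> ada_tau C0 L1 c0 n d \<rho> m"
  shows "spec_norm d (\<lambda>p. ada_assemble C0 L1 c0 n d \<rho> Y p - A p) \<le>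
    3 * e0 + 2 * (\<Sum>m\<in>{1..J}. if m < S then min (3 / 2 * ada_tau C0 L1 c0 n d \<rho> m) (2 * s (m - 1)) else 2 * s (m - 1))"
proof -
  let ?\<tau> = "ada_tau C0 L1 c0 n d \<rho>"
  let ?b = "\<lambda>m. if m < S then min (3 / 2 * ?\<tau> m) (2 * s (m - 1)) else 2 * s (m - 1)"
  define E0 where "E0 = (\<lambda>r p. \<Sum>l\<in>{1..N 0 - r}. mask (\<lambda>p. Y (0, l, r) p - A p) (blk (k 0) l r) p)"
  define E where "E = (\<lambda>m p. \<Sum>l\<in>{1..<N m}. (if m < S then ada_piece C0 L1 c0 n d \<rho> (m, l, 1) (Y (m, l, 1)) p else 0) - mask A (\<Gamma> m l) p)"
  have call0: "(0, l, r) \<in> calls" if "l \<in> {1..N 0 - r}" "r \<le> 1" for l r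
    using that unfolding ada_calls_def by (cases r) auto
  have callm: "(m, l, 1) \<in> calls" if "1 \<le> m" "m < S" "l \<in> {1..<N m}" for m l
    using that unfolding ada_calls_def by auto
  have E0b: "op_bounded D (E0 r) e0" if "r \<le> 1" for r
    unfolding E0_def
    by (rule op_bounded_level[where kk = "k 0" and r = r]) (use e0 call0 that in \<open>auto simp: mask_def blk_def\<close>)
  have Eb: "op_bounded D (E m) (?b m)" if m: "1 \<le> m" for m
    unfolding E_def
  proof (rule op_bounded_level[where kk = "k m" and r = 1])
    show "0 \<le> ?b m" using s[of "m - 1"] tau[of m] by auto
    obtain m' where m': "m = Suc m'" using m by (cases m) auto
    fix l assume l: "l \<in> {1..<N m}"
    have T: "op_bounded D (mask A (\<Gamma> m l)) (2 * s (m - 1))"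
      unfolding m' using op_bounded_Gamma_class[OF _ A(1) cls s, of l m' m'] l by simp
    show "op_bounded D (\<lambda>p. (if m < S then ada_piece C0 L1 c0 n d \<rho> (m, l, 1) (Y (m, l, 1)) p else 0) - mask A (\<Gamma> m l) p) (?b m)"
    proof (cases "m < S")
      case True
      have "op_bounded D (mask (\<lambda>p. Y (m, l, 1) p - A p) (\<Gamma> m l)) (2 * (?\<tau> m / 4))"
        using op_bounded_Gamma[of l "\<lambda>p. Y (m, l, 1) p - A p" m' "?\<tau> m / 4"] e[OF callm[OF m True l] m] l tau[of m] m' by simp
      moreover have "mask (\<lambda>p. Y (m, l, 1) p - A p) (\<Gamma> m l) = (\<lambda>p. mask (Y (m, l, 1)) (\<Gamma> m l) p - mask A (\<Gamma> m l) p)"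
        by (auto simp: mask_def)
      ultimately have w: "op_bounded D (\<lambda>p. mask (Y (m, l, 1)) (\<Gamma> m l) p - mask A (\<Gamma> m l) p) (?\<tau> m / 2)" by simp
      have "op_bounded D (\<lambda>p. (if spec_norm D (mask (Y (m, l, 1)) (\<Gamma> m l)) > ?\<tau> m then mask (Y (m, l, 1)) (\<Gamma> m l) else (\<lambda>_. 0)) p
          - mask A (\<Gamma> m l) p) (min (3 / 2 * ?\<tau> m) (2 * s (m - 1)))"
        by (rule threshold_error[OF w _ _ T]) (use tau[of m] s in auto)
      then show ?thesis using True m by (simp add: ada_piece_def Let_def)
    next
      case False
      then show ?thesis using op_bounded_scale[OF T, of "-1"] by simp
    qed
    show "(if m < S then ada_piece C0 L1 c0 n d \<rho> (m, l, 1) (Y (m, l, 1)) p else 0) - mask A (\<Gamma> m l) p = 0"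
      if "p \<notin> idx (k m) l \<times> idx (k m) (l + 1)" for p
      using that Gamma_subset[OF m, of l] m by (auto simp: ada_piece_def Let_def mask_def)
  qed auto
  have upper: "mask B (blk (k m) l 1) (i, j) = 0" if "j \<le> i" for B :: rmat and m l i j
    using that by (auto simp: mask_def blk_def idx_def)
  have E01s: "op_bounded D (\<lambda>(i, j). E0 1 (min i j, max i j)) (2 * e0)"
    by (rule op_bounded_symmetrize_upper[OF E0b]) (auto simp: E0_def intro!: sum.neutral upper)
  have Ems: "op_bounded D (\<lambda>(i, j). E m (min i j, max i j)) (2 * ?b m)" if m: "1 \<le> m" for m
  proof (rule op_bounded_symmetrize_upper[OF Eb[OF m]])
    fix i j :: nat assume ji: "j \<le> i"
    have "(i, j) \<notin> \<Gamma> m l" for l using Gamma_subset[OF m, of l] ji by (auto simp: idx_def)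
    then show "E m (i, j) = 0" using m by (auto simp: E_def ada_piece_def Let_def mask_def intro!: sum.neutral)
  qed
  have E00s: "op_bounded D (\<lambda>(i, j). E0 0 (min i j, max i j)) e0"
  proof -
    have "E0 0 (min i j, max i j) = E0 0 (i, j)" for i j
    proof (cases "i \<le> j")
      case False
      have "E0 0 (j, i) = E0 0 (i, j)"
        unfolding E0_def
      proof (intro sum.cong refl)
        fix l assume l: "l \<in> {1..N 0 - 0}"
        then have c: "(0, l, 0) \<in> calls" by (intro call0) auto
        show "mask (\<lambda>p. Y (0, l, 0) p - A p) (blk (k 0) l 0) (j, i) = mask (\<lambda>p. Y (0, l, 0) p - A p) (blk (k 0) l 0) (i, j)"
          using sym[OF c, of j i] A(2)[of i j] by (auto simp: mask_def blk_def)
      qed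
      then show ?thesis using False by (simp add: min_def max_def)
    qed (simp add: min_def max_def)
    then have "(\<lambda>(i, j). E0 0 (min i j, max i j)) = E0 0" by auto
    then show ?thesis using E0b[of 0] by simp
  qed
  have total: "op_bounded D (\<lambda>p. (case p of (i, j) \<Rightarrow> E0 0 (min i j, max i j)) + (case p of (i, j) \<Rightarrow> E0 1 (min i j, max i j))
      + (\<Sum>m\<in>{1..J}. case p of (i, j) \<Rightarrow> E m (min i j, max i j))) (e0 + 2 * e0 + (\<Sum>m\<in>{1..J}. 2 * ?b m))"
    by (intro op_bounded_add op_bounded_sum E00s E01s Ems) auto
  have eq: "ada_assemble C0 L1 c0 n d \<rho> Y p - A p = (case p of (i, j) \<Rightarrow> E0 0 (min i j, max i j)) + (case p of (i, j) \<Rightarrow> E0 1 (min i j, max i j))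
      + (\<Sum>m\<in>{1..J}. case p of (i, j) \<Rightarrow> E m (min i j, max i j))" if p: "p \<in> {1..d} \<times> {1..d}" for p
  proof -
    obtain i j where ij: "p = (i, j)" "i \<in> {1..d}" "j \<in> {1..d}" using p by auto
    let ?q = "(min i j, max i j)"
    have q: "min i j \<in> {1..D}" "max i j \<in> {1..D}" "min i j \<le> max i j" using ij d_le_D by auto
    have "A p = A ?q" using A(2)[of i j] by (simp add: ij min_def max_def)
    also have "\<dots> = (\<Sum>l\<in>{1..N 0}. mask A (blk (k 0) l 0) ?q) + (\<Sum>l\<in>{1..<N 0}. mask A (blk (k 0) l 1) ?q)
     + (\<Sum>m\<in>{1..J}. \<Sum>l\<in>{1..<N m}. mask A (\<Gamma> m l) ?q)" by (rule decompose[OF q])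
    finally have Ap: "A p = \<dots>" .
    have "ada_assemble C0 L1 c0 n d \<rho> Y p = (\<Sum>c\<in>calls. ada_piece C0 L1 c0 n d \<rho> c (Y c) ?q)"
      using ij by (simp add: ada_assemble_def)
    also have "\<dots> = (\<Sum>l\<in>{1..N 0}. mask (Y (0, l, 0)) (blk (k 0) l 0) ?q) + (\<Sum>l\<in>{1..<N 0}. mask (Y (0, l, 1)) (blk (k 0) l 1) ?q)
      + (\<Sum>m\<in>{1..<S}. \<Sum>l\<in>{1..<N m}. ada_piece C0 L1 c0 n d \<rho> (m, l, 1) (Y (m, l, 1)) ?q)"
      by (subst sum_calls) (simp add: ada_piece_def)
    also have "(\<Sum>m\<in>{1..<S}. \<Sum>l\<in>{1..<N m}. ada_piece C0 L1 c0 n d \<rho> (m, l, 1) (Y (m, l, 1)) ?q) =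
        (\<Sum>m\<in>{1..J}. \<Sum>l\<in>{1..<N m}. if m < S then ada_piece C0 L1 c0 n d \<rho> (m, l, 1) (Y (m, l, 1)) ?q else 0)"
      by (rule sum.mono_neutral_cong_left) (use S_le_J in auto)
    finally have "ada_assemble C0 L1 c0 n d \<rho> Y p - A p =
        ((\<Sum>l\<in>{1..N 0}. mask (Y (0, l, 0)) (blk (k 0) l 0) ?q) - (\<Sum>l\<in>{1..N 0}. mask A (blk (k 0) l 0) ?q))
        + ((\<Sum>l\<in>{1..<N 0}. mask (Y (0, l, 1)) (blk (k 0) l 1) ?q) - (\<Sum>l\<in>{1..<N 0}. mask A (blk (k 0) l 1) ?q))
        + ((\<Sum>m\<in>{1..J}. \<Sum>l\<in>{1..<N m}. if m < S then ada_piece C0 L1 c0 n d \<rho> (m, l, 1) (Y (m, l, 1)) ?q else 0)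
           - (\<Sum>m\<in>{1..J}. \<Sum>l\<in>{1..<N m}. mask A (\<Gamma> m l) ?q))"
      unfolding Ap by simp
    moreover have "{1..N 0 - 1} = {1..<N 0}" by auto
    moreover have "mask (\<lambda>p. B p - A p) R x = mask B R x - mask A R x" for B R x by (simp add: mask_def)
    ultimately show ?thesis unfolding ij E0_def E_def by (simp add: sum_subtractf[symmetric])
  qed
  have "op_bounded d (\<lambda>p. ada_assemble C0 L1 c0 n d \<rho> Y p - A p) (e0 + 2 * e0 + (\<Sum>m\<in>{1..J}. 2 * ?b m))"
    using op_bounded_restrict_dim[OF d_le_D total] eq by (subst op_bounded_cong[of d]) auto
  moreover have "0 \<le> ?b m" for m using s[of "m - 1"] tau[of m] by auto
  ultimately have "spec_norm d (\<lambda>p. ada_assemble C0 L1 c0 n d \<rho> Y p - A p) \<le> e0 + 2 * e0 + (\<Sum>m\<in>{1..J}. 2 * ?b m)"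
    using e0 by (intro spec_norm_le add_nonneg_nonneg sum_nonneg) auto
  then show ?thesis by (simp add: sum_distrib_left)
qed

end

section \<open>Summing the errors of the scales to the rate\<close>

lemma sum_geometric_le:
  assumes B: "finite B" and r: "0 \<le> r" "r < (1::real)"
  shows "(\<Sum>j\<in>B. r ^ j) \<le> 1 / (1 - r)"
proof -
  have "(\<Sum>j\<in>B. r ^ j) \<le> (\<Sum>j. r ^ j)"
    using r by (intro sum_le_suminf B summable_geometric) auto
  also have "\<dots> = 1 / (1 - r)" using r by (intro suminf_geometric) auto
  finally show ?thesis .
qed

definition geo :: "real \<Rightarrow> real" where "geo \<beta> = 1 / (1 - 2 powr (- \<beta>))"

lemma geo_pos: "0 < \<beta> \<Longrightarrow> 0 < geo \<beta>"
  using powr_less_cancel_iff[of 2 "- \<beta>" 0] by (simp add: geo_def)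

lemma powr_two_power: "(2 ^ j) powr \<beta> = (2 powr \<beta>) ^ j" for \<beta> :: real
  by (simp add: powr_power powr_realpow[symmetric] powr_powr mult.commute)

context ada_setup
begin

lemma real_k_pos: "0 < real (k m)"
  using k_pos[of m] by simp

lemma sum_powr_up:
  assumes A: "finite A" and t: "\<And>m. m \<in> A \<Longrightarrow> real (k m) \<le> t" and \<beta>: "0 < \<beta>" and t0: "0 \<le> t"
  shows "(\<Sum>m\<in>A. real (k m) powr \<beta>) \<le> geo \<beta> * t powr \<beta>"
proof (cases "A = {}")
  case True then show ?thesis using geo_pos[OF \<beta>] by simp
next
  case False
  define M where "M = Max A"
  have M: "M \<in> A" "\<And>m. m \<in> A \<Longrightarrow> m \<le> M" using A False by (auto simp: M_def)
  let ?r = "2 powr (- \<beta>)"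
  have r: "0 \<le> ?r" "?r < 1" using \<beta> powr_less_cancel_iff[of 2 "- \<beta>" 0] by auto
  have "(\<Sum>m\<in>A. real (k m) powr \<beta>) = (\<Sum>m\<in>A. real (k M) powr \<beta> * ?r ^ (M - m))"
  proof (rule sum.cong[OF refl])
    fix m assume m: "m \<in> A"
    have "real (k M) = 2 ^ (M - m) * real (k m)" using k_add[of m "M - m"] M(2)[OF m] by simp
    then have "real (k M) powr \<beta> = (2 powr \<beta>) ^ (M - m) * real (k m) powr \<beta>"
      by (simp add: powr_mult powr_two_power)
    then show "real (k m) powr \<beta> = real (k M) powr \<beta> * ?r ^ (M - m)"
      by (simp add: powr_minus power_inverse field_simps)
  qed
  also have "\<dots> = real (k M) powr \<beta> * (\<Sum>m\<in>A. ?r ^ (M - m))" by (simp add: sum_distrib_left)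
  also have "(\<Sum>m\<in>A. ?r ^ (M - m)) = (\<Sum>j\<in>(\<lambda>m. M - m) ` A. ?r ^ j)"
  proof (subst sum.reindex)
    show "inj_on (\<lambda>m. M - m) A" by (rule inj_onI) (metis M(2) diff_diff_cancel)
  qed simp
  also have "real (k M) powr \<beta> * (\<Sum>j\<in>(\<lambda>m. M - m) ` A. ?r ^ j) \<le> t powr \<beta> * geo \<beta>"
    unfolding geo_def using A r t[OF M(1)] \<beta>
    by (intro mult_mono sum_geometric_le powr_mono2) (auto intro!: sum_nonneg)
  finally show ?thesis by (simp add: mult.commute)
qed

lemma sum_powr_down:
  assumes A: "finite A" and t: "\<And>m. m \<in> A \<Longrightarrow> t \<le> real (k m)" and \<alpha>: "0 < \<alpha>" and t0: "0 < t"
  shows "(\<Sum>m\<in>A. real (k m) powr (- \<alpha>)) \<le> geo \<alpha> * t powr (- \<alpha>)"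
proof (cases "A = {}")
  case True then show ?thesis using geo_pos[OF \<alpha>] by simp
next
  case False
  define M where "M = Min A"
  have M: "M \<in> A" "\<And>m. m \<in> A \<Longrightarrow> M \<le> m" using A False by (auto simp: M_def)
  let ?r = "2 powr (- \<alpha>)"
  have r: "0 \<le> ?r" "?r < 1" using \<alpha> powr_less_cancel_iff[of 2 "- \<alpha>" 0] by auto
  have "(\<Sum>m\<in>A. real (k m) powr (- \<alpha>)) = (\<Sum>m\<in>A. real (k M) powr (- \<alpha>) * ?r ^ (m - M))"
  proof (rule sum.cong[OF refl])
    fix m assume m: "m \<in> A"
    have "real (k m) = 2 ^ (m - M) * real (k M)" using k_add[of M "m - M"] M(2)[OF m] by simp
    then show "real (k m) powr (- \<alpha>) = real (k M) powr (- \<alpha>) * ?r ^ (m - M)"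
      by (simp add: powr_mult powr_two_power)
  qed
  also have "\<dots> = real (k M) powr (- \<alpha>) * (\<Sum>m\<in>A. ?r ^ (m - M))" by (simp add: sum_distrib_left)
  also have "(\<Sum>m\<in>A. ?r ^ (m - M)) = (\<Sum>j\<in>(\<lambda>m. m - M) ` A. ?r ^ j)"
  proof (subst sum.reindex)
    show "inj_on (\<lambda>m. m - M) A" by (rule inj_onI) (metis M(2) le_add_diff_inverse)
  qed simp
  also have "real (k M) powr (- \<alpha>) * (\<Sum>j\<in>(\<lambda>m. m - M) ` A. ?r ^ j) \<le> t powr (- \<alpha>) * geo \<alpha>"
    unfolding geo_def using A r t[OF M(1)] \<alpha> t0 real_k_pos
    by (intro mult_mono sum_geometric_le powr_mono2') (auto intro!: sum_nonneg)
  finally show ?thesis by (simp add: mult.commute)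
qed

text \<open>
  Below the crossing point \<open>t\<close> the growing term is used and above it the decaying one; both
  geometric sums are dominated by their terms next to \<open>t\<close>.
\<close>

lemma sum_min_crossing:
  assumes A: "finite A" and \<alpha>: "0 < \<alpha>" and \<beta>: "0 < \<beta>" and t: "0 < t" and a: "0 \<le> a" and b: "0 \<le> b"
  shows "(\<Sum>m\<in>A. min (a * real (k m) powr \<beta>) (b * real (k m) powr (- \<alpha>))) \<le> a * (geo \<beta> * t powr \<beta>) + b * (geo \<alpha> * t powr (- \<alpha>))"
proof -
  let ?f = "\<lambda>m. min (a * real (k m) powr \<beta>) (b * real (k m) powr (- \<alpha>))"
  let ?A1 = "{m \<in> A. real (k m) \<le> t}" and ?A2 = "{m \<in> A. \<not> real (k m) \<le> t}"
  have "(\<Sum>m\<in>A. ?f m) = (\<Sum>m\<in>?A1. ?f m) + (\<Sum>m\<in>?A2. ?f m)"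
    by (subst sum.union_disjoint[symmetric]) (auto intro!: sum.cong A finite_subset[OF _ A])
  also have "\<dots> \<le> (\<Sum>m\<in>?A1. a * real (k m) powr \<beta>) + (\<Sum>m\<in>?A2. b * real (k m) powr (- \<alpha>))"
    by (intro add_mono sum_mono) auto
  also have "\<dots> \<le> a * (geo \<beta> * t powr \<beta>) + b * (geo \<alpha> * t powr (- \<alpha>))"
    unfolding sum_distrib_left[symmetric] using A t
    by (intro add_mono mult_left_mono sum_powr_up sum_powr_down a b \<alpha> \<beta>) auto
  finally show ?thesis .
qed

lemma sum_min_saturated:
  assumes A: "finite A" "\<And>m. m \<in> A \<Longrightarrow> k m \<le> D" and \<beta>: "0 < \<beta>" and a: "0 \<le> a"
  shows "(\<Sum>m\<in>A. min (a * real (k m) powr \<beta>) (g m)) \<le> a * (geo \<beta> * (2 * real d) powr \<beta>)"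
proof -
  have "(\<Sum>m\<in>A. min (a * real (k m) powr \<beta>) (g m)) \<le> a * (\<Sum>m\<in>A. real (k m) powr \<beta>)"
    unfolding sum_distrib_left by (intro sum_mono) auto
  also have "\<dots> \<le> a * (geo \<beta> * (2 * real d) powr \<beta>)"
  proof (intro mult_left_mono sum_powr_up A(1) \<beta> a)
    fix m assume "m \<in> A"
    then have "k m \<le> 2 * d" using A(2) D_le order_trans by blast
    then show "real (k m) \<le> 2 * real d" by linarith
  qed auto
  finally show ?thesis .
qed

lemma S_le_ln:
  assumes n3: "3 \<le> n" and c0: "c0 \<le> 1"
  shows "real S \<le> 3 * ln (real n)"
proof -
  have e: "1 \<le> ln (real n)"
    using n3 exp_le ln_le_cancel_iff[of "exp 1" "real n"] by (simp add: order_trans[of "exp 1" 3])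
  show ?thesis
  proof (cases "S = 1")
    case True then show ?thesis using e by simp
  next
    case False
    then have S1: "S - 1 < S" "S - 1 \<noteq> 0" using S_pos by auto
    have "real (2 ^ (S - 1)) \<le> real (k (S - 1))"
      unfolding of_nat_le_iff using k_eq[of "S - 1"] k_0_pos by simp
    also have "\<dots> \<le> c0 * real n" using k_le_of_less_S(1)[OF S1(1)] S1(2) by simp
    also have "\<dots> \<le> real n" using mult_right_mono[OF c0, of "real n"] by simp
    finally have "ln (2 ^ (S - 1)) \<le> ln (real n)" using n by simp
    then have "real (S - 1) * ln 2 \<le> ln (real n)" by (simp add: ln_realpow)
    moreover have "real (S - 1) * (1 / 2) \<le> real (S - 1) * ln 2"
      using ln2_ge_two_thirds by (intro mult_left_mono) auto
    ultimately show ?thesis using e S_pos by (simp add: of_nat_diff)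
  qed
qed

text \<open>
  If there is a second scale, then the initial block size was not capped by the dimension.
\<close>

lemma k_ge_of_thresholded:
  assumes "1 \<le> m" "m < S"
  shows "C0 * ln (real n) \<le> real (k 0)"
proof -
  have "1 \<le> J" using less_S_le_J[OF assms(2)] assms(1) by simp
  then have "\<not> d \<le> k 0" using not_less_Least[of 0 "\<lambda>J. d \<le> k J"] unfolding ada_J_def by simp
  then have "k 0 = nat \<lceil>C0 * ln (real n)\<rceil>" by (simp add: ada_k_def min_def split: if_splits)
  then show ?thesis by linarith
qed

lemma k_0_le_ln:
  assumes "1 \<le> C0" "3 \<le> n"
  shows "real (k 0) \<le> 2 * C0 * ln (real n)"
proof -
  have e: "1 \<le> ln (real n)"
    using assms exp_le ln_le_cancel_iff[of "exp 1" "real n"] by (simp add: order_trans[of "exp 1" 3])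
  have "1 * 1 \<le> C0 * ln (real n)" using assms(1) e by (intro mult_mono) auto
  moreover have "real (k 0) \<le> real (nat \<lceil>C0 * ln (real n)\<rceil>)" by (simp add: ada_k_def)
  moreover have "real (nat \<lceil>C0 * ln (real n)\<rceil>) \<le> C0 * ln (real n) + 1"
    using calculation(1) by linarith
  ultimately show ?thesis by linarith
qed

abbreviation "priv_noise \<rho> \<equiv> real d * ln (real n) / (\<rho> * (real n)\<^sup>2)"

text \<open>
  The variance of the privacy noise in a block, times its side. The \<open>D / k\<close> calls of a
  scale share its budget, so one of the three factors \<open>k\<close> is replaced by \<open>D \<le> 2 d\<close>; the division
  of \<open>\<rho>\<close> among the scales accounts for the logarithm.
\<close>

lemma cube_over_rho_le:
  assumes \<rho>: "0 < \<rho>" and n3: "3 \<le> n" and c0: "c0 \<le> 1" and m: "m \<le> J"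
  shows "real (k m) ^ 3 / (ada_rho C0 c0 n d \<rho> m * (real n)\<^sup>2) \<le> 12 * (real (k m))\<^sup>2 * priv_noise \<rho>"
proof -
  have N: "real (N m) * real (k m) = real D" using N_mult_k[OF m] by (metis of_nat_mult)
  have Npos: "0 < real (N m)" using N_pos[OF m] by simp
  have Spos: "0 < real S" using S_pos by simp
  have r: "\<rho> / (2 * real S * real (N m)) \<le> ada_rho C0 c0 n d \<rho> m"
    using \<rho> Npos Spos N_pos[of 0] by (cases "m = 0") (auto simp: ada_rho_def field_simps)
  have "real (k m) ^ 3 / (ada_rho C0 c0 n d \<rho> m * (real n)\<^sup>2) \<le> real (k m) ^ 3 / (\<rho> / (2 * real S * real (N m)) * (real n)\<^sup>2)"
    using r \<rho> Npos Spos n by (intro divide_left_mono mult_right_mono mult_pos_pos) (auto intro!: ada_rho_pos m)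
  also have "\<dots> = (real (k m))\<^sup>2 * (2 * real S * (real (N m) * real (k m)) / (\<rho> * (real n)\<^sup>2))"
    using Npos Spos \<rho> by (simp add: field_simps power2_eq_square power3_eq_cube)
  also have "\<dots> = (real (k m))\<^sup>2 * (2 * real S * real D / (\<rho> * (real n)\<^sup>2))" unfolding N ..
  also have "\<dots> \<le> (real (k m))\<^sup>2 * (2 * (3 * ln (real n)) * (2 * real d) / (\<rho> * (real n)\<^sup>2))"
    using S_le_ln[OF n3 c0] D_le \<rho> n by (intro mult_left_mono divide_right_mono mult_mono) auto
  finally show ?thesis by (simp add: field_simps)
qed

lemma sqrt_bound_split:
  assumes x: "0 \<le> x" and y: "0 \<le> y" and z: "z\<^sup>2 \<le> c * (x\<^sup>2 + y\<^sup>2)" and c: "0 \<le> c"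
  shows "z \<le> sqrt c * (x + y)"
proof -
  have "x\<^sup>2 + y\<^sup>2 \<le> (x + y)\<^sup>2" using x y by (simp add: power2_sum)
  then have "z\<^sup>2 \<le> c * (x + y)\<^sup>2" using z mult_left_mono[OF _ c] order_trans by blast
  then have "z\<^sup>2 \<le> (sqrt c * (x + y))\<^sup>2" using c by (simp add: power_mult_distrib)
  then show ?thesis by (rule power2_le_imp_le) (use x y c in auto)
qed

text \<open>
  The logarithm of the dimension is of the order of the smallest block, and \<open>exp (- 2 k)\<close> is below
  \<open>1/n\<close>, so both disappear into the main terms.
\<close>

lemma tau_le:
  assumes \<rho>: "0 < \<rho>" and n3: "3 \<le> n" and c0: "c0 \<le> 1" and C01: "1 \<le> C0" and L1: "0 \<le> L1" and w: "0 \<le> w"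
    and lnD: "ln (real D) \<le> w * real (k 0)" and m: "1 \<le> m" "m < S"
  shows "ada_tau C0 L1 c0 n d \<rho> m \<le> sqrt (12 * L1 * (2 + w)) * (sqrt (real (k m) / real n) + real (k m) * sqrt (priv_noise \<rho>))"
proof (rule sqrt_bound_split)
  have mJ: "m \<le> J" using less_S_le_J[OF m(2)] .
  have L0: "0 \<le> priv_noise \<rho>" using \<rho> n by simp
  have k0m: "real (k 0) \<le> real (k m)" using k_mono[of 0 m] by simp
  have D0: "0 \<le> ln (real D)" using D_pos by simp
  have wk: "ln (real D) \<le> w * real (k m)" using lnD mult_left_mono[OF k0m w] by linarith
  let ?k = "real (k m)" and ?r = "ada_rho C0 c0 n d \<rho> m * (real n)\<^sup>2"
  have r: "0 < ?r" using ada_rho_pos[OF \<rho> mJ] n by simp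
  have 1: "(?k + ln (real D)) / real n \<le> (1 + w) * (?k / real n)"
    using wk by (simp add: field_simps divide_right_mono)
  have "?k\<^sup>2 * (?k + ln (real D)) \<le> ?k\<^sup>2 * ((1 + w) * ?k)" using wk by (intro mult_left_mono) (auto simp: algebra_simps)
  then have "?k\<^sup>2 * (?k + ln (real D)) / ?r \<le> (1 + w) * (?k ^ 3 / ?r)"
    using r by (simp add: divide_right_mono power2_eq_square power3_eq_cube mult_ac)
  also have "\<dots> \<le> (1 + w) * (12 * ?k\<^sup>2 * priv_noise \<rho>)"
    using w by (intro mult_left_mono cube_over_rho_le \<rho> n3 c0 mJ) auto
  finally have 2: "?k\<^sup>2 * (?k + ln (real D)) / ?r \<le> (1 + w) * (12 * ?k\<^sup>2 * priv_noise \<rho>)" .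
  have "ln (real n) \<le> C0 * ln (real n)" using C01 n by (simp add: mult_le_cancel_right1)
  also have "\<dots> \<le> 2 * ?k" using k_ge_of_thresholded[OF m] k0m by linarith
  finally have "exp (- 2 * ?k) \<le> exp (- ln (real n))" by simp
  also have "\<dots> = 1 / real n" using n by (simp add: exp_minus inverse_eq_divide)
  also have "\<dots> \<le> ?k / real n" using k_pos[of m] by (simp add: divide_right_mono)
  finally have 3: "exp (- 2 * ?k) \<le> ?k / real n" .
  have T2: "(ada_tau C0 L1 c0 n d \<rho> m)\<^sup>2 = L1 * ((?k + ln (real D)) / real n + ?k\<^sup>2 * (?k + ln (real D)) / ?r + exp (- 2 * ?k))"
    unfolding ada_tau_def Let_def using L1 D0 r by (intro real_sqrt_pow2) (auto intro!: mult_nonneg_nonneg add_nonneg_nonneg divide_nonneg_nonneg)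
  also have "\<dots> \<le> L1 * ((1 + w) * (?k / real n) + (1 + w) * (12 * ?k\<^sup>2 * priv_noise \<rho>) + ?k / real n)"
    by (intro mult_left_mono add_mono 1 2 3 L1)
  also have "\<dots> \<le> L1 * (12 * (2 + w) * (?k / real n) + 12 * (2 + w) * (?k\<^sup>2 * priv_noise \<rho>))"
  proof (intro mult_left_mono L1)
    have a: "0 \<le> ?k / real n" "0 \<le> ?k\<^sup>2 * priv_noise \<rho>" using mult_nonneg_nonneg[OF zero_le_power2 L0] by auto
    have "0 \<le> (22 + 11 * w) * (?k / real n) + 12 * (?k\<^sup>2 * priv_noise \<rho>)"
      by (intro add_nonneg_nonneg mult_nonneg_nonneg[OF _ a(1)] mult_nonneg_nonneg[OF _ a(2)]) (use w in auto)
    also have "\<dots> = 12 * (2 + w) * (?k / real n) + 12 * (2 + w) * (?k\<^sup>2 * priv_noise \<rho>)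
        - ((1 + w) * (?k / real n) + (1 + w) * (12 * ?k\<^sup>2 * priv_noise \<rho>) + ?k / real n)"
      by (simp only: distrib_right distrib_left mult.assoc) simp
    finally show "(1 + w) * (?k / real n) + (1 + w) * (12 * ?k\<^sup>2 * priv_noise \<rho>) + ?k / real n
        \<le> 12 * (2 + w) * (?k / real n) + 12 * (2 + w) * (?k\<^sup>2 * priv_noise \<rho>)"
      by simp
  qed
  also have "\<dots> = 12 * L1 * (2 + w) * ((sqrt (?k / real n))\<^sup>2 + (?k * sqrt (priv_noise \<rho>))\<^sup>2)"
  proof -
    have "(sqrt (?k / real n))\<^sup>2 = ?k / real n" "(?k * sqrt (priv_noise \<rho>))\<^sup>2 = ?k\<^sup>2 * priv_noise \<rho>"
      using L0 by (auto simp: power_mult_distrib)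
    then show ?thesis by (simp only: distrib_left mult_ac)
  qed
  finally show "(ada_tau C0 L1 c0 n d \<rho> m)\<^sup>2 \<le> 12 * L1 * (2 + w) * ((sqrt (?k / real n))\<^sup>2 + (?k * sqrt (priv_noise \<rho>))\<^sup>2)" .
qed (use \<rho> n w L1 in auto)

lemma two_bias_eq: "1 \<le> m \<Longrightarrow> 2 * (M * real (k (m - 1)) powr (- \<alpha>)) = 2 * M * 2 powr \<alpha> * real (k m) powr (- \<alpha>)"
proof -
  assume "1 \<le> m"
  then have "real (k m) = 2 * real (k (m - 1))" using k_Suc[of "m - 1"] by simp
  then have "real (k m) powr (- \<alpha>) = 2 powr (- \<alpha>) * real (k (m - 1)) powr (- \<alpha>)"
    by (simp add: powr_mult)
  moreover have "2 powr \<alpha> * 2 powr (- \<alpha>) = (1 :: real)" by (simp add: powr_minus)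
  ultimately show ?thesis by simp
qed

lemma le_min_scaled: "x \<le> a * u \<Longrightarrow> x \<le> a * v \<Longrightarrow> x \<le> a * min u v" for x a u v :: real
  by (simp add: min_def)

lemma min_le_sum_min: "x \<le> a + b \<Longrightarrow> 0 \<le> a \<Longrightarrow> 0 \<le> b \<Longrightarrow> 0 \<le> c \<Longrightarrow> min x c \<le> min a c + min b c" for x a b c :: real
  unfolding min_def by auto

lemma collect_two_rates:
  "3 * (q * (x * s + y * p)) + 2 * (g * s + h * p + t * s) = (3 * q * x + 2 * g + 2 * t) * s + (3 * q * y + 2 * h) * p"
  for q x y s p g h t :: real
  by (simp add: algebra_simps)

text \<open>
  Square roots of the four quantities in the rate: \<open>u\<close> is the nonparametric and \<open>v\<close> the
  saturated regime, where even the largest blocks are estimated.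
\<close>

definition u_rate :: "real \<Rightarrow> real" where "u_rate \<alpha> = real n powr (- (\<alpha> / (2 * \<alpha> + 1)))"
definition v_rate :: real where "v_rate = sqrt (real d / real n)"
definition u_priv :: "real \<Rightarrow> real \<Rightarrow> real" where "u_priv \<alpha> \<rho> = priv_noise \<rho> powr (\<alpha> / (2 * (\<alpha> + 1)))"
definition v_priv :: "real \<Rightarrow> real" where "v_priv \<rho> = real d * sqrt (priv_noise \<rho>)"

lemma priv_noise_pos: "0 < \<rho> \<Longrightarrow> 0 < priv_noise \<rho>"
  using n d by simp

text \<open>
  The terms \<open>sqrt (k / n)\<close> and \<open>k powr (- \<alpha>)\<close> cross at \<open>k = n powr (1 / (2 * \<alpha> + 1))\<close>.
\<close>

lemma sum_statistical_le:
  assumes \<alpha>: "0 < \<alpha>" and T: "0 \<le> T" and b: "0 \<le> b"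
  shows "(\<Sum>m\<in>{1..<S}. min (T / sqrt (real n) * real (k m) powr (1 / 2)) (b * real (k m) powr (- \<alpha>)))
    \<le> (2 * T * geo (1 / 2) + b * geo \<alpha>) * min (u_rate \<alpha>) v_rate"
proof (rule le_min_scaled)
  let ?sum = "\<Sum>m\<in>{1..<S}. min (T / sqrt (real n) * real (k m) powr (1 / 2)) (b * real (k m) powr (- \<alpha>))"
  have n0: "0 < real n" using n by simp
  have g: "0 < geo (1 / 2)" "0 < geo \<alpha>" using geo_pos \<alpha> by auto
  let ?t = "real n powr (1 / (2 * \<alpha> + 1))"
  have sq: "sqrt (real n) = real n powr (1 / 2)" using n0 by (simp add: powr_half_sqrt)
  have "1 / sqrt (real n) * ?t powr (1 / 2) = real n powr (- (1 / 2) + 1 / (2 * \<alpha> + 1) * (1 / 2))"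
    unfolding sq powr_powr using n0 by (simp only: powr_add powr_minus inverse_eq_divide)
  also have "- (1 / 2) + 1 / (2 * \<alpha> + 1) * (1 / 2) = - (\<alpha> / (2 * \<alpha> + 1))" using \<alpha> by (simp add: field_simps)
  finally have 1: "1 / sqrt (real n) * ?t powr (1 / 2) = u_rate \<alpha>" by (simp add: u_rate_def)
  have 2: "?t powr (- \<alpha>) = u_rate \<alpha>" unfolding powr_powr u_rate_def by simp
  have "?sum \<le> T / sqrt (real n) * (geo (1 / 2) * ?t powr (1 / 2)) + b * (geo \<alpha> * ?t powr (- \<alpha>))"
    by (rule sum_min_crossing) (use \<alpha> T b n0 in auto)
  also have "T / sqrt (real n) * (geo (1 / 2) * ?t powr (1 / 2)) = T * geo (1 / 2) * (1 / sqrt (real n) * ?t powr (1 / 2))" by simp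
  also have "T * geo (1 / 2) * (1 / sqrt (real n) * ?t powr (1 / 2)) + b * (geo \<alpha> * ?t powr (- \<alpha>)) = (T * geo (1 / 2) + b * geo \<alpha>) * u_rate \<alpha>"
    unfolding 1 2 by (simp add: algebra_simps)
  also have "\<dots> \<le> (2 * T * geo (1 / 2) + b * geo \<alpha>) * u_rate \<alpha>"
    using T g by (intro mult_right_mono) (auto simp: u_rate_def)
  finally show "?sum \<le> (2 * T * geo (1 / 2) + b * geo \<alpha>) * u_rate \<alpha>" .
  have "?sum \<le> T / sqrt (real n) * (geo (1 / 2) * (2 * real d) powr (1 / 2))"
    by (rule sum_min_saturated) (use T k_le_of_less_S(2) in auto)
  also have "\<dots> = T * geo (1 / 2) * sqrt 2 * v_rate"
    by (simp add: v_rate_def powr_half_sqrt real_sqrt_mult real_sqrt_divide)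
  also have "\<dots> \<le> (2 * T * geo (1 / 2) + b * geo \<alpha>) * v_rate"
  proof (intro mult_right_mono)
    have "sqrt 2 \<le> sqrt (2\<^sup>2)" by (intro real_sqrt_le_mono) auto
    then have "T * geo (1 / 2) * sqrt 2 \<le> T * geo (1 / 2) * 2" using T g by (intro mult_left_mono) auto
    moreover have "0 \<le> b * geo \<alpha>" using b g by simp
    ultimately show "T * geo (1 / 2) * sqrt 2 \<le> 2 * T * geo (1 / 2) + b * geo \<alpha>" by linarith
  qed (simp add: v_rate_def)
  finally show "?sum \<le> (2 * T * geo (1 / 2) + b * geo \<alpha>) * v_rate" .
qed

text \<open>
  With \<open>L\<close> the privacy noise level, the terms \<open>k * sqrt L\<close> and \<open>k powr (- \<alpha>)\<close> cross at
  \<open>k = L powr (- 1 / (2 * (\<alpha> + 1)))\<close>.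
\<close>

lemma sum_privacy_le:
  assumes \<alpha>: "0 < \<alpha>" and T: "0 \<le> T" and b: "0 \<le> b" and \<rho>: "0 < \<rho>"
  shows "(\<Sum>m\<in>{1..<S}. min (T * sqrt (priv_noise \<rho>) * real (k m) powr 1) (b * real (k m) powr (- \<alpha>)))
    \<le> (2 * T * geo 1 + b * geo \<alpha>) * min (u_priv \<alpha> \<rho>) (v_priv \<rho>)"
proof (rule le_min_scaled)
  let ?sum = "\<Sum>m\<in>{1..<S}. min (T * sqrt (priv_noise \<rho>) * real (k m) powr 1) (b * real (k m) powr (- \<alpha>))"
  let ?L = "priv_noise \<rho>"
  have L: "0 < ?L" by (rule priv_noise_pos[OF \<rho>])
  have g: "0 < geo 1" "0 < geo \<alpha>" using geo_pos \<alpha> by auto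
  let ?t = "?L powr (- (1 / (2 * (\<alpha> + 1))))"
  have sq: "sqrt ?L = ?L powr (1 / 2)" using L by (simp add: powr_half_sqrt)
  have "sqrt ?L * ?t powr 1 = ?L powr (1 / 2 + - (1 / (2 * (\<alpha> + 1))))"
    unfolding sq powr_powr using L by (simp only: powr_add mult_1_right)
  also have "1 / 2 + - (1 / (2 * (\<alpha> + 1))) = \<alpha> / (2 * (\<alpha> + 1))" using \<alpha> by (simp add: field_simps)
  finally have 1: "sqrt ?L * ?t powr 1 = u_priv \<alpha> \<rho>" unfolding u_priv_def .
  have 2: "?t powr (- \<alpha>) = u_priv \<alpha> \<rho>" unfolding powr_powr u_priv_def by simp
  have "?sum \<le> T * sqrt ?L * (geo 1 * ?t powr 1) + b * (geo \<alpha> * ?t powr (- \<alpha>))"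
    by (rule sum_min_crossing) (use \<alpha> T b L d n in \<open>auto simp del: powr_one\<close>)
  also have "T * sqrt ?L * (geo 1 * ?t powr 1) = T * geo 1 * (sqrt ?L * ?t powr 1)" by (simp only: mult_ac)
  also have "T * geo 1 * (sqrt ?L * ?t powr 1) + b * (geo \<alpha> * ?t powr (- \<alpha>)) = (T * geo 1 + b * geo \<alpha>) * u_priv \<alpha> \<rho>"
    unfolding 1 2 by (simp add: algebra_simps)
  also have "\<dots> \<le> (2 * T * geo 1 + b * geo \<alpha>) * u_priv \<alpha> \<rho>"
    using T g by (intro mult_right_mono) (auto simp: u_priv_def)
  finally show "?sum \<le> (2 * T * geo 1 + b * geo \<alpha>) * u_priv \<alpha> \<rho>" .
  have "?sum \<le> T * sqrt ?L * (geo 1 * (2 * real d) powr 1)"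
    by (rule sum_min_saturated) (use T L k_le_of_less_S(2) in auto)
  also have "\<dots> = 2 * T * geo 1 * v_priv \<rho>" by (simp add: v_priv_def)
  also have "\<dots> \<le> (2 * T * geo 1 + b * geo \<alpha>) * v_priv \<rho>"
    using b g L by (intro mult_right_mono) (auto simp: v_priv_def)
  finally show "?sum \<le> (2 * T * geo 1 + b * geo \<alpha>) * v_priv \<rho>" .
qed

text \<open>
  Scales that are never estimated exist only if their blocks are larger than \<open>c\<^sub>0 n\<close>. Then \<open>d / n\<close> is
  bounded below, and dropping the blocks costs at most a multiple of \<open>n powr (- \<alpha>)\<close>, which is at
  most of the order of either regime of the statistical rate.
\<close>

lemma sum_tail_le:
  assumes \<alpha>: "0 < \<alpha>" and b: "0 \<le> b" and c0: "0 < c0" "c0 \<le> 1"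
  shows "(\<Sum>m\<in>{S..J}. b * real (k m) powr (- \<alpha>)) \<le> b * geo \<alpha> * c0 powr (- \<alpha>) * sqrt (2 / c0) * min (u_rate \<alpha>) v_rate"
proof (cases "S \<le> J")
  case False
  then show ?thesis using b geo_pos[OF \<alpha>] c0 by (simp add: u_rate_def v_rate_def)
next
  case True
  have n0: "1 \<le> real n" using n by simp
  let ?c = "b * geo \<alpha> * c0 powr (- \<alpha>)"
  have c: "0 \<le> ?c" using b geo_pos[OF \<alpha>] by simp
  have big: "c0 * real n < real (k S)" by (rule S_maximal[OF True])
  have "(\<Sum>m\<in>{S..J}. b * real (k m) powr (- \<alpha>)) \<le> b * (geo \<alpha> * (c0 * real n) powr (- \<alpha>))"
    unfolding sum_distrib_left[symmetric]
  proof (intro mult_left_mono sum_powr_down \<alpha> b)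
    fix m assume "m \<in> {S..J}"
    then have "k S \<le> k m" by (intro k_mono) auto
    then show "c0 * real n \<le> real (k m)" using big by linarith
  qed (use c0 n in auto)
  also have "\<dots> = ?c * real n powr (- \<alpha>)" using c0 by (simp add: powr_mult)
  finally have le: "(\<Sum>m\<in>{S..J}. b * real (k m) powr (- \<alpha>)) \<le> ?c * real n powr (- \<alpha>)" .
  have s1: "1 \<le> sqrt (2 / c0)" using c0 by simp
  have "real n powr (- \<alpha>) \<le> u_rate \<alpha>"
    unfolding u_rate_def using n0 \<alpha> by (intro powr_mono) (auto simp: field_simps)
  also have "\<dots> \<le> sqrt (2 / c0) * u_rate \<alpha>" using mult_right_mono[OF s1, of "u_rate \<alpha>"] by (simp add: u_rate_def)
  finally have 1: "real n powr (- \<alpha>) \<le> sqrt (2 / c0) * u_rate \<alpha>" .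
  have "real n powr (- \<alpha>) \<le> 1" using n0 \<alpha> powr_mono[of "- \<alpha>" 0 "real n"] by simp
  also have "1 \<le> sqrt (2 / c0) * v_rate"
  proof -
    have "k S \<le> D" using k_mono[OF True] D_eq by simp
    then have "c0 * real n \<le> 2 * real d" using big D_le by linarith
    then have "1 \<le> 2 / c0 * (real d / real n)" using c0 n by (simp add: field_simps)
    then have "sqrt 1 \<le> sqrt (2 / c0 * (real d / real n))" by (rule real_sqrt_le_mono)
    then show ?thesis by (simp only: v_rate_def real_sqrt_mult real_sqrt_one)
  qed
  finally have 2: "real n powr (- \<alpha>) \<le> sqrt (2 / c0) * v_rate" .
  have "?c * real n powr (- \<alpha>) \<le> ?c * (sqrt (2 / c0) * min (u_rate \<alpha>) v_rate)"
    by (intro mult_left_mono le_min_scaled 1 2 c)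
  then show ?thesis using le by (simp add: mult.assoc)
qed

lemma scale0_statistical_le:
  assumes \<alpha>: "0 < \<alpha>" and C01: "1 \<le> C0" and n3: "3 \<le> n"
  shows "sqrt (real (k 0) / real n) \<le> sqrt (2 * C0 * (2 * \<alpha> + 1)) * min (u_rate \<alpha>) v_rate"
proof (rule le_min_scaled)
  have n0: "0 < real n" using n by simp
  let ?e = "1 / (2 * \<alpha> + 1)"
  have "ln (real n) \<le> real n powr ?e / ?e" by (rule ln_powr_bound) (use n \<alpha> in auto)
  then have lnb: "ln (real n) \<le> (2 * \<alpha> + 1) * real n powr ?e" by (simp add: mult.commute)
  have "real (k 0) \<le> 2 * C0 * ln (real n)" by (rule k_0_le_ln[OF C01 n3])
  also have "\<dots> \<le> 2 * C0 * ((2 * \<alpha> + 1) * real n powr ?e)" by (intro mult_left_mono lnb) (use C01 in auto)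
  finally have "real (k 0) \<le> 2 * C0 * (2 * \<alpha> + 1) * real n powr ?e" by (simp only: mult.assoc)
  then have "real (k 0) / real n \<le> 2 * C0 * (2 * \<alpha> + 1) * real n powr ?e / real n" by (intro divide_right_mono) auto
  also have "\<dots> = 2 * C0 * (2 * \<alpha> + 1) * real n powr (?e - 1)" using n0 by (simp add: powr_diff)
  also have "?e - 1 = - (\<alpha> / (2 * \<alpha> + 1)) * 2" using \<alpha> by (simp add: field_simps)
  also have "real n powr (- (\<alpha> / (2 * \<alpha> + 1)) * 2) = (u_rate \<alpha>)\<^sup>2"
    using n0 unfolding u_rate_def powr_powr[symmetric] by (simp add: powr_numeral)
  finally have "sqrt (real (k 0) / real n) \<le> sqrt (2 * C0 * (2 * \<alpha> + 1) * (u_rate \<alpha>)\<^sup>2)" by (rule real_sqrt_le_mono)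
  also have "\<dots> = sqrt (2 * C0 * (2 * \<alpha> + 1)) * u_rate \<alpha>" by (simp add: real_sqrt_mult u_rate_def)
  finally show "sqrt (real (k 0) / real n) \<le> sqrt (2 * C0 * (2 * \<alpha> + 1)) * u_rate \<alpha>" .
  have "1 * 1 \<le> 2 * C0 * (2 * \<alpha> + 1)" using C01 \<alpha> by (intro mult_mono) auto
  then have s: "1 \<le> sqrt (2 * C0 * (2 * \<alpha> + 1))" by simp
  have "sqrt (real (k 0) / real n) \<le> 1 * v_rate"
    using k_0_le_d by (simp add: v_rate_def divide_right_mono)
  also have "\<dots> \<le> sqrt (2 * C0 * (2 * \<alpha> + 1)) * v_rate" by (intro mult_right_mono s) (simp add: v_rate_def)
  finally show "sqrt (real (k 0) / real n) \<le> sqrt (2 * C0 * (2 * \<alpha> + 1)) * v_rate" .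
qed

text \<open>
  The smallest blocks carry a privacy error \<open>k\<^sub>0 * sqrt L\<close> with \<open>k\<^sub>0\<close> of order \<open>ln n\<close>, which no
  threshold removes. The signal condition makes \<open>ln n * L powr (1 / (2 * \<alpha> + 2))\<close> bounded, and the
  remaining factor of \<open>sqrt L\<close> is \<open>L powr (\<alpha> / (2 * (\<alpha> + 1)))\<close>.
\<close>

lemma scale0_privacy_le:
  assumes \<alpha>: "0 < \<alpha>" and C01: "1 \<le> C0" and n3: "3 \<le> n" and \<rho>: "0 < \<rho>" and c: "0 < c"
    and signal: "c * ln (real n) powr (2 * \<alpha> + 3) \<le> \<rho> * (real n)\<^sup>2 / real d"
  shows "real (k 0) * sqrt (priv_noise \<rho>) \<le> (2 * C0 * (1 / c) powr (1 / (2 * \<alpha> + 2)) + 1) * min (u_priv \<alpha> \<rho>) (v_priv \<rho>)"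
proof (rule le_min_scaled)
  let ?L = "priv_noise \<rho>" and ?e = "1 / (2 * \<alpha> + 2)"
  have L: "0 < ?L" by (rule priv_noise_pos[OF \<rho>])
  have ln0: "0 < ln (real n)" using n by simp
  have q: "0 < \<rho> * (real n)\<^sup>2" using \<rho> n by simp
  have "?L * ln (real n) powr (2 * \<alpha> + 2) = real d / (\<rho> * (real n)\<^sup>2) * ln (real n) powr (1 + (2 * \<alpha> + 2))"
    using ln0 by (simp add: powr_add power2_eq_square power3_eq_cube)
  also have "1 + (2 * \<alpha> + 2) = 2 * \<alpha> + 3" by simp
  also have "real d / (\<rho> * (real n)\<^sup>2) * ln (real n) powr (2 * \<alpha> + 3) \<le> 1 / c"
    using signal q d c by (simp add: field_simps)
  finally have "(?L * ln (real n) powr (2 * \<alpha> + 2)) powr ?e \<le> (1 / c) powr ?e"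
    using \<alpha> by (intro powr_mono2 mult_nonneg_nonneg[OF less_imp_le[OF L]]) auto
  moreover have "(?L * ln (real n) powr (2 * \<alpha> + 2)) powr ?e = ?L powr ?e * ln (real n)"
  proof -
    have "(?L * ln (real n) powr (2 * \<alpha> + 2)) powr ?e = ?L powr ?e * (ln (real n) powr (2 * \<alpha> + 2)) powr ?e"
      by (rule powr_mult)
    also have "(ln (real n) powr (2 * \<alpha> + 2)) powr ?e = ln (real n)"
      unfolding powr_powr using \<alpha> ln0 by simp
    finally show ?thesis .
  qed
  ultimately have 1: "?L powr ?e * ln (real n) \<le> (1 / c) powr ?e" by simp
  have "sqrt ?L = ?L powr (?e + \<alpha> / (2 * (\<alpha> + 1)))"
  proof -
    have half: "?e + \<alpha> / (2 * (\<alpha> + 1)) = 1 / 2" using \<alpha> by (simp add: field_simps)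
    show ?thesis unfolding half using L by (simp add: powr_half_sqrt)
  qed
  also have "\<dots> = ?L powr ?e * u_priv \<alpha> \<rho>" unfolding u_priv_def by (rule powr_add)
  finally have sq: "sqrt ?L = ?L powr ?e * u_priv \<alpha> \<rho>" .
  have u0: "0 \<le> u_priv \<alpha> \<rho>" by (simp add: u_priv_def)
  have "real (k 0) * sqrt ?L \<le> 2 * C0 * ln (real n) * sqrt ?L"
    using k_0_le_ln[OF C01 n3] L by (intro mult_right_mono) auto
  also have "\<dots> = 2 * C0 * (?L powr ?e * ln (real n)) * u_priv \<alpha> \<rho>" unfolding sq by simp
  also have "\<dots> \<le> 2 * C0 * (1 / c) powr ?e * u_priv \<alpha> \<rho>"
    using C01 by (intro mult_right_mono mult_left_mono 1 u0) auto
  also have "\<dots> \<le> (2 * C0 * (1 / c) powr ?e + 1) * u_priv \<alpha> \<rho>" using u0 by (intro mult_right_mono) auto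
  finally show "real (k 0) * sqrt ?L \<le> (2 * C0 * (1 / c) powr ?e + 1) * u_priv \<alpha> \<rho>" .
  have "real (k 0) * sqrt ?L \<le> 1 * v_priv \<rho>"
    using k_0_le_d L by (simp add: v_priv_def mult_right_mono)
  also have "\<dots> \<le> (2 * C0 * (1 / c) powr ?e + 1) * v_priv \<rho>"
    using C01 L by (intro mult_right_mono) (auto simp: v_priv_def)
  finally show "real (k 0) * sqrt ?L \<le> (2 * C0 * (1 / c) powr ?e + 1) * v_priv \<rho>" .
qed

lemma min_power2: "0 \<le> a \<Longrightarrow> 0 \<le> b \<Longrightarrow> (min a b)\<^sup>2 = min (a\<^sup>2) (b\<^sup>2)" for a b :: real
  by (auto simp: min_def power2_le_iff_abs_le not_le dest: power_mono[of _ _ 2])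

lemma rate_eq:
  assumes \<rho>: "0 < \<rho>" and \<alpha>: "0 < \<alpha>"
  shows "rate \<alpha> n d \<rho> = (min (u_rate \<alpha>) v_rate)\<^sup>2 + (min (u_priv \<alpha> \<rho>) (v_priv \<rho>))\<^sup>2"
proof -
  have n0: "0 < real n" using n by simp
  have L: "0 < priv_noise \<rho>" by (rule priv_noise_pos[OF \<rho>])
  have "(u_rate \<alpha>)\<^sup>2 = real n powr (- (\<alpha> / (2 * \<alpha> + 1)) * 2)"
    using n0 unfolding u_rate_def powr_powr[symmetric] by (simp add: powr_numeral)
  then have 1: "(u_rate \<alpha>)\<^sup>2 = real n powr (- (2 * \<alpha> / (2 * \<alpha> + 1)))" by (simp add: mult.commute)
  have 2: "v_rate\<^sup>2 = real d / real n" by (simp add: v_rate_def)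
  have "(u_priv \<alpha> \<rho>)\<^sup>2 = priv_noise \<rho> powr (\<alpha> / (2 * (\<alpha> + 1)) * 2)"
    using L unfolding u_priv_def powr_powr[symmetric] by (simp add: powr_numeral)
  also have "\<alpha> / (2 * (\<alpha> + 1)) * 2 = \<alpha> / (\<alpha> + 1)" using \<alpha> by (simp add: field_simps)
  finally have 3: "(u_priv \<alpha> \<rho>)\<^sup>2 = priv_noise \<rho> powr (\<alpha> / (\<alpha> + 1))" .
  have 4: "(v_priv \<rho>)\<^sup>2 = real d ^ 3 * ln (real n) / (\<rho> * (real n)\<^sup>2)"
  proof -
    have s: "(sqrt (priv_noise \<rho>))\<^sup>2 = priv_noise \<rho>" using L by (intro real_sqrt_pow2) auto
    show ?thesis unfolding v_priv_def power_mult_distrib s by (simp add: power2_eq_square power3_eq_cube)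
  qed
  have nn: "0 \<le> u_rate \<alpha>" "0 \<le> v_rate" "0 \<le> u_priv \<alpha> \<rho>" "0 \<le> v_priv \<rho>"
    using L by (auto simp: u_rate_def v_rate_def u_priv_def v_priv_def)
  show ?thesis unfolding min_power2[OF nn(1,2)] min_power2[OF nn(3,4)] 1 2 3 4 rate_def ..
qed

lemma rate_ge: "0 < \<rho> \<Longrightarrow> 0 < \<alpha> \<Longrightarrow> 1 / real n \<le> rate \<alpha> n d \<rho>"
proof -
  assume \<rho>: "0 < \<rho>" and \<alpha>: "0 < \<alpha>"
  have n0: "1 \<le> real n" using n by simp
  have "1 / real n = real n powr (-1)" using n0 by (simp add: powr_minus_divide)
  also have "\<dots> \<le> real n powr (- (2 * \<alpha> / (2 * \<alpha> + 1)))"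
    using n0 \<alpha> by (intro powr_mono) (auto simp: field_simps)
  finally have "1 / real n \<le> min (real n powr (- (2 * \<alpha> / (2 * \<alpha> + 1)))) (real d / real n)"
    using d n0 by (simp add: divide_right_mono)
  moreover have "0 \<le> min (priv_noise \<rho> powr (\<alpha> / (\<alpha> + 1))) (real d ^ 3 * ln (real n) / (\<rho> * (real n)\<^sup>2))"
    using \<rho> n by simp
  ultimately show ?thesis unfolding rate_def by linarith
qed

text \<open>
  The loss on the good event when the error of a scale-zero block is \<open>e0\<close>; the norms of the true
  blocks enter through the class bound \<open>M * k powr (- \<alpha>)\<close>.
\<close>

definition total_bound :: "real \<Rightarrow> real \<Rightarrow> real \<Rightarrow> real \<Rightarrow> real \<Rightarrow> real" where
  "total_bound L1 \<rho> M \<alpha> e0 = 3 * e0 + 2 * (\<Sum>m\<in>{1..J}.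
     if m < S then min (3 / 2 * ada_tau C0 L1 c0 n d \<rho> m) (2 * (M * real (k (m - 1)) powr (- \<alpha>)))
     else 2 * (M * real (k (m - 1)) powr (- \<alpha>)))"

lemma total_bound_le:
  assumes \<rho>: "0 < \<rho>" and n3: "3 \<le> n" and c0: "0 < c0" "c0 \<le> 1" and C01: "1 \<le> C0" and L1: "0 \<le> L1" and w: "0 \<le> w"
    and lnD: "ln (real D) \<le> w * real (k 0)" and \<alpha>: "0 < \<alpha>" and M: "0 < M" and c: "0 < c" and Q: "0 \<le> Q"
    and signal: "c * ln (real n) powr (2 * \<alpha> + 3) \<le> \<rho> * (real n)\<^sup>2 / real d"
    and e0: "0 \<le> e0" "e0\<^sup>2 \<le> Q * (real (k 0) / real n + real (k 0) ^ 3 / (ada_rho C0 c0 n d \<rho> 0 * (real n)\<^sup>2))"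
  defines "T \<equiv> 3 / 2 * sqrt (12 * L1 * (2 + w))" and "b \<equiv> 2 * M * 2 powr \<alpha>"
  defines "A1 \<equiv> 3 * sqrt (12 * Q) * sqrt (2 * C0 * (2 * \<alpha> + 1)) + 2 * (2 * T * geo (1 / 2) + b * geo \<alpha>)
      + 2 * (b * geo \<alpha> * c0 powr (- \<alpha>) * sqrt (2 / c0))"
    and "A2 \<equiv> 3 * sqrt (12 * Q) * (2 * C0 * (1 / c) powr (1 / (2 * \<alpha> + 2)) + 1) + 2 * (2 * T * geo 1 + b * geo \<alpha>)"
  shows "(total_bound L1 \<rho> M \<alpha> e0)\<^sup>2 \<le> 2 * (A1\<^sup>2 + A2\<^sup>2) * rate \<alpha> n d \<rho>"
proof -
  let ?s = "min (u_rate \<alpha>) v_rate" and ?p = "min (u_priv \<alpha> \<rho>) (v_priv \<rho>)"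
  let ?\<tau> = "ada_tau C0 L1 c0 n d \<rho>"
  let ?b = "\<lambda>m. b * real (k m) powr (- \<alpha>)"
  have L: "0 < priv_noise \<rho>" by (rule priv_noise_pos[OF \<rho>])
  have T0: "0 \<le> T" using L1 w by (simp add: T_def)
  have b0: "0 \<le> b" using M by (simp add: b_def)
  have tau0: "0 \<le> ?\<tau> m" if "m \<le> J" for m
    unfolding ada_tau_def Let_def using L1 D_pos ada_rho_pos[OF \<rho> that]
    by (intro real_sqrt_ge_zero mult_nonneg_nonneg add_nonneg_nonneg divide_nonneg_nonneg) auto
  have bias: "2 * (M * real (k (m - 1)) powr (- \<alpha>)) = ?b m" if "1 \<le> m" for m
    using two_bias_eq[OF that, of M \<alpha>] by (simp add: b_def)
  have level: "min (3 / 2 * ?\<tau> m) (?b m) \<le> min (T / sqrt (real n) * real (k m) powr (1 / 2)) (?b m)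
      + min (T * sqrt (priv_noise \<rho>) * real (k m) powr 1) (?b m)" if m: "m \<in> {1..<S}" for m
  proof -
    have "?\<tau> m \<le> sqrt (12 * L1 * (2 + w)) * (sqrt (real (k m) / real n) + real (k m) * sqrt (priv_noise \<rho>))"
      by (rule tau_le[OF \<rho> n3 c0(2) C01 L1 w lnD]) (use m in auto)
    then have "3 / 2 * ?\<tau> m \<le> T * sqrt (real (k m) / real n) + T * (real (k m) * sqrt (priv_noise \<rho>))"
      unfolding T_def by (simp add: algebra_simps)
    also have "T * sqrt (real (k m) / real n) = T / sqrt (real n) * real (k m) powr (1 / 2)"
      by (simp add: powr_half_sqrt real_sqrt_divide)
    also have "T * (real (k m) * sqrt (priv_noise \<rho>)) = T * sqrt (priv_noise \<rho>) * real (k m) powr 1" by simp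
    finally have "3 / 2 * ?\<tau> m \<le> T / sqrt (real n) * real (k m) powr (1 / 2) + T * sqrt (priv_noise \<rho>) * real (k m) powr 1" .
    moreover have "0 \<le> T / sqrt (real n) * real (k m) powr (1 / 2)" "0 \<le> T * sqrt (priv_noise \<rho>) * real (k m) powr 1" "0 \<le> ?b m"
      using T0 L b0 by auto
    ultimately show ?thesis by (intro min_le_sum_min)
  qed
  define g where "g = (\<lambda>m. if m < S then min (3 / 2 * ?\<tau> m) (2 * (M * real (k (m - 1)) powr (- \<alpha>))) else 2 * (M * real (k (m - 1)) powr (- \<alpha>)))"
  have gJ: "(\<Sum>m\<in>{1..J}. g m) = (\<Sum>m\<in>{1..<S}. g m) + (\<Sum>m\<in>{S..J}. g m)"
  proof -
    have "{1..J} = {1..<S} \<union> {S..J}" using S_pos S_le_J by auto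
    then show ?thesis by (simp only:) (rule sum.union_disjoint, auto)
  qed
  have g1: "(\<Sum>m\<in>{1..<S}. g m) \<le> (\<Sum>m\<in>{1..<S}. min (T / sqrt (real n) * real (k m) powr (1 / 2)) (?b m)
      + min (T * sqrt (priv_noise \<rho>) * real (k m) powr 1) (?b m))"
  proof (rule sum_mono)
    fix m assume m: "m \<in> {1..<S}"
    then have "g m = min (3 / 2 * ?\<tau> m) (?b m)" using bias[of m] by (simp add: g_def)
    then show "g m \<le> min (T / sqrt (real n) * real (k m) powr (1 / 2)) (?b m) + min (T * sqrt (priv_noise \<rho>) * real (k m) powr 1) (?b m)"
      using level[OF m] by simp
  qed
  have g2: "(\<Sum>m\<in>{S..J}. g m) = (\<Sum>m\<in>{S..J}. ?b m)"
  proof (rule sum.cong[OF refl])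
    fix m assume m: "m \<in> {S..J}"
    then have "1 \<le> m" "\<not> m < S" using S_pos by auto
    then show "g m = ?b m" using bias[of m] by (simp add: g_def)
  qed
  have sum: "(\<Sum>m\<in>{1..J}. g m)
      \<le> (2 * T * geo (1 / 2) + b * geo \<alpha>) * ?s + (2 * T * geo 1 + b * geo \<alpha>) * ?p + b * geo \<alpha> * c0 powr (- \<alpha>) * sqrt (2 / c0) * ?s"
    using g1 sum_statistical_le[OF \<alpha> T0 b0] sum_privacy_le[OF \<alpha> T0 b0 \<rho>] sum_tail_le[OF \<alpha> b0 c0]
    unfolding gJ g2 sum.distrib by linarith
  have "e0 \<le> sqrt (12 * Q) * (sqrt (real (k 0) / real n) + real (k 0) * sqrt (priv_noise \<rho>))"
  proof (rule sqrt_bound_split)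
    have "real (k 0) / real n + real (k 0) ^ 3 / (ada_rho C0 c0 n d \<rho> 0 * (real n)\<^sup>2) \<le> 12 * (real (k 0) / real n) + 12 * (real (k 0))\<^sup>2 * priv_noise \<rho>"
    proof (rule add_mono)
      have "0 \<le> real (k 0) / real n" by simp
      then show "real (k 0) / real n \<le> 12 * (real (k 0) / real n)" by linarith
    qed (rule cube_over_rho_le[OF \<rho> n3 c0(2)], simp)
    also have "\<dots> = 12 * ((sqrt (real (k 0) / real n))\<^sup>2 + (real (k 0) * sqrt (priv_noise \<rho>))\<^sup>2)"
      using L by (simp add: power_mult_distrib)
    finally have "Q * (real (k 0) / real n + real (k 0) ^ 3 / (ada_rho C0 c0 n d \<rho> 0 * (real n)\<^sup>2)) \<le>
        Q * (12 * ((sqrt (real (k 0) / real n))\<^sup>2 + (real (k 0) * sqrt (priv_noise \<rho>))\<^sup>2))" by (rule mult_left_mono[OF _ Q])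
    then show "e0\<^sup>2 \<le> 12 * Q * ((sqrt (real (k 0) / real n))\<^sup>2 + (real (k 0) * sqrt (priv_noise \<rho>))\<^sup>2)"
      using e0(2) by (simp only: mult_ac)
  qed (use L Q in auto)
  also have "\<dots> \<le> sqrt (12 * Q) * (sqrt (2 * C0 * (2 * \<alpha> + 1)) * ?s + (2 * C0 * (1 / c) powr (1 / (2 * \<alpha> + 2)) + 1) * ?p)"
    using Q by (intro mult_left_mono add_mono scale0_statistical_le[OF \<alpha> C01 n3] scale0_privacy_le[OF \<alpha> C01 n3 \<rho> c signal]) auto
  finally have e: "e0 \<le> sqrt (12 * Q) * (sqrt (2 * C0 * (2 * \<alpha> + 1)) * ?s + (2 * C0 * (1 / c) powr (1 / (2 * \<alpha> + 2)) + 1) * ?p)" .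
  have "total_bound L1 \<rho> M \<alpha> e0 \<le> 3 * (sqrt (12 * Q) * (sqrt (2 * C0 * (2 * \<alpha> + 1)) * ?s + (2 * C0 * (1 / c) powr (1 / (2 * \<alpha> + 2)) + 1) * ?p))
     + 2 * ((2 * T * geo (1 / 2) + b * geo \<alpha>) * ?s + (2 * T * geo 1 + b * geo \<alpha>) * ?p + b * geo \<alpha> * c0 powr (- \<alpha>) * sqrt (2 / c0) * ?s)"
    unfolding total_bound_def g_def[symmetric] by (intro add_mono mult_left_mono e sum) auto
  also have "\<dots> = A1 * ?s + A2 * ?p" unfolding A1_def A2_def by (rule collect_two_rates)
  finally have tot: "total_bound L1 \<rho> M \<alpha> e0 \<le> A1 * ?s + A2 * ?p" .
  have nonneg: "0 \<le> total_bound L1 \<rho> M \<alpha> e0"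
    unfolding total_bound_def using e0 tau0 M
    by (intro add_nonneg_nonneg mult_nonneg_nonneg sum_nonneg) (auto split: if_splits)
  have "(total_bound L1 \<rho> M \<alpha> e0)\<^sup>2 \<le> (A1 * ?s + A2 * ?p)\<^sup>2" using tot nonneg by (intro power_mono) auto
  also have "\<dots> \<le> 2 * ((A1 * ?s)\<^sup>2 + (A2 * ?p)\<^sup>2)"
    using zero_le_power2[of "A1 * ?s - A2 * ?p"] by (simp add: power2_sum power2_diff)
  also have "\<dots> = 2 * (A1\<^sup>2 * ?s\<^sup>2 + A2\<^sup>2 * ?p\<^sup>2)" by (simp only: power_mult_distrib)
  also have "\<dots> \<le> 2 * ((A1\<^sup>2 + A2\<^sup>2) * ?s\<^sup>2 + (A1\<^sup>2 + A2\<^sup>2) * ?p\<^sup>2)"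
    by (intro mult_left_mono add_mono mult_right_mono) auto
  also have "\<dots> = 2 * (A1\<^sup>2 + A2\<^sup>2) * rate \<alpha> n d \<rho>"
    unfolding rate_eq[OF \<rho> \<alpha>] by (simp only: distrib_left distrib_right mult.assoc)
  finally show ?thesis .
qed

end

section \<open>The loss on and off the good event\<close>

lemma nn_integral_PiM_component:
  assumes M: "\<And>i. prob_space (M i)" and i: "i \<in> I" and f: "f \<in> borel_measurable (M i)"
  shows "(\<integral>\<^sup>+ x. f (x i) \<partial>PiM I M) = (\<integral>\<^sup>+ y. f y \<partial>M i)"
proof -
  have "distr (PiM I M) (M i) (\<lambda>x. x i) = M i" by (rule distr_PiM_component) (use M i in auto)
  then have "(\<integral>\<^sup>+ y. f y \<partial>M i) = (\<integral>\<^sup>+ y. f y \<partial>distr (PiM I M) (M i) (\<lambda>x. x i))" by simp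
  also have "\<dots> = (\<integral>\<^sup>+ x. f (x i) \<partial>PiM I M)"
    by (rule nn_integral_distr) (use i f in auto)
  finally show ?thesis by simp
qed

lemma (in subgaussian_law) cov_mat_bound:
  assumes "i \<in> {1..d}" "j \<in> {1..d}"
  shows "\<bar>cov_mat P (i, j)\<bar> \<le> 1 + 64 * K ^ 4"
proof -
  let ?Y = "\<lambda>x. lin_form d (\<lambda>a. if a = i then 1 else 0) x * lin_form d (\<lambda>a. if a = j then 1 else 0) x"
  have Ym: "?Y \<in> borel_measurable P" by measurable
  have Yexp: "(\<integral>\<^sup>+ x. ennreal (exp (\<bar>?Y x\<bar> / (4 * K\<^sup>2))) \<partial>P) \<le> 2"
    by (rule exp_product_moment[OF L2_unit_le L2_unit_le]) auto
  have b: "0 < 4 * K\<^sup>2" using K by simp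
  note Y = mgf_centered_le(1,2,3)[OF Ym b Yexp, of 0, unfolded lin_form_unit[OF assms(1)] lin_form_unit[OF assms(2)]]
  have Y1: "integrable P (\<lambda>x. x i * x j)" and Y2: "(\<integral>x. (x i * x j)\<^sup>2 \<partial>P) \<le> 4 * (4 * K\<^sup>2)\<^sup>2"
    and Y3: "integrable P (\<lambda>x. (x i * x j)\<^sup>2)" using Y b by auto
  have "\<bar>\<integral>x. x i * x j \<partial>P\<bar> \<le> (\<integral>x. \<bar>x i * x j\<bar> \<partial>P)" by (rule integral_abs_bound)
  also have "\<dots> \<le> (\<integral>x. 1 + (x i * x j)\<^sup>2 \<partial>P)"
  proof (rule integral_mono)
    fix x :: rvec
    have "0 \<le> (\<bar>x i * x j\<bar> - 1)\<^sup>2" by simp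
    then have "2 * \<bar>x i * x j\<bar> \<le> 1 + (x i * x j)\<^sup>2" by (simp add: power2_diff)
    then show "\<bar>x i * x j\<bar> \<le> 1 + (x i * x j)\<^sup>2" by linarith
  qed (use Y1 Y3 in auto)
  also have "\<dots> = 1 + (\<integral>x. (x i * x j)\<^sup>2 \<partial>P)" using Y3 by (simp add: prob_space)
  also have "\<dots> \<le> 1 + 64 * K ^ 4" using Y2 by (simp add: power_mult_distrib)
  finally show ?thesis by (simp only: cov_mat_eq[OF assms])
qed

lemma emp_block_entry_le:
  assumes "finite I" "finite J" "i \<in> I" "j \<in> J" "0 \<le> R" "1 \<le> n"
  shows "\<bar>emp_block n X I J R (i, j)\<bar> \<le> R\<^sup>2"
proof -
  have clip: "\<bar>clip R I z i\<bar> \<le> R" if "finite I" "i \<in> I" for I i z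
  proof -
    have "\<bar>clip R I z i\<bar> \<le> L2_set (\<lambda>i. \<bar>clip R I z i\<bar>) I" by (rule member_le_L2_set[OF that])
    also have "\<dots> = L2_set (clip R I z) I" by (simp add: L2_set_def)
    finally show ?thesis using L2_set_clip_le[OF assms(5), of I z] by linarith
  qed
  have "\<bar>\<Sum>a\<in>{1..n}. clip R I (X a) i * clip R J (X a) j\<bar> \<le> (\<Sum>a\<in>{1..n}. R * R)"
    by (intro order_trans[OF sum_abs] sum_mono) (auto simp: abs_mult intro!: mult_mono clip assms)
  then show ?thesis using assms(6) by (simp add: emp_block_def abs_mult pos_divide_le_eq power2_eq_square mult.commute)
qed

text \<open>
  The constant of the bound for the clipped sample covariance, see \<open>emp_block_tail\<close>.
\<close>

definition sample_const :: "real \<Rightarrow> real \<Rightarrow> real" where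
  "sample_const K h = 8 * K\<^sup>2 * (39 + h) + (2 * (4 * K\<^sup>2)\<^sup>2 + 2)"

text \<open>
  Bounds the squared error of one block relative to the sum of the statistical and the privacy
  variance; \<open>144 = 2 * 4 * 18\<close> combines the square of a sum, the net argument and the noise variance.
\<close>

definition block_const :: "real \<Rightarrow> real \<Rightarrow> real \<Rightarrow> real" where
  "block_const K C h = 8 * (sample_const K h)\<^sup>2 + 144 * (38 + h)\<^sup>2 * C\<^sup>2"

locale ada_law = ada_setup C0 c0 n d + law: subgaussian_law d K P
  for C0 c0 :: real and n d :: nat and K :: real and P :: "rvec measure" +
  fixes C \<rho> h :: real
  assumes C: "16 * K\<^sup>2 * (18 + h) \<le> C" and \<rho>: "0 < \<rho>" and h: "0 \<le> h"
begin

lemma C_pos: "0 < C"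
proof -
  have "0 < 16 * K\<^sup>2 * (18 + h)" using law.K h by simp
  then show ?thesis using C by linarith
qed

abbreviation "rho m \<equiv> ada_rho C0 c0 n d \<rho> m"
abbreviation "R m \<equiv> sqrt (C * real (k m))"

abbreviation "stat_const \<equiv> sample_const K h"
abbreviation "err_const \<equiv> block_const K C h"

text \<open>
  The operator norm error of one call outside the exceptional event: sampling plus noise.
\<close>

definition block_err :: "nat \<Rightarrow> real" where
  "block_err m = 2 * (stat_const * sqrt (real (k m) / real n)) + noise_scale n (rho m) (R m) * (2 * ((38 + h) * sqrt (real (k m))))"

lemma noise_scale_power2:
  assumes "m \<le> J"
  shows "(noise_scale n (rho m) (R m))\<^sup>2 = 18 * C\<^sup>2 * ((real (k m))\<^sup>2 / (rho m * (real n)\<^sup>2))"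
proof -
  have "R m ^ 4 = (C * real (k m))\<^sup>2"
  proof -
    have "R m ^ 4 = ((R m)\<^sup>2)\<^sup>2" by (simp add: power2_eq_square power4_eq_xxxx mult.assoc)
    also have "(R m)\<^sup>2 = C * real (k m)" using C_pos by simp
    finally show ?thesis .
  qed
  moreover have "0 < rho m" by (rule ada_rho_pos[OF \<rho> assms])
  ultimately show ?thesis unfolding noise_scale_def using n
    by (simp add: power_mult_distrib)
qed

lemma stat_const_pos: "0 < stat_const"
proof -
  have "0 \<le> 8 * K\<^sup>2 * (39 + h)" using h by simp
  moreover have "0 \<le> 2 * (4 * K\<^sup>2)\<^sup>2" by simp
  ultimately show ?thesis unfolding sample_const_def by linarith
qed

lemma block_err_nonneg: "0 \<le> block_err m"
proof (cases "0 \<le> noise_scale n (rho m) (R m)")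
  case True then show ?thesis unfolding block_err_def using stat_const_pos h by simp
next
  case False
  then have "rho m < 0"
    by (auto simp: noise_scale_def zero_le_divide_iff not_le mult_less_0_iff zero_le_mult_iff divide_less_0_iff)
  moreover have "0 \<le> rho m" unfolding ada_rho_def using \<rho> by simp
  ultimately show ?thesis by simp
qed

lemma block_err_power2_le:
  assumes m: "m \<le> J"
  shows "(block_err m)\<^sup>2 \<le> err_const * (real (k m) / real n + real (k m) ^ 3 / (rho m * (real n)\<^sup>2))"
proof -
  let ?a = "2 * (stat_const * sqrt (real (k m) / real n))" and ?b = "noise_scale n (rho m) (R m) * (2 * ((38 + h) * sqrt (real (k m))))"
  let ?x = "real (k m) / real n" and ?y = "real (k m) ^ 3 / (rho m * (real n)\<^sup>2)"
  have y0: "0 \<le> ?y" using ada_rho_pos[OF \<rho> m] by simp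
  have a: "?a\<^sup>2 = 4 * stat_const\<^sup>2 * ?x" by (simp add: power_mult_distrib)
  have b: "?b\<^sup>2 = 72 * (38 + h)\<^sup>2 * C\<^sup>2 * ?y"
    unfolding power_mult_distrib noise_scale_power2[OF m]
    by (simp add: power2_eq_square power3_eq_cube)
  have "(block_err m)\<^sup>2 \<le> 2 * (?a\<^sup>2 + ?b\<^sup>2)"
    unfolding block_err_def using zero_le_power2[of "?a - ?b"] by (simp add: power2_sum power2_diff)
  also have "\<dots> = (8 * stat_const\<^sup>2) * ?x + (144 * (38 + h)\<^sup>2 * C\<^sup>2) * ?y" unfolding a b by simp
  also have "\<dots> \<le> err_const * ?x + err_const * ?y"
    using y0 unfolding block_const_def by (intro add_mono mult_right_mono) auto
  finally show ?thesis by (simp only: distrib_left)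
qed

lemma block_err_le_tau:
  assumes m: "1 \<le> m" "m \<le> J" and L1: "16 * err_const \<le> L1"
  shows "block_err m \<le> ada_tau C0 L1 c0 n d \<rho> m / 4"
proof -
  let ?k = "real (k m)" and ?r = "rho m * (real n)\<^sup>2"
  have r: "0 < ?r" using ada_rho_pos[OF \<rho> m(2)] n by simp
  have e0: "0 \<le> err_const" by (simp add: block_const_def)
  have lnD: "0 \<le> ln (real D)" using D_pos by simp
  have "(4 * block_err m)\<^sup>2 \<le> 16 * (err_const * (?k / real n + ?k ^ 3 / ?r))"
    using block_err_power2_le[OF m(2)] by (simp add: power_mult_distrib)
  also have "\<dots> = (16 * err_const) * (?k / real n + ?k ^ 3 / ?r)" by simp
  also have "\<dots> \<le> L1 * (?k / real n + ?k ^ 3 / ?r)" using L1 r by (intro mult_right_mono) auto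
  also have "\<dots> \<le> L1 * ((?k + ln (real D)) / real n + ?k\<^sup>2 * (?k + ln (real D)) / ?r + exp (- 2 * ?k))"
  proof (intro mult_left_mono)
    have "?k / real n \<le> (?k + ln (real D)) / real n" using lnD by (intro divide_right_mono) auto
    moreover have "?k ^ 3 / ?r \<le> ?k\<^sup>2 * (?k + ln (real D)) / ?r"
      using lnD r by (intro divide_right_mono) (auto simp: power2_eq_square power3_eq_cube algebra_simps)
    moreover have "0 \<le> exp (- 2 * ?k)" by simp
    ultimately show "?k / real n + ?k ^ 3 / ?r \<le> (?k + ln (real D)) / real n + ?k\<^sup>2 * (?k + ln (real D)) / ?r + exp (- 2 * ?k)" by linarith
  qed (use e0 L1 in linarith)
  finally have "4 * block_err m \<le> ada_tau C0 L1 c0 n d \<rho> m"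
    unfolding ada_tau_def Let_def by (rule real_le_rsqrt)
  then show ?thesis by simp
qed

definition call_block :: "(nat \<Rightarrow> rvec) \<Rightarrow> nat \<times> nat \<times> nat \<Rightarrow> rmat \<Rightarrow> rmat" where
  "call_block X = (\<lambda>(m, l, r). noisy_block n D (pad D d X) (idx (k m) l) (idx (k m) (l + r)) (rho m) (R m))"

definition outputs :: "(nat \<Rightarrow> rvec) \<Rightarrow> (nat \<times> nat \<times> nat \<Rightarrow> rmat) \<Rightarrow> nat \<times> nat \<times> nat \<Rightarrow> rmat" where
  "outputs X G = (\<lambda>c\<in>calls. call_block X c (G c))"

lemma measurable_call_block: "call_block X c \<in> measurable (sym_gauss D) (mat_space D)"
  by (cases c) (simp add: call_block_def measurable_noisy_block measurable_cong_sets[OF sets_sym_gauss refl])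

lemma measurable_outputs: "outputs X \<in> measurable (\<Pi>\<^sub>M c\<in>calls. sym_gauss D) (\<Pi>\<^sub>M c\<in>calls. mat_space D)"
  unfolding outputs_def[abs_def]
proof (rule measurable_restrict)
  fix c assume c: "c \<in> calls"
  show "(\<lambda>G. call_block X c (G c)) \<in> measurable (\<Pi>\<^sub>M c\<in>calls. sym_gauss D) (mat_space D)"
    by (rule measurable_compose[OF measurable_component_singleton[OF c, of "\<lambda>_. sym_gauss D"] measurable_call_block])
qed

text \<open>
  Exposes the noise matrices of all calls as one product space, so that the good event can be
  described in terms of data and noise separately.
\<close>

lemma ada_estimator_eq:
  "ada_estimator C0 C L1 c0 n d \<rho> X =
    distr (\<Pi>\<^sub>M c\<in>calls. sym_gauss D) (mat_space d) (\<lambda>G. ada_assemble C0 L1 c0 n d \<rho> (outputs X G))"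
proof -
  have "ada_call C0 C c0 n d \<rho> X c = distr (sym_gauss D) (mat_space D) (call_block X c)" for c
    by (cases c) (simp add: ada_call_def Let_def DPCovBlock_eq call_block_def)
  then have "ada_call C0 C c0 n d \<rho> X = (\<lambda>c. distr (sym_gauss D) (mat_space D) (call_block X c))" by (rule ext)
  then have "PiM calls (ada_call C0 C c0 n d \<rho> X) = distr (\<Pi>\<^sub>M c\<in>calls. sym_gauss D) (\<Pi>\<^sub>M c\<in>calls. mat_space D) (outputs X)"
    unfolding outputs_def[abs_def]
    by (simp only:) (rule distr_PiM_componentwise[symmetric], auto intro: prob_space_sym_gauss measurable_call_block)
  then show ?thesis
    unfolding ada_estimator_def
    by (simp only:) (subst distr_distr[OF measurable_ada_assemble measurable_outputs], simp add: comp_def)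
qed

lemma block_good:
  assumes mlr: "(m, l, r) \<in> calls"
    and X: "op_bounded D (mask (\<lambda>p. emp_block n (pad D d X) (idx (k m) l) (idx (k m) (l + r)) (R m) p - law.cov0 p) (blk (k m) l r))
        (2 * (stat_const * sqrt (real (k m) / real n)))"
    and G: "op_bounded D (mask (G (m, l, r)) (blk (k m) l r)) (2 * ((38 + h) * sqrt (real (k m))))"
  shows "op_bounded D (mask (\<lambda>p. outputs X G (m, l, r) p - law.cov0 p) (blk (k m) l r)) (block_err m)"
proof -
  obtain mJ: "m \<le> J" and l: "1 \<le> l" "l + r \<le> N m" using calls_cases[OF mlr] by auto
  let ?s = "noise_scale n (rho m) (R m)"
  have s: "0 \<le> ?s" unfolding noise_scale_def using ada_rho_pos[OF \<rho> mJ] by (intro real_sqrt_ge_zero divide_nonneg_nonneg) auto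
  have sub: "idx (k m) l \<subseteq> {1..D}" "idx (k m) (l + r) \<subseteq> {1..D}" using idx_subset[OF mJ] l by auto
  have "mask (\<lambda>p. outputs X G (m, l, r) p - law.cov0 p) (blk (k m) l r) =
    (\<lambda>p. mask (\<lambda>p. emp_block n (pad D d X) (idx (k m) l) (idx (k m) (l + r)) (R m) p - law.cov0 p) (blk (k m) l r) p
      + ?s * mask (G (m, l, r)) (blk (k m) l r) p)"
  proof (rule ext)
    fix p
    show "mask (\<lambda>p. outputs X G (m, l, r) p - law.cov0 p) (blk (k m) l r) p =
      mask (\<lambda>p. emp_block n (pad D d X) (idx (k m) l) (idx (k m) (l + r)) (R m) p - law.cov0 p) (blk (k m) l r) p
      + ?s * mask (G (m, l, r)) (blk (k m) l r) p"
    proof (cases "p \<in> blk (k m) l r")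
      case True
      then obtain i j where p: "p = (i, j)" "i \<in> idx (k m) l" "j \<in> idx (k m) (l + r)" by (auto simp: blk_def)
      then have "i \<in> {1..D}" "j \<in> {1..D}" using sub by auto
      then show ?thesis using True mlr p by (simp add: mask_def outputs_def call_block_def noisy_block_def)
    qed (simp add: mask_def)
  qed
  moreover have "op_bounded D (\<lambda>p. mask (\<lambda>p. emp_block n (pad D d X) (idx (k m) l) (idx (k m) (l + r)) (R m) p - law.cov0 p) (blk (k m) l r) p
      + ?s * mask (G (m, l, r)) (blk (k m) l r) p) (block_err m)"
    unfolding block_err_def using op_bounded_add[OF X op_bounded_scale[OF G, of ?s]] s by simp
  ultimately show ?thesis by simp
qed

lemma good_event_loss:
  assumes cls: "cov_mat P \<in> cov_class d \<alpha> M0 M" and M: "0 < M" and L1: "16 * err_const \<le> L1"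
    and X: "\<And>m l r. (m, l, r) \<in> calls \<Longrightarrow>
      op_bounded D (mask (\<lambda>p. emp_block n (pad D d X) (idx (k m) l) (idx (k m) (l + r)) (R m) p - law.cov0 p) (idx (k m) l \<times> idx (k m) (l + r)))
        (2 * (stat_const * sqrt (real (k m) / real n)))"
    and G: "\<And>m l r. (m, l, r) \<in> calls \<Longrightarrow> op_bounded D (mask (G (m, l, r)) (idx (k m) l \<times> idx (k m) (l + r))) (2 * ((38 + h) * sqrt (real (k m))))"
    and Gsym: "\<And>c i j. c \<in> calls \<Longrightarrow> i \<in> {1..D} \<Longrightarrow> j \<in> {1..D} \<Longrightarrow> G c (i, j) = G c (j, i)"
  shows "spec_norm d (\<lambda>p. ada_assemble C0 L1 c0 n d \<rho> (outputs X G) p - cov_mat P p) \<le> total_bound L1 \<rho> M \<alpha> (block_err 0)"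
proof -
  have e0: "0 \<le> err_const" by (simp add: block_const_def)
  have L0: "0 \<le> L1" using L1 e0 by linarith
  have good: "op_bounded D (mask (\<lambda>p. outputs X G (m, l, r) p - law.cov0 p) (blk (k m) l r)) (block_err m)" if "(m, l, r) \<in> calls" for m l r
    by (rule block_good[OF that]) (use X[OF that] G[OF that] in \<open>simp_all add: blk_def\<close>)
  have "spec_norm d (\<lambda>p. ada_assemble C0 L1 c0 n d \<rho> (outputs X G) p - cov_mat P p) =
      spec_norm d (\<lambda>p. ada_assemble C0 L1 c0 n d \<rho> (outputs X G) p - law.cov0 p)"
    by (rule spec_norm_cong) (simp add: mask_def)
  also have "\<dots> \<le> total_bound L1 \<rho> M \<alpha> (block_err 0)"
    unfolding total_bound_def
  proof (rule assemble_error[where s = "\<lambda>m. M * real (k m) powr (- \<alpha>)"])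
    show "law.cov0 p = 0" if "p \<notin> {1..d} \<times> {1..d}" for p using that by (simp add: mask_def)
    show "law.cov0 (i, j) = law.cov0 (j, i)" for i j by (simp add: mask_def cov_mat_def mult.commute conj_commute)
    show "spec_norm d (mask law.cov0 R) \<le> M * real (k m) powr (- \<alpha>)" if R: "off_diag_block d (k m) R" for m R
    proof -
      have "R \<subseteq> {1..d} \<times> {1..d}" using R unfolding off_diag_block_def by blast
      then have "mask law.cov0 R = mask (cov_mat P) R" by (auto simp: mask_def fun_eq_iff)
      then show ?thesis using cls R k_pos[of m] by (simp add: cov_class_def)
    qed
    show "0 \<le> M * real (k m) powr (- \<alpha>)" for m using M by simp
    show "0 \<le> block_err 0" by (rule block_err_nonneg)
    show "op_bounded D (mask (\<lambda>p. outputs X G (0, l, r) p - law.cov0 p) (blk (k 0) l r)) (block_err 0)" if "(0, l, r) \<in> calls" for l r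
      by (rule good[OF that])
    show "op_bounded D (mask (\<lambda>p. outputs X G (m, l, 1) p - law.cov0 p) (blk (k m) l 1)) (ada_tau C0 L1 c0 n d \<rho> m / 4)"
      if "(m, l, 1) \<in> calls" "1 \<le> m" for m l
    proof (rule op_bounded_mono[OF good[OF that(1)] block_err_le_tau[OF that(2) _ L1]])
      show "m \<le> J" using calls_cases[OF that(1)] by auto
    qed
    show "outputs X G (0, l, 0) (i, j) = outputs X G (0, l, 0) (j, i)" if "(0, l, 0) \<in> calls" "(i, j) \<in> blk (k 0) l 0" for l i j
    proof -
      have l: "1 \<le> l" "l \<le> N 0" by (rule calls_cases[OF that(1)]; simp)+
      have "idx (k 0) l \<subseteq> {1..D}" using idx_subset[of 0 l] l by auto
      then have ij: "i \<in> {1..D}" "j \<in> {1..D}" "i \<in> idx (k 0) l" "j \<in> idx (k 0) l" using that(2) by (auto simp: blk_def)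
      then show ?thesis using that(1) Gsym[OF that(1) ij(1,2)]
        by (simp add: outputs_def call_block_def noisy_block_def emp_block_def mult.commute)
    qed
    show "0 \<le> ada_tau C0 L1 c0 n d \<rho> m" for m
    proof -
      have "0 \<le> rho m" unfolding ada_rho_def using \<rho> by simp
      then show ?thesis unfolding ada_tau_def Let_def using L0 D_pos
        by (intro real_sqrt_ge_zero mult_nonneg_nonneg add_nonneg_nonneg divide_nonneg_nonneg) auto
    qed
  qed
  finally show ?thesis .
qed

text \<open>
  Without any concentration: clipping bounds the entries of the sample blocks, thresholding can only
  decrease the absolute values of entries, and the spectral norm is at most the sum of the entries.
\<close>

lemma crude_loss:
  assumes kn: "\<And>m. m < S \<Longrightarrow> k m \<le> n" and ns: "\<And>m. m < S \<Longrightarrow> noise_scale n (rho m) (R m) \<le> s"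
  defines "W \<equiv> (real D)\<^sup>2 * (1 + 64 * K ^ 4 + real (card calls) * (C * real n) + s)"
  shows "spec_norm d (\<lambda>p. ada_assemble C0 L1 c0 n d \<rho> (outputs X G) p - cov_mat P p)
    \<le> W * (1 + (\<Sum>c\<in>calls. \<Sum>q\<in>{1..D} \<times> {1..D}. \<bar>G c q\<bar>))"
proof -
  let ?Z = "\<Sum>c\<in>calls. \<Sum>q\<in>{1..D} \<times> {1..D}. \<bar>G c q\<bar>"
  let ?Kc = "1 + 64 * K ^ 4"
  have Z0: "0 \<le> ?Z" by (intro sum_nonneg) auto
  have s0: "0 \<le> s"
  proof -
    have "0 < S" using S_pos by simp
    moreover have "0 \<le> noise_scale n (rho 0) (R 0)"
      unfolding noise_scale_def using ada_rho_pos[OF \<rho>, of 0] by (intro real_sqrt_ge_zero divide_nonneg_nonneg) auto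
    ultimately show ?thesis using ns[of 0] by linarith
  qed
  have K0: "0 \<le> ?Kc" by simp
  have out: "\<bar>outputs X G c q\<bar> \<le> C * real n + s * \<bar>G c q\<bar>" if c: "c \<in> calls" and q: "q \<in> {1..D} \<times> {1..D}" for c q
  proof -
    obtain m l r where mlr: "c = (m, l, r)" "m < S" "m \<le> J" using calls_cases[OF c] by metis
    obtain i j where ij: "q = (i, j)" using prod.exhaust by blast
    let ?I = "idx (k m) l" and ?J = "idx (k m) (l + r)"
    have Cn: "0 \<le> C * real n" using C_pos by simp
    show ?thesis
    proof (cases "q \<in> ?I \<times> ?J")
      case True
      have "\<bar>emp_block n (pad D d X) ?I ?J (R m) q\<bar> \<le> (R m)\<^sup>2"
        unfolding ij by (rule emp_block_entry_le) (use True ij C_pos n in \<open>auto simp: idx_def\<close>)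
      also have "\<dots> = C * real (k m)" using C_pos by simp
      also have "\<dots> \<le> C * real n" using C_pos kn[OF mlr(2)] by (intro mult_left_mono) auto
      finally have 1: "\<bar>emp_block n (pad D d X) ?I ?J (R m) q\<bar> \<le> C * real n" .
      have ns0: "0 \<le> noise_scale n (rho m) (R m)"
        unfolding noise_scale_def using ada_rho_pos[OF \<rho> mlr(3)] by (intro real_sqrt_ge_zero divide_nonneg_nonneg) auto
      have 2: "\<bar>noise_scale n (rho m) (R m) * G c q\<bar> \<le> s * \<bar>G c q\<bar>"
        unfolding abs_mult using ns0 ns[OF mlr(2)] by (intro mult_right_mono) auto
      have "outputs X G c q = emp_block n (pad D d X) ?I ?J (R m) q + noise_scale n (rho m) (R m) * G c q"
        using True c q by (simp add: mlr(1) ij outputs_def call_block_def noisy_block_def)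
      then show ?thesis using 1 2 by linarith
    next
      case False
      then have "outputs X G c q = 0" using c q by (auto simp: mlr(1) ij outputs_def call_block_def noisy_block_def)
      then show ?thesis using Cn s0 by simp
    qed
  qed
  have piece: "\<bar>ada_piece C0 L1 c0 n d \<rho> c Y q\<bar> \<le> \<bar>Y q\<bar>" for c Y q
    by (cases c) (auto simp: ada_piece_def Let_def mask_def)
  have entry: "\<bar>ada_assemble C0 L1 c0 n d \<rho> (outputs X G) p - cov_mat P p\<bar> \<le> ?Kc + real (card calls) * (C * real n) + s * ?Z"
    if p: "p \<in> {1..d} \<times> {1..d}" for p
  proof -
    obtain i j where ij: "p = (i, j)" "i \<in> {1..d}" "j \<in> {1..d}" using p by auto
    let ?q = "(min i j, max i j)"
    have q: "?q \<in> {1..D} \<times> {1..D}" using ij d_le_D by auto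
    have "\<bar>ada_assemble C0 L1 c0 n d \<rho> (outputs X G) p\<bar> \<le> (\<Sum>c\<in>calls. \<bar>ada_piece C0 L1 c0 n d \<rho> c (outputs X G c) ?q\<bar>)"
      using ij by (simp add: ada_assemble_def)
    also have "\<dots> \<le> (\<Sum>c\<in>calls. C * real n + s * (\<Sum>q\<in>{1..D} \<times> {1..D}. \<bar>G c q\<bar>))"
    proof (rule sum_mono)
      fix c assume c: "c \<in> calls"
      have "\<bar>ada_piece C0 L1 c0 n d \<rho> c (outputs X G c) ?q\<bar> \<le> C * real n + s * \<bar>G c ?q\<bar>"
        using piece[of c "outputs X G c" ?q] out[OF c q] by linarith
      also have "\<dots> \<le> C * real n + s * (\<Sum>q\<in>{1..D} \<times> {1..D}. \<bar>G c q\<bar>)"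
        using s0 q by (intro add_left_mono mult_left_mono member_le_sum[of ?q _ "\<lambda>q. \<bar>G c q\<bar>"]) auto
      finally show "\<bar>ada_piece C0 L1 c0 n d \<rho> c (outputs X G c) ?q\<bar> \<le> \<dots>" .
    qed
    also have "\<dots> = real (card calls) * (C * real n) + s * ?Z" by (simp add: sum.distrib sum_distrib_left)
    finally show ?thesis using law.cov_mat_bound[OF ij(2,3)] unfolding ij(1) by linarith
  qed
  have "spec_norm d (\<lambda>p. ada_assemble C0 L1 c0 n d \<rho> (outputs X G) p - cov_mat P p)
      \<le> (\<Sum>p\<in>{1..d} \<times> {1..d}. \<bar>ada_assemble C0 L1 c0 n d \<rho> (outputs X G) p - cov_mat P p\<bar>)" by (rule spec_norm_le_sum)
  also have "\<dots> \<le> (\<Sum>p\<in>{1..d} \<times> {1..d}. ?Kc + real (card calls) * (C * real n) + s * ?Z)" by (intro sum_mono entry)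
  also have "\<dots> = (real d)\<^sup>2 * (?Kc + real (card calls) * (C * real n) + s * ?Z)" by (simp add: power2_eq_square card_cartesian_product)
  also have "\<dots> \<le> (real D)\<^sup>2 * (?Kc + real (card calls) * (C * real n) + s * ?Z)"
    using d_le_D K0 C_pos s0 Z0 by (intro mult_right_mono power_mono add_nonneg_nonneg mult_nonneg_nonneg) auto
  also have "\<dots> \<le> (real D)\<^sup>2 * ((?Kc + real (card calls) * (C * real n) + s) * (1 + ?Z))"
  proof (intro mult_left_mono)
    have "0 \<le> (?Kc + real (card calls) * (C * real n)) * ?Z" using K0 C_pos Z0 by (intro mult_nonneg_nonneg add_nonneg_nonneg) auto
    moreover have "(?Kc + real (card calls) * (C * real n) + s) * (1 + ?Z) = ?Kc + real (card calls) * (C * real n) + s * ?Z + s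
        + (?Kc + real (card calls) * (C * real n)) * ?Z" by (simp add: algebra_simps)
    ultimately show "?Kc + real (card calls) * (C * real n) + s * ?Z \<le> (?Kc + real (card calls) * (C * real n) + s) * (1 + ?Z)" using s0 by linarith
  qed simp
  finally show ?thesis unfolding W_def by (simp only: mult.assoc)
qed

end

section \<open>Expected loss and the risk bound\<close>

text \<open>
  Each square is split as \<open>f\<^sup>2 \<le> u f\<^sup>4 / 2 + 1 / (2 u)\<close>. On the exceptional event the constant part is
  paid for by the small probability and the fourth moments by a small weight \<open>u\<close>; this replaces the
  Cauchy-Schwarz inequality between the event and the noise.
\<close>

lemma square_le_weighted:
  fixes f :: "'a \<Rightarrow> real"
  assumes "finite Z" "0 < u"
  shows "(1 + (\<Sum>z\<in>Z. \<bar>f z\<bar>))\<^sup>2 \<le> 2 * (1 + (real (card Z))\<^sup>2 / (2 * u)) + real (card Z) * u * (\<Sum>z\<in>Z. f z ^ 4)"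
proof -
  let ?s = "\<Sum>z\<in>Z. \<bar>f z\<bar>"
  have amgm: "(f z)\<^sup>2 \<le> u / 2 * f z ^ 4 + 1 / (2 * u)" for z
  proof -
    have "0 \<le> (u * (f z)\<^sup>2 - 1)\<^sup>2" by simp
    then have "2 * u * (f z)\<^sup>2 \<le> u\<^sup>2 * f z ^ 4 + 1" by (simp add: power2_diff power_mult_distrib mult_ac)
    then have "(2 * u * (f z)\<^sup>2) / (2 * u) \<le> (u\<^sup>2 * f z ^ 4 + 1) / (2 * u)" using assms(2) by (intro divide_right_mono) auto
    then show ?thesis using assms(2) by (simp add: add_divide_distrib power2_eq_square)
  qed
  have "?s\<^sup>2 \<le> (\<Sum>z\<in>Z. \<bar>f z\<bar>\<^sup>2) * real (card Z)" by (rule sum_squared_le_sum_of_squares)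
  also have "\<dots> \<le> (\<Sum>z\<in>Z. u / 2 * f z ^ 4 + 1 / (2 * u)) * real (card Z)"
    by (intro mult_right_mono sum_mono) (use amgm in auto)
  also have "\<dots> = real (card Z) * u / 2 * (\<Sum>z\<in>Z. f z ^ 4) + (real (card Z))\<^sup>2 / (2 * u)"
    by (simp add: sum.distrib sum_distrib_left[symmetric] sum_divide_distrib[symmetric] power2_eq_square algebra_simps)
  finally have s: "?s\<^sup>2 \<le> real (card Z) * u / 2 * (\<Sum>z\<in>Z. f z ^ 4) + (real (card Z))\<^sup>2 / (2 * u)" .
  have "(1 + ?s)\<^sup>2 \<le> 2 * (1 + ?s\<^sup>2)" using zero_le_power2[of "1 - ?s"] by (simp add: power2_sum power2_diff)
  also have "\<dots> \<le> 2 * (1 + (real (card Z) * u / 2 * (\<Sum>z\<in>Z. f z ^ 4) + (real (card Z))\<^sup>2 / (2 * u)))" using s by simp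
  finally show ?thesis by (simp add: algebra_simps)
qed

lemma (in prob_space) nn_integral_affine:
  assumes "f \<in> borel_measurable M" "g \<in> borel_measurable M"
  shows "(\<integral>\<^sup>+ x. c + a * f x + b * g x \<partial>M) = c + a * (\<integral>\<^sup>+ x. f x \<partial>M) + b * (\<integral>\<^sup>+ x. g x \<partial>M)"
  using assms by (simp add: nn_integral_add nn_integral_cmult emeasure_space_1)

lemma ennreal_collect:
  assumes "0 \<le> r" "0 \<le> a" "0 \<le> b" "0 \<le> N" "0 \<le> e" "0 \<le> q"
  shows "ennreal (r + a * (N * e) + b * (N * (q * 2048)) + a * (N * e)) =
    ennreal r + ennreal a * (ennreal N * ennreal e) + ennreal b * (ennreal N * (ennreal q * 2048)) + ennreal a * (ennreal N * ennreal e)"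
  using assms by (simp only: ennreal_plus ennreal_mult mult_nonneg_nonneg add_nonneg_nonneg zero_le_numeral ennreal_numeral)

context ada_law
begin

text \<open>
  Let \<open>F\<close> be the sum of the exceptional functions of all calls, for the data and for the noise. If
  \<open>F < 1\<close>, the loss is at most \<open>total_bound\<close>. Otherwise the crude bound applies, and its constant
  part may be multiplied by \<open>F \<ge> 1\<close>. So the loss is pointwise at most a constant plus multiples of
  \<open>F\<close> and of the fourth powers of the noise entries, and these are integrated term by term.
\<close>

lemma expected_loss_le:
  assumes cls: "cov_mat P \<in> cov_class d \<alpha> M0 M" and M: "0 < M" and L1: "16 * err_const \<le> L1"
    and kn: "\<And>m. m < S \<Longrightarrow> k m \<le> n" and ns: "\<And>m. m < S \<Longrightarrow> noise_scale n (rho m) (R m) \<le> s"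
    and small: "exp (- h * real (k 0)) \<le> 1 / (real n)\<^sup>2" and u: "0 < u"
  defines "W \<equiv> (real D)\<^sup>2 * (1 + 64 * K ^ 4 + real (card calls) * (C * real n) + s)"
    and "Z \<equiv> real (card calls) * (real D)\<^sup>2"
  shows "expected_loss n P (ada_estimator C0 C L1 c0 n d \<rho>) (\<lambda>E. (spec_norm d E)\<^sup>2) \<le>
    ennreal ((total_bound L1 \<rho> M \<alpha> (block_err 0))\<^sup>2 +
      2 * W\<^sup>2 * ((1 + Z\<^sup>2 / (2 * u)) * (2 * real (card calls) * exp (- h * real (k 0))) + Z\<^sup>2 * (u / 2) * 2048))"
proof -
  let ?M = "\<Pi>\<^sub>M a\<in>{1..n}. P" and ?G = "\<Pi>\<^sub>M c\<in>calls. sym_gauss D"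
  let ?\<delta> = "exp (- h * real (k 0))"
  let ?r = "total_bound L1 \<rho> M \<alpha> (block_err 0)"
  let ?loss = "\<lambda>E. (spec_norm d (\<lambda>p. E p - cov_mat P p))\<^sup>2"
  let ?I = "\<lambda>(m, l, r). idx (k m) l" and ?J = "\<lambda>(m, l, r). idx (k m) (l + r)"
  interpret GG: product_prob_space "\<lambda>_. sym_gauss D" by (intro product_prob_spaceI prob_space_sym_gauss)
  interpret PP: product_prob_space "\<lambda>_. P" by (intro product_prob_spaceI law.prob_space_axioms)
  interpret G: prob_space ?G by (intro prob_space_PiM prob_space_sym_gauss)
  interpret X: prob_space ?M by (intro prob_space_PiM law.prob_space_axioms)
  have small_m: "exp (- h * real (k m)) \<le> ?\<delta>" for m
  proof -
    have "h * real (k 0) \<le> h * real (k m)" using k_mono[of 0 m] h by (intro mult_left_mono) auto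
    then show ?thesis by simp
  qed
  have blocks: "m < S" "idx (k m) l \<subseteq> {1..D}" "idx (k m) (l + r) \<subseteq> {1..D}" if "(m, l, r) \<in> calls" for m l r
  proof -
    have c: "m < S \<and> m \<le> J \<and> l \<le> N m \<and> l + r \<le> N m" by (rule calls_cases[OF that]) auto
    then show "m < S" "idx (k m) l \<subseteq> {1..D}" "idx (k m) (l + r) \<subseteq> {1..D}" using idx_subset by blast+
  qed
  let ?okX = "\<lambda>m l r X. op_bounded D (mask (\<lambda>p. emp_block n (pad D d X) (idx (k m) l) (idx (k m) (l + r)) (R m) p - law.cov0 p)
      (idx (k m) l \<times> idx (k m) (l + r))) (2 * (stat_const * sqrt (real (k m) / real n)))"
  let ?okG = "\<lambda>m l r G. op_bounded D (mask G (idx (k m) l \<times> idx (k m) (l + r))) (2 * ((38 + h) * sqrt (real (k m))))"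
  let ?sym = "\<lambda>G :: rmat. \<forall>i\<in>{1..D}. \<forall>j\<in>{1..D}. G (i, j) = G (j, i)"
  have \<delta>_mono: "ennreal (exp (- h * real (k m))) \<le> ennreal ?\<delta>" for m by (intro ennreal_leI small_m)
  have "\<forall>c\<in>calls. \<exists>H. H \<in> borel_measurable ?M \<and> (\<integral>\<^sup>+ X. H X \<partial>?M) \<le> ennreal ?\<delta> \<and>
      (\<forall>X. H X < 1 \<longrightarrow> (case c of (m, l, r) \<Rightarrow> ?okX m l r X))"
  proof
    fix c assume c: "c \<in> calls"
    obtain m l r where mlr: "c = (m, l, r)" using prod_cases3 by blast
    note b = blocks[OF c[unfolded mlr]]
    have sm: "exp (- h * real (k m)) \<le> 1 / (real n)\<^sup>2" using small_m[of m] small by linarith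
    obtain H where H: "H \<in> borel_measurable ?M" "(\<integral>\<^sup>+ X. H X \<partial>?M) \<le> ennreal (exp (- h * real (k m)))"
      "\<And>X. H X < 1 \<Longrightarrow> ?okX m l r X"
      using law.emp_block_tail[OF b(2) card_idx_le b(3) card_idx_le k_pos kn[OF b(1)] d_le_D h C sm]
      unfolding sample_const_def by blast
    then show "\<exists>H. H \<in> borel_measurable ?M \<and> (\<integral>\<^sup>+ X. H X \<partial>?M) \<le> ennreal ?\<delta> \<and>
      (\<forall>X. H X < 1 \<longrightarrow> (case c of (m, l, r) \<Rightarrow> ?okX m l r X))"
      using \<delta>_mono[of m] order_trans unfolding mlr split by blast
  qed
  then obtain HX where HX: "\<And>c. c \<in> calls \<Longrightarrow> HX c \<in> borel_measurable ?M" "\<And>c. c \<in> calls \<Longrightarrow> (\<integral>\<^sup>+ X. HX c X \<partial>?M) \<le> ennreal ?\<delta>"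
    "\<And>m l r X. (m, l, r) \<in> calls \<Longrightarrow> HX (m, l, r) X < 1 \<Longrightarrow> ?okX m l r X"
    unfolding bchoice_iff by fastforce
  have "\<forall>c\<in>calls. \<exists>H. H \<in> borel_measurable (mat_space D) \<and> (\<integral>\<^sup>+ G. H G \<partial>sym_gauss D) \<le> ennreal ?\<delta> \<and>
      (\<forall>G. H G < 1 \<longrightarrow> (case c of (m, l, r) \<Rightarrow> ?okG m l r G) \<and> ?sym G)"
  proof
    fix c assume c: "c \<in> calls"
    obtain m l r where mlr: "c = (m, l, r)" using prod_cases3 by blast
    note b = blocks[OF c[unfolded mlr]]
    show "\<exists>H. H \<in> borel_measurable (mat_space D) \<and> (\<integral>\<^sup>+ G. H G \<partial>sym_gauss D) \<le> ennreal ?\<delta> \<and>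
      (\<forall>G. H G < 1 \<longrightarrow> (case c of (m, l, r) \<Rightarrow> ?okG m l r G) \<and> ?sym G)"
      using sym_gauss_block_tail[OF b(2) card_idx_le b(3) card_idx_le k_pos h] \<delta>_mono[of m] order_trans
      unfolding mlr split by blast
  qed
  then obtain HG where HG: "\<And>c. c \<in> calls \<Longrightarrow> HG c \<in> borel_measurable (mat_space D)" "\<And>c. c \<in> calls \<Longrightarrow> (\<integral>\<^sup>+ G. HG c G \<partial>sym_gauss D) \<le> ennreal ?\<delta>"
    "\<And>m l r G. (m, l, r) \<in> calls \<Longrightarrow> HG (m, l, r) G < 1 \<Longrightarrow> ?okG m l r G"
    "\<And>c G i j. c \<in> calls \<Longrightarrow> HG c G < 1 \<Longrightarrow> i \<in> {1..D} \<Longrightarrow> j \<in> {1..D} \<Longrightarrow> G (i, j) = G (j, i)"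
    unfolding bchoice_iff by fastforce
  have s0: "0 \<le> s"
  proof -
    have "0 < S" using S_pos by simp
    moreover have "0 \<le> noise_scale n (rho 0) (R 0)"
      unfolding noise_scale_def using ada_rho_pos[OF \<rho>, of 0] by (intro real_sqrt_ge_zero divide_nonneg_nonneg) auto
    ultimately show ?thesis using ns[of 0] by linarith
  qed
  have W0: "0 \<le> W" unfolding W_def using s0 C_pos by (intro mult_nonneg_nonneg add_nonneg_nonneg) auto
  have Z0: "0 \<le> Z" by (simp add: Z_def)
  define a where "a = 2 * W\<^sup>2 * (1 + Z\<^sup>2 / (2 * u))"
  define b where "b = W\<^sup>2 * Z * u"
  have ab: "0 \<le> a" "0 \<le> b" using u Z0 by (auto simp: a_def b_def)
  let ?Q = "{1..D} \<times> {1..D}"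
  have pointwise: "ennreal (?loss (ada_assemble C0 L1 c0 n d \<rho> (outputs X G))) \<le>
      ennreal (?r\<^sup>2) + ennreal a * ((\<Sum>c\<in>calls. HX c X) + (\<Sum>c\<in>calls. HG c (G c)))
      + ennreal b * (\<Sum>c\<in>calls. \<Sum>q\<in>?Q. ennreal ((G c q) ^ 4))" for X G
  proof (cases "(\<Sum>c\<in>calls. HX c X) + (\<Sum>c\<in>calls. HG c (G c)) < 1")
    case True
    have "HX c X < 1" "HG c (G c) < 1" if "c \<in> calls" for c
    proof -
      have "HX c X \<le> (\<Sum>c\<in>calls. HX c X)" "HG c (G c) \<le> (\<Sum>c\<in>calls. HG c (G c))"
        using member_le_sum[OF that, of "\<lambda>c. HX c X"] member_le_sum[OF that, of "\<lambda>c. HG c (G c)"] by auto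
      then have "HX c X \<le> (\<Sum>c\<in>calls. HX c X) + (\<Sum>c\<in>calls. HG c (G c))" "HG c (G c) \<le> (\<Sum>c\<in>calls. HX c X) + (\<Sum>c\<in>calls. HG c (G c))"
        by (auto intro: order_trans add_increasing add_increasing2)
      then show "HX c X < 1" "HG c (G c) < 1" using True by (auto intro: le_less_trans)
    qed
    then have "spec_norm d (\<lambda>p. ada_assemble C0 L1 c0 n d \<rho> (outputs X G) p - cov_mat P p) \<le> ?r"
      by (intro good_event_loss[OF cls M L1] HX(3) HG(3) HG(4)) auto
    then have "?loss (ada_assemble C0 L1 c0 n d \<rho> (outputs X G)) \<le> ?r\<^sup>2"
      by (intro power_mono spec_norm_nonneg)
    then have "ennreal (?loss (ada_assemble C0 L1 c0 n d \<rho> (outputs X G))) \<le> ennreal (?r\<^sup>2)" by (rule ennreal_leI)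
    then show ?thesis by (intro order_trans[OF _ add_increasing2[OF _ add_increasing2]]) auto
  next
    case False
    let ?F = "(\<Sum>c\<in>calls. HX c X) + (\<Sum>c\<in>calls. HG c (G c))"
    have F: "1 \<le> ?F" using False by simp
    define f where "f = (\<lambda>(c, q). G c q)"
    have cardZ: "real (card (calls \<times> ?Q)) = Z" by (simp add: Z_def card_cartesian_product power2_eq_square)
    have "spec_norm d (\<lambda>p. ada_assemble C0 L1 c0 n d \<rho> (outputs X G) p - cov_mat P p) \<le> W * (1 + (\<Sum>c\<in>calls. \<Sum>q\<in>?Q. \<bar>G c q\<bar>))"
      unfolding W_def by (rule crude_loss[OF kn ns])
    then have "?loss (ada_assemble C0 L1 c0 n d \<rho> (outputs X G)) \<le> (W * (1 + (\<Sum>c\<in>calls. \<Sum>q\<in>?Q. \<bar>G c q\<bar>)))\<^sup>2"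
      by (intro power_mono spec_norm_nonneg)
    also have "\<dots> = W\<^sup>2 * (1 + (\<Sum>z\<in>calls \<times> ?Q. \<bar>f z\<bar>))\<^sup>2"
      by (simp add: power_mult_distrib f_def sum.cartesian_product case_prod_beta')
    also have "\<dots> \<le> W\<^sup>2 * (2 * (1 + Z\<^sup>2 / (2 * u)) + Z * u * (\<Sum>z\<in>calls \<times> ?Q. f z ^ 4))"
      using square_le_weighted[of "calls \<times> ?Q" u f] u unfolding cardZ by (intro mult_left_mono) auto
    also have "\<dots> = a + b * (\<Sum>c\<in>calls. \<Sum>q\<in>?Q. (G c q) ^ 4)"
      by (simp add: a_def b_def f_def sum.cartesian_product case_prod_beta' distrib_left mult.assoc)
    finally have "ennreal (?loss (ada_assemble C0 L1 c0 n d \<rho> (outputs X G))) \<le> ennreal (a + b * (\<Sum>c\<in>calls. \<Sum>q\<in>?Q. (G c q) ^ 4))"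
      by (rule ennreal_leI)
    also have "\<dots> = ennreal a + ennreal b * (\<Sum>c\<in>calls. \<Sum>q\<in>?Q. ennreal ((G c q) ^ 4))"
    proof -
      have "0 \<le> (\<Sum>c\<in>calls. \<Sum>q\<in>?Q. (G c q) ^ 4)" by (intro sum_nonneg) auto
      moreover have "ennreal (\<Sum>c\<in>calls. \<Sum>q\<in>?Q. (G c q) ^ 4) = (\<Sum>c\<in>calls. \<Sum>q\<in>?Q. ennreal ((G c q) ^ 4))"
        by (simp add: sum_ennreal sum_nonneg)
      ultimately show ?thesis using ab by (simp add: ennreal_plus ennreal_mult)
    qed
    also have "\<dots> \<le> ennreal a * ?F + ennreal b * (\<Sum>c\<in>calls. \<Sum>q\<in>?Q. ennreal ((G c q) ^ 4))"
      using mult_left_mono[OF F, of "ennreal a"] by (intro add_right_mono) auto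
    finally show ?thesis by (rule order_trans) (simp add: add_increasing add.assoc)
  qed
  have HGc: "(\<lambda>G. HG c (G c)) \<in> borel_measurable ?G" if "c \<in> calls" for c
    using measurable_compose[OF measurable_component_singleton[OF that, of "\<lambda>_. sym_gauss D"]] HG(1)[OF that]
      measurable_cong_sets[OF sets_sym_gauss refl] by blast
  have Gq: "(\<lambda>A. ennreal ((A q) ^ 4)) \<in> borel_measurable (sym_gauss D)" if "q \<in> ?Q" for q
  proof -
    have [measurable]: "(\<lambda>A. A q) \<in> borel_measurable (sym_gauss D)"
      using mat_space_component[OF that] measurable_cong_sets[OF sets_sym_gauss refl] by blast
    show ?thesis by measurable
  qed
  have Gcq: "(\<lambda>G. ennreal ((G c q) ^ 4)) \<in> borel_measurable ?G" if "c \<in> calls" "q \<in> ?Q" for c q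
    using measurable_compose[OF measurable_component_singleton[OF that(1), of "\<lambda>_. sym_gauss D"] Gq[OF that(2)]] .
  have intHG: "(\<integral>\<^sup>+ G. HG c (G c) \<partial>?G) \<le> ennreal ?\<delta>" if "c \<in> calls" for c
  proof -
    have m: "HG c \<in> borel_measurable (sym_gauss D)" using HG(1)[OF that] measurable_cong_sets[OF sets_sym_gauss refl] by blast
    have "(\<integral>\<^sup>+ G. HG c (G c) \<partial>?G) = (\<integral>\<^sup>+ A. HG c A \<partial>sym_gauss D)"
      by (rule nn_integral_PiM_component[of "\<lambda>_. sym_gauss D", OF prob_space_sym_gauss that m])
    then show ?thesis using HG(2)[OF that] by (simp only:)
  qed
  have intG4: "(\<integral>\<^sup>+ G. ennreal ((G c q) ^ 4) \<partial>?G) \<le> 2048" if "c \<in> calls" "q \<in> ?Q" for c q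
  proof -
    have "(\<integral>\<^sup>+ G. ennreal ((G c q) ^ 4) \<partial>?G) = (\<integral>\<^sup>+ A. ennreal ((A q) ^ 4) \<partial>sym_gauss D)"
      by (rule nn_integral_PiM_component[of "\<lambda>_. sym_gauss D", OF prob_space_sym_gauss that(1) Gq[OF that(2)]])
    then show ?thesis using sym_gauss_fourth_moment[OF that(2)] by (simp only:)
  qed
  let ?c = "ennreal (?r\<^sup>2) + ennreal a * (of_nat (card calls) * ennreal ?\<delta>) + ennreal b * (of_nat (card calls) * (of_nat (card ?Q) * 2048))"
  have loss_meas: "(\<lambda>E. ennreal (?loss E)) \<in> borel_measurable (mat_space d)"
  proof -
    have "(\<lambda>E. spec_norm d (\<lambda>p. E p - cov_mat P p)) \<in> borel_measurable (mat_space d)"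
      by (intro borel_measurable_spec_norm borel_measurable_diff mat_space_component borel_measurable_const)
    then show ?thesis by measurable
  qed
  have inner: "(\<integral>\<^sup>+ E. ennreal (?loss E) \<partial>ada_estimator C0 C L1 c0 n d \<rho> X) \<le> ?c + ennreal a * (\<Sum>c\<in>calls. HX c X)" for X
  proof -
    have asm: "(\<lambda>G. ada_assemble C0 L1 c0 n d \<rho> (outputs X G)) \<in> measurable ?G (mat_space d)"
      by (rule measurable_compose[OF measurable_outputs measurable_ada_assemble])
    have "(\<integral>\<^sup>+ E. ennreal (?loss E) \<partial>ada_estimator C0 C L1 c0 n d \<rho> X) =
        (\<integral>\<^sup>+ G. ennreal (?loss (ada_assemble C0 L1 c0 n d \<rho> (outputs X G))) \<partial>?G)"
      unfolding ada_estimator_eq by (rule nn_integral_distr[OF asm]) (use loss_meas in simp)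
    also have "\<dots> \<le> (\<integral>\<^sup>+ G. (ennreal (?r\<^sup>2) + ennreal a * (\<Sum>c\<in>calls. HX c X)) + ennreal a * (\<Sum>c\<in>calls. HG c (G c))
        + ennreal b * (\<Sum>c\<in>calls. \<Sum>q\<in>?Q. ennreal ((G c q) ^ 4)) \<partial>?G)"
      by (intro nn_integral_mono order_trans[OF pointwise]) (simp add: distrib_left add_ac)
    also have "\<dots> = (ennreal (?r\<^sup>2) + ennreal a * (\<Sum>c\<in>calls. HX c X)) + ennreal a * (\<Sum>c\<in>calls. \<integral>\<^sup>+ G. HG c (G c) \<partial>?G)
        + ennreal b * (\<Sum>c\<in>calls. \<Sum>q\<in>?Q. \<integral>\<^sup>+ G. ennreal ((G c q) ^ 4) \<partial>?G)"
    proof -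
      have m1: "(\<lambda>G. \<Sum>c\<in>calls. HG c (G c)) \<in> borel_measurable ?G" by (intro borel_measurable_sum HGc)
      have m2: "(\<lambda>G. \<Sum>q\<in>?Q. ennreal ((G c q) ^ 4)) \<in> borel_measurable ?G" if "c \<in> calls" for c
        by (intro borel_measurable_sum Gcq that)
      have m3: "(\<lambda>G. \<Sum>c\<in>calls. \<Sum>q\<in>?Q. ennreal ((G c q) ^ 4)) \<in> borel_measurable ?G" by (intro borel_measurable_sum m2)
      have i1: "(\<integral>\<^sup>+ G. (\<Sum>c\<in>calls. HG c (G c)) \<partial>?G) = (\<Sum>c\<in>calls. \<integral>\<^sup>+ G. HG c (G c) \<partial>?G)"
        by (intro nn_integral_sum HGc)
      have i2: "(\<integral>\<^sup>+ G. (\<Sum>c\<in>calls. \<Sum>q\<in>?Q. ennreal ((G c q) ^ 4)) \<partial>?G) = (\<Sum>c\<in>calls. \<integral>\<^sup>+ G. (\<Sum>q\<in>?Q. ennreal ((G c q) ^ 4)) \<partial>?G)"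
        by (intro nn_integral_sum m2)
      have i3: "(\<Sum>c\<in>calls. \<integral>\<^sup>+ G. (\<Sum>q\<in>?Q. ennreal ((G c q) ^ 4)) \<partial>?G) = (\<Sum>c\<in>calls. \<Sum>q\<in>?Q. \<integral>\<^sup>+ G. ennreal ((G c q) ^ 4) \<partial>?G)"
        by (intro sum.cong refl nn_integral_sum Gcq)
      show ?thesis
        unfolding G.nn_integral_affine[OF m1 m3] i1 i2 i3 ..
    qed
    also have "\<dots> \<le> (ennreal (?r\<^sup>2) + ennreal a * (\<Sum>c\<in>calls. HX c X)) + ennreal a * (\<Sum>c\<in>calls. ennreal ?\<delta>)
        + ennreal b * (\<Sum>c\<in>calls. \<Sum>q\<in>?Q. 2048)"
      by (intro add_mono mult_left_mono sum_mono intHG intG4 order_refl) auto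
    also have "\<dots> = ?c + ennreal a * (\<Sum>c\<in>calls. HX c X)" by (simp add: add_ac)
    finally show ?thesis .
  qed
  have "expected_loss n P (ada_estimator C0 C L1 c0 n d \<rho>) (\<lambda>E. (spec_norm d E)\<^sup>2) \<le> (\<integral>\<^sup>+ X. ?c + ennreal a * (\<Sum>c\<in>calls. HX c X) \<partial>?M)"
    unfolding expected_loss_def by (intro nn_integral_mono inner)
  also have "\<dots> = ?c + ennreal a * (\<Sum>c\<in>calls. \<integral>\<^sup>+ X. HX c X \<partial>?M)"
  proof -
    have "(\<lambda>X. \<Sum>c\<in>calls. HX c X) \<in> borel_measurable ?M" by (intro borel_measurable_sum HX(1))
    moreover have "(\<integral>\<^sup>+ X. (\<Sum>c\<in>calls. HX c X) \<partial>?M) = (\<Sum>c\<in>calls. \<integral>\<^sup>+ X. HX c X \<partial>?M)" by (intro nn_integral_sum HX(1))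
    ultimately show ?thesis by (simp add: nn_integral_add nn_integral_cmult X.emeasure_space_1)
  qed
  also have "\<dots> \<le> ?c + ennreal a * (\<Sum>c\<in>calls. ennreal ?\<delta>)"
    by (intro add_left_mono mult_left_mono sum_mono HX(2)) auto
  also have "\<dots> = ennreal (?r\<^sup>2 + a * (real (card calls) * ?\<delta>) + b * (real (card calls) * (real (card ?Q) * 2048)) + a * (real (card calls) * ?\<delta>))"
    unfolding sum_constant ennreal_of_nat_eq_real_of_nat by (rule ennreal_collect[symmetric]) (use ab in auto)
  also have "?r\<^sup>2 + a * (real (card calls) * ?\<delta>) + b * (real (card calls) * (real (card ?Q) * 2048)) + a * (real (card calls) * ?\<delta>) =
      ?r\<^sup>2 + 2 * W\<^sup>2 * ((1 + Z\<^sup>2 / (2 * u)) * (2 * real (card calls) * ?\<delta>) + Z\<^sup>2 * (u / 2) * 2048)"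
  proof -
    have "real (card calls) * real (card ?Q) = Z" by (simp add: Z_def card_cartesian_product power2_eq_square)
    then have "b * (real (card calls) * (real (card ?Q) * 2048)) = b * (Z * 2048)" by (metis mult.assoc)
    also have "\<dots> = 2 * W\<^sup>2 * (Z\<^sup>2 * (u / 2) * 2048)" by (simp add: b_def power2_eq_square)
    finally have 1: "b * (real (card calls) * (real (card ?Q) * 2048)) = 2 * W\<^sup>2 * (Z\<^sup>2 * (u / 2) * 2048)" .
    show ?thesis unfolding 1 a_def by (simp only: distrib_left mult.assoc mult_2 distrib_right add_ac)
  qed
  finally show ?thesis .
qed

lemma card_calls_le: "real (card calls) \<le> (2 + real S) * real D"
proof -
  have ND: "N m \<le> D" if "m \<le> J" for m
    using N_mult_k[OF that] k_pos[of m] by (metis mult_le_mono2 mult_1_right)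
  have "card calls = (\<Sum>c\<in>calls. 1)" by simp
  also have "\<dots> = N 0 + (N 0 - 1) + (\<Sum>m\<in>{1..<S}. N m - 1)" by (subst sum_calls) simp
  also have "\<dots> \<le> D + D + (\<Sum>m\<in>{1..<S}. D)"
  proof (intro add_mono sum_mono)
    show "N 0 \<le> D" "N 0 - 1 \<le> D" using ND[of 0] by auto
    show "N m - 1 \<le> D" if "m \<in> {1..<S}" for m using ND[of m] less_S_le_J[of m] that by auto
  qed
  also have "\<dots> \<le> (2 + S) * D" by (simp add: algebra_simps)
  finally have "real (card calls) \<le> real ((2 + S) * D)" by (rule of_nat_mono)
  then show ?thesis by (simp add: distrib_right)
qed

end

text \<open>
  Exponent count for \<open>x = n\<close>: the crude bound \<open>W\<close>, the number \<open>Z\<close> of noise entries and the number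
  \<open>N\<close> of calls are at most the stated powers. The weight \<open>u\<close> with exponent \<open>- 64\<close> beats
  \<open>W\<^sup>2 Z\<^sup>2\<close>, whose exponent is \<open>50\<close>, and the probability with exponent \<open>- 130\<close> beats \<open>W\<^sup>2 Z\<^sup>2 N / u\<close>,
  whose exponent is \<open>119\<close>; the remaining powers absorb the numerical constants.
\<close>

lemma polynomial_slack:
  fixes x W Z N \<delta> :: real
  assumes x: "4 \<le> x" and W: "0 \<le> W" "W \<le> x ^ 14" and Z: "0 \<le> Z" "Z \<le> x ^ 11" and N: "0 \<le> N" "N \<le> x ^ 5"
    and \<delta>: "0 \<le> \<delta>" "\<delta> \<le> 1 / x ^ 130"
  shows "2 * W\<^sup>2 * ((1 + Z\<^sup>2 / (2 * (1 / x ^ 64))) * (2 * N * \<delta>) + Z\<^sup>2 * ((1 / x ^ 64) / 2) * 2048) \<le> 1 / x"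
proof -
  have x0: "0 < x" "1 \<le> x" using x by auto
  have W2: "W\<^sup>2 \<le> x ^ 28"
    using power_mono[OF W(2,1), of 2] by (simp add: power_mult[symmetric])
  have Z2: "Z\<^sup>2 \<le> x ^ 22" using power_mono[OF Z(2,1), of 2] by (simp add: power_mult[symmetric])
  have big: "4 ^ j \<le> x ^ j" for j using x by (intro power_mono) auto
  have "1 + Z\<^sup>2 / (2 * (1 / x ^ 64)) = 1 + Z\<^sup>2 * x ^ 64 / 2" by simp
  also have "\<dots> \<le> 1 + x ^ 22 * x ^ 64 / 2" using Z2 x0 by (intro add_left_mono divide_right_mono mult_right_mono) auto
  also have "x ^ 22 * x ^ 64 = x ^ 86" by (simp add: power_add[symmetric])
  also have "1 + x ^ 86 / 2 \<le> x ^ 86"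
  proof -
    have "x ^ 1 \<le> x ^ 86" using x0 by (intro power_increasing) auto
    then show ?thesis using x by simp
  qed
  finally have 1: "1 + Z\<^sup>2 / (2 * (1 / x ^ 64)) \<le> x ^ 86" .
  have "2 * N * \<delta> \<le> 2 * x ^ 5 * (1 / x ^ 130)" using N \<delta> x0 by (intro mult_mono) auto
  with 1 have "(1 + Z\<^sup>2 / (2 * (1 / x ^ 64))) * (2 * N * \<delta>) \<le> x ^ 86 * (2 * x ^ 5 * (1 / x ^ 130))"
    using N \<delta> x0 by (intro mult_mono) auto
  also have "\<dots> = 2 / x ^ 39"
  proof -
    have "x ^ 130 = x ^ 86 * x ^ 5 * x ^ 39" by (simp add: power_add[symmetric])
    then show ?thesis using x0 by (simp add: field_simps)
  qed
  also have "\<dots> \<le> 2 / x ^ 37" using x0 by (intro divide_left_mono power_increasing) auto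
  finally have 2: "(1 + Z\<^sup>2 / (2 * (1 / x ^ 64))) * (2 * N * \<delta>) \<le> 2 / x ^ 37" .
  have "Z\<^sup>2 * ((1 / x ^ 64) / 2) * 2048 \<le> x ^ 22 * ((1 / x ^ 64) / 2) * 2048"
    using Z2 x0 by (intro mult_right_mono) auto
  also have "\<dots> = 4 ^ 5 * x ^ 22 / x ^ 64" by simp
  also have "\<dots> \<le> x ^ 5 * x ^ 22 / x ^ 64" using big[of 5] x0 by (intro divide_right_mono mult_right_mono) auto
  also have "\<dots> = 1 / x ^ 37"
  proof -
    have "x ^ 64 = x ^ 5 * x ^ 22 * x ^ 37" by (simp add: power_add[symmetric])
    then show ?thesis using x0 by (simp add: field_simps)
  qed
  finally have 3: "Z\<^sup>2 * ((1 / x ^ 64) / 2) * 2048 \<le> 1 / x ^ 37" .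
  have "2 * W\<^sup>2 * ((1 + Z\<^sup>2 / (2 * (1 / x ^ 64))) * (2 * N * \<delta>) + Z\<^sup>2 * ((1 / x ^ 64) / 2) * 2048) \<le> 2 * x ^ 28 * (2 / x ^ 37 + 1 / x ^ 37)"
    using W2 2 3 N \<delta> x0 by (intro mult_mono add_mono) auto
  also have "\<dots> = 6 / x ^ 8 * (1 / x)"
  proof -
    have "x ^ 37 = x ^ 28 * (x ^ 8 * x)" by (simp add: power_add[symmetric] power_Suc2[symmetric])
    then show ?thesis using x0 by (simp add: field_simps)
  qed
  also have "\<dots> \<le> 1 * (1 / x)"
    using big[of 8] x0 by (intro mult_right_mono) (auto simp: divide_le_eq_1)
  finally show ?thesis by simp
qed

text \<open>
  The three summands are the contributions of scale zero, of the thresholded scales, and of the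
  scales that are never estimated.
\<close>

definition statistical_coeff :: "real \<Rightarrow> real \<Rightarrow> real \<Rightarrow> real \<Rightarrow> real \<Rightarrow> real \<Rightarrow> real \<Rightarrow> real" where
  "statistical_coeff C0 c0 L1 w \<alpha> M Q =
     3 * sqrt (12 * Q) * sqrt (2 * C0 * (2 * \<alpha> + 1))
     + 2 * (2 * (3 / 2 * sqrt (12 * L1 * (2 + w))) * geo (1 / 2) + 2 * M * 2 powr \<alpha> * geo \<alpha>)
     + 2 * (2 * M * 2 powr \<alpha> * geo \<alpha> * c0 powr (- \<alpha>) * sqrt (2 / c0))"

text \<open>
  The two summands are the contributions of scale zero and of the thresholded scales; scales that
  are not estimated carry no noise.
\<close>

definition privacy_coeff :: "real \<Rightarrow> real \<Rightarrow> real \<Rightarrow> real \<Rightarrow> real \<Rightarrow> real \<Rightarrow> real \<Rightarrow> real" where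
  "privacy_coeff C0 c L1 w \<alpha> M Q =
     3 * sqrt (12 * Q) * (2 * C0 * (1 / c) powr (1 / (2 * \<alpha> + 2)) + 1)
     + 2 * (2 * (3 / 2 * sqrt (12 * L1 * (2 + w))) * geo 1 + 2 * M * 2 powr \<alpha> * geo \<alpha>)"

context ada_law
begin

text \<open>
  The hypotheses \<open>large\<close>, which hold for all sufficiently large \<open>n\<close>, make all the quantities in
  the crude bound polynomial in \<open>n\<close>, the dimension being polynomial since \<open>d \<le> \<rho> n\<^sup>2\<close>, so the
  exceptional event costs at most \<open>1/n\<close>, which is below the rate.
\<close>

lemma risk_le:
  fixes x :: real
  assumes cls: "cov_mat P \<in> cov_class d \<alpha> M0 M" and M: "0 < M" and \<alpha>: "0 < \<alpha>" and L1: "16 * err_const \<le> L1"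
    and C01: "1 \<le> C0" and c0: "0 < c0" "c0 \<le> 1" and c: "0 < c"
    and signal: "c * ln (real n) powr (2 * \<alpha> + 3) \<le> \<rho> * (real n)\<^sup>2 / real d"
    and \<kappa>: "0 < \<kappa>" "\<kappa> * ln (real n) \<le> real (k 0)" "130 \<le> h * \<kappa>"
    and d\<rho>: "real d / (\<rho> * (real n)\<^sup>2) \<le> 1" and \<rho>max: "\<rho> \<le> \<rho>max"
    and n4: "4 \<le> real n" and large: "2 * \<rho>max \<le> real n" "216 * C\<^sup>2 \<le> real n" "C \<le> real n" "1 + 64 * K ^ 4 \<le> real n" "16 * C0\<^sup>2 \<le> real n"
  shows "expected_loss n P (ada_estimator C0 C L1 c0 n d \<rho>) (\<lambda>E. (spec_norm d E)\<^sup>2) \<le>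
    ennreal ((2 * ((statistical_coeff C0 c0 L1 (3 / \<kappa>) \<alpha> M err_const)\<^sup>2 + (privacy_coeff C0 c L1 (3 / \<kappa>) \<alpha> M err_const)\<^sup>2) + 1) * rate \<alpha> n d \<rho>)"
proof -
  define x where "x = real n"
  have x: "4 \<le> x" "1 \<le> x" "0 < x" using n4 by (auto simp: x_def)
  have n3: "3 \<le> n" using n4 by linarith
  have ln0: "0 < ln x" using x by simp
  have lnx: "ln x \<le> x" using ln_le_minus_one[of x] x by linarith
  have e0: "0 \<le> err_const" by (simp add: block_const_def)
  have L0: "0 \<le> L1" using L1 e0 by linarith
  have q: "0 < \<rho> * x\<^sup>2" using \<rho> x by simp
  have d_le: "real d \<le> \<rho> * x\<^sup>2" using d\<rho> q by (simp add: x_def pos_divide_le_eq)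
  have "real D \<le> 2 * real d" using D_le by linarith
  also have "\<dots> \<le> 2 * (\<rho>max * x\<^sup>2)" using d_le mult_right_mono[OF \<rho>max zero_le_power2[of x]] by linarith
  also have "\<dots> = (2 * \<rho>max) * x\<^sup>2" by simp
  also have "\<dots> \<le> x * x\<^sup>2" using large(1) by (intro mult_right_mono) (auto simp: x_def)
  finally have D3: "real D \<le> x ^ 3" by (simp add: power2_eq_square power3_eq_cube)
  have lnD: "ln (real D) \<le> 3 / \<kappa> * real (k 0)"
  proof -
    have "ln (real D) \<le> ln (x ^ 3)" using D3 D_pos x by simp
    also have "\<dots> = 3 * ln x" using x by (simp add: ln_realpow)
    also have "\<dots> \<le> 3 * (real (k 0) / \<kappa>)" using \<kappa> by (simp add: pos_le_divide_eq mult.commute x_def)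
    finally show ?thesis by simp
  qed
  have kn: "k m \<le> n" if m: "m < S" for m
  proof (cases "m = 0")
    case True
    have "ln x \<le> x powr (1 / 2) / (1 / 2)" by (rule ln_powr_bound) (use x in auto)
    then have ln_sqrt: "ln x \<le> 2 * sqrt x" using x by (simp add: powr_half_sqrt)
    have C00: "0 \<le> C0" using C01 by simp
    have "real (k 0) \<le> 2 * C0 * ln x" using k_0_le_ln[OF C01 n3] by (simp add: x_def)
    also have "\<dots> \<le> 2 * C0 * (2 * sqrt x)" using C00 by (intro mult_left_mono ln_sqrt) auto
    also have "\<dots> = 4 * C0 * sqrt x" by simp
    also have "\<dots> \<le> sqrt x * sqrt x"
    proof (intro mult_right_mono)
      show "4 * C0 \<le> sqrt x" by (rule real_le_rsqrt) (use large(5) in \<open>simp add: power_mult_distrib x_def\<close>)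
    qed (use x in auto)
    also have "\<dots> = x" using x by simp
    finally show ?thesis using True by (simp add: x_def)
  next
    case False
    then have "real (k m) \<le> c0 * real n" using k_le_of_less_S(1)[OF m] by simp
    also have "\<dots> \<le> real n" using mult_right_mono[OF c0(2), of "real n"] by simp
    finally show ?thesis by simp
  qed
  have ns: "noise_scale n (rho m) (R m) \<le> x ^ 2" if m: "m < S" for m
  proof (rule power2_le_imp_le)
    have mJ: "m \<le> J" by (rule less_S_le_J[OF m])
    have kx: "real (k m) \<le> x" using kn[OF m] by (simp add: x_def)
    have r0: "0 < rho m * (real n)\<^sup>2" using ada_rho_pos[OF \<rho> mJ] n by simp
    have "(real (k m))\<^sup>2 / (rho m * (real n)\<^sup>2) \<le> real (k m) ^ 3 / (rho m * (real n)\<^sup>2)"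
      using r0 k_pos[of m] by (intro divide_right_mono power_increasing) auto
    also have "\<dots> \<le> 12 * (real (k m))\<^sup>2 * priv_noise \<rho>" by (rule cube_over_rho_le[OF \<rho> n3 c0(2) mJ])
    also have "\<dots> \<le> 12 * x\<^sup>2 * x"
    proof (intro mult_mono)
      have "priv_noise \<rho> = real d / (\<rho> * (real n)\<^sup>2) * ln x" by (simp add: x_def)
      also have "\<dots> \<le> 1 * ln x" using d\<rho> ln0 by (intro mult_right_mono) auto
      finally show "priv_noise \<rho> \<le> x" using lnx by linarith
      show "0 \<le> priv_noise \<rho>" using priv_noise_pos[OF \<rho>] by linarith
      show "(real (k m))\<^sup>2 \<le> x\<^sup>2" using kx by (intro power_mono) auto
    qed (use x in auto)
    finally have "18 * C\<^sup>2 * ((real (k m))\<^sup>2 / (rho m * (real n)\<^sup>2)) \<le> 18 * C\<^sup>2 * (12 * x\<^sup>2 * x)" by (intro mult_left_mono) auto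
    also have "\<dots> = (216 * C\<^sup>2) * (x\<^sup>2 * x)" by simp
    also have "\<dots> \<le> x * (x\<^sup>2 * x)" using large(2) x by (intro mult_right_mono) (auto simp: x_def)
    also have "\<dots> = (x ^ 2)\<^sup>2" by (simp add: power2_eq_square)
    finally show "(noise_scale n (rho m) (R m))\<^sup>2 \<le> (x ^ 2)\<^sup>2" unfolding noise_scale_power2[OF mJ] .
  qed simp
  have \<delta>: "exp (- h * real (k 0)) \<le> 1 / x ^ 130"
  proof -
    have "130 * ln x \<le> h * \<kappa> * ln x" using \<kappa>(3) ln0 by (intro mult_right_mono) auto
    also have "\<dots> = h * (\<kappa> * ln x)" by simp
    also have "\<dots> \<le> h * real (k 0)" using \<kappa>(2) h by (intro mult_left_mono) (auto simp: x_def)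
    finally have "exp (- h * real (k 0)) \<le> exp (- (130 * ln x))" by simp
    also have "\<dots> = 1 / x ^ 130"
    proof -
      have "130 * ln x = ln (x ^ 130)" using x by (simp add: ln_realpow)
      then show ?thesis using x by (simp add: exp_minus inverse_eq_divide)
    qed
    finally show ?thesis .
  qed
  have small: "exp (- h * real (k 0)) \<le> 1 / (real n)\<^sup>2"
  proof -
    have "1 / x ^ 130 \<le> 1 / x ^ 2" using x by (intro divide_left_mono power_increasing) auto
    then show ?thesis using \<delta> by (simp add: x_def)
  qed
  have Nc: "real (card calls) \<le> x ^ 5"
  proof -
    have "real S \<le> 3 * x" using S_le_ln[OF n3 c0(2)] lnx by (simp add: x_def)
    then have "(2 + real S) * real D \<le> (2 + 3 * x) * x ^ 3" using D3 x by (intro mult_mono) auto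
    also have "\<dots> \<le> x ^ 2 * x ^ 3"
    proof (intro mult_right_mono)
      have "4 * x \<le> x * x" using x by (intro mult_right_mono) auto
      then show "2 + 3 * x \<le> x ^ 2" unfolding power2_eq_square using x by linarith
    qed (use x in auto)
    also have "\<dots> = x ^ 5" by (simp add: power_add[symmetric])
    finally show ?thesis using card_calls_le by linarith
  qed
  have D2: "(real D)\<^sup>2 \<le> x ^ 6"
    using power_mono[OF D3, of 2] by (simp add: power_mult[symmetric])
  let ?W = "(real D)\<^sup>2 * (1 + 64 * K ^ 4 + real (card calls) * (C * real n) + x ^ 2)"
  have W: "?W \<le> x ^ 14"
  proof -
    have "real (card calls) * (C * real n) \<le> x ^ 5 * (x * x)"
      using Nc large(3) C_pos x by (intro mult_mono) (auto simp: x_def)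
    then have "1 + 64 * K ^ 4 + real (card calls) * (C * real n) + x ^ 2 \<le> x + x ^ 5 * (x * x) + x ^ 2"
      using large(4) by (simp add: x_def)
    also have "\<dots> \<le> x ^ 7 + x ^ 7 + x ^ 7"
    proof (intro add_mono)
      show "x \<le> x ^ 7" "x ^ 2 \<le> x ^ 7" using x power_increasing[of 1 7 x] power_increasing[of 2 7 x] by auto
      show "x ^ 5 * (x * x) \<le> x ^ 7" by (simp add: power_numeral_reduce)
    qed
    also have "\<dots> \<le> x * x ^ 7" using mult_right_mono[of 3 x "x ^ 7"] x by simp
    also have "\<dots> = x ^ 8" by (simp add: power_numeral_reduce)
    finally have "?W \<le> x ^ 6 * x ^ 8" using D2 C_pos x by (intro mult_mono add_nonneg_nonneg mult_nonneg_nonneg) auto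
    then show ?thesis by (simp add: power_add[symmetric])
  qed
  have W0: "0 \<le> ?W" using C_pos by (intro mult_nonneg_nonneg add_nonneg_nonneg) auto
  have Z: "real (card calls) * (real D)\<^sup>2 \<le> x ^ 11"
  proof -
    have "real (card calls) * (real D)\<^sup>2 \<le> x ^ 5 * x ^ 6" using Nc D2 x by (intro mult_mono) auto
    then show ?thesis by (simp add: power_add[symmetric])
  qed
  have w0: "0 \<le> 3 / \<kappa>" using \<kappa> by simp
  have r2: "(total_bound L1 \<rho> M \<alpha> (block_err 0))\<^sup>2 \<le>
      2 * ((statistical_coeff C0 c0 L1 (3 / \<kappa>) \<alpha> M err_const)\<^sup>2 + (privacy_coeff C0 c L1 (3 / \<kappa>) \<alpha> M err_const)\<^sup>2) * rate \<alpha> n d \<rho>"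
    unfolding statistical_coeff_def privacy_coeff_def
    by (rule total_bound_le[OF \<rho> n3 c0 C01 L0 w0 lnD \<alpha> M c e0 signal block_err_nonneg block_err_power2_le]) simp
  have u: "0 < 1 / x ^ 64" using x by simp
  have "expected_loss n P (ada_estimator C0 C L1 c0 n d \<rho>) (\<lambda>E. (spec_norm d E)\<^sup>2) \<le>
    ennreal ((total_bound L1 \<rho> M \<alpha> (block_err 0))\<^sup>2 +
      2 * ?W\<^sup>2 * ((1 + (real (card calls) * (real D)\<^sup>2)\<^sup>2 / (2 * (1 / x ^ 64))) * (2 * real (card calls) * exp (- h * real (k 0)))
        + (real (card calls) * (real D)\<^sup>2)\<^sup>2 * ((1 / x ^ 64) / 2) * 2048))"
    by (rule expected_loss_le[OF cls M L1 kn ns small u])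
  also have "\<dots> \<le> ennreal (2 * ((statistical_coeff C0 c0 L1 (3 / \<kappa>) \<alpha> M err_const)\<^sup>2 + (privacy_coeff C0 c L1 (3 / \<kappa>) \<alpha> M err_const)\<^sup>2) * rate \<alpha> n d \<rho> + 1 / x)"
    by (intro ennreal_leI add_mono r2 polynomial_slack[OF x(1) W0 W _ Z _ Nc _ \<delta>]) auto
  also have "\<dots> \<le> ennreal (2 * ((statistical_coeff C0 c0 L1 (3 / \<kappa>) \<alpha> M err_const)\<^sup>2 + (privacy_coeff C0 c L1 (3 / \<kappa>) \<alpha> M err_const)\<^sup>2) * rate \<alpha> n d \<rho> + rate \<alpha> n d \<rho>)"
    using rate_ge[OF \<rho> \<alpha>] by (intro ennreal_leI add_left_mono) (simp add: x_def)
  finally show ?thesis by (simp add: distrib_right)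
qed

end

lemma expected_loss_mono:
  assumes "\<And>E. loss E \<le> loss' E"
  shows "expected_loss n P A loss \<le> expected_loss n P A loss'"
  unfolding expected_loss_def by (intro nn_integral_mono ennreal_leI assms)

text \<open>
  Only the threshold for \<open>L1\<close> depends on a constant chosen before it.
\<close>

lemma nested_thresholds:
  fixes a b :: real
  assumes "0 < a" "0 < b" "\<And>C. 0 < f C"
    and "\<And>C0 C L1 c0. a \<le> C0 \<Longrightarrow> b \<le> C \<Longrightarrow> f C \<le> L1 \<Longrightarrow> 0 < c0 \<Longrightarrow> c0 \<le> 1 \<Longrightarrow> Q C0 C L1 c0"
  shows "\<exists>C0min>0. \<forall>C0\<ge>C0min. \<exists>Cmin>0. \<forall>C\<ge>Cmin. \<exists>L1min>0. \<forall>L1\<ge>L1min.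
     \<exists>c0max>0. \<forall>c0. 0 < c0 \<and> c0 \<le> c0max \<longrightarrow> Q C0 C (L1 :: real) (c0 :: real)"
proof -
  have "\<exists>c0max>0. \<forall>c0. 0 < c0 \<and> c0 \<le> c0max \<longrightarrow> Q C0 C L1 c0" if "a \<le> C0" "b \<le> C" "f C \<le> L1" for C0 C L1
    using assms(4)[OF that] zero_less_one by blast
  then have "\<exists>L1min>0. \<forall>L1\<ge>L1min. \<exists>c0max>0. \<forall>c0. 0 < c0 \<and> c0 \<le> c0max \<longrightarrow> Q C0 C L1 c0"
    if "a \<le> C0" "b \<le> C" for C0 C
    using that assms(3) by blast
  then have "\<exists>Cmin>0. \<forall>C\<ge>Cmin. \<exists>L1min>0. \<forall>L1\<ge>L1min. \<exists>c0max>0. \<forall>c0. 0 < c0 \<and> c0 \<le> c0max \<longrightarrow> Q C0 C L1 c0"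
    if "a \<le> C0" for C0
    using that assms(2) by blast
  then show ?thesis using assms(1) by blast
qed

theorem theorem5p1:
  fixes K M0 M c\<^sub>d \<rho>\<^sub>m\<^sub>a\<^sub>x :: real
  assumes "0 < K" and "0 < M0" and "0 < M" and "0 < c\<^sub>d" and "0 < \<rho>\<^sub>m\<^sub>a\<^sub>x"
  shows
    "\<exists>C0min>0. \<forall>C0\<ge>C0min. \<exists>Cmin>0. \<forall>C\<ge>Cmin. \<exists>L1min>0. \<forall>L1\<ge>L1min.
     \<exists>c0max>0. \<forall>c0. 0 < c0 \<and> c0 \<le> c0max \<longrightarrow>
       (\<forall>n\<ge>2. \<forall>d\<ge>1. \<forall>\<rho>>0.
          zCDP \<rho> n (space (vec_space d)) (ada_estimator C0 C L1 c0 n d \<rho>)) \<and>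
       (\<forall>\<alpha>>0. \<forall>c>0. \<exists>A>0. \<forall>(n :: nat \<Rightarrow> nat) (d :: nat \<Rightarrow> nat) (\<rho> :: nat \<Rightarrow> real).
          regime c\<^sub>d \<rho>\<^sub>m\<^sub>a\<^sub>x n d \<rho> \<longrightarrow>
          (\<forall>\<^sub>F t in sequentially.
             \<rho> t * (real (n t))\<^sup>2 / real (d t) \<ge> c * ln (real (n t)) powr (2 * \<alpha> + 3)) \<longrightarrow>
          (\<forall>\<^sub>F t in sequentially. \<forall>P.
             centered_subgaussian (d t) K P \<and> cov_mat P \<in> cov_class (d t) \<alpha> M0 M \<longrightarrow>
             expected_loss (n t) P (ada_estimator C0 C L1 c0 (n t) (d t) (\<rho> t))
               (\<lambda>E. (spec_norm (d t) E)\<^sup>2) \<le> ennreal (A * rate \<alpha> (n t) (d t) (\<rho> t)) \<and>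
             expected_loss (n t) P (ada_estimator C0 C L1 c0 (n t) (d t) (\<rho> t))
               (\<lambda>E. 1 / real (d t) * (frob_norm (d t) E)\<^sup>2)
               \<le> ennreal (A * rate \<alpha> (n t) (d t) (\<rho> t))))"
proof -
  define \<kappa> where "\<kappa> = min c\<^sub>d 1"
  \<comment> \<open>the smallest block has side at least \<open>\<kappa> ln n\<close>, so \<open>exp (- h * k\<^sub>0)\<close> is at most \<open>1 / n ^ 130\<close>\<close>
  define h where "h = 130 / \<kappa>"
  have \<kappa>: "0 < \<kappa>" using assms(4) by (simp add: \<kappa>_def)
  have h: "0 < h" using \<kappa> by (simp add: h_def)
  have Cmin: "0 < 16 * K\<^sup>2 * (18 + h)" using assms(1) h by simp
  have block_pos: "0 < 16 * block_const K C h" for C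
  proof -
    have "0 < 8 * K\<^sup>2 * (39 + h)" using assms(1) h by simp
    then have "0 < sample_const K h" unfolding sample_const_def by (simp add: add_pos_nonneg)
    then show ?thesis unfolding block_const_def by (simp add: add_pos_nonneg)
  qed
  show ?thesis
  proof (rule nested_thresholds[where f = "\<lambda>C. 16 * block_const K C h", OF zero_less_one Cmin block_pos], intro conjI allI impI, goal_cases)
    case (1 C0 C L1 c0 n d \<rho>)
    moreover have "0 < C" using 1(2) Cmin by linarith
    ultimately show ?case by (intro ada_setup.zCDP_ada_estimator) (auto simp: ada_setup_def)
  next
    case (2 C0 C L1 c0 \<alpha> c)
    note C0_ge = 2(1) and C_ge = 2(2) and L1_ge = 2(3) and c0_range = 2(4,5) and \<alpha> = 2(6) and c = 2(7)
    define A where "A = 2 * ((statistical_coeff C0 c0 L1 (3 / \<kappa>) \<alpha> M (block_const K C h))\<^sup>2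
        + (privacy_coeff C0 c L1 (3 / \<kappa>) \<alpha> M (block_const K C h))\<^sup>2) + 1"
    let ?B = "max 4 (max (2 * \<rho>\<^sub>m\<^sub>a\<^sub>x) (max (216 * C\<^sup>2) (max C (max (1 + 64 * K ^ 4) (16 * C0\<^sup>2)))))"
    have A: "0 < A" unfolding A_def by (intro add_nonneg_pos mult_nonneg_nonneg add_nonneg_nonneg) auto
    have bound: "expected_loss n P (ada_estimator C0 C L1 c0 n d \<rho>) (\<lambda>E. (spec_norm d E)\<^sup>2) \<le> ennreal (A * rate \<alpha> n d \<rho>) \<and>
        expected_loss n P (ada_estimator C0 C L1 c0 n d \<rho>) (\<lambda>E. 1 / real d * (frob_norm d E)\<^sup>2) \<le> ennreal (A * rate \<alpha> n d \<rho>)"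
      if big: "?B \<le> real n"
        and dn: "c\<^sub>d * ln (real n) \<le> real d" and \<rho>_range: "0 < \<rho>" "\<rho> \<le> \<rho>\<^sub>m\<^sub>a\<^sub>x" and d\<rho>: "real d / (\<rho> * (real n)\<^sup>2) \<le> 1"
        and signal: "c * ln (real n) powr (2 * \<alpha> + 3) \<le> \<rho> * (real n)\<^sup>2 / real d"
        and P: "centered_subgaussian d K P" "cov_mat P \<in> cov_class d \<alpha> M0 M"
      for n d :: nat and \<rho> :: real and P
    proof -
      have n4: "4 \<le> real n" and large: "2 * \<rho>\<^sub>m\<^sub>a\<^sub>x \<le> real n" "216 * C\<^sup>2 \<le> real n" "C \<le> real n" "1 + 64 * K ^ 4 \<le> real n" "16 * C0\<^sup>2 \<le> real n"
        using big by auto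
      have ln0: "0 < ln (real n)" using n4 by simp
      have "0 < c\<^sub>d * ln (real n)" using assms(4) ln0 by simp
      then have d1: "1 \<le> d" using dn by (cases d) auto
      interpret ada_law C0 c0 n d K P C \<rho> h
        by unfold_locales (use C0_ge n4 d1 assms(1) P C_ge \<rho>_range h in auto)
      have k0: "\<kappa> * ln (real n) \<le> real (ada_k C0 n d 0)"
      proof -
        have "\<kappa> * ln (real n) \<le> c\<^sub>d * ln (real n)" using ln0 by (intro mult_right_mono) (auto simp: \<kappa>_def)
        then have 1: "\<kappa> * ln (real n) \<le> real d" using dn by linarith
        have "\<kappa> * ln (real n) \<le> C0 * ln (real n)" using ln0 C0_ge by (intro mult_right_mono) (auto simp: \<kappa>_def min_le_iff_disj)
        also have "\<dots> \<le> real (nat \<lceil>C0 * ln (real n)\<rceil>)" by linarith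
        finally show ?thesis using 1 by (simp add: ada_k_def min_def)
      qed
      have spec: "expected_loss n P (ada_estimator C0 C L1 c0 n d \<rho>) (\<lambda>E. (spec_norm d E)\<^sup>2) \<le> ennreal (A * rate \<alpha> n d \<rho>)"
        unfolding A_def
        by (rule risk_le[OF P(2) assms(3) \<alpha> L1_ge C0_ge c0_range c signal \<kappa> k0 _ d\<rho> \<rho>_range(2) n4 large]) (use \<kappa> in \<open>simp add: h_def\<close>)
      have "expected_loss n P (ada_estimator C0 C L1 c0 n d \<rho>) (\<lambda>E. 1 / real d * (frob_norm d E)\<^sup>2)
          \<le> expected_loss n P (ada_estimator C0 C L1 c0 n d \<rho>) (\<lambda>E. (spec_norm d E)\<^sup>2)"
      proof (rule expected_loss_mono)
        fix E
        have "1 / real d * (frob_norm d E)\<^sup>2 \<le> 1 / real d * (real d * (spec_norm d E)\<^sup>2)"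
          by (intro mult_left_mono frob_norm_le_spec_norm) auto
        then show "1 / real d * (frob_norm d E)\<^sup>2 \<le> (spec_norm d E)\<^sup>2" using d1 by simp
      qed
      with spec show ?thesis by (auto intro: order_trans)
    qed
    show ?case
    proof (intro exI[of _ A] conjI A allI impI, goal_cases)
      case (1 n d \<rho>)
      note reg = 1(1)[unfolded regime_def]
      have "filterlim (\<lambda>t. real (n t)) at_top sequentially"
        using reg by (intro filterlim_compose[OF filterlim_real_sequentially]) auto
      then have e1: "\<forall>\<^sub>F t in sequentially. ?B \<le> real (n t)" unfolding filterlim_at_top by blast
      have e2: "\<forall>\<^sub>F t in sequentially. c\<^sub>d * ln (real (n t)) \<le> real (d t)"
        and e3: "\<forall>\<^sub>F t in sequentially. 0 < \<rho> t \<and> \<rho> t \<le> \<rho>\<^sub>m\<^sub>a\<^sub>x"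
        using reg by auto
      have e4: "\<forall>\<^sub>F t in sequentially. real (d t) / (\<rho> t * (real (n t))\<^sup>2) < 1"
        using reg by (intro order_tendstoD(2)[of _ 0]) auto
      from e1 e2 e3 e4 1(2) show ?case
      proof eventually_elim
        case (elim t)
        show ?case
        proof (intro allI impI, goal_cases)
          case (1 P)
          show ?case
            by (rule bound[OF elim(1,2) conjunct1[OF elim(3)] conjunct2[OF elim(3)] less_imp_le[OF elim(4)] elim(5)
                  conjunct1[OF 1] conjunct2[OF 1]])
        qed
      qed
    qed
  qed
qed

end
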